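(* Let $(X,J)$ be a compact almost complex manifold and let $E$ be a complex vector bundle over $X$ with a pseudoholomorphic structure $\bar\partial_E$. Then $H^0(X,E)=\{s\in\Gamma(X,E):\bar\partial_E s=0\}$ is finite dimensional. In particular, for every $m\ge 1$, $H^0(X,\mathcal K^{\otimes m})$ is finite dimensional and an invariant of $J$.
   Context: Let $(X,J)$ be an almost complex manifold of real dimension $2n$. The complexified cotangent bundle splits as $T^*X\otimes\mathbb C=(T^*X)^{1,0}\oplus(T^*X)^{0,1}$; put $\Lambda^{p,q}=\Lambda^p((T^*X)^{1,0})\otimes\Lambda^q((T^*X)^{0,1})$, $\Omega^{p,q}(X)=\Gamma(X,\Lambda^{p,q})$ (smooth sections), $\pi^{p,q}$ the projection of forms onto type $(p,q)$, and $\bar\partial=\pi^{p,q+1}\circ d:\Omega^{p,q}(X)\to\Omega^{p,q+1}(X)$. A pseudoholomorphic structure on a complex vector bundle $E\to X$ is a differential operator $\bar\partial_E:\Gamma(X,E)\to\Gamma(X,(T^*X)^{0,1}\otimes E)$ satisfying $\bar\partial_E(fs)=\bar\partial f\otimes s+f\bar\partial_E s$ for all smooth functions $f$ and sections $s$. The canonical bundle is $\mathcal K=\Lambda^{n,0}$. Using $\Lambda^{n,1}\cong(T^*X)^{0,1}\otimes\mathcal K$, $\bar\partial$ gives a pseudoholomorphic structure $\bar\partial_1=\bar\partial$ on $\mathcal K$, and $\bar\partial_m$ on $\mathcal K^{\otimes m}$ ($m\ge2$) is defined inductively by $\bar\partial_m(s_1\otimes s_2)=\bar\partial s_1\otimes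 s_2+s_1\otimes\bar\partial_{m-1}s_2$. $H^0(X,\mathcal K^{\otimes m})=\{s\in\Gamma(X,\mathcal K^{\otimes m}):\bar\partial_m s=0\}$. "Invariant of $J$" means that it depends only on $J$: if $F:X'\to X$ is a diffeomorphism from another almost complex manifold $(X',J')$ with $dF\circ J'=J\circ dF$, then pullback by $F$ induces an isomorphism $H^0(X,\mathcal K_J^{\otimes m})\cong H^0(X',\mathcal K_{J'}^{\otimes m})$. *)

theory Defs
  imports "HOL-Analysis.Analysis" "HOL-Library.Function_Algebras"
begin

section \<open>Smooth manifolds\<close>

primrec Ck_on :: "nat \<Rightarrow> 'a::real_normed_vector set \<Rightarrow> ('a \<Rightarrow> 'b::real_normed_vector) \<Rightarrow> bool" where
  "Ck_on 0 S f \<longleftrightarrow> continuous_on S f"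
| "Ck_on (Suc k) S f \<longleftrightarrow> (\<forall>x\<in>S. f differentiable (at x)) \<and>
     (\<forall>v. Ck_on k S (\<lambda>x. frechet_derivative f (at x) v))"

text \<open>Only used for open sets of a Euclidean space.\<close>
definition smooth_on :: "'a::real_normed_vector set \<Rightarrow> ('a \<Rightarrow> 'b::real_normed_vector) \<Rightarrow> bool" where
  "smooth_on S f \<longleftrightarrow> (\<forall>k. Ck_on k S f)"

type_synonym ('x, 'e) chart = "'x set \<times> ('x \<Rightarrow> 'e)"
type_synonym ('x, 'e) atlas = "('x, 'e) chart set"

definition chart_inv :: "('x, 'e) chart \<Rightarrow> 'e \<Rightarrow> 'x" where
  "chart_inv c = inv_into (fst c) (snd c)"

text \<open>The manifold is the whole (Hausdorff, second countable) type; its smooth structure is the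
  one generated by the atlas, which need not be maximal.\<close>
definition smooth_atlas ::
  "('x::{t2_space,second_countable_topology}, 'e::euclidean_space) atlas \<Rightarrow> bool" where
  "smooth_atlas A \<longleftrightarrow>
     (\<forall>(U, \<phi>)\<in>A. open U \<and> open (\<phi> ` U) \<and> (\<exists>\<psi>. homeomorphism U (\<phi> ` U) \<phi> \<psi>)) \<and>
     (\<Union>c\<in>A. fst c) = UNIV \<and>
     (\<forall>c\<in>A. \<forall>d\<in>A. smooth_on (snd c ` (fst c \<inter> fst d)) (snd d \<circ> chart_inv c))"

definition smooth_fun :: "('x, 'e::euclidean_space) atlas \<Rightarrow> 'x set \<Rightarrow>
    ('x \<Rightarrow> 'b::real_normed_vector) \<Rightarrow> bool" where
  "smooth_fun A W f \<longleftrightarrow> (\<forall>c\<in>A. smooth_on (snd c ` (W \<inter> fst c)) (f \<circ> chart_inv c))"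

text \<open>A chart around each point is chosen once and for all. The tangent space at \<open>x\<close> is the model
  space \<open>'e\<close>, a vector being given by its components in the chart chosen at \<open>x\<close>.
  \<open>from_chart A c x\<close> and \<open>to_chart A c x\<close> convert from and to components in another chart \<open>c\<close>
  around \<open>x\<close>; smoothness is always tested on components in charts that are fixed while the
  point varies.\<close>
definition at_chart :: "('x, 'e) atlas \<Rightarrow> 'x \<Rightarrow> ('x, 'e) chart" where
  "at_chart A x = (SOME c. c \<in> A \<and> x \<in> fst c)"

definition from_chart :: "('x, 'e::euclidean_space) atlas \<Rightarrow> ('x, 'e) chart \<Rightarrow> 'x \<Rightarrow> 'e \<Rightarrow> 'e" where
  "from_chart A c x = frechet_derivative (snd (at_chart A x) \<circ> chart_inv c) (at (snd c x))"

definition to_chart :: "('x, 'e::euclidean_space) atlas \<Rightarrow> ('x, 'e) chart \<Rightarrow> 'x \<Rightarrow> 'e \<Rightarrow> 'e" where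
  "to_chart A c x =
     frechet_derivative (snd c \<circ> chart_inv (at_chart A x)) (at (snd (at_chart A x) x))"

definition smooth_map :: "('y::topological_space, 'f::euclidean_space) atlas \<Rightarrow>
    ('x::topological_space, 'e::euclidean_space) atlas \<Rightarrow> ('y \<Rightarrow> 'x) \<Rightarrow> bool" where
  "smooth_map B A F \<longleftrightarrow> continuous_on UNIV F \<and>
     (\<forall>d\<in>B. \<forall>c\<in>A. smooth_on (snd d ` (fst d \<inter> F -` fst c)) (snd c \<circ> F \<circ> chart_inv d))"

definition diffeomorphism :: "('y::topological_space, 'f::euclidean_space) atlas \<Rightarrow>
    ('x::topological_space, 'e::euclidean_space) atlas \<Rightarrow> ('y \<Rightarrow> 'x) \<Rightarrow> bool" where
  "diffeomorphism B A F \<longleftrightarrow> bij F \<and> smooth_map B A F \<and> smooth_map A B (inv F)"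

definition tangent_map :: "('y, 'f::euclidean_space) atlas \<Rightarrow> ('x, 'e::euclidean_space) atlas \<Rightarrow>
    ('y \<Rightarrow> 'x) \<Rightarrow> 'y \<Rightarrow> 'f \<Rightarrow> 'e" where
  "tangent_map B A F y =
     frechet_derivative (snd (at_chart A (F y)) \<circ> F \<circ> chart_inv (at_chart B y))
       (at (snd (at_chart B y) y))"


section \<open>Almost complex structures and forms of type (p,q)\<close>

definition almost_complex_structure ::
  "('x, 'e::euclidean_space) atlas \<Rightarrow> ('x \<Rightarrow> 'e \<Rightarrow> 'e) \<Rightarrow> bool" where
  "almost_complex_structure A J \<longleftrightarrow>
     (\<forall>x. linear (J x) \<and> (\<forall>v. J x (J x v) = - v)) \<and>
     (\<forall>c\<in>A. \<forall>w. smooth_fun A (fst c) (\<lambda>x. to_chart A c x (J x (from_chart A c x w))))"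

definition almost_complex_manifold ::
  "nat \<Rightarrow> ('x::{t2_space,second_countable_topology}, 'e::euclidean_space) atlas \<Rightarrow>
     ('x \<Rightarrow> 'e \<Rightarrow> 'e) \<Rightarrow> bool" where
  "almost_complex_manifold n A J \<longleftrightarrow>
     DIM('e) = 2 * n \<and> smooth_atlas A \<and> almost_complex_structure A J"

text \<open>The vector space structure of complex-valued functions; the addition is the pointwise one.\<close>
definition fscale :: "complex \<Rightarrow> ('a \<Rightarrow> complex) \<Rightarrow> 'a \<Rightarrow> complex" where
  "fscale c f = (\<lambda>v. c * f v)"

text \<open>The argument is the value of \<open>J\<close> at a point.\<close>
definition T10 :: "('e::euclidean_space \<Rightarrow> 'e) \<Rightarrow> ('e \<Rightarrow> complex) set" where
  "T10 j = {\<alpha>. linear \<alpha> \<and> (\<forall>v. \<alpha> (j v) = \<i> * \<alpha> v)}"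

definition T01 :: "('e::euclidean_space \<Rightarrow> 'e) \<Rightarrow> ('e \<Rightarrow> complex) set" where
  "T01 j = {\<alpha>. linear \<alpha> \<and> (\<forall>v. \<alpha> (j v) = - \<i> * \<alpha> v)}"

text \<open>A \<open>k\<close>-form at a point is a function of the first \<open>k\<close> terms of a sequence of tangent
  vectors.\<close>
type_synonym 'e form = "(nat \<Rightarrow> 'e) \<Rightarrow> complex"

definition wedge :: "nat \<Rightarrow> (nat \<Rightarrow> 'e \<Rightarrow> complex) \<Rightarrow> 'e form" where
  "wedge k \<alpha> = (\<lambda>v. \<Sum>\<sigma> | \<sigma> permutes {..<k}. of_int (sign \<sigma>) * (\<Prod>i<k. \<alpha> i (v (\<sigma> i))))"

definition Lambda_pq :: "('e::euclidean_space \<Rightarrow> 'e) \<Rightarrow> nat \<Rightarrow> nat \<Rightarrow> 'e form set" where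
  "Lambda_pq j p q = module.span fscale
     {wedge (p + q) \<alpha> |\<alpha>. (\<forall>i<p. \<alpha> i \<in> T10 j) \<and> (\<forall>i. p \<le> i \<and> i < p + q \<longrightarrow> \<alpha> i \<in> T01 j)}"

text \<open>\<open>\<pi>\<^sup>p\<^sup>,\<^sup>q\<close> on complex \<open>(p + q)\<close>-forms, which are the direct sum of the \<open>\<Lambda>\<^sup>a\<^sup>,\<^sup>b\<close> with
  \<open>a + b = p + q\<close>.\<close>
definition proj_pq :: "('e::euclidean_space \<Rightarrow> 'e) \<Rightarrow> nat \<Rightarrow> nat \<Rightarrow> 'e form \<Rightarrow> 'e form" where
  "proj_pq j p q \<omega> = (THE \<eta>. \<exists>\<tau>. (\<forall>a\<le>p + q. \<tau> a \<in> Lambda_pq j a (p + q - a)) \<and>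
     \<omega> = (\<Sum>a\<le>p + q. \<tau> a) \<and> \<eta> = \<tau> p)"

definition omit :: "nat \<Rightarrow> (nat \<Rightarrow> 'e) \<Rightarrow> nat \<Rightarrow> 'e" where
  "omit i v = (\<lambda>l. if l < i then v l else v (Suc l))"

text \<open>Exterior derivative of a \<open>k\<close>-form, normalised compatibly with \<open>wedge\<close>, by its formula for
  constant vector fields in the chart chosen at the point.\<close>
definition ext_d :: "('x, 'e::euclidean_space) atlas \<Rightarrow> nat \<Rightarrow> ('x \<Rightarrow> 'e form) \<Rightarrow> 'x \<Rightarrow> 'e form" where
  "ext_d A k \<omega> x = (let c = at_chart A x in
     (\<lambda>v. \<Sum>i\<le>k. (-1) ^ i *
        frechet_derivative
          (\<lambda>z. \<omega> (chart_inv c z) (\<lambda>l. from_chart A c (chart_inv c z) (omit i v l)))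
          (at (snd c x)) (v i)))"

definition dbar :: "('x, 'e::euclidean_space) atlas \<Rightarrow> ('x \<Rightarrow> 'e \<Rightarrow> 'e) \<Rightarrow> nat \<Rightarrow> nat \<Rightarrow>
    ('x \<Rightarrow> 'e form) \<Rightarrow> 'x \<Rightarrow> 'e form" where
  "dbar A J p q \<omega> x = proj_pq (J x) p (q + 1) (ext_d A (p + q) \<omega> x)"

text \<open>The case of functions, seen as 0-forms; the resulting (0,1)-form is a function of one
  tangent vector.\<close>
definition dbar_fun :: "('x, 'e::euclidean_space) atlas \<Rightarrow> ('x \<Rightarrow> 'e \<Rightarrow> 'e) \<Rightarrow>
    ('x \<Rightarrow> complex) \<Rightarrow> 'x \<Rightarrow> 'e \<Rightarrow> complex" where
  "dbar_fun A J f x u = dbar A J 0 0 (\<lambda>x v. f x) x (\<lambda>_. u)"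


section \<open>Complex vector bundles and pseudoholomorphic structures\<close>

text \<open>The fibres are subspaces of one complex vector space \<open>'v\<close>, with scalar multiplication
  \<open>smul\<close>. This is no restriction, as \<open>'v\<close> may be the algebraic direct sum of all the fibres: fibres
  over different points are related only through the smooth structure, which is given by local
  frames \<open>(U, r, e)\<close>, that is, by the local trivialisations
  \<open>(x, a) \<mapsto> \<Sum>i<r. smul (a i) (e i x)\<close> over \<open>U\<close>. The rank is locally constant.\<close>
type_synonym ('x, 'v) frame = "'x set \<times> nat \<times> (nat \<Rightarrow> 'x \<Rightarrow> 'v)"

record ('x, 'v) cbundle =
  fibre :: "'x \<Rightarrow> 'v set"
  smul :: "complex \<Rightarrow> 'v \<Rightarrow> 'v"
  frames :: "('x, 'v) frame set"

definition local_frame :: "('x::topological_space \<Rightarrow> 'v::ab_group_add set) \<Rightarrow>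
    (complex \<Rightarrow> 'v \<Rightarrow> 'v) \<Rightarrow> ('x, 'v) frame \<Rightarrow> bool" where
  "local_frame V sm = (\<lambda>(U, r, e). open U \<and>
     (\<forall>x\<in>U. (\<forall>i<r. e i x \<in> V x) \<and>
        (\<forall>v\<in>V x. \<exists>!a. (\<forall>i\<ge>r. a i = 0) \<and> v = (\<Sum>i<r. sm (a i) (e i x)))))"

text \<open>\<open>s\<close> has smooth coefficients over \<open>W\<close> with respect to a frame.\<close>
definition smooth_coeffs :: "('x, 'e::euclidean_space) atlas \<Rightarrow> (complex \<Rightarrow> 'v \<Rightarrow> 'v) \<Rightarrow>
    'x set \<Rightarrow> nat \<Rightarrow> (nat \<Rightarrow> 'x \<Rightarrow> 'v::ab_group_add) \<Rightarrow> ('x \<Rightarrow> 'v) \<Rightarrow> bool" where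
  "smooth_coeffs A sm W r e s \<longleftrightarrow> (\<exists>a. (\<forall>i<r. smooth_fun A W (a i)) \<and>
     (\<forall>x\<in>W. s x = (\<Sum>i<r. sm (a i x) (e i x))))"

definition complex_vector_bundle :: "('x::topological_space, 'e::euclidean_space) atlas \<Rightarrow>
    ('x, 'v::ab_group_add) cbundle \<Rightarrow> bool" where
  "complex_vector_bundle A E \<longleftrightarrow>
     vector_space (smul E) \<and>
     (\<forall>x. module.subspace (smul E) (fibre E x)) \<and>
     (\<forall>fr\<in>frames E. local_frame (fibre E) (smul E) fr) \<and>
     (\<Union>fr\<in>frames E. fst fr) = UNIV \<and>
     (\<forall>(U, r, e)\<in>frames E. \<forall>(U', r', e')\<in>frames E. \<forall>l<r'.
        smooth_coeffs A (smul E) (U \<inter> U') r e (e' l))"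

definition sections :: "('x, 'e::euclidean_space) atlas \<Rightarrow> ('x, 'v::ab_group_add) cbundle \<Rightarrow>
    ('x \<Rightarrow> 'v) set" where
  "sections A E = {s. (\<forall>x. s x \<in> fibre E x) \<and>
     (\<forall>(U, r, e)\<in>frames E. smooth_coeffs A (smul E) U r e s)}"

text \<open>\<open>(T\<^sup>*X)\<^sup>0\<^sup>,\<^sup>1 \<otimes> E\<close> at a point, with \<open>\<alpha> \<otimes> e\<close> realised as the map \<open>u \<mapsto> \<alpha>(u) e\<close>
  from the tangent space to the fibre.\<close>
definition T01_tensor :: "('e::euclidean_space \<Rightarrow> 'e) \<Rightarrow> (complex \<Rightarrow> 'v \<Rightarrow> 'v) \<Rightarrow>
    'v::ab_group_add set \<Rightarrow> ('e \<Rightarrow> 'v) set" where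
  "T01_tensor j sm V = module.span (\<lambda>c t u. sm c (t u))
     {\<lambda>u. sm (\<alpha> u) e |\<alpha> e. \<alpha> \<in> T01 j \<and> e \<in> V}"

text \<open>Smooth sections of \<open>(T\<^sup>*X)\<^sup>0\<^sup>,\<^sup>1 \<otimes> E\<close>: smooth after contraction with every
  coordinate vector field.\<close>
definition sections01 :: "('x, 'e::euclidean_space) atlas \<Rightarrow> ('x \<Rightarrow> 'e \<Rightarrow> 'e) \<Rightarrow>
    ('x, 'v::ab_group_add) cbundle \<Rightarrow> ('x \<Rightarrow> 'e \<Rightarrow> 'v) set" where
  "sections01 A J E = {t. (\<forall>x. t x \<in> T01_tensor (J x) (smul E) (fibre E x)) \<and>
     (\<forall>(U, r, e)\<in>frames E. \<forall>c\<in>A. \<forall>w.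
        smooth_coeffs A (smul E) (U \<inter> fst c) r e (\<lambda>x. t x (from_chart A c x w)))}"

text \<open>Differential operators of order at most \<open>k\<close> among the complex-linear operators:
  \<open>k + 1\<close> successive commutators with multiplications by smooth functions vanish.\<close>
primrec order_le :: "nat \<Rightarrow> ('x, 'e::euclidean_space) atlas \<Rightarrow> ('x, 'v::ab_group_add) cbundle \<Rightarrow>
    (('x \<Rightarrow> 'v) \<Rightarrow> 'x \<Rightarrow> 'e \<Rightarrow> 'v) \<Rightarrow> bool" where
  "order_le 0 A E D \<longleftrightarrow> (\<forall>f s. smooth_fun A UNIV f \<and> s \<in> sections A E \<longrightarrow>
     D (\<lambda>x. smul E (f x) (s x)) = (\<lambda>x u. smul E (f x) (D s x u)))"
| "order_le (Suc k) A E D \<longleftrightarrow> (\<forall>f. smooth_fun A UNIV f \<longrightarrow>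
     order_le k A E (\<lambda>s x u. D (\<lambda>x. smul E (f x) (s x)) x u - smul E (f x) (D s x u)))"

definition differential_operator :: "('x, 'e::euclidean_space) atlas \<Rightarrow> ('x \<Rightarrow> 'e \<Rightarrow> 'e) \<Rightarrow>
    ('x, 'v::ab_group_add) cbundle \<Rightarrow> (('x \<Rightarrow> 'v) \<Rightarrow> 'x \<Rightarrow> 'e \<Rightarrow> 'v) \<Rightarrow> bool" where
  "differential_operator A J E D \<longleftrightarrow>
     (\<forall>s\<in>sections A E. D s \<in> sections01 A J E) \<and>
     (\<forall>s\<in>sections A E. \<forall>t\<in>sections A E. D (\<lambda>x. s x + t x) = (\<lambda>x u. D s x u + D t x u)) \<and>
     (\<forall>c. \<forall>s\<in>sections A E. D (\<lambda>x. smul E c (s x)) = (\<lambda>x u. smul E c (D s x u))) \<and>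
     (\<exists>k. order_le k A E D)"

definition pseudoholomorphic_structure :: "('x, 'e::euclidean_space) atlas \<Rightarrow> ('x \<Rightarrow> 'e \<Rightarrow> 'e) \<Rightarrow>
    ('x, 'v::ab_group_add) cbundle \<Rightarrow> (('x \<Rightarrow> 'v) \<Rightarrow> 'x \<Rightarrow> 'e \<Rightarrow> 'v) \<Rightarrow> bool" where
  "pseudoholomorphic_structure A J E D \<longleftrightarrow> differential_operator A J E D \<and>
     (\<forall>f s. smooth_fun A UNIV f \<and> s \<in> sections A E \<longrightarrow>
        D (\<lambda>x. smul E (f x) (s x)) =
          (\<lambda>x u. smul E (dbar_fun A J f x u) (s x) + smul E (f x) (D s x u)))"

definition H0 :: "('x, 'e::euclidean_space) atlas \<Rightarrow> ('x, 'v::ab_group_add) cbundle \<Rightarrow>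
    (('x \<Rightarrow> 'v) \<Rightarrow> 'x \<Rightarrow> 'e \<Rightarrow> 'v) \<Rightarrow> ('x \<Rightarrow> 'v) set" where
  "H0 A E D = {s \<in> sections A E. \<forall>x u. D s x u = 0}"

definition section_scale :: "('x, 'v) cbundle \<Rightarrow> complex \<Rightarrow> ('x \<Rightarrow> 'v) \<Rightarrow> 'x \<Rightarrow> 'v" where
  "section_scale E c s = (\<lambda>x. smul E c (s x))"

definition finite_dimensional_subspace ::
  "(complex \<Rightarrow> 'w \<Rightarrow> 'w) \<Rightarrow> 'w::ab_group_add set \<Rightarrow> bool" where
  "finite_dimensional_subspace sc H \<longleftrightarrow> (\<exists>B. finite B \<and> module.span sc B = H)"

definition complex_isomorphism :: "(complex \<Rightarrow> 'w \<Rightarrow> 'w) \<Rightarrow> 'w::ab_group_add set \<Rightarrow>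
    (complex \<Rightarrow> 'z \<Rightarrow> 'z) \<Rightarrow> 'z::ab_group_add set \<Rightarrow> ('w \<Rightarrow> 'z) \<Rightarrow> bool" where
  "complex_isomorphism sc H sc' H' T \<longleftrightarrow> bij_betw T H H' \<and>
     (\<forall>s\<in>H. \<forall>t\<in>H. T (s + t) = T s + T t) \<and> (\<forall>c. \<forall>s\<in>H. T (sc c s) = sc' c (T s))"


section \<open>Powers of the canonical bundle\<close>

text \<open>An element of the \<open>m\<close>-th tensor power of \<open>\<K> = \<Lambda>\<^sup>n\<^sup>,\<^sup>0\<close> is a function of \<open>m\<close> families of
  \<open>n\<close> tangent vectors, \<open>\<omega>\<^sub>0 \<otimes> \<dots> \<otimes> \<omega>\<^sub>m\<^sub>-\<^sub>1\<close> being \<open>v \<mapsto> \<omega>\<^sub>0(v 0) \<cdots> \<omega>\<^sub>m\<^sub>-\<^sub>1(v (m-1))\<close>.\<close>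
type_synonym 'e multiform = "(nat \<Rightarrow> nat \<Rightarrow> 'e) \<Rightarrow> complex"

definition K_fibre :: "('e::euclidean_space \<Rightarrow> 'e) \<Rightarrow> nat \<Rightarrow> nat \<Rightarrow> 'e multiform set" where
  "K_fibre j n m = module.span fscale
     {\<lambda>v. \<Prod>i<m. \<omega> i (v i) |\<omega>. \<forall>i<m. \<omega> i \<in> Lambda_pq j n 0}"

definition smooth_tensor :: "('x, 'e::euclidean_space) atlas \<Rightarrow> 'x set \<Rightarrow>
    ('x \<Rightarrow> 'e multiform) \<Rightarrow> bool" where
  "smooth_tensor A W t \<longleftrightarrow> (\<forall>c\<in>A. \<forall>w.
     smooth_fun A (W \<inter> fst c) (\<lambda>x. t x (\<lambda>i l. from_chart A c x (w i l))))"

definition K_power :: "('x::topological_space, 'e::euclidean_space) atlas \<Rightarrow> ('x \<Rightarrow> 'e \<Rightarrow> 'e) \<Rightarrow>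
    nat \<Rightarrow> nat \<Rightarrow> ('x, 'e multiform) cbundle" where
  "K_power A J n m = \<lparr>
     fibre = (\<lambda>x. K_fibre (J x) n m),
     smul = fscale,
     frames = {(U, r, e). local_frame (\<lambda>x. K_fibre (J x) n m) fscale (U, r, e) \<and>
       (\<forall>i<r. smooth_tensor A U (e i))}\<rparr>"

text \<open>\<open>\<beta> \<otimes> \<omega> \<mapsto> \<beta> \<and> \<omega>\<close>, which identifies \<open>(T\<^sup>*X)\<^sup>0\<^sup>,\<^sup>1 \<otimes> \<K>\<close> with \<open>\<Lambda>\<^sup>n\<^sup>,\<^sup>1\<close>. An element of
  \<open>\<K>\<close>, as a first tensor power, only depends on the family of index 0.\<close>
definition wedge01 :: "nat \<Rightarrow> ('e \<Rightarrow> 'e multiform) \<Rightarrow> 'e form" where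
  "wedge01 n t = (\<lambda>v. \<Sum>i\<le>n. (-1) ^ i * t (v i) (\<lambda>_. omit i v))"

definition dbar_K :: "('x::topological_space, 'e::euclidean_space) atlas \<Rightarrow> ('x \<Rightarrow> 'e \<Rightarrow> 'e) \<Rightarrow>
    nat \<Rightarrow> ('x \<Rightarrow> 'e multiform) \<Rightarrow> 'x \<Rightarrow> 'e \<Rightarrow> 'e multiform" where
  "dbar_K A J n s x = (THE t. t \<in> T01_tensor (J x) fscale (K_fibre (J x) n 1) \<and>
     wedge01 n t = dbar A J n 0 (\<lambda>y v. s y (\<lambda>_. v)) x)"

text \<open>\<open>\<K> \<otimes> \<K>\<^sup>m \<rightarrow> \<K>\<^sup>m\<^sup>+\<^sup>1\<close>\<close>
definition tensor :: "'e multiform \<Rightarrow> 'e multiform \<Rightarrow> 'e multiform" where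
  "tensor a b = (\<lambda>v. a v * b (\<lambda>i. v (Suc i)))"

text \<open>On smooth sections, the operator selected here is determined uniquely by its two
  properties.\<close>
fun dbar_K_power :: "('x::topological_space, 'e::euclidean_space) atlas \<Rightarrow> ('x \<Rightarrow> 'e \<Rightarrow> 'e) \<Rightarrow>
    nat \<Rightarrow> nat \<Rightarrow> ('x \<Rightarrow> 'e multiform) \<Rightarrow> 'x \<Rightarrow> 'e \<Rightarrow> 'e multiform" where
  "dbar_K_power A J n 0 = undefined"
| "dbar_K_power A J n (Suc 0) = dbar_K A J n"
| "dbar_K_power A J n (Suc (Suc m)) = (SOME D.
     pseudoholomorphic_structure A J (K_power A J n (Suc (Suc m))) D \<and>
     (\<forall>s1 \<in> sections A (K_power A J n 1). \<forall>s2 \<in> sections A (K_power A J n (Suc m)).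
        D (\<lambda>x. tensor (s1 x) (s2 x)) =
          (\<lambda>x u. tensor (dbar_K A J n s1 x u) (s2 x) +
                 tensor (s1 x) (dbar_K_power A J n (Suc m) s2 x u))))"

definition H0_K :: "('x::topological_space, 'e::euclidean_space) atlas \<Rightarrow> ('x \<Rightarrow> 'e \<Rightarrow> 'e) \<Rightarrow>
    nat \<Rightarrow> nat \<Rightarrow> ('x \<Rightarrow> 'e multiform) set" where
  "H0_K A J n m = H0 A (K_power A J n m) (dbar_K_power A J n m)"

definition pullback :: "('y, 'f::euclidean_space) atlas \<Rightarrow> ('x, 'e::euclidean_space) atlas \<Rightarrow>
    ('y \<Rightarrow> 'x) \<Rightarrow> ('x \<Rightarrow> 'e multiform) \<Rightarrow> 'y \<Rightarrow> 'f multiform" where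
  "pullback B A F s y = (\<lambda>v. s (F y) (\<lambda>i l. tangent_map B A F y (v i l)))"

end

theory Submission
  imports Defs
begin

text \<open>In a local frame and a chart, a section annihilated by a pseudoholomorphic structure solves a
  first order system \<open>a\<^sub>w + \<i> a\<^bsub>Jw\<^esub> = \<Theta>\<^sub>w a\<close>. With \<open>J\<close> frozen at a point, integration by parts
  bounds all derivatives of a compactly supported function in \<open>L\<^sup>2\<close> by its (0,1)-part; iterating this
  on small balls, where \<open>J\<close> is nearly constant, and using a Sobolev inequality gives
  \<open>sup |\<nabla>a| \<le> C sup |a|\<close> on a smaller ball. Hence a section vanishing on a sufficiently fine finite net
  of a compact manifold is zero, and \<open>H\<^sup>0\<close> embeds into a finite-dimensional space of values.

  For \<open>\<K>\<^sup>m\<close>, let \<open>\<kappa>\<close> be a nowhere zero local section of \<open>\<K>\<close>, so that \<open>dbar \<kappa> = \<theta> \<otimes> \<kappa>\<close>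
  for a (0,1)-form \<open>\<theta>\<close>. Then \<open>f \<kappa>\<^sup>m \<mapsto> (dbar f + m f \<theta>) \<otimes> \<kappa>\<^sup>m\<close> does not depend on \<open>\<kappa>\<close>,
  satisfies the product rules, and is the only operator that does. Its invariance under
  diffeomorphisms compatible with the almost complex structures follows from the naturality of the
  exterior derivative and of the type decomposition.\<close>

section \<open>Calculus of smooth functions\<close>

text \<open>Sections are smooth by definition, so everything rests on an a priori estimate. The
  energy identity behind it concerns two constant directions; this is why \<open>J\<close> is
  frozen, and the error can be absorbed once the coefficients of \<open>J\<close> vary by at most
  1/(2 DIM) on the ball. All constants must be uniform over the solutions, so the estimates are made
  for operators on a whole solution set (\<open>dop\<close>) and not for single functions.

  A pseudoholomorphic structure is given on global sections only, and its locality has to be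
  recovered with cut-off functions. The operators on powers of the canonical bundle are reached
  through descriptions and choices (\<open>proj_pq\<close>, \<open>dbar_K\<close>,
  \<open>dbar_K_power\<close>), each of which must be computed. To this end the type projections are
  written as (1 -+ i J)/2 acting in single arguments; uniqueness of the type decomposition,
  smoothness and naturality then become calculations. Tangent vectors are components in a chart that
  jumps with the point, so every claim of smoothness passes to a fixed chart first.\<close>

definition ddir :: "'a::real_normed_vector \<Rightarrow> ('a \<Rightarrow> 'b::real_normed_vector) \<Rightarrow> 'a \<Rightarrow> 'b" where
  "ddir v f = (\<lambda>x. frechet_derivative f (at x) v)"

lemma Ck_on_Suc_ddir:
  "Ck_on (Suc k) S f \<longleftrightarrow> (\<forall>x\<in>S. f differentiable (at x)) \<and> (\<forall>v. Ck_on k S (ddir v f))"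
  by (simp add: ddir_def)

declare Ck_on.simps(2) [simp del]

lemma Ck_on_Suc_differentiable: "Ck_on (Suc k) S f \<Longrightarrow> x \<in> S \<Longrightarrow> f differentiable (at x)"
  and Ck_on_Suc_ddirD: "Ck_on (Suc k) S f \<Longrightarrow> Ck_on k S (ddir v f)"
  and Ck_on_SucI: "(\<And>x. x \<in> S \<Longrightarrow> f differentiable (at x)) \<Longrightarrow> (\<And>v. Ck_on k S (ddir v f)) \<Longrightarrow>
    Ck_on (Suc k) S f"
  by (simp_all add: Ck_on_Suc_ddir)

lemmas Ck_on_SucE = Ck_on_Suc_differentiable Ck_on_Suc_ddirD

lemma ddir_eqI: "(f has_derivative f') (at x) \<Longrightarrow> ddir v f x = f' v"
  unfolding ddir_def by (metis frechet_derivative_at)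

lemma differentiable_has_ddir:
  "f differentiable (at x) \<Longrightarrow> (f has_derivative (\<lambda>v. ddir v f x)) (at x)"
  unfolding ddir_def using frechet_derivative_works by fastforce

lemma linear_ddir: "f differentiable (at x) \<Longrightarrow> linear (\<lambda>v. ddir v f x)"
  using differentiable_has_ddir has_derivative_linear by blast

lemma differentiable_transform_open:
  "open S \<Longrightarrow> x \<in> S \<Longrightarrow> (\<And>y. y \<in> S \<Longrightarrow> f y = g y) \<Longrightarrow> f differentiable (at x) \<Longrightarrow>
     g differentiable (at x)"
  unfolding differentiable_def using has_derivative_transform_within_open by blast

text \<open>Both functions have the same derivatives at \<open>x\<close>, and
  \<open>frechet_derivative\<close> picks from that common set; hence points where neither function
  is differentiable are covered too.\<close>

lemma ddir_cong_open:
  assumes "open S" "x \<in> S" "\<And>y. y \<in> S \<Longrightarrow> f y = g y"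
  shows "ddir v f x = ddir v g x"
proof -
  have "(f has_derivative f') (at x) \<longleftrightarrow> (g has_derivative f') (at x)" for f'
    using has_derivative_transform_within_open[of f f' x UNIV S g]
      has_derivative_transform_within_open[of g f' x UNIV S f] assms by auto
  then show ?thesis
    unfolding ddir_def frechet_derivative_def by simp
qed

lemma Ck_on_cong:
  "open S \<Longrightarrow> (\<And>x. x \<in> S \<Longrightarrow> f x = g x) \<Longrightarrow> Ck_on k S f \<Longrightarrow> Ck_on k S g"
proof (induction k arbitrary: f g)
  case 0
  then show ?case by (simp cong: continuous_on_cong)
next
  case (Suc k)
  then show ?case
    unfolding Ck_on_Suc_ddir
    by (metis (no_types, lifting) ddir_cong_open differentiable_transform_open)
qed

lemma Ck_on_continuous: "Ck_on k S f \<Longrightarrow> continuous_on S f"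
proof (cases k)
  case (Suc l)
  assume "Ck_on k S f"
  then show ?thesis
    unfolding Suc Ck_on_Suc_ddir
    by (simp add: continuous_at_imp_continuous_on differentiable_imp_continuous_within)
qed simp

lemma Ck_on_SucD: "Ck_on (Suc k) S f \<Longrightarrow> Ck_on k S f"
proof (induction k arbitrary: f)
  case 0
  then show ?case using Ck_on_continuous by auto
next
  case (Suc k)
  then show ?case using Ck_on_Suc_ddir by blast
qed

lemma Ck_on_subset: "Ck_on k S f \<Longrightarrow> T \<subseteq> S \<Longrightarrow> Ck_on k T f"
  by (induction k arbitrary: f) (auto simp: Ck_on_Suc_ddir intro: continuous_on_subset)

lemma Ck_on_local:
  "(\<And>x. x \<in> S \<Longrightarrow> \<exists>T. open T \<and> x \<in> T \<and> Ck_on k T f) \<Longrightarrow> Ck_on k S f"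
proof (induction k arbitrary: f)
  case 0
  have "isCont f x" if x: "x \<in> S" for x
    using 0[OF x] by (metis Ck_on.simps(1) continuous_on_eq_continuous_at)
  then show ?case by (simp add: continuous_at_imp_continuous_on)
next
  case (Suc k)
  show ?case
    unfolding Ck_on_Suc_ddir
  proof (intro conjI ballI allI)
    show "f differentiable at x" if "x \<in> S" for x
      using Suc.prems[OF that] Ck_on_Suc_ddir by blast
    show "Ck_on k S (ddir v f)" for v
      by (rule Suc.IH) (meson Suc.prems Ck_on_Suc_ddir)
  qed
qed

lemma Ck_on_const: "Ck_on k S (\<lambda>_. c)"
  by (induction k arbitrary: c) (auto simp: Ck_on_Suc_ddir ddir_def)

lemma Ck_on_linear: "bounded_linear L \<Longrightarrow> Ck_on k S L"
proof (cases k)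
  case 0
  assume "bounded_linear L"
  with 0 show ?thesis by (simp add: linear_continuous_on)
next
  case (Suc l)
  assume L: "bounded_linear L"
  then have "ddir v L = (\<lambda>_. L v)" for v
    by (intro ext ddir_eqI bounded_linear_imp_has_derivative)
  with Suc L show ?thesis
    by (auto simp: Ck_on_Suc_ddir Ck_on_const bounded_linear_imp_differentiable)
qed

lemma Ck_on_add: "open S \<Longrightarrow> Ck_on k S f \<Longrightarrow> Ck_on k S g \<Longrightarrow> Ck_on k S (\<lambda>x. f x + g x)"
proof (induction k arbitrary: f g)
  case 0
  then show ?case by (simp add: continuous_on_add)
next
  case (Suc k)
  have *: "ddir v f x + ddir v g x = ddir v (\<lambda>x. f x + g x) x" if "x \<in> S" for x v
    by (rule sym, rule ddir_eqI)
      (intro has_derivative_add differentiable_has_ddir Ck_on_Suc_differentiable[OF Suc.prems(2) that]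
        Ck_on_Suc_differentiable[OF Suc.prems(3) that])
  show ?case
    unfolding Ck_on_Suc_ddir
  proof (intro conjI ballI allI)
    show "Ck_on k S (ddir v (\<lambda>x. f x + g x))" for v
      by (rule Ck_on_cong[OF Suc.prems(1) *]) (use Suc.IH[OF Suc.prems(1) Ck_on_Suc_ddirD[OF Suc.prems(2)] Ck_on_Suc_ddirD[OF Suc.prems(3)]] in auto)
  qed (use Suc.prems Ck_on_Suc_ddir in \<open>auto intro!: differentiable_add\<close>)
qed

lemma Ck_on_bilinear:
  assumes P: "bounded_bilinear P"
  shows "open S \<Longrightarrow> Ck_on k S f \<Longrightarrow> Ck_on k S g \<Longrightarrow> Ck_on k S (\<lambda>x. P (f x) (g x))"
proof (induction k arbitrary: f g)
  case 0
  then show ?case using P bounded_bilinear.continuous_on by auto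
next
  case (Suc k)
  have d: "((\<lambda>x. P (f x) (g x)) has_derivative (\<lambda>v. P (f x) (ddir v g x) + P (ddir v f x) (g x))) (at x)"
    if "x \<in> S" for x
    by (intro bounded_bilinear.FDERIV[OF P] differentiable_has_ddir
        Ck_on_Suc_differentiable[OF Suc.prems(2) that] Ck_on_Suc_differentiable[OF Suc.prems(3) that])
  then have *: "P (f x) (ddir v g x) + P (ddir v f x) (g x) = ddir v (\<lambda>x. P (f x) (g x)) x"
    if "x \<in> S" for x v
    using that ddir_eqI by fastforce
  show ?case
    unfolding Ck_on_Suc_ddir
  proof (intro conjI ballI allI)
    show "Ck_on k S (ddir v (\<lambda>x. P (f x) (g x)))" for v
      by (rule Ck_on_cong[OF Suc.prems(1) *])
        (assumption | intro Ck_on_add Suc.IH Ck_on_Suc_ddirD Suc.prems Ck_on_SucD)+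
  qed (use d differentiable_def in blast)
qed

lemma Ck_on_linear_comp:
  assumes L: "bounded_linear L" and S: "open S"
  shows "Ck_on k S f \<Longrightarrow> Ck_on k S (\<lambda>x. L (f x))"
proof (induction k arbitrary: f)
  case 0
  then show ?case using L bounded_linear.continuous_on by auto
next
  case (Suc k)
  have d: "((\<lambda>x. L (f x)) has_derivative (\<lambda>v. L (ddir v f x))) (at x)" if "x \<in> S" for x
    by (intro bounded_linear.has_derivative[OF L] differentiable_has_ddir
        Ck_on_Suc_differentiable[OF Suc.prems that])
  then have *: "L (ddir v f x) = ddir v (\<lambda>x. L (f x)) x" if "x \<in> S" for x v
    using that ddir_eqI by fastforce
  show ?case
    unfolding Ck_on_Suc_ddir
  proof (intro conjI ballI allI)
    show "Ck_on k S (ddir v (\<lambda>x. L (f x)))" for v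
      by (rule Ck_on_cong[OF S *]) (assumption | intro Suc.IH Ck_on_Suc_ddirD Suc.prems)+
  qed (use d differentiable_def in blast)
qed

lemma Ck_on_sum:
  "open S \<Longrightarrow> (\<And>i. i \<in> I \<Longrightarrow> Ck_on k S (f i)) \<Longrightarrow> Ck_on k S (\<lambda>x. \<Sum>i\<in>I. f i x)"
  by (induction I rule: infinite_finite_induct) (auto intro: Ck_on_const Ck_on_add)

lemma ddir_compose:
  fixes g :: "'a::real_normed_vector \<Rightarrow> 'e::euclidean_space"
  assumes "g differentiable (at x)" "f differentiable (at (g x))"
  shows "(\<lambda>z. f (g z)) differentiable (at x)"
    and "ddir v (\<lambda>z. f (g z)) x = ddir (ddir v g x) f (g x)"
    and "ddir v (\<lambda>z. f (g z)) x = (\<Sum>b\<in>Basis. (ddir v g x \<bullet> b) *\<^sub>R ddir b f (g x))"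
proof -
  have d: "((\<lambda>z. f (g z)) has_derivative (\<lambda>v. ddir (ddir v g x) f (g x))) (at x)"
    using has_derivative_compose[OF differentiable_has_ddir[OF assms(1)] differentiable_has_ddir[OF assms(2)]] .
  then show "(\<lambda>z. f (g z)) differentiable (at x)" using differentiable_def by blast
  show *: "ddir v (\<lambda>z. f (g z)) x = ddir (ddir v g x) f (g x)" by (rule ddir_eqI[OF d])
  interpret linear "\<lambda>v. ddir v f (g x)" by (rule linear_ddir[OF assms(2)])
  have "ddir (\<Sum>b\<in>Basis. (ddir v g x \<bullet> b) *\<^sub>R b) f (g x) = (\<Sum>b\<in>Basis. (ddir v g x \<bullet> b) *\<^sub>R ddir b f (g x))"
    by (simp add: sum scaleR)
  then show "ddir v (\<lambda>z. f (g z)) x = (\<Sum>b\<in>Basis. (ddir v g x \<bullet> b) *\<^sub>R ddir b f (g x))"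
    unfolding * by (simp add: euclidean_representation)
qed

text \<open>The chain rule differentiates \<open>f\<close> in a direction that moves with the point,
  to which the induction hypothesis does not apply. Expanding this direction in the basis leaves
  derivatives of \<open>f\<close> in fixed directions, with coefficients that are derivatives of
  \<open>g\<close>.\<close>

lemma Ck_on_compose:
  fixes g :: "'a::real_normed_vector \<Rightarrow> 'e::euclidean_space"
  assumes S: "open S" and T: "open T"
  shows "Ck_on k T f \<Longrightarrow> Ck_on k S g \<Longrightarrow> g ` S \<subseteq> T \<Longrightarrow> Ck_on k S (\<lambda>x. f (g x))"
proof (induction k arbitrary: f)
  case 0
  then show ?case using continuous_on_compose2 by auto
next
  case (Suc k)
  note d = ddir_compose[of g _ f]
  have fd: "f differentiable (at (g x))" "g differentiable (at x)" if "x \<in> S" for x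
    using Suc.prems that by (auto intro: Ck_on_Suc_differentiable)
  have "Ck_on k S (\<lambda>x. \<Sum>b\<in>Basis. (ddir v g x \<bullet> b) *\<^sub>R ddir b f (g x))" for v
    by (intro Ck_on_sum S Ck_on_bilinear[OF bounded_bilinear_scaleR]
        Ck_on_linear_comp[OF bounded_linear_inner_left] Suc.IH Ck_on_Suc_ddirD Suc.prems Ck_on_SucD)
  then have "Ck_on k S (ddir v (\<lambda>x. f (g x)))" for v
    by (rule Ck_on_cong[OF S, rotated]) (use d(3) fd in fastforce)
  then show ?case
    using d(1) fd by (auto intro: Ck_on_SucI)
qed

section \<open>Closure properties of smooth functions\<close>

lemma smooth_onD_ddir: "smooth_on S f \<Longrightarrow> smooth_on S (ddir v f)"
  unfolding smooth_on_def by (blast intro: Ck_on_Suc_ddirD)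

lemma smooth_on_differentiable: "smooth_on S f \<Longrightarrow> x \<in> S \<Longrightarrow> f differentiable (at x)"
  unfolding smooth_on_def by (blast intro: Ck_on_Suc_differentiable)

lemma smooth_on_has_derivative:
  "smooth_on S f \<Longrightarrow> x \<in> S \<Longrightarrow> (f has_derivative (\<lambda>v. ddir v f x)) (at x)"
  by (simp add: smooth_on_differentiable differentiable_has_ddir)

lemma smooth_on_continuous: "smooth_on S f \<Longrightarrow> continuous_on S f"
  unfolding smooth_on_def using Ck_on_continuous by blast

lemma smooth_on_cong: "open S \<Longrightarrow> (\<And>x. x \<in> S \<Longrightarrow> f x = g x) \<Longrightarrow> smooth_on S f \<Longrightarrow> smooth_on S g"
  unfolding smooth_on_def using Ck_on_cong by blast

lemma smooth_on_subset: "smooth_on S f \<Longrightarrow> T \<subseteq> S \<Longrightarrow> smooth_on T f"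
  unfolding smooth_on_def using Ck_on_subset by blast

lemma smooth_on_local:
  "(\<And>x. x \<in> S \<Longrightarrow> \<exists>T. open T \<and> x \<in> T \<and> smooth_on T f) \<Longrightarrow> smooth_on S f"
  unfolding smooth_on_def by (meson Ck_on_local)

lemma smooth_on_empty [simp]: "smooth_on {} f"
  by (rule smooth_on_local) simp

lemma smooth_on_const: "smooth_on S (\<lambda>_. c)"
  unfolding smooth_on_def using Ck_on_const by blast

lemma smooth_on_linear: "bounded_linear L \<Longrightarrow> smooth_on S L"
  unfolding smooth_on_def using Ck_on_linear by blast

lemma smooth_on_id: "smooth_on S (\<lambda>x. x)"
  by (intro smooth_on_linear bounded_linear_ident)

lemma smooth_on_add: "open S \<Longrightarrow> smooth_on S f \<Longrightarrow> smooth_on S g \<Longrightarrow> smooth_on S (\<lambda>x. f x + g x)"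
  unfolding smooth_on_def using Ck_on_add by blast

lemma smooth_on_bilinear:
  "bounded_bilinear P \<Longrightarrow> open S \<Longrightarrow> smooth_on S f \<Longrightarrow> smooth_on S g \<Longrightarrow> smooth_on S (\<lambda>x. P (f x) (g x))"
  unfolding smooth_on_def using Ck_on_bilinear by blast

lemmas smooth_on_scaleR = smooth_on_bilinear[OF bounded_bilinear_scaleR]
  and smooth_on_mult = smooth_on_bilinear[OF bounded_bilinear_mult]
  and smooth_on_inner = smooth_on_bilinear[OF bounded_bilinear_inner]

lemma smooth_on_linear_comp:
  "bounded_linear L \<Longrightarrow> open S \<Longrightarrow> smooth_on S f \<Longrightarrow> smooth_on S (\<lambda>x. L (f x))"
  unfolding smooth_on_def using Ck_on_linear_comp by blast

lemma smooth_on_uminus: "open S \<Longrightarrow> smooth_on S f \<Longrightarrow> smooth_on S (\<lambda>x. - f x)"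
  by (rule smooth_on_linear_comp[OF bounded_linear_minus[OF bounded_linear_ident]])

lemma smooth_on_diff: "open S \<Longrightarrow> smooth_on S f \<Longrightarrow> smooth_on S g \<Longrightarrow> smooth_on S (\<lambda>x. f x - g x)"
  using smooth_on_add[of S f "\<lambda>x. - g x"] smooth_on_uminus[of S g] by simp

lemma smooth_on_sum:
  "open S \<Longrightarrow> (\<And>i. i \<in> I \<Longrightarrow> smooth_on S (f i)) \<Longrightarrow> smooth_on S (\<lambda>x. \<Sum>i\<in>I. f i x)"
  unfolding smooth_on_def by (simp add: Ck_on_sum)

lemma smooth_on_prod:
  fixes f :: "'i \<Rightarrow> 'a::real_normed_vector \<Rightarrow> complex"
  shows "open S \<Longrightarrow> (\<And>i. i \<in> I \<Longrightarrow> smooth_on S (f i)) \<Longrightarrow> smooth_on S (\<lambda>x. \<Prod>i\<in>I. f i x)"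
  by (induction I rule: infinite_finite_induct) (auto intro: smooth_on_const smooth_on_mult)

lemma smooth_on_compose:
  fixes g :: "'a::real_normed_vector \<Rightarrow> 'e::euclidean_space"
  shows "open S \<Longrightarrow> open T \<Longrightarrow> smooth_on T f \<Longrightarrow> smooth_on S g \<Longrightarrow> g ` S \<subseteq> T \<Longrightarrow>
    smooth_on S (\<lambda>x. f (g x))"
  unfolding smooth_on_def using Ck_on_compose by blast

text \<open>The derivative of the reciprocal is polynomial in the reciprocal and a derivative of
  \<open>f\<close>, so being k times differentiable improves itself by one order.\<close>

lemma smooth_on_inverse:
  fixes f :: "'a::real_normed_vector \<Rightarrow> 'b::real_normed_field"
  assumes S: "open S" and f: "smooth_on S f" and nz: "\<And>x. x \<in> S \<Longrightarrow> f x \<noteq> 0"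
  shows "smooth_on S (\<lambda>x. inverse (f x))"
proof -
  have "Ck_on k S (\<lambda>x. inverse (f x))" for k
  proof (induction k)
    case 0
    then show ?case
      using f nz by (simp add: smooth_on_continuous continuous_on_inverse)
  next
    case (Suc k)
    have d: "((\<lambda>x. inverse (f x)) has_derivative (\<lambda>v. - (inverse (f x) * ddir v f x * inverse (f x)))) (at x)"
      if "x \<in> S" for x
      using Deriv.has_derivative_inverse[of f x, OF nz[OF that] smooth_on_has_derivative[OF f that]] .
    have "Ck_on k S (\<lambda>x. - (inverse (f x) * ddir v f x * inverse (f x)))" for v
      using smooth_onD_ddir[OF f, of v] unfolding smooth_on_def
      by (intro Ck_on_linear_comp[OF bounded_linear_minus[OF bounded_linear_ident] S]
          Ck_on_bilinear[OF bounded_bilinear_mult] S Suc.IH) auto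
    then have "Ck_on k S (ddir v (\<lambda>x. inverse (f x)))" for v
      by (rule Ck_on_cong[OF S, rotated]) (use ddir_eqI[OF d] in fastforce)
    with d show ?case unfolding Ck_on_Suc_ddir differentiable_def by blast
  qed
  then show ?thesis unfolding smooth_on_def by blast
qed

section \<open>Rules for directional derivatives\<close>

lemma ddir_add:
  "f differentiable (at x) \<Longrightarrow> g differentiable (at x) \<Longrightarrow>
     ddir v (\<lambda>x. f x + g x) x = ddir v f x + ddir v g x"
  by (intro ddir_eqI has_derivative_add differentiable_has_ddir)

lemma ddir_const [simp]: "ddir v (\<lambda>_. c) = (\<lambda>_. 0)"
  by (simp add: ddir_def)

lemma ddir_mult:
  fixes f g :: "'a::real_normed_vector \<Rightarrow> 'b::real_normed_algebra"
  shows "f differentiable (at x) \<Longrightarrow> g differentiable (at x) \<Longrightarrow>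
     ddir v (\<lambda>x. f x * g x) x = f x * ddir v g x + ddir v f x * g x"
  by (intro ddir_eqI has_derivative_mult differentiable_has_ddir)

lemma ddir_cmult:
  fixes g :: "'a::real_normed_vector \<Rightarrow> 'b::real_normed_algebra"
  shows "g differentiable (at x) \<Longrightarrow> ddir v (\<lambda>x. c * g x) x = c * ddir v g x"
  by (intro ddir_eqI has_derivative_mult_right differentiable_has_ddir)

lemma ddir_linear_comp:
  "bounded_linear L \<Longrightarrow> g differentiable (at x) \<Longrightarrow> ddir v (\<lambda>x. L (g x)) x = L (ddir v g x)"
  by (rule ddir_eqI[OF bounded_linear.has_derivative[OF _ differentiable_has_ddir]])

lemma ddir_sum:
  "(\<And>i. i \<in> I \<Longrightarrow> f i differentiable (at x)) \<Longrightarrow>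
     ddir v (\<lambda>x. \<Sum>i\<in>I. f i x) x = (\<Sum>i\<in>I. ddir v (f i) x)"
  by (intro ddir_eqI has_derivative_sum differentiable_has_ddir)

lemma ddir_expand:
  fixes v :: "'e::euclidean_space"
  assumes "f differentiable (at x)"
  shows "ddir v f x = (\<Sum>b\<in>Basis. (v \<bullet> b) *\<^sub>R ddir b f x)"
proof -
  interpret linear "\<lambda>v. ddir v f x" by (rule linear_ddir[OF assms])
  have "ddir (\<Sum>b\<in>Basis. (v \<bullet> b) *\<^sub>R b) f x = (\<Sum>b\<in>Basis. (v \<bullet> b) *\<^sub>R ddir b f x)"
    by (simp add: sum scaleR)
  then show ?thesis by (simp add: euclidean_representation)
qed

subsection \<open>Symmetry of second derivatives\<close>

text \<open>The mean value theorem is applied twice: along \<open>u\<close> to the increment of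
  \<open>f\<close> in direction \<open>v\<close>, then along \<open>v\<close> to
  \<open>ddir u f\<close>. The second difference is symmetric in \<open>u\<close> and
  \<open>v\<close> while the derivative on the right is not; that asymmetry is what gets
  exploited.\<close>

lemma second_difference_mvt:
  fixes f :: "'a::real_normed_vector \<Rightarrow> real"
  assumes S: "open S" and f: "Ck_on 2 S f" and t: "t > 0"
    and seg: "\<And>a b. 0 \<le> a \<Longrightarrow> a \<le> t \<Longrightarrow> 0 \<le> b \<Longrightarrow> b \<le> t \<Longrightarrow> x + a *\<^sub>R u + b *\<^sub>R v \<in> S"
  shows "\<exists>a b. 0 \<le> a \<and> a \<le> t \<and> 0 \<le> b \<and> b \<le> t \<and>
    f (x + t *\<^sub>R u + t *\<^sub>R v) - f (x + t *\<^sub>R u) - f (x + t *\<^sub>R v) + f x =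
      t * t * ddir v (ddir u f) (x + a *\<^sub>R u + b *\<^sub>R v)"
proof -
  have C1: "Ck_on 1 S (ddir w f)" for w
    using f by (simp add: numeral_2_eq_2 Ck_on_Suc_ddir)
  have fd: "f differentiable (at y)" "ddir w f differentiable (at y)" if "y \<in> S" for y w
    using f C1[of w] that by (simp_all add: numeral_2_eq_2 Ck_on_Suc_ddir)
  have comp: "DERIV (\<lambda>a. g (p + a *\<^sub>R w)) a :> ddir w g (p + a *\<^sub>R w)"
    if "g differentiable (at (p + a *\<^sub>R w))" for g :: "'a \<Rightarrow> real" and p w a
  proof -
    have "((\<lambda>a. p + a *\<^sub>R w) has_derivative (\<lambda>h. h *\<^sub>R w)) (at a)"
      by (auto intro!: derivative_eq_intros)
    from has_derivative_compose[OF this differentiable_has_ddir[OF that]]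
    have "((\<lambda>a. g (p + a *\<^sub>R w)) has_derivative (\<lambda>h. ddir (h *\<^sub>R w) g (p + a *\<^sub>R w))) (at a)" .
    moreover have "ddir (h *\<^sub>R w) g (p + a *\<^sub>R w) = ddir w g (p + a *\<^sub>R w) * h" for h
      using linear_scale[OF linear_ddir[OF that], of h w] by simp
    ultimately show ?thesis by (simp add: has_field_derivative_def)
  qed
  define \<phi> where "\<phi> a = f ((x + t *\<^sub>R v) + a *\<^sub>R u) - f (x + a *\<^sub>R u)" for a
  have D\<phi>: "DERIV \<phi> a :> ddir u f ((x + t *\<^sub>R v) + a *\<^sub>R u) - ddir u f (x + a *\<^sub>R u)"
    if "0 \<le> a" "a \<le> t" for a
    unfolding \<phi>_def
    using seg[OF that, of t] seg[OF that, of 0] t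
    by (intro DERIV_diff comp fd) (auto simp: algebra_simps)
  obtain a where a: "0 < a" "a < t"
    and e1: "\<phi> t - \<phi> 0 = (t - 0) * (ddir u f ((x + t *\<^sub>R v) + a *\<^sub>R u) - ddir u f (x + a *\<^sub>R u))"
    using MVT2[OF t D\<phi>] by blast
  have "DERIV (\<lambda>b. ddir u f ((x + a *\<^sub>R u) + b *\<^sub>R v)) b :> ddir v (ddir u f) ((x + a *\<^sub>R u) + b *\<^sub>R v)"
    if "0 \<le> b" "b \<le> t" for b
    using seg[of a b] a that by (intro comp fd) auto
  from MVT2[OF t this] obtain b where b: "0 < b" "b < t"
    and e2: "ddir u f ((x + a *\<^sub>R u) + t *\<^sub>R v) - ddir u f ((x + a *\<^sub>R u) + 0 *\<^sub>R v) =
      (t - 0) * ddir v (ddir u f) ((x + a *\<^sub>R u) + b *\<^sub>R v)"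
    by blast
  have "f (x + t *\<^sub>R u + t *\<^sub>R v) - f (x + t *\<^sub>R u) - f (x + t *\<^sub>R v) + f x = \<phi> t - \<phi> 0"
    by (simp add: \<phi>_def algebra_simps)
  also have "\<dots> = t * (ddir u f ((x + a *\<^sub>R u) + t *\<^sub>R v) - ddir u f (x + a *\<^sub>R u))"
    using e1 by (simp add: algebra_simps)
  also have "\<dots> = t * t * ddir v (ddir u f) (x + a *\<^sub>R u + b *\<^sub>R v)"
    using e2 by simp
  finally show ?thesis using a b by (intro exI[of _ a] exI[of _ b]) simp
qed

text \<open>The symmetric second difference forces the two mixed derivatives to take a common value
  at two points arbitrarily close to \<open>x\<close>; continuity of both then excludes a gap at
  \<open>x\<close>.\<close>

lemma ddir_commute_real:
  fixes f :: "'a::real_normed_vector \<Rightarrow> real"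
  assumes S: "open S" and f: "Ck_on 2 S f" and x: "x \<in> S"
  shows "ddir u (ddir v f) x = ddir v (ddir u f) x"
proof (rule ccontr)
  assume ne: "ddir u (ddir v f) x \<noteq> ddir v (ddir u f) x"
  define e where "e = \<bar>ddir u (ddir v f) x - ddir v (ddir u f) x\<bar> / 2"
  have e: "e > 0" using ne by (simp add: e_def)
  have cont: "isCont (ddir w (ddir w' f)) x" for w w'
    using f S x by (simp add: numeral_2_eq_2 Ck_on_Suc_ddir continuous_on_eq_continuous_at)
  obtain d1 where d1: "d1 > 0" "\<And>y. dist y x < d1 \<Longrightarrow> dist (ddir u (ddir v f) y) (ddir u (ddir v f) x) < e"
    using cont e unfolding continuous_at_eps_delta by blast
  obtain d2 where d2: "d2 > 0" "\<And>y. dist y x < d2 \<Longrightarrow> dist (ddir v (ddir u f) y) (ddir v (ddir u f) x) < e"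
    using cont e unfolding continuous_at_eps_delta by blast
  obtain d3 where d3: "d3 > 0" "ball x d3 \<subseteq> S"
    using S x open_contains_ball by blast
  define d where "d = min d1 (min d2 d3)"
  \<comment> \<open>Keeps the parallelogram with sides \<open>t *\<^sub>R u\<close> and
    \<open>t *\<^sub>R v\<close> within distance \<open>d\<close> of \<open>x\<close>; the summand 1
    covers the case that both vectors vanish.\<close>
  define t where "t = d / (2 * (norm u + norm v + 1))"
  have np: "norm u + norm v + 1 > 0" by (simp add: add_nonneg_pos)
  have d: "d > 0" using d1 d2 d3 by (simp add: d_def)
  have t: "t > 0" using d np by (simp add: t_def)
  have near: "dist (x + a *\<^sub>R u + b *\<^sub>R v) x < d" if "0 \<le> a" "a \<le> t" "0 \<le> b" "b \<le> t" for a b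
  proof -
    have "dist (x + a *\<^sub>R u + b *\<^sub>R v) x = norm (a *\<^sub>R u + b *\<^sub>R v)"
      by (simp add: dist_norm algebra_simps)
    also have "\<dots> \<le> a * norm u + b * norm v"
      using norm_triangle_ineq[of "a *\<^sub>R u" "b *\<^sub>R v"] that by simp
    also have "\<dots> \<le> t * norm u + t * norm v"
      using that by (intro add_mono mult_right_mono) auto
    also have "\<dots> \<le> t * (norm u + norm v + 1)" using t by (simp add: algebra_simps)
    also have "\<dots> = d / 2" unfolding t_def using np by (simp add: field_simps)
    also have "\<dots> < d" using d by simp
    finally show ?thesis .
  qed
  have inS: "x + a *\<^sub>R u + b *\<^sub>R v \<in> S" "x + b *\<^sub>R v + a *\<^sub>R u \<in> S"
    if "0 \<le> a" "a \<le> t" "0 \<le> b" "b \<le> t" for a b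
  proof -
    have "x + a *\<^sub>R u + b *\<^sub>R v \<in> ball x d3"
      using near[OF that] by (simp add: d_def dist_commute)
    then show "x + a *\<^sub>R u + b *\<^sub>R v \<in> S" using d3 by blast
    then show "x + b *\<^sub>R v + a *\<^sub>R u \<in> S" by (simp add: add_ac)
  qed
  obtain a b where ab: "0 \<le> a" "a \<le> t" "0 \<le> b" "b \<le> t"
    "f (x + t *\<^sub>R u + t *\<^sub>R v) - f (x + t *\<^sub>R u) - f (x + t *\<^sub>R v) + f x =
      t * t * ddir v (ddir u f) (x + a *\<^sub>R u + b *\<^sub>R v)"
    using second_difference_mvt[OF S f t, of x u v] inS by blast
  obtain a' b' where ab': "0 \<le> a'" "a' \<le> t" "0 \<le> b'" "b' \<le> t"
    "f (x + t *\<^sub>R v + t *\<^sub>R u) - f (x + t *\<^sub>R v) - f (x + t *\<^sub>R u) + f x =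
      t * t * ddir u (ddir v f) (x + a' *\<^sub>R v + b' *\<^sub>R u)"
    using second_difference_mvt[OF S f t, of x v u] inS by blast
  have sw: "x + t *\<^sub>R v + t *\<^sub>R u = x + t *\<^sub>R u + t *\<^sub>R v"
    "x + a' *\<^sub>R v + b' *\<^sub>R u = x + b' *\<^sub>R u + a' *\<^sub>R v"
    by (simp_all add: add_ac)
  have "t * t * ddir v (ddir u f) (x + a *\<^sub>R u + b *\<^sub>R v) =
    t * t * ddir u (ddir v f) (x + b' *\<^sub>R u + a' *\<^sub>R v)"
    using ab(5) ab'(5) unfolding sw by linarith
  then have "ddir v (ddir u f) (x + a *\<^sub>R u + b *\<^sub>R v) = ddir u (ddir v f) (x + b' *\<^sub>R u + a' *\<^sub>R v)"
    using t by simp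
  moreover have "dist (ddir v (ddir u f) (x + a *\<^sub>R u + b *\<^sub>R v)) (ddir v (ddir u f) x) < e"
    using d2(2) near[OF ab(1-4)] by (simp add: d_def)
  moreover have "dist (ddir u (ddir v f) (x + b' *\<^sub>R u + a' *\<^sub>R v)) (ddir u (ddir v f) x) < e"
    using d1(2) near[OF ab'(3,4,1,2)] by (simp add: d_def)
  ultimately have "dist (ddir u (ddir v f) x) (ddir v (ddir u f) x) < e + e"
    by (metis dist_triangle_less_add dist_commute)
  then show False unfolding e_def dist_real_def by simp
qed

lemma ddir_commute:
  fixes f :: "'a::real_normed_vector \<Rightarrow> 'b::euclidean_space"
  assumes S: "open S" and f: "smooth_on S f" and x: "x \<in> S"
  shows "ddir u (ddir v f) x = ddir v (ddir u f) x"
proof (rule euclidean_eqI)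
  fix b :: 'b assume "b \<in> Basis"
  have 1: "ddir w (\<lambda>y. f y \<bullet> b) y = ddir w f y \<bullet> b" if "y \<in> S" for w y
    by (rule ddir_linear_comp[OF bounded_linear_inner_left smooth_on_differentiable[OF f that]])
  have 2: "ddir w' (ddir w (\<lambda>y. f y \<bullet> b)) x = ddir w' (ddir w f) x \<bullet> b" for w w'
  proof -
    have "ddir w' (ddir w (\<lambda>y. f y \<bullet> b)) x = ddir w' (\<lambda>y. ddir w f y \<bullet> b) x"
      by (rule ddir_cong_open[OF S x 1])
    also have "\<dots> = ddir w' (ddir w f) x \<bullet> b"
      by (rule ddir_linear_comp[OF bounded_linear_inner_left smooth_on_differentiable[OF smooth_onD_ddir[OF f] x]])
    finally show ?thesis .
  qed
  have "Ck_on 2 S (\<lambda>y. f y \<bullet> b)"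
    using smooth_on_linear_comp[OF bounded_linear_inner_left S f] unfolding smooth_on_def by blast
  from ddir_commute_real[OF S this x]
  show "ddir u (ddir v f) x \<bullet> b = ddir v (ddir u f) x \<bullet> b" by (simp add: 2)
qed

subsection \<open>Bump functions\<close>

text \<open>The flat function exp(-1/t), times powers of 1/t: with these powers the family is closed
  under differentiation up to linear combinations, which makes smoothness an induction over all
  \<open>n\<close> at once.\<close>

definition expinv :: "nat \<Rightarrow> real \<Rightarrow> real" where
  "expinv n t = (if t \<le> 0 then 0 else (1 / t) ^ n * exp (- (1 / t)))"

lemma expinv_tendsto_0: "(expinv n \<longlongrightarrow> 0) (at 0)"
proof (rule filterlim_split_at)
  have "((\<lambda>t. (1 / t) ^ n * exp (- (1 / t))) \<longlongrightarrow> 0) (at_right (0::real))"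
  proof -
    have "((\<lambda>u::real. u ^ n / exp u) \<longlongrightarrow> 0) at_top" by (rule tendsto_power_div_exp_0)
    from filterlim_compose[OF this filterlim_inverse_at_top_right]
    show ?thesis by (simp add: exp_minus divide_inverse)
  qed
  then show "(expinv n \<longlongrightarrow> 0) (at_right 0)"
    by (rule Lim_transform_eventually) (auto simp: expinv_def eventually_at_right_less eventually_at intro!: exI[of _ 1])
  show "(expinv n \<longlongrightarrow> 0) (at_left 0)"
    by (rule Lim_transform_eventually[OF tendsto_const]) (auto simp: expinv_def eventually_at intro!: exI[of _ 1])
qed

lemma expinv_deriv:
  "(expinv n has_real_derivative expinv (n + 2) t - real n * expinv (n + 1) t) (at t)"
proof -
  consider "t < 0" | "t = 0" | "t > 0" by linarith
  then show ?thesis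
  proof cases
    case 1
    have "((\<lambda>_. 0) has_real_derivative 0) (at t)" by simp
    then have "(expinv n has_real_derivative 0) (at t)"
      by (rule has_field_derivative_transform_within_open[of _ _ _ "{..<0}"])
        (use 1 in \<open>auto simp: expinv_def\<close>)
    then show ?thesis using 1 by (simp add: expinv_def)
  next
    case 2
    \<comment> \<open>The difference quotient at 0 is the next member of the family, whose limit at
      0 is already known.\<close>
    have "((\<lambda>h. (expinv n (0 + h) - expinv n 0) / h) \<longlongrightarrow> 0) (at 0)"
      by (rule Lim_transform_eventually[OF expinv_tendsto_0[of "Suc n"]])
        (auto simp: expinv_def eventually_at_filter)
    with 2 show ?thesis by (simp add: expinv_def DERIV_def)
  next
    case 3
    have "((\<lambda>t. (1 / t) ^ n * exp (- (1 / t))) has_real_derivative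
      real n * (1 / t) ^ (n - 1) * (- (1 / t\<^sup>2)) * exp (- (1 / t)) + (1 / t) ^ n * (exp (- (1 / t)) * (1 / t\<^sup>2))) (at t)"
    proof -
      have u: "((\<lambda>t. 1 / t) has_real_derivative - (1 / t\<^sup>2)) (at t)"
        using 3 by (auto intro!: derivative_eq_intros simp: power2_eq_square)
      show ?thesis
        using DERIV_mult[OF DERIV_power[OF u, of n] DERIV_fun_exp[OF DERIV_minus[OF u]]]
        by (simp add: mult_ac)
    qed
    moreover have "real n * (1 / t) ^ (n - 1) * (- (1 / t\<^sup>2)) * exp (- (1 / t)) + (1 / t) ^ n * (exp (- (1 / t)) * (1 / t\<^sup>2))
      = expinv (n + 2) t - real n * expinv (n + 1) t"
      by (cases n; use 3 in \<open>simp add: expinv_def power2_eq_square field_simps power_add\<close>)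
    ultimately have "((\<lambda>t. (1 / t) ^ n * exp (- (1 / t))) has_real_derivative
      expinv (n + 2) t - real n * expinv (n + 1) t) (at t)" by simp
    then show ?thesis
      by (rule has_field_derivative_transform_within_open[of _ _ _ "{0<..}"])
        (use 3 in \<open>auto simp: expinv_def\<close>)
  qed
qed

lemma smooth_expinv: "smooth_on UNIV (expinv n)"
proof -
  have "Ck_on k UNIV (expinv n)" for k
  proof (induction k arbitrary: n)
    case 0
    have "isCont (expinv n) t" for t using expinv_deriv DERIV_isCont by blast
    then show ?case by (simp add: continuous_at_imp_continuous_on)
  next
    case (Suc k)
    have d: "(expinv n has_derivative (\<lambda>v. (expinv (n + 2) t - real n * expinv (n + 1) t) * v)) (at t)" for t
      using expinv_deriv[of n t] by (simp add: has_field_derivative_def)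
    have e: "ddir v (expinv n) = (\<lambda>t. v *\<^sub>R expinv (n + 2) t + (- v * real n) *\<^sub>R expinv (n + 1) t)" for v
      by (rule ext, subst ddir_eqI[OF d]) (simp add: algebra_simps)
    show ?case
      unfolding Ck_on_Suc_ddir e
      by (intro conjI ballI allI Ck_on_add Ck_on_linear_comp[OF bounded_linear_scaleR_right] Suc open_UNIV)
        (use d differentiable_def in blast)
  qed
  then show ?thesis unfolding smooth_on_def by blast
qed

lemma bump_exists:
  fixes z :: "'e::euclidean_space"
  assumes "0 < a" "a < b"
  shows "\<exists>\<rho> :: 'e \<Rightarrow> complex. smooth_on UNIV \<rho> \<and> (\<forall>x. dist z x \<le> a \<longrightarrow> \<rho> x = 1) \<and>
    (\<forall>x. b \<le> dist z x \<longrightarrow> \<rho> x = 0) \<and> (\<forall>x. norm (\<rho> x) \<le> 1)"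
proof -
  \<comment> \<open>The squared distance is smooth also at \<open>z\<close>, unlike the distance.
    The bump is the quotient of \<open>f\<close> by \<open>f + g\<close>, where \<open>f\<close>
    vanishes outside the ball of radius \<open>b\<close> and \<open>g\<close> inside the ball of
    radius \<open>a\<close>.\<close>
  define q where "q x = (x - z) \<bullet> (x - z)" for x
  have q: "q x = (dist z x)\<^sup>2" for x
    by (simp add: q_def dist_norm norm_minus_commute dot_square_norm)
  define f where "f x = expinv 0 (b\<^sup>2 - q x)" for x
  define g where "g x = expinv 0 (q x - a\<^sup>2)" for x
  have sq: "smooth_on UNIV q"
    unfolding q_def by (intro smooth_on_inner smooth_on_diff smooth_on_id smooth_on_const open_UNIV)
  have sf: "smooth_on UNIV f" "smooth_on UNIV g"
    unfolding f_def g_def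
    by (intro smooth_on_compose[OF _ _ smooth_expinv] smooth_on_diff smooth_on_const sq open_UNIV subset_UNIV)+
  have nn: "f x \<ge> 0" "g x \<ge> 0" for x by (simp_all add: f_def g_def expinv_def)
  have ab: "a\<^sup>2 < b\<^sup>2" using assms by (simp add: power_strict_mono)
  have pos: "f x + g x > 0" for x
  proof (cases "q x < b\<^sup>2")
    case True
    then have "f x > 0" by (simp add: f_def expinv_def)
    then show ?thesis using nn(2)[of x] by linarith
  next
    case False
    then have "g x > 0" using ab by (simp add: g_def expinv_def)
    then show ?thesis using nn(1)[of x] by linarith
  qed
  define \<rho> where "\<rho> x = complex_of_real (f x * inverse (f x + g x))" for x
  have "smooth_on UNIV \<rho>"
    unfolding \<rho>_def
    by (intro smooth_on_linear_comp[OF bounded_linear_of_real] smooth_on_mult smooth_on_inverse smooth_on_add sf open_UNIV)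
      (use pos in \<open>simp add: less_imp_neq[symmetric]\<close>)
  moreover have "\<rho> x = 1" if "dist z x \<le> a" for x
  proof -
    have "q x \<le> a\<^sup>2" unfolding q using that by (simp add: power_mono)
    then have "g x = 0" by (simp add: g_def expinv_def)
    then show ?thesis using pos[of x] by (simp add: \<rho>_def flip: of_real_mult)
  qed
  moreover have "\<rho> x = 0" if "b \<le> dist z x" for x
  proof -
    have "b\<^sup>2 \<le> q x" unfolding q using that assms by (simp add: power_mono)
    then have "f x = 0" by (simp add: f_def expinv_def)
    then show ?thesis by (simp add: \<rho>_def)
  qed
  moreover have "norm (\<rho> x) \<le> 1" for x
    unfolding \<rho>_def norm_of_real using nn[of x] pos[of x] by (simp add: field_simps)
  ultimately show ?thesis by blast
qed

section \<open>Test functions and integration by parts\<close>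

definition test_function :: "('e::euclidean_space \<Rightarrow> complex) \<Rightarrow> bool" where
  "test_function \<phi> \<longleftrightarrow> smooth_on UNIV \<phi> \<and> bounded {x. \<phi> x \<noteq> 0}"

lemma ddir_zero_off_support:
  assumes "x \<notin> closure {x. \<phi> x \<noteq> 0}"
  shows "ddir v \<phi> x = 0"
proof -
  have "ddir v \<phi> x = ddir v (\<lambda>_. 0) x"
    by (rule ddir_cong_open[of "- closure {x. \<phi> x \<noteq> 0}"])
      (use assms closure_subset[of "{x. \<phi> x \<noteq> 0}"] in auto)
  then show ?thesis by simp
qed

lemma test_function_ddir:
  assumes "test_function \<phi>"
  shows "test_function (ddir v \<phi>)"
proof -
  have "{x. ddir v \<phi> x \<noteq> 0} \<subseteq> closure {x. \<phi> x \<noteq> 0}"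
    using ddir_zero_off_support by blast
  then show ?thesis
    using assms unfolding test_function_def
    by (meson bounded_closure bounded_subset smooth_onD_ddir)
qed

lemma integrable_bounded_support:
  fixes f :: "'e::euclidean_space \<Rightarrow> 'b::{banach, second_countable_topology}"
  assumes "continuous_on UNIV f" "bounded {x. f x \<noteq> 0}"
  shows "integrable lborel f"
proof -
  let ?K = "closure {x. f x \<noteq> 0}"
  have "integrable lborel (\<lambda>x. indicator ?K x *\<^sub>R f x)"
    using assms by (intro borel_integrable_compact) (auto intro: continuous_on_subset)
  moreover have "(\<lambda>x. indicator ?K x *\<^sub>R f x) = f"
    using closure_subset[of "{x. f x \<noteq> 0}"] by (auto simp: fun_eq_iff indicator_def)
  ultimately show ?thesis by simp
qed

lemma bounded_range_bounded_support:
  fixes f :: "'e::euclidean_space \<Rightarrow> 'b::real_normed_vector"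
  assumes "continuous_on UNIV f" "bounded {x. f x \<noteq> 0}"
  shows "\<exists>M\<ge>0. \<forall>x. norm (f x) \<le> M"
proof -
  let ?K = "closure {x. f x \<noteq> 0}"
  have "compact (f ` ?K)"
    using assms by (intro compact_continuous_image) (auto intro: continuous_on_subset)
  then obtain M where M: "\<And>x. x \<in> ?K \<Longrightarrow> norm (f x) \<le> M"
    using compact_imp_bounded bounded_iff by (metis imageI)
  have "norm (f x) \<le> max M 0" for x
    using M[of x] closure_subset[of "{x. f x \<noteq> 0}"] by (cases "f x = 0") (auto simp: le_max_iff_disj)
  then show ?thesis by (meson max.cobounded2)
qed

lemma test_function_mult:
  assumes "test_function f" "smooth_on UNIV g"
  shows "test_function (\<lambda>x. f x * g x)"
proof -
  have "{x. f x * g x \<noteq> 0} \<subseteq> {x. f x \<noteq> 0}" by auto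
  then show ?thesis
    using assms bounded_subset by (auto simp: test_function_def intro: smooth_on_mult)
qed

lemma test_function_cnj: "test_function f \<Longrightarrow> test_function (\<lambda>x. cnj (f x))"
  unfolding test_function_def by (simp add: smooth_on_linear_comp[OF bounded_linear_cnj])

lemma test_function_integrable: "test_function \<phi> \<Longrightarrow> integrable lborel \<phi>"
  unfolding test_function_def by (simp add: integrable_bounded_support smooth_on_continuous)

lemma lborel_integral_shift:
  fixes f :: "'e::euclidean_space \<Rightarrow> complex"
  assumes "continuous_on UNIV f"
  shows "(\<integral>x. f (x + c) \<partial>lborel) = (\<integral>x. f x \<partial>lborel)"
proof -
  have m: "f \<in> borel_measurable borel" using assms by (rule borel_measurable_continuous_onI)
  have "(\<integral>x. f x \<partial>lborel) = (\<integral>x. f x \<partial>(distr lborel borel ((+) c)))"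
    by (simp add: lborel_distr_plus)
  also have "\<dots> = (\<integral>x. f (c + x) \<partial>lborel)"
    using m by (intro integral_distr) auto
  finally show ?thesis by (simp add: add.commute)
qed

lemma has_derivative_along_line:
  assumes "\<phi> differentiable (at (x + s *\<^sub>R v))"
  shows "((\<lambda>s. \<phi> (x + s *\<^sub>R v)) has_derivative (\<lambda>h. h *\<^sub>R ddir v \<phi> (x + s *\<^sub>R v))) (at s)"
proof -
  have "((\<lambda>s. x + s *\<^sub>R v) has_derivative (\<lambda>h. h *\<^sub>R v)) (at s)"
    by (auto intro!: derivative_eq_intros)
  from has_derivative_compose[OF this differentiable_has_ddir[OF assms]]
  show ?thesis
    using linear_scale[OF linear_ddir[OF assms]] by simp
qed

text \<open>Difference quotients have integral zero by translation invariance, and dominated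
  convergence carries this over to the derivative.\<close>

lemma integral_ddir_eq_0:
  fixes \<phi> :: "'e::euclidean_space \<Rightarrow> complex"
  assumes "test_function \<phi>"
  shows "(\<integral>x. ddir v \<phi> x \<partial>lborel) = 0"
proof -
  have sm: "smooth_on UNIV \<phi>" and bd: "bounded {x. \<phi> x \<noteq> 0}"
    using assms by (auto simp: test_function_def)
  have c: "continuous_on UNIV \<phi>" "continuous_on UNIV (ddir v \<phi>)"
    using sm smooth_on_continuous smooth_onD_ddir by blast+
  obtain M where M: "M \<ge> 0" "\<And>x. norm (ddir v \<phi> x) \<le> M"
    using bounded_range_bounded_support[OF c(2)] test_function_ddir[OF assms]
    unfolding test_function_def by blast
  obtain r where r: "\<And>x. \<phi> x \<noteq> 0 \<Longrightarrow> norm x \<le> r"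
    using bd by (auto simp: bounded_iff)
  \<comment> \<open>Contains the supports of all difference quotients \<open>g k\<close>, since
    their shifts have length at most \<open>norm v\<close>; they are dominated by the constant
    \<open>M\<close> on this ball.\<close>
  define K where "K = cball (0::'e) (r + norm v)"
  define g where "g k x = (\<phi> (x + (1 / real (Suc k)) *\<^sub>R v) - \<phi> x) * of_nat (Suc k)" for k x
  have lip: "norm (\<phi> (x + s *\<^sub>R v) - \<phi> x) \<le> M * \<bar>s\<bar>" for x s
  proof -
    have "norm (\<phi> (x + s *\<^sub>R v) - \<phi> (x + 0 *\<^sub>R v)) \<le> M * norm (s - 0)"
    proof (rule differentiable_bound[of UNIV "\<lambda>s. \<phi> (x + s *\<^sub>R v)" "\<lambda>s h. h *\<^sub>R ddir v \<phi> (x + s *\<^sub>R v)"])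
      show "onorm (\<lambda>h. h *\<^sub>R ddir v \<phi> (x + t *\<^sub>R v)) \<le> M" for t :: real
        by (rule onorm_bound) (simp_all add: mult.commute[of M] mult_left_mono M)
    qed (auto intro!: has_derivative_along_line smooth_on_differentiable[OF sm])
    then show ?thesis by simp
  qed
  have gK: "norm (g k x) \<le> indicator K x *\<^sub>R M" for k x
  proof (cases "x \<in> K")
    case True
    have "norm (g k x) = norm (\<phi> (x + (1 / real (Suc k)) *\<^sub>R v) - \<phi> x) * real (Suc k)"
      unfolding g_def norm_mult norm_of_nat ..
    also have "\<dots> \<le> (M * \<bar>1 / real (Suc k)\<bar>) * real (Suc k)"
      by (intro mult_right_mono lip) simp
    also have "\<dots> = M" by simp
    finally show ?thesis using True by simp
  next
    case False
    then have n: "norm x > r + norm v" by (simp add: K_def)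
    have "norm ((1 / real (Suc k)) *\<^sub>R v) \<le> norm v"
      using divide_left_mono[of 1 "real (Suc k)" "norm v"] by (simp del: of_nat_Suc)
    then have "norm (x + (1 / real (Suc k)) *\<^sub>R v) > r"
      using norm_triangle_ineq4[of "x + (1 / real (Suc k)) *\<^sub>R v" "(1 / real (Suc k)) *\<^sub>R v"] n by simp
    moreover have "norm x > r" using n norm_ge_zero[of v] by linarith
    ultimately have "\<phi> (x + (1 / real (Suc k)) *\<^sub>R v) = 0" "\<phi> x = 0"
      using r by (meson not_le)+
    then show ?thesis by (simp add: g_def False)
  qed
  have lim: "(\<lambda>k. g k x) \<longlonglongrightarrow> ddir v \<phi> x" for x
  proof -
    have lim0: "((\<lambda>h. norm (\<phi> (x + h *\<^sub>R v) - \<phi> x - h *\<^sub>R ddir v \<phi> x) / norm h) \<longlongrightarrow> 0) (at 0)"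
      using has_derivative_along_line[of \<phi> x 0 v] smooth_on_differentiable[OF sm, of x]
      by (simp add: has_derivative_at)
    have eq: "norm (\<phi> (x + h *\<^sub>R v) - \<phi> x - h *\<^sub>R ddir v \<phi> x) / norm h =
        norm (inverse h *\<^sub>R (\<phi> (x + h *\<^sub>R v) - \<phi> x) - ddir v \<phi> x)" if "h \<noteq> 0" for h
    proof -
      have "inverse h *\<^sub>R (\<phi> (x + h *\<^sub>R v) - \<phi> x) - ddir v \<phi> x =
          inverse h *\<^sub>R (\<phi> (x + h *\<^sub>R v) - \<phi> x - h *\<^sub>R ddir v \<phi> x)"
        using that by (simp add: scaleR_diff_right)
      then show ?thesis by (simp only: norm_scaleR) (simp add: field_simps abs_inverse)
    qed
    have "((\<lambda>h. norm (inverse h *\<^sub>R (\<phi> (x + h *\<^sub>R v) - \<phi> x) - ddir v \<phi> x)) \<longlongrightarrow> 0) (at 0)"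
      by (rule Lim_transform_eventually[OF lim0]) (auto simp: eventually_at_filter eq intro!: always_eventually simp del: real_norm_def)
    then have "((\<lambda>s. inverse s *\<^sub>R (\<phi> (x + s *\<^sub>R v) - \<phi> x)) \<longlongrightarrow> ddir v \<phi> x) (at 0)"
      by (simp add: tendsto_norm_zero_iff LIM_zero_iff)
    moreover have "filterlim (\<lambda>k. 1 / real (Suc k)) (at 0) sequentially"
      unfolding filterlim_at using LIMSEQ_inverse_real_of_nat by (simp add: inverse_eq_divide)
    ultimately have "(\<lambda>k. inverse (1 / real (Suc k)) *\<^sub>R (\<phi> (x + (1 / real (Suc k)) *\<^sub>R v) - \<phi> x)) \<longlonglongrightarrow> ddir v \<phi> x"
      using filterlim_compose by blast
    moreover have "g k x = inverse (1 / real (Suc k)) *\<^sub>R (\<phi> (x + (1 / real (Suc k)) *\<^sub>R v) - \<phi> x)" for k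
      unfolding g_def scaleR_conv_of_real by simp
    ultimately show ?thesis by simp
  qed
  have sh: "continuous_on UNIV (\<lambda>x. \<phi> (x + w))" for w
    by (rule continuous_on_compose2[OF c(1)]) (auto intro: continuous_intros)
  have "(\<lambda>k. \<integral>x. g k x \<partial>lborel) \<longlonglongrightarrow> (\<integral>x. ddir v \<phi> x \<partial>lborel)"
  proof (rule integral_dominated_convergence)
    show "integrable lborel (\<lambda>x. indicator K x *\<^sub>R M)"
      by (rule borel_integrable_compact) (auto simp: K_def)
    show "ddir v \<phi> \<in> borel_measurable lborel"
      using c(2) by (simp add: borel_measurable_continuous_onI)
    show "g k \<in> borel_measurable lborel" for k
      unfolding g_def using c(1) sh by (simp add: borel_measurable_continuous_onI continuous_on_diff continuous_on_mult_right)
  qed (use gK lim in auto)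
  moreover have "(\<integral>x. g k x \<partial>lborel) = 0" for k
  proof -
    let ?w = "(1 / real (Suc k)) *\<^sub>R v"
    have i1: "integrable lborel \<phi>" by (rule test_function_integrable[OF assms])
    have "{x. \<phi> (x + ?w) \<noteq> 0} \<subseteq> cball 0 (r + norm ?w)"
    proof
      fix x assume "x \<in> {x. \<phi> (x + ?w) \<noteq> 0}"
      then have "norm (x + ?w) \<le> r" using r by blast
      then show "x \<in> cball 0 (r + norm ?w)"
        using norm_triangle_ineq4[of "x + ?w" ?w] by (simp only: mem_cball dist_0_norm add_diff_cancel_right')
    qed
    then have i2: "integrable lborel (\<lambda>x. \<phi> (x + ?w))"
      by (intro integrable_bounded_support sh) (use bounded_cball bounded_subset in blast)
    have "(\<integral>x. \<phi> (x + ?w) \<partial>lborel) = (\<integral>x. \<phi> x \<partial>lborel)"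
      by (rule lborel_integral_shift[OF c(1)])
    then have "(\<integral>x. \<phi> (x + ?w) - \<phi> x \<partial>lborel) = 0"
      by (simp only: Bochner_Integration.integral_diff[OF i2 i1] diff_self)
    then show ?thesis
      by (simp only: g_def integral_mult_left_zero mult_zero_left)
  qed
  ultimately have "(\<lambda>k::nat. 0) \<longlonglongrightarrow> (\<integral>x. ddir v \<phi> x \<partial>lborel)" by simp
  then show ?thesis by (rule LIMSEQ_unique[OF _ tendsto_const, symmetric, THEN sym])
qed

lemma integration_by_parts:
  assumes f: "test_function f" and g: "test_function g"
  shows "(\<integral>x. ddir v f x * g x \<partial>lborel) = - (\<integral>x. f x * ddir v g x \<partial>lborel)"
proof -
  have sf: "smooth_on UNIV f" "smooth_on UNIV g" using f g by (auto simp: test_function_def)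
  have e: "ddir v (\<lambda>x. f x * g x) x = f x * ddir v g x + ddir v f x * g x" for x
    by (intro ddir_mult smooth_on_differentiable[of UNIV] sf) auto
  have i: "integrable lborel (\<lambda>x. f x * ddir v g x)" "integrable lborel (\<lambda>x. ddir v f x * g x)"
    by (intro test_function_integrable test_function_mult test_function_ddir f smooth_onD_ddir sf)+
  have "0 = (\<integral>x. f x * ddir v g x + ddir v f x * g x \<partial>lborel)"
    using integral_ddir_eq_0[OF test_function_mult[OF f sf(2)], of v] by (simp add: e)
  also have "\<dots> = (\<integral>x. f x * ddir v g x \<partial>lborel) + (\<integral>x. ddir v f x * g x \<partial>lborel)"
    by (rule Bochner_Integration.integral_add[OF i])
  finally show ?thesis by (simp add: eq_neg_iff_add_eq_0 add.commute)
qed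

lemma integrable_cmod_square:
  assumes "test_function f"
  shows "integrable lborel (\<lambda>x. (cmod (f x))\<^sup>2)"
proof -
  have "continuous_on UNIV f" using assms smooth_on_continuous unfolding test_function_def by blast
  then show ?thesis
    using assms unfolding test_function_def
    by (intro integrable_bounded_support continuous_intros) auto
qed

text \<open>The cross term vanishes because second derivatives commute.\<close>
lemma dbar_energy_identity:
  assumes f: "test_function f"
  shows "(\<integral>x. (cmod (ddir v f x + \<i> * ddir w f x))\<^sup>2 \<partial>lborel) =
    (\<integral>x. (cmod (ddir v f x))\<^sup>2 \<partial>lborel) + (\<integral>x. (cmod (ddir w f x))\<^sup>2 \<partial>lborel)"
proof -
  have sf: "smooth_on UNIV f" using f by (auto simp: test_function_def)
  note tf = test_function_ddir[OF f] test_function_cnj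
  have cnjd: "ddir u (\<lambda>x. cnj (f x)) x = cnj (ddir u f x)" for u x
    by (intro ddir_linear_comp bounded_linear_cnj smooth_on_differentiable[OF sf]) auto
  have parts: "(\<integral>x. cnj (ddir a f x) * ddir b f x \<partial>lborel) =
      - (\<integral>x. cnj (f x) * ddir a (ddir b f) x \<partial>lborel)" for a b
    using integration_by_parts[OF test_function_cnj[OF f] tf(1), of a b] by (simp add: cnjd)
  let ?I = "\<integral>x. cnj (ddir v f x) * ddir w f x \<partial>lborel"
  \<comment> \<open>So \<open>?I\<close> equals its conjugate and is real. The mixed term of the
    square is twice the real part of \<i> times the integrand of \<open>?I\<close>.\<close>
  have "?I = (\<integral>x. cnj (ddir w f x) * ddir v f x \<partial>lborel)"
    unfolding parts by (simp add: ddir_commute[OF open_UNIV sf UNIV_I, of v w])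
  also have "\<dots> = (\<integral>x. cnj (cnj (ddir v f x) * ddir w f x) \<partial>lborel)" by (simp add: mult.commute)
  also have "\<dots> = cnj ?I" by (rule Bochner_Integration.integral_cnj)
  finally have "Im ?I = 0" by (metis Im_complex_of_real Reals_cnj_iff complex_is_Real_iff)
  moreover have ii: "integrable lborel (\<lambda>x. \<i> * (cnj (ddir v f x) * ddir w f x))"
    by (intro integrable_mult_right test_function_integrable test_function_mult tf smooth_onD_ddir sf)
  ultimately have z: "(\<integral>x. Re (\<i> * (cnj (ddir v f x) * ddir w f x)) \<partial>lborel) = 0"
    by (simp only: integral_Re[OF ii] integral_mult_right_zero) simp
  have e: "(cmod (ddir v f x + \<i> * ddir w f x))\<^sup>2 =
    (cmod (ddir v f x))\<^sup>2 + (cmod (ddir w f x))\<^sup>2 + 2 * Re (\<i> * (cnj (ddir v f x) * ddir w f x))" for x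
    unfolding cmod_power2 by (simp add: power2_eq_square algebra_simps)
  have i: "integrable lborel (\<lambda>x. Re (\<i> * (cnj (ddir v f x) * ddir w f x)))"
    by (rule integrable_Re[OF ii])
  note q = integrable_cmod_square[OF tf(1)]
  show ?thesis
    by (simp only: e Bochner_Integration.integral_add[OF Bochner_Integration.integrable_add[OF q q]
          integrable_mult_right[OF i]] Bochner_Integration.integral_add[OF q q] integral_mult_right_zero z
          mult_zero_right add_0_right)
qed

text \<open>Freezing and absorption. For the constant directions \<open>w0 b\<close> the energy is
  controlled by \<open>dbar_energy_identity\<close>. With N the dimension, Cauchy-Schwarz bounds the
  squared error of replacing \<open>W b x\<close> by \<open>w0 b\<close> by
  \<open>S x / (4 * N)\<close>; splitting the square of a sum costs a factor 2, and the sum over the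
  N basis vectors is then half of the energy. This half moves to the left, which leaves the factor 4
  N.\<close>

lemma energy_bound:
  fixes f :: "'e::euclidean_space \<Rightarrow> complex" and W :: "'e \<Rightarrow> 'e \<Rightarrow> 'e"
  assumes f: "test_function f" and g: "integrable lborel g"
    and close: "\<And>x b c. x \<in> K \<Longrightarrow> b \<in> Basis \<Longrightarrow> c \<in> Basis \<Longrightarrow>
      \<bar>(W b x - w0 b) \<bullet> c\<bar> \<le> 1 / (2 * DIM('e))"
    and off: "\<And>x b. x \<notin> K \<Longrightarrow> ddir b f x = 0"
    and le: "\<And>x b. b \<in> Basis \<Longrightarrow> (cmod (ddir b f x + \<i> * ddir (W b x) f x))\<^sup>2 \<le> g x"
  shows "(\<Sum>b\<in>Basis. \<integral>x. (cmod (ddir b f x))\<^sup>2 \<partial>lborel) \<le> 4 * DIM('e) * (\<integral>x. g x \<partial>lborel)"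
proof -
  let ?N = "real DIM('e)"
  define S where "S x = (\<Sum>b\<in>Basis. (cmod (ddir b f x))\<^sup>2)" for x
  have N: "?N > 0" by simp
  have sf: "smooth_on UNIV f" using f by (auto simp: test_function_def)
  have fd: "f differentiable (at x)" for x by (rule smooth_on_differentiable[OF sf]) simp
  have iS: "integrable lborel S"
    unfolding S_def by (intro Bochner_Integration.integrable_sum integrable_cmod_square test_function_ddir f)
  have iE: "(\<integral>x. S x \<partial>lborel) = (\<Sum>b\<in>Basis. \<integral>x. (cmod (ddir b f x))\<^sup>2 \<partial>lborel)"
    unfolding S_def by (intro Bochner_Integration.integral_sum integrable_cmod_square test_function_ddir f)
  have pt: "(cmod (ddir b f x + \<i> * ddir (w0 b) f x))\<^sup>2 \<le> 2 * g x + 1 / (2 * ?N) * S x"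
    if b: "b \<in> Basis" for b x
  proof -
    let ?A = "ddir b f x + \<i> * ddir (W b x) f x"
    let ?B = "\<i> * ddir (w0 b - W b x) f x"
    have "ddir (w0 b) f x = ddir (W b x) f x + ddir (w0 b - W b x) f x"
      using linear_add[OF linear_ddir[OF fd], of "W b x" "w0 b - W b x"] by simp
    then have eq: "ddir b f x + \<i> * ddir (w0 b) f x = ?A + ?B" by (simp add: algebra_simps)
    have 1: "(cmod (ddir b f x + \<i> * ddir (w0 b) f x))\<^sup>2 \<le> 2 * (cmod ?A)\<^sup>2 + 2 * (cmod ?B)\<^sup>2"
    proof -
      have "(cmod (?A + ?B))\<^sup>2 \<le> (cmod ?A + cmod ?B)\<^sup>2"
        by (intro power_mono norm_triangle_ineq) simp
      also have "\<dots> \<le> 2 * (cmod ?A)\<^sup>2 + 2 * (cmod ?B)\<^sup>2"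
        using sum_squares_bound[of "cmod ?A" "cmod ?B"] by (simp add: power2_sum)
      finally show ?thesis by (simp only: eq)
    qed
    have "cmod ?B \<le> (\<Sum>c\<in>Basis. 1 / (2 * ?N) * cmod (ddir c f x))"
    proof (cases "x \<in> K")
      case True
      have "cmod ?B = cmod (\<Sum>c\<in>Basis. ((w0 b - W b x) \<bullet> c) *\<^sub>R ddir c f x)"
        by (subst ddir_expand[OF fd]) (simp add: norm_mult)
      also have "\<dots> \<le> (\<Sum>c\<in>Basis. \<bar>(w0 b - W b x) \<bullet> c\<bar> * cmod (ddir c f x))"
        by (rule order_trans[OF norm_sum]) simp
      also have "\<dots> \<le> (\<Sum>c\<in>Basis. 1 / (2 * ?N) * cmod (ddir c f x))"
        using close[OF True b] by (intro sum_mono mult_right_mono) (auto simp: inner_diff_left abs_minus_commute)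
      finally show ?thesis .
    next
      case False
      then show ?thesis using off by (auto intro!: sum_nonneg)
    qed
    then have "(cmod ?B)\<^sup>2 \<le> (\<Sum>c\<in>Basis. 1 / (2 * ?N) * cmod (ddir c f x))\<^sup>2"
      by (rule power_mono) simp
    also have "\<dots> \<le> (\<Sum>c\<in>Basis. (1 / (2 * ?N) * cmod (ddir c f x))\<^sup>2) * ?N"
      by (rule sum_squared_le_sum_of_squares)
    also have "\<dots> = (1 / (2 * ?N))\<^sup>2 * S x * ?N"
      by (simp only: power_mult_distrib S_def sum_distrib_left)
    also have "\<dots> = 1 / (4 * ?N) * S x"
      using N by (simp add: field_simps power2_eq_square)
    finally have "2 * (cmod ?B)\<^sup>2 \<le> 1 / (2 * ?N) * S x" by simp
    with 1 le[OF b, of x] show ?thesis by linarith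
  qed
  have "(\<Sum>b\<in>Basis. \<integral>x. (cmod (ddir b f x))\<^sup>2 \<partial>lborel)
    \<le> (\<Sum>b\<in>Basis. \<integral>x. (cmod (ddir b f x + \<i> * ddir (w0 b) f x))\<^sup>2 \<partial>lborel)"
    unfolding dbar_energy_identity[OF f] by (intro sum_mono) simp
  also have "\<dots> \<le> (\<Sum>b\<in>(Basis::'e set). \<integral>x. 2 * g x + 1 / (2 * ?N) * S x \<partial>lborel)"
  proof (intro sum_mono Bochner_Integration.integral_mono pt)
    fix b :: 'e assume "b \<in> Basis"
    show "integrable lborel (\<lambda>x. 2 * g x + 1 / (2 * ?N) * S x)"
      by (intro Bochner_Integration.integrable_add integrable_mult_right g iS)
    have "test_function (\<lambda>x. ddir b f x + \<i> * ddir (w0 b) f x)"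
    proof -
      have t: "test_function (ddir b f)" "test_function (ddir (w0 b) f)" by (intro test_function_ddir f)+
      have "{x. ddir b f x + \<i> * ddir (w0 b) f x \<noteq> 0} \<subseteq> {x. ddir b f x \<noteq> 0} \<union> {x. ddir (w0 b) f x \<noteq> 0}" by auto
      moreover have "bounded ({x. ddir b f x \<noteq> 0} \<union> {x. ddir (w0 b) f x \<noteq> 0})"
        using t by (simp add: test_function_def)
      moreover have "smooth_on UNIV (\<lambda>x. ddir b f x + \<i> * ddir (w0 b) f x)"
        by (intro smooth_on_add smooth_on_mult smooth_on_const smooth_onD_ddir sf open_UNIV)
      ultimately show ?thesis unfolding test_function_def using bounded_subset by blast
    qed
    then show "integrable lborel (\<lambda>x. (cmod (ddir b f x + \<i> * ddir (w0 b) f x))\<^sup>2)"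
      by (rule integrable_cmod_square)
  qed
  also have "\<dots> = ?N * (2 * (\<integral>x. g x \<partial>lborel) + 1 / (2 * ?N) * (\<integral>x. S x \<partial>lborel))"
    using g iS by simp
  also have "\<dots> = 2 * ?N * (\<integral>x. g x \<partial>lborel) + (\<integral>x. S x \<partial>lborel) / 2"
    using N by (simp add: field_simps)
  finally show ?thesis unfolding iE by linarith
qed


section \<open>A Sobolev inequality\<close>

text \<open>Multi-indices are words with the outermost derivative first, so that adding a letter is
  differentiating once more.\<close>

primrec pd :: "'e::real_normed_vector list \<Rightarrow> ('e \<Rightarrow> complex) \<Rightarrow> 'e \<Rightarrow> complex" where
  "pd [] f = f"
| "pd (b # w) f = ddir b (pd w f)"

lemma smooth_on_pd: "smooth_on S f \<Longrightarrow> smooth_on S (pd w f)"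
  by (induction w) (auto intro: smooth_onD_ddir)

lemma test_function_pd: "test_function f \<Longrightarrow> test_function (pd w f)"
  by (induction w) (auto intro: test_function_ddir)

text \<open>Fundamental theorem of calculus on the line through \<open>x\<close> in direction
  \<open>b\<close>, started outside the support. The right-hand side is a nonnegative integral so
  that it can be iterated before its finiteness is known.\<close>

lemma norm_le_integral_ddir:
  fixes f :: "'e::euclidean_space \<Rightarrow> complex"
  assumes f: "test_function f" and b: "b \<noteq> 0"
  shows "ennreal (cmod (f (x + s *\<^sub>R b))) \<le> (\<integral>\<^sup>+t. ennreal (cmod (ddir b f (x + t *\<^sub>R b))) \<partial>lborel)"
proof -
  have sf: "smooth_on UNIV f" using f by (auto simp: test_function_def)
  obtain r where r: "\<And>y. f y \<noteq> 0 \<Longrightarrow> norm y \<le> r"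
    using f by (auto simp: bounded_iff test_function_def)
  \<comment> \<open>A parameter at most \<open>s\<close> whose point
    \<open>x + a *\<^sub>R b\<close> lies outside the ball of radius \<open>r\<close> that contains
    the support.\<close>
  define a where "a = min s (- ((\<bar>r\<bar> + norm x + 1) / norm b))"
  have "\<bar>r\<bar> + norm x + 1 \<le> - a * norm b"
  proof -
    have "(\<bar>r\<bar> + norm x + 1) / norm b \<le> - a" by (simp add: a_def)
    then show ?thesis using b by (simp add: pos_divide_le_eq)
  qed
  moreover have "a \<le> 0"
  proof -
    have "0 \<le> (\<bar>r\<bar> + norm x + 1) / norm b" by simp
    then show ?thesis unfolding a_def by linarith
  qed
  ultimately have "norm (a *\<^sub>R b) > \<bar>r\<bar> + norm x" by simp
  then have "norm (x + a *\<^sub>R b) > r"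
    using norm_triangle_ineq4[of "x + a *\<^sub>R b" x] by simp
  then have z: "f (x + a *\<^sub>R b) = 0" using r by (meson not_le)
  have as: "a \<le> s" by (simp add: a_def)
  let ?g = "\<lambda>t. ddir b f (x + t *\<^sub>R b)"
  have cg: "continuous_on UNIV ?g"
    by (rule continuous_on_compose2[OF smooth_on_continuous[OF smooth_onD_ddir[OF sf]]])
      (auto intro!: continuous_intros)
  have "((\<lambda>t. f (x + t *\<^sub>R b)) has_vector_derivative ?g t) (at t within {a..s})" for t
    unfolding has_vector_derivative_def
    by (rule has_derivative_at_withinI, rule has_derivative_along_line, rule smooth_on_differentiable[OF sf]) simp
  then have "has_bochner_integral lborel (\<lambda>t. indicator {a..s} t *\<^sub>R ?g t) (f (x + s *\<^sub>R b) - f (x + a *\<^sub>R b))"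
    by (intro has_bochner_integral_FTC_Icc as continuous_on_subset[OF cg]) auto
  then have i: "integrable lborel (\<lambda>t. indicator {a..s} t *\<^sub>R ?g t)" and
    e: "(\<integral>t. indicator {a..s} t *\<^sub>R ?g t \<partial>lborel) = f (x + s *\<^sub>R b)"
    by (auto simp: has_bochner_integral_iff z)
  have "ennreal (cmod (f (x + s *\<^sub>R b))) \<le> (\<integral>\<^sup>+t. ennreal (norm (indicator {a..s} t *\<^sub>R ?g t)) \<partial>lborel)"
    using integral_norm_bound_ennreal[OF i] by (simp add: e)
  also have "\<dots> \<le> (\<integral>\<^sup>+t. ennreal (cmod (?g t)) \<partial>lborel)"
    by (intro nn_integral_mono) (auto simp: indicator_def)
  finally show ?thesis .
qed

text \<open>The coordinates in \<open>w\<close> have been integrated over, the others are still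
  those of \<open>x\<close>. Each new letter applies the one-dimensional estimate along its axis,
  and the new integral joins the product measure.\<close>

lemma sobolev_aux:
  fixes f :: "'e::euclidean_space \<Rightarrow> complex"
  assumes "test_function f" "distinct w" "set w \<subseteq> Basis"
  shows "ennreal (cmod (f x)) \<le> (\<integral>\<^sup>+y. ennreal (cmod (pd w f
    (\<Sum>b\<in>Basis. (if b \<in> set w then y b else x \<bullet> b) *\<^sub>R b))) \<partial>(\<Pi>\<^sub>M b\<in>set w. lborel))"
  using assms(2,3)
proof (induction w)
  case Nil
  interpret product_sigma_finite "\<lambda>_::'e. lborel :: real measure" ..
  show ?case by (simp add: space_PiM_empty euclidean_representation)
next
  case (Cons c w)
  interpret product_sigma_finite "\<lambda>_::'e. lborel :: real measure" ..
  define R where "R w y = (\<Sum>b\<in>Basis. (if b \<in> set w then y b else x \<bullet> b) *\<^sub>R b)" for w and y :: "'e \<Rightarrow> real"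
  have cB: "c \<in> Basis" "c \<notin> set w" using Cons.prems by auto
  have c0: "c \<noteq> 0" using cB nonzero_Basis by blast
  have split: "R (c # w) (y(c := t)) = R w y + (t - x \<bullet> c) *\<^sub>R c" for y t
  proof -
    have "R (c # w) (y(c := t)) = (\<Sum>b\<in>Basis. (if b \<in> set w then y b else x \<bullet> b) *\<^sub>R b + (if b = c then (t - x \<bullet> c) *\<^sub>R c else 0))"
      unfolding R_def using cB by (intro sum.cong) (auto simp: scaleR_diff_left)
    also have "\<dots> = R w y + (t - x \<bullet> c) *\<^sub>R c"
      unfolding R_def sum.distrib using cB by simp
    finally show ?thesis .
  qed
  have "ennreal (cmod (f x)) \<le> (\<integral>\<^sup>+y. ennreal (cmod (pd w f (R w y))) \<partial>(\<Pi>\<^sub>M b\<in>set w. lborel))"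
    unfolding R_def using Cons by simp
  also have "\<dots> \<le> (\<integral>\<^sup>+y. (\<integral>\<^sup>+t. ennreal (cmod (pd (c # w) f (R (c # w) (y(c := t))))) \<partial>lborel) \<partial>(\<Pi>\<^sub>M b\<in>set w. lborel))"
  proof (rule nn_integral_mono)
    fix y
    have "ennreal (cmod (pd w f ((R w y + (- (x \<bullet> c)) *\<^sub>R c) + (x \<bullet> c) *\<^sub>R c)))
        \<le> (\<integral>\<^sup>+t. ennreal (cmod (ddir c (pd w f) ((R w y + (- (x \<bullet> c)) *\<^sub>R c) + t *\<^sub>R c))) \<partial>lborel)"
      by (rule norm_le_integral_ddir[OF test_function_pd[OF assms(1)] c0])
    then show "ennreal (cmod (pd w f (R w y))) \<le> (\<integral>\<^sup>+t. ennreal (cmod (pd (c # w) f (R (c # w) (y(c := t))))) \<partial>lborel)"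
      by (simp add: split algebra_simps)
  qed
  also have "\<dots> = (\<integral>\<^sup>+y. ennreal (cmod (pd (c # w) f (R (c # w) y))) \<partial>(\<Pi>\<^sub>M b\<in>insert c (set w). lborel))"
  proof (rule product_nn_integral_insert[symmetric])
    have [measurable]: "pd (c # w) f \<in> borel_measurable borel"
      using test_function_pd[OF assms(1), of "c # w"] unfolding test_function_def
      by (intro borel_measurable_continuous_onI smooth_on_continuous) blast
    have [measurable]: "R (c # w) \<in> borel_measurable (\<Pi>\<^sub>M b\<in>insert c (set w). lborel)"
      unfolding R_def
    proof (intro borel_measurable_sum borel_measurable_scaleR borel_measurable_const)
      fix b :: 'e
      show "(\<lambda>y. if b \<in> set (c # w) then y b else x \<bullet> b) \<in> borel_measurable (\<Pi>\<^sub>M b\<in>insert c (set w). lborel)"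
        by (cases "b \<in> set (c # w)") (auto intro!: measurable_component_singleton[THEN measurable_compose])
    qed
    show "(\<lambda>y. ennreal (cmod (pd (c # w) f (R (c # w) y)))) \<in> borel_measurable (\<Pi>\<^sub>M b\<in>insert c (set w). lborel)"
      by measurable
  qed (use cB in auto)
  finally show ?case unfolding R_def by simp
qed

text \<open>The elementary embedding by the L1 norm of the mixed derivative that contains every
  coordinate direction exactly once. The price of \<open>DIM('e)\<close> derivatives is affordable,
  as the L2 estimates below hold for every order.\<close>

lemma sobolev:
  fixes f :: "'e::euclidean_space \<Rightarrow> complex"
  assumes "test_function f" "distinct w" "set w = Basis"
  shows "cmod (f x) \<le> (\<integral>y. cmod (pd w f y) \<partial>lborel)"
proof -
  have t: "test_function (pd w f)" by (rule test_function_pd[OF assms(1)])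
  have m: "pd w f \<in> borel_measurable borel"
    using t unfolding test_function_def by (intro borel_measurable_continuous_onI smooth_on_continuous) blast
  have "ennreal (cmod (f x)) \<le> (\<integral>\<^sup>+y. ennreal (cmod (pd w f
    (\<Sum>b\<in>Basis. (if b \<in> set w then y b else x \<bullet> b) *\<^sub>R b))) \<partial>(\<Pi>\<^sub>M b\<in>set w. lborel))"
    using assms by (intro sobolev_aux) auto
  also have "\<dots> = (\<integral>\<^sup>+y. ennreal (cmod (pd w f (\<Sum>b\<in>Basis. y b *\<^sub>R b))) \<partial>(\<Pi>\<^sub>M b\<in>Basis. lborel))"
    by (simp add: assms(3) cong: sum.cong)
  also have "\<dots> = (\<integral>\<^sup>+y. ennreal (cmod (pd w f y)) \<partial>lborel)"
    unfolding lborel_eq[where 'a = 'e] using m by (subst nn_integral_distr) auto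
  also have "\<dots> = ennreal (\<integral>y. cmod (pd w f y) \<partial>lborel)"
    by (intro nn_integral_eq_integral integrable_norm test_function_integrable t) simp
  finally show ?thesis by (simp add: ennreal_le_iff)
qed

section \<open>Interior estimates for the perturbed Cauchy-Riemann system\<close>

definition words :: "nat \<Rightarrow> 'e::euclidean_space list set" where
  "words k = {u. set u \<subseteq> Basis \<and> length u \<le> k}"

lemma finite_words [simp]: "finite (words k)"
  unfolding words_def by (rule finite_lists_length_le) simp

lemma words_mono: "u \<in> words k \<Longrightarrow> k \<le> l \<Longrightarrow> u \<in> words l"
  by (simp add: words_def)

text \<open>Operators on a set of solutions that are linear combinations, with smooth coefficients, of the
  partial derivatives of order at most \<open>k\<close>. Only the values over the open set \<open>S\<close> matter.\<close>
inductive dop :: "'e::euclidean_space set \<Rightarrow> (nat \<Rightarrow> 'e \<Rightarrow> complex) set \<Rightarrow> nat \<Rightarrow> nat \<Rightarrow>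
    ((nat \<Rightarrow> 'e \<Rightarrow> complex) \<Rightarrow> 'e \<Rightarrow> complex) \<Rightarrow> bool"
  for S Sol r k where
  dop_pd: "u \<in> words k \<Longrightarrow> j < r \<Longrightarrow> dop S Sol r k (\<lambda>a. pd u (a j))"
| dop_zero: "dop S Sol r k (\<lambda>a x. 0)"
| dop_add: "dop S Sol r k g \<Longrightarrow> dop S Sol r k h \<Longrightarrow> dop S Sol r k (\<lambda>a x. g a x + h a x)"
| dop_mult: "smooth_on S c \<Longrightarrow> dop S Sol r k g \<Longrightarrow> dop S Sol r k (\<lambda>a x. c x * g a x)"
| dop_cong: "dop S Sol r k g \<Longrightarrow> (\<And>a x. a \<in> Sol \<Longrightarrow> x \<in> S \<Longrightarrow> g a x = h a x) \<Longrightarrow> dop S Sol r k h"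

lemma dop_mono: "dop S Sol r k g \<Longrightarrow> k \<le> l \<Longrightarrow> dop S Sol r l g"
  by (induction rule: dop.induct) (auto intro: dop.intros words_mono)

lemma dop_sum: "(\<And>i. i \<in> I \<Longrightarrow> dop S Sol r k (g i)) \<Longrightarrow> dop S Sol r k (\<lambda>a x. \<Sum>i\<in>I. g i a x)"
  by (induction I rule: infinite_finite_induct) (auto intro: dop_zero dop_add)

definition jet_norm :: "nat \<Rightarrow> nat \<Rightarrow> (nat \<Rightarrow> 'e::euclidean_space \<Rightarrow> complex) \<Rightarrow> 'e \<Rightarrow> real" where
  "jet_norm r k a x = (\<Sum>(u, j)\<in>words k \<times> {..<r}. cmod (pd u (a j) x))"

lemma jet_norm_nonneg [simp]: "jet_norm r k a x \<ge> 0"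
  unfolding jet_norm_def by (auto intro: sum_nonneg)

text \<open>Smooth coefficients are bounded on the compact set \<open>K\<close>. The constant
  depends on the operator and not on the solution \<open>a\<close>; this uniformity is the purpose
  of \<open>dop\<close>.\<close>

lemma dop_bound:
  assumes "compact K" "K \<subseteq> S"
  shows "dop S Sol r k g \<Longrightarrow> \<exists>C\<ge>0. \<forall>a\<in>Sol. \<forall>x\<in>K. cmod (g a x) \<le> C * jet_norm r k a x"
proof (induction rule: dop.induct)
  case (dop_pd u j)
  have "cmod (pd u (a j) x) \<le> jet_norm r k a x" for a x
    unfolding jet_norm_def
    using member_le_sum[of "(u, j)" "words k \<times> {..<r}" "\<lambda>(u, j). cmod (pd u (a j) x)"] dop_pd by auto
  then show ?case by (intro exI[of _ 1]) auto
next
  case dop_zero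
  then show ?case by (intro exI[of _ 0]) auto
next
  case (dop_add g h)
  then obtain C D where "C \<ge> 0" "D \<ge> 0"
    and C: "\<And>a x. a \<in> Sol \<Longrightarrow> x \<in> K \<Longrightarrow> cmod (g a x) \<le> C * jet_norm r k a x"
    and D: "\<And>a x. a \<in> Sol \<Longrightarrow> x \<in> K \<Longrightarrow> cmod (h a x) \<le> D * jet_norm r k a x" by blast
  have "cmod (g a x + h a x) \<le> (C + D) * jet_norm r k a x" if "a \<in> Sol" "x \<in> K" for a x
    using norm_triangle_ineq[of "g a x" "h a x"] C[OF that] D[OF that] by (simp add: distrib_right)
  then show ?case using \<open>C \<ge> 0\<close> \<open>D \<ge> 0\<close> by (intro exI[of _ "C + D"]) auto
next
  case (dop_mult c g)
  then obtain C where C: "C \<ge> 0" "\<And>a x. a \<in> Sol \<Longrightarrow> x \<in> K \<Longrightarrow> cmod (g a x) \<le> C * jet_norm r k a x" by blast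
  have "compact (c ` K)"
    using assms dop_mult(1) by (intro compact_continuous_image) (auto intro: continuous_on_subset smooth_on_continuous)
  then obtain M where M: "\<And>x. x \<in> K \<Longrightarrow> cmod (c x) \<le> M"
    using compact_imp_bounded bounded_iff by (metis imageI)
  have "cmod (c x * g a x) \<le> (max M 0 * C) * jet_norm r k a x" if "a \<in> Sol" "x \<in> K" for a x
  proof -
    have "cmod (c x * g a x) \<le> max M 0 * (C * jet_norm r k a x)"
      unfolding norm_mult using M[OF that(2)] C(2)[OF that] by (intro mult_mono) auto
    then show ?thesis by (simp add: mult.assoc)
  qed
  then show ?case using C(1) by (intro exI[of _ "max M 0 * C"]) auto
next
  case (dop_cong g h)
  then obtain C where C: "C \<ge> 0" "\<And>a x. a \<in> Sol \<Longrightarrow> x \<in> K \<Longrightarrow> cmod (g a x) \<le> C * jet_norm r k a x" by blast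
  have "cmod (h a x) \<le> C * jet_norm r k a x" if "a \<in> Sol" "x \<in> K" for a x
    using C(2)[OF that] dop_cong(2)[OF that(1)] that(2) assms(2) by auto
  then show ?case using C(1) by blast
qed

text \<open>\<open>W b x\<close> stands for J applied to \<open>b\<close> at \<open>x\<close>, in
  coordinates. The last assumption is the equation of the overview: on solutions, the
  (0,1)-derivative of each component is an operator of order zero in all the components.\<close>

locale cr_system =
  fixes S :: "'e::euclidean_space set" and Sol :: "(nat \<Rightarrow> 'e \<Rightarrow> complex) set" and r :: nat
    and W :: "'e \<Rightarrow> 'e \<Rightarrow> 'e"
  assumes S: "open S"
    and smooth: "\<And>a j. a \<in> Sol \<Longrightarrow> j < r \<Longrightarrow> smooth_on S (a j)"
    and smooth_W: "\<And>b. b \<in> Basis \<Longrightarrow> smooth_on S (W b)"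
    and eqn: "\<And>b j. b \<in> Basis \<Longrightarrow> j < r \<Longrightarrow>
      dop S Sol r 0 (\<lambda>a x. ddir b (a j) x + \<i> * ddir (W b x) (a j) x)"
begin

abbreviation "op k \<equiv> dop S Sol r k"

lemma dop_smooth: "op k g \<Longrightarrow> a \<in> Sol \<Longrightarrow> smooth_on S (g a)"
  by (induction rule: dop.induct)
    (auto intro: smooth_on_pd smooth smooth_on_const smooth_on_add smooth_on_mult S smooth_on_cong)

lemma dop_differentiable: "op k g \<Longrightarrow> a \<in> Sol \<Longrightarrow> x \<in> S \<Longrightarrow> g a differentiable (at x)"
  using dop_smooth smooth_on_differentiable by blast

lemma dop_ddir_Basis:
  assumes b: "b \<in> Basis"
  shows "op k g \<Longrightarrow> op (Suc k) (\<lambda>a. ddir b (g a))"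
proof (induction rule: dop.induct)
  case (dop_pd u j)
  then have "op (Suc k) (\<lambda>a. pd (b # u) (a j))"
    by (intro dop.dop_pd) (use b in \<open>auto simp: words_def\<close>)
  then show ?case by simp
next
  case dop_zero
  then show ?case by (simp add: dop.dop_zero)
next
  case (dop_add g h)
  show ?case
    by (rule dop_cong[OF dop.dop_add[OF dop_add.IH]])
      (use dop_add dop_differentiable in \<open>auto simp: ddir_add\<close>)
next
  case (dop_mult c g)
  have "op (Suc k) (\<lambda>a x. c x * ddir b (g a) x + ddir b c x * g a x)"
    using dop_mult by (intro dop.dop_add dop.dop_mult smooth_onD_ddir) (auto intro: dop_mono)
  then show ?case
    by (rule dop_cong)
      (simp add: ddir_mult smooth_on_differentiable[OF dop_mult(1)] dop_differentiable[OF dop_mult(2)])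
next
  case (dop_cong g h)
  show ?case
    by (rule dop.dop_cong[OF dop_cong.IH]) (use dop_cong.hyps ddir_cong_open[OF S] in blast)
qed

lemma dop_ddir_field:
  assumes "\<And>c. c \<in> Basis \<Longrightarrow> smooth_on S (\<lambda>x. V x \<bullet> c)" and g: "op k g"
  shows "op (Suc k) (\<lambda>a x. ddir (V x) (g a) x)"
proof -
  have "op (Suc k) (\<lambda>a x. \<Sum>c\<in>Basis. of_real (V x \<bullet> c) * ddir c (g a) x)"
    by (intro dop_sum dop_mult dop_ddir_Basis g smooth_on_linear_comp[OF bounded_linear_of_real] S assms(1))
  then show ?thesis
    by (rule dop_cong) (subst ddir_expand, auto simp: dop_differentiable[OF g] scaleR_conv_of_real)
qed

lemma smooth_W_inner: "b \<in> Basis \<Longrightarrow> smooth_on S (\<lambda>x. W b x \<bullet> c)"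
  by (intro smooth_on_linear_comp[OF bounded_linear_inner_left] S smooth_W)

text \<open>The expression looks like an operator of order k + 1 but has order k on solutions.
  Differentiating the system in direction \<open>c\<close> reproduces it for the derivative, up to a
  term in which the coefficient field \<open>W b\<close> itself is differentiated; that term is
  again of admissible order and is subtracted.\<close>

lemma eqn_pd:
  assumes "u \<in> words k" "b \<in> Basis" "j < r"
  shows "op k (\<lambda>a x. ddir b (pd u (a j)) x + \<i> * ddir (W b x) (pd u (a j)) x)"
proof -
  have "op (length u) (\<lambda>a x. ddir b (pd u (a j)) x + \<i> * ddir (W b x) (pd u (a j)) x)"
    if "set u \<subseteq> Basis" for u
    using that
  proof (induction u)
    case Nil
    then show ?case using eqn[OF assms(2,3)] by simp
  next
    case (Cons c u)
    then have c: "c \<in> Basis" and u: "set u \<subseteq> Basis" by auto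
    let ?f = "\<lambda>a. pd u (a j)"
    have f: "op (length u) ?f" using u assms by (intro dop_pd) (auto simp: words_def)
    have d: "op (Suc (length u)) (\<lambda>a x. ddir c (\<lambda>x. ddir b (?f a) x + \<i> * ddir (W b x) (?f a) x) x
        + (- \<i>) * ddir (ddir c (W b) x) (?f a) x)"
    proof (rule dop_add[OF dop_ddir_Basis[OF c Cons.IH[OF u]] dop_mult[OF smooth_on_const dop_ddir_field[OF _ f]]])
      fix c' :: 'e
      show "smooth_on S (\<lambda>x. ddir c (W b) x \<bullet> c')"
        by (intro smooth_on_linear_comp[OF bounded_linear_inner_left] S smooth_onD_ddir smooth_W assms)
    qed
    have "op (Suc (length u)) (\<lambda>a x. ddir b (ddir c (?f a)) x + \<i> * ddir (W b x) (ddir c (?f a)) x)"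
    proof (rule dop_cong[OF d])
      fix a x assume a: "a \<in> Sol" and x: "x \<in> S"
      have sf: "smooth_on S (?f a)" by (rule dop_smooth[OF f a])
      have fd: "?f a differentiable (at y)" if "y \<in> S" for y by (rule smooth_on_differentiable[OF sf that])
      have fd2: "ddir v (?f a) differentiable (at y)" if "y \<in> S" for y v
        by (rule smooth_on_differentiable[OF smooth_onD_ddir[OF sf] that])
      let ?g = "\<lambda>x. \<Sum>b'\<in>Basis. of_real (W b x \<bullet> b') * ddir b' (?f a) x"
      have Wd: "(\<lambda>x. W b x \<bullet> b') differentiable (at x)" for b'
        by (rule smooth_on_differentiable[OF smooth_W_inner[OF assms(2)] x])
      have ofd: "(\<lambda>x. complex_of_real (W b x \<bullet> b')) differentiable (at x)" for b'
        by (rule smooth_on_differentiable[OF smooth_on_linear_comp[OF bounded_linear_of_real S smooth_W_inner[OF assms(2)]] x])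
      have mulD: "(\<lambda>x. of_real (W b x \<bullet> b') * ddir b' (?f a) x) differentiable (at x)" for b'
        by (intro differentiable_mult ofd fd2 x)
      have gD: "?g differentiable (at x)"
        by (rule differentiable_sum) (simp_all add: mulD)
      have "ddir c (\<lambda>x. ddir b (?f a) x + \<i> * ddir (W b x) (?f a) x) x =
          ddir c (\<lambda>x. ddir b (?f a) x + \<i> * ?g x) x"
        by (rule ddir_cong_open[OF S x]) (subst ddir_expand[OF fd], auto simp: scaleR_conv_of_real)
      also have "\<dots> = ddir c (ddir b (?f a)) x + \<i> * ddir c ?g x"
        using fd2[OF x] gD by (simp add: ddir_add ddir_cmult differentiable_mult)
      also have "ddir c ?g x = (\<Sum>b'\<in>Basis. of_real (W b x \<bullet> b') * ddir c (ddir b' (?f a)) x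
          + of_real (ddir c (W b) x \<bullet> b') * ddir b' (?f a) x)"
      proof -
        have "ddir c (\<lambda>x. complex_of_real (W b x \<bullet> b')) x = of_real (ddir c (W b) x \<bullet> b')" for b'
          using ddir_linear_comp[OF bounded_linear_of_real Wd]
            ddir_linear_comp[OF bounded_linear_inner_left smooth_on_differentiable[OF smooth_W[OF assms(2)] x]]
          by simp
        then show ?thesis
          by (subst ddir_sum[OF mulD]) (simp add: ddir_mult[OF ofd fd2[OF x]])
      qed
      also have "\<dots> = ddir (W b x) (ddir c (?f a)) x + ddir (ddir c (W b) x) (?f a) x"
        using ddir_expand[OF fd2[OF x], of "W b x" c] ddir_expand[OF fd[OF x], of "ddir c (W b) x"]
          ddir_commute[OF S sf x, of c]
        by (simp add: sum.distrib scaleR_conv_of_real)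
      finally show "ddir c (\<lambda>x. ddir b (?f a) x + \<i> * ddir (W b x) (?f a) x) x
          + (- \<i>) * ddir (ddir c (W b) x) (?f a) x =
        ddir b (ddir c (?f a)) x + \<i> * ddir (W b x) (ddir c (?f a)) x"
        using ddir_commute[OF S sf x, of c b] by (simp add: algebra_simps)
    qed
    then show ?case by simp
  qed
  then show ?thesis using assms(1) dop_mono unfolding words_def by blast
qed

end

lemma test_function_cutoff:
  fixes f :: "'e::euclidean_space \<Rightarrow> complex"
  assumes "smooth_on UNIV \<zeta>" "\<And>x. \<rho> \<le> dist z x \<Longrightarrow> \<zeta> x = 0" "\<rho> < R" "smooth_on (ball z R) f"
  shows "test_function (\<lambda>x. \<zeta> x * f x)"
proof -
  have "smooth_on UNIV (\<lambda>x. \<zeta> x * f x)"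
  proof (rule smooth_on_local)
    fix x :: 'e
    show "\<exists>T. open T \<and> x \<in> T \<and> smooth_on T (\<lambda>x. \<zeta> x * f x)"
    proof (cases "dist z x < R")
      case True
      have "smooth_on (ball z R) (\<lambda>x. \<zeta> x * f x)"
        by (intro smooth_on_mult open_ball assms(4) smooth_on_subset[OF assms(1)] subset_UNIV)
      then show ?thesis using True by (intro exI[of _ "ball z R"]) auto
    next
      case False
      have "smooth_on (- cball z \<rho>) (\<lambda>x. \<zeta> x * f x)"
        by (rule smooth_on_cong[OF _ _ smooth_on_const[of _ 0]]) (use assms(2) in auto)
      then show ?thesis using False assms(3) by (intro exI[of _ "- cball z \<rho>"]) auto
    qed
  qed
  moreover have "{x. \<zeta> x * f x \<noteq> 0} \<subseteq> ball z \<rho>" using assms(2) by force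
  ultimately show ?thesis unfolding test_function_def using bounded_ball bounded_subset by blast
qed

text \<open>The bound on the oscillation of \<open>W\<close> is exactly what
  \<open>energy_bound\<close> can absorb when the field is frozen at the centre
  \<open>z\<close>.\<close>

locale cr_ball = cr_system "ball z R" Sol r W
  for z :: "'e::euclidean_space" and R Sol r W +
  assumes R: "R > 0"
    and close: "\<And>x b c. x \<in> ball z R \<Longrightarrow> b \<in> Basis \<Longrightarrow> c \<in> Basis \<Longrightarrow>
      \<bar>(W b x - W b z) \<bullet> c\<bar> \<le> 1 / (2 * DIM('e))"
begin

lemma integrable_pd_square:
  assumes "a \<in> Sol" "j < r" "\<rho> < R"
  shows "integrable lborel (\<lambda>x. indicator (cball z \<rho>) x * (cmod (pd u (a j) x))\<^sup>2)"
    and "integrable lborel (\<lambda>x. indicator (cball z \<rho>) x * cmod (pd u (a j) x))"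
proof -
  have c: "continuous_on (cball z \<rho>) (pd u (a j))"
    by (rule continuous_on_subset[OF smooth_on_continuous[OF smooth_on_pd[OF smooth]]])
      (use assms in auto)
  show "integrable lborel (\<lambda>x. indicator (cball z \<rho>) x * (cmod (pd u (a j) x))\<^sup>2)"
    "integrable lborel (\<lambda>x. indicator (cball z \<rho>) x * cmod (pd u (a j) x))"
    using borel_integrable_compact[OF compact_cball continuous_on_power[OF continuous_on_norm[OF c]], of 2]
      borel_integrable_compact[OF compact_cball continuous_on_norm[OF c]] by auto
qed

text \<open>Every further derivative costs a somewhat smaller ball. A derivative of order k times a
  cut-off function satisfies the system up to operators of order k, whose L2 norms on the larger
  ball are known by induction; \<open>energy_bound\<close> then controls all its first
  derivatives.\<close>

lemma l2_estimate:
  assumes "0 < \<rho>" "\<rho> < R"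
  shows "\<exists>C\<ge>0. \<forall>a\<in>Sol. \<forall>A. (\<forall>x\<in>ball z R. \<forall>j<r. cmod (a j x) \<le> A) \<longrightarrow>
    (\<forall>u\<in>words k. \<forall>j<r. (\<integral>x. indicator (cball z \<rho>) x * (cmod (pd u (a j) x))\<^sup>2 \<partial>lborel) \<le> C * A\<^sup>2)"
  using assms
proof (induction k arbitrary: \<rho>)
  case 0
  define C :: real where "C = (\<integral>x. indicator (cball z \<rho>) x \<partial>(lborel :: 'e measure))"
  have i: "integrable lborel (\<lambda>x. indicator (cball z \<rho>) x *\<^sub>R (1::real))"
    by (rule borel_integrable_compact) auto
  show ?case
  proof (intro exI[of _ C] conjI ballI allI impI)
    show "C \<ge> 0" unfolding C_def by (rule integral_nonneg_AE) auto
    fix a A j and u :: "'e list"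
    assume h: "a \<in> Sol" "\<forall>x\<in>ball z R. \<forall>j<r. cmod (a j x) \<le> A" "u \<in> words 0" "j < r"
    then have u: "u = []" by (simp add: words_def)
    have "(\<integral>x. indicator (cball z \<rho>) x * (cmod (pd u (a j) x))\<^sup>2 \<partial>lborel)
      \<le> (\<integral>x. indicator (cball z \<rho>) x * A\<^sup>2 \<partial>(lborel :: 'e measure))"
    proof (rule Bochner_Integration.integral_mono)
      show "integrable lborel (\<lambda>x. indicator (cball z \<rho>) x * (cmod (pd u (a j) x))\<^sup>2)"
        by (rule integrable_pd_square) (use h 0 in auto)
      show "integrable lborel (\<lambda>x. indicator (cball z \<rho>) x * A\<^sup>2)" using i by simp
      fix x
      show "indicator (cball z \<rho>) x * (cmod (pd u (a j) x))\<^sup>2 \<le> indicator (cball z \<rho>) x * A\<^sup>2"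
        using h(2,4) 0 by (auto simp: u indicator_def intro!: power_mono)
    qed
    also have "\<dots> = C * A\<^sup>2" unfolding C_def by simp
    finally show "(\<integral>x. indicator (cball z \<rho>) x * (cmod (pd u (a j) x))\<^sup>2 \<partial>lborel) \<le> C * A\<^sup>2" .
  qed
next
  case (Suc k)
  \<comment> \<open>The cut-off function is 1 up to radius \<open>\<rho>1\<close> and 0 from
    \<open>\<rho>2\<close> on, where the induction hypothesis is used. The gap between
    \<open>\<rho>\<close> and \<open>\<rho>1\<close> makes derivatives agree with those of the
    cut-off function on the whole closed ball of radius \<open>\<rho>\<close>.\<close>
  define \<rho>2 where "\<rho>2 = (\<rho> + R) / 2"
  define \<rho>1 where "\<rho>1 = (\<rho> + \<rho>2) / 2"
  have rh: "0 < \<rho>1" "\<rho> < \<rho>1" "\<rho>1 < \<rho>2" "\<rho>2 < R" "0 < \<rho>2"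
    using Suc.prems by (auto simp: \<rho>1_def \<rho>2_def field_simps)
  let ?K = "cball z \<rho>2"
  have KS: "?K \<subseteq> ball z R" using rh by auto
  obtain C0 where C0: "C0 \<ge> 0" "\<And>a A u j. a \<in> Sol \<Longrightarrow> (\<forall>x\<in>ball z R. \<forall>j<r. cmod (a j x) \<le> A) \<Longrightarrow>
      u \<in> words k \<Longrightarrow> j < r \<Longrightarrow> (\<integral>x. indicator ?K x * (cmod (pd u (a j) x))\<^sup>2 \<partial>lborel) \<le> C0 * A\<^sup>2"
    using Suc.IH[OF rh(5,4)] by blast
  obtain \<zeta> :: "'e \<Rightarrow> complex" where \<zeta>: "smooth_on UNIV \<zeta>" "\<And>x. dist z x \<le> \<rho>1 \<Longrightarrow> \<zeta> x = 1"
    "\<And>x. \<rho>2 \<le> dist z x \<Longrightarrow> \<zeta> x = 0"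
    using bump_exists[OF rh(1,3), of z] by blast
  have \<zeta>d: "\<zeta> differentiable (at x)" for x using smooth_on_differentiable[OF \<zeta>(1)] by simp
  \<comment> \<open>The left-hand side of the system for the product of \<open>\<zeta>\<close> with
    \<open>pd u (a j)\<close>, sorted by the product rule: the first summand has order k by
    \<open>eqn_pd\<close>, the second has no derivative beyond \<open>pd u (a j)\<close>.\<close>
  define G where "G u j b a x = \<zeta> x * (ddir b (pd u (a j)) x + \<i> * ddir (W b x) (pd u (a j)) x)
      + (ddir b \<zeta> x + \<i> * ddir (W b x) \<zeta> x) * pd u (a j) x" for u j b and a :: "nat \<Rightarrow> 'e \<Rightarrow> complex" and x
  have opG: "op k (G u j b)" if "u \<in> words k" "j < r" "b \<in> Basis" for u j b
    unfolding G_def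
  proof (rule dop_add[OF dop_mult[OF _ eqn_pd[OF that(1,3,2)]] dop_mult[OF _ dop_pd[OF that(1,2)]]])
    show "smooth_on (ball z R) \<zeta>" using \<zeta>(1) smooth_on_subset by blast
    have "smooth_on (ball z R) (\<lambda>x. ddir b \<zeta> x + \<i> * (\<Sum>c\<in>Basis. of_real (W b x \<bullet> c) * ddir c \<zeta> x))"
      by (intro smooth_on_add smooth_on_mult smooth_on_const smooth_on_sum open_ball smooth_W_inner that
          smooth_on_linear_comp[OF bounded_linear_of_real] smooth_on_subset[OF smooth_onD_ddir[OF \<zeta>(1)]] subset_UNIV)
    then show "smooth_on (ball z R) (\<lambda>x. ddir b \<zeta> x + \<i> * ddir (W b x) \<zeta> x)"
      by (rule smooth_on_cong[OF open_ball, rotated])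
        (subst ddir_expand[OF \<zeta>d, of "W b _"], simp add: scaleR_conv_of_real)
  qed
  \<comment> \<open>One constant for each of finitely many operators; their sum \<open>C1\<close>
    serves all of them.\<close>
  define c where "c u j b = (SOME C. C \<ge> 0 \<and>
      (\<forall>a\<in>Sol. \<forall>x\<in>?K. cmod (G u j b a x) \<le> C * jet_norm r k a x))" for u j b
  have c: "c u j b \<ge> 0 \<and> (\<forall>a\<in>Sol. \<forall>x\<in>?K. cmod (G u j b a x) \<le> c u j b * jet_norm r k a x)"
    if "(u, j, b) \<in> words k \<times> {..<r} \<times> Basis" for u j b
    unfolding c_def by (rule someI_ex) (use dop_bound[OF compact_cball KS opG] that in blast)
  define C1 where "C1 = (\<Sum>(u, j, b)\<in>words k \<times> {..<r} \<times> (Basis :: 'e set). c u j b)"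
  have C1: "C1 \<ge> 0" unfolding C1_def using c by (intro sum_nonneg) auto
  have GC1: "cmod (G u j b a x) \<le> C1 * jet_norm r k a x"
    if "a \<in> Sol" "x \<in> ?K" "u \<in> words k" "j < r" "b \<in> Basis" for u j b a x
  proof -
    have "c u j b \<le> C1"
      unfolding C1_def
      using member_le_sum[of "(u, j, b)" "words k \<times> {..<r} \<times> (Basis :: 'e set)" "\<lambda>(u, j, b). c u j b"] c that by auto
    moreover have "cmod (G u j b a x) \<le> c u j b * jet_norm r k a x" using c that by auto
    ultimately show ?thesis by (meson jet_norm_nonneg mult_right_mono order_trans)
  qed
  define M where "M = real (card (words k \<times> {..<r} :: ('e list \<times> nat) set))"
  \<comment> \<open>\<open>4 * DIM('e)\<close> comes from \<open>energy_bound\<close> and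
    \<open>C1\<^sup>2\<close> from the squared bound on \<open>G\<close>. One factor
    \<open>M\<close> is due to Cauchy-Schwarz over the jet, the other counts the integrals, each at
    most \<open>C0 * A\<^sup>2\<close>.\<close>
  define C2 where "C2 = 4 * DIM('e) * (C1\<^sup>2 * (M * M * C0))"
  have C2: "C2 \<ge> 0" unfolding C2_def M_def using C0(1) by simp
  have key: "(\<integral>x. indicator (cball z \<rho>) x * (cmod (ddir b (pd u (a j)) x))\<^sup>2 \<partial>lborel) \<le> C2 * A\<^sup>2"
    if a: "a \<in> Sol" and A: "\<forall>x\<in>ball z R. \<forall>j<r. cmod (a j x) \<le> A" and u: "u \<in> words k" and j: "j < r"
      and b: "b \<in> Basis" for a A u j b
  proof -
    let ?f = "pd u (a j)"
    let ?\<phi> = "\<lambda>x. \<zeta> x * ?f x"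
    have sf: "smooth_on (ball z R) ?f" by (rule smooth_on_pd[OF smooth[OF a j]])
    have t: "test_function ?\<phi>" by (rule test_function_cutoff[OF \<zeta>(1,3) rh(4) sf])
    have off: "ddir v ?\<phi> x = 0" if "x \<notin> ?K" for v x
    proof -
      have "ddir v ?\<phi> x = ddir v (\<lambda>_. 0) x"
        by (rule ddir_cong_open[of "- ?K"]) (use that \<zeta>(3) in auto)
      then show ?thesis by simp
    qed
    have on: "ddir v ?\<phi> x = \<zeta> x * ddir v ?f x + ddir v \<zeta> x * ?f x" if "x \<in> ?K" for v x
      using that KS by (intro ddir_mult \<zeta>d smooth_on_differentiable[OF sf]) blast
    define g where "g x = indicator ?K x * (C1\<^sup>2 * (M * (\<Sum>(u, j)\<in>words k \<times> {..<r}. (cmod (pd u (a j) x))\<^sup>2)))" for x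
    have ge: "g x = C1\<^sup>2 * (M * (\<Sum>(u, j)\<in>words k \<times> {..<r}. indicator ?K x * (cmod (pd u (a j) x))\<^sup>2))" for x
      unfolding g_def by (cases "x \<in> ?K") (simp_all add: case_prod_unfold)
    have ii: "integrable lborel (\<lambda>x. case p of (u, j) \<Rightarrow> indicator ?K x * (cmod (pd u (a j) x))\<^sup>2)"
      if "p \<in> words k \<times> {..<r}" for p
      using that integrable_pd_square(1)[OF a _ rh(4)] by auto
    have ig: "integrable lborel g"
      unfolding ge by (intro integrable_mult_right Bochner_Integration.integrable_sum ii)
    have "(\<integral>x. g x \<partial>lborel) = C1\<^sup>2 * (M * (\<Sum>p\<in>words k \<times> {..<r}. \<integral>x. (case p of (u, j) \<Rightarrow> indicator ?K x * (cmod (pd u (a j) x))\<^sup>2) \<partial>lborel))"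
      unfolding ge by (simp only: integral_mult_right_zero Bochner_Integration.integral_sum[OF ii])
    also have "\<dots> \<le> C1\<^sup>2 * (M * (\<Sum>p\<in>(words k \<times> {..<r} :: ('e list \<times> nat) set). C0 * A\<^sup>2))"
    proof (intro mult_left_mono sum_mono)
      fix p :: "'e list \<times> nat" assume "p \<in> words k \<times> {..<r}"
      then show "(\<integral>x. (case p of (u, j) \<Rightarrow> indicator ?K x * (cmod (pd u (a j) x))\<^sup>2) \<partial>lborel) \<le> C0 * A\<^sup>2"
        using C0(2)[OF a A] by auto
    qed (auto simp: M_def)
    finally have gi: "4 * DIM('e) * (\<integral>x. g x \<partial>lborel) \<le> C2 * A\<^sup>2"
      by (simp add: C2_def M_def mult_ac)
    have "(\<Sum>b\<in>Basis. \<integral>x. (cmod (ddir b ?\<phi> x))\<^sup>2 \<partial>lborel) \<le> 4 * DIM('e) * (\<integral>x. g x \<partial>lborel)"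
    proof (rule energy_bound[OF t ig, of ?K W "\<lambda>b. W b z"])
      show "\<bar>(W b x - W b z) \<bullet> c\<bar> \<le> 1 / real (2 * DIM('e))" if "x \<in> ?K" "b \<in> Basis" "c \<in> Basis" for x b c
        using close[of x b c] that KS by auto
      fix x b assume b: "b \<in> (Basis :: 'e set)"
      show "(cmod (ddir b ?\<phi> x + \<i> * ddir (W b x) ?\<phi> x))\<^sup>2 \<le> g x"
      proof (cases "x \<in> ?K")
        case True
        have "ddir b ?\<phi> x + \<i> * ddir (W b x) ?\<phi> x = G u j b a x"
          unfolding on[OF True] G_def by (simp add: algebra_simps)
        then have "(cmod (ddir b ?\<phi> x + \<i> * ddir (W b x) ?\<phi> x))\<^sup>2 \<le> (C1 * jet_norm r k a x)\<^sup>2"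
          using GC1[OF a True u j b] by (simp add: power_mono)
        also have "\<dots> \<le> C1\<^sup>2 * ((\<Sum>(u, j)\<in>words k \<times> {..<r}. (cmod (pd u (a j) x))\<^sup>2) * M)"
          unfolding power_mult_distrib jet_norm_def M_def
          using sum_squared_le_sum_of_squares[of "\<lambda>(u, j). cmod (pd u (a j) x)" "words k \<times> {..<r}"]
          by (intro mult_left_mono) (auto simp: case_prod_unfold)
        also have "\<dots> = g x" using True by (simp add: g_def mult_ac)
        finally show ?thesis .
      next
        case False
        then show ?thesis by (simp add: off g_def)
      qed
    qed (use off in auto)
    moreover have "(\<integral>x. (cmod (ddir b ?\<phi> x))\<^sup>2 \<partial>lborel) \<le> (\<Sum>b\<in>Basis. \<integral>x. (cmod (ddir b ?\<phi> x))\<^sup>2 \<partial>lborel)"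
      by (rule member_le_sum[OF b, of "\<lambda>b. \<integral>x. (cmod (ddir b ?\<phi> x))\<^sup>2 \<partial>lborel"])
        (auto intro!: integral_nonneg_AE)
    moreover have "(\<integral>x. indicator (cball z \<rho>) x * (cmod (ddir b ?f x))\<^sup>2 \<partial>lborel) \<le> (\<integral>x. (cmod (ddir b ?\<phi> x))\<^sup>2 \<partial>lborel)"
    proof (rule Bochner_Integration.integral_mono)
      show "integrable lborel (\<lambda>x. indicator (cball z \<rho>) x * (cmod (ddir b ?f x))\<^sup>2)"
        using integrable_pd_square(1)[OF a j, of \<rho> "b # u"] Suc.prems by simp
      show "integrable lborel (\<lambda>x. (cmod (ddir b ?\<phi> x))\<^sup>2)"
        by (rule integrable_cmod_square[OF test_function_ddir[OF t]])
      fix x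
      have "ddir b ?f x = ddir b ?\<phi> x" if "x \<in> cball z \<rho>"
        by (rule ddir_cong_open[of "ball z \<rho>1"]) (use that rh \<zeta>(2) in auto)
      then show "indicator (cball z \<rho>) x * (cmod (ddir b ?f x))\<^sup>2 \<le> (cmod (ddir b ?\<phi> x))\<^sup>2"
        by (auto simp: indicator_def)
    qed
    ultimately show ?thesis using gi by linarith
  qed
  \<comment> \<open>Serves the empty word: every other word of length at most k + 1 starts with a
    derivative and is covered by \<open>key\<close>.\<close>
  obtain C3 where C3: "C3 \<ge> 0" "\<And>a A u j. a \<in> Sol \<Longrightarrow> (\<forall>x\<in>ball z R. \<forall>j<r. cmod (a j x) \<le> A) \<Longrightarrow>
      u \<in> words k \<Longrightarrow> j < r \<Longrightarrow> (\<integral>x. indicator (cball z \<rho>) x * (cmod (pd u (a j) x))\<^sup>2 \<partial>lborel) \<le> C3 * A\<^sup>2"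
    using Suc.IH[OF Suc.prems] by blast
  show ?case
  proof (intro exI[of _ "C2 + C3"] conjI ballI allI impI)
    fix a A j and u :: "'e list"
    assume h: "a \<in> Sol" "\<forall>x\<in>ball z R. \<forall>j<r. cmod (a j x) \<le> A" "u \<in> words (Suc k)" "j < r"
    show "(\<integral>x. indicator (cball z \<rho>) x * (cmod (pd u (a j) x))\<^sup>2 \<partial>lborel) \<le> (C2 + C3) * A\<^sup>2"
    proof (cases u)
      case Nil
      then have "(\<integral>x. indicator (cball z \<rho>) x * (cmod (pd u (a j) x))\<^sup>2 \<partial>lborel) \<le> C3 * A\<^sup>2"
        using C3(2)[OF h(1,2), of u j] h(4) by (simp add: words_def)
      also have "\<dots> \<le> (C2 + C3) * A\<^sup>2" using C2 by (intro mult_right_mono) auto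
      finally show ?thesis .
    next
      case (Cons b w)
      then have "(\<integral>x. indicator (cball z \<rho>) x * (cmod (pd u (a j) x))\<^sup>2 \<partial>lborel) \<le> C2 * A\<^sup>2"
        using key[OF h(1,2), of w j b] h(3,4) by (simp add: words_def)
      also have "\<dots> \<le> (C2 + C3) * A\<^sup>2" using C3 by (intro mult_right_mono) auto
      finally show ?thesis .
    qed
  qed (use C2 C3 in auto)
qed

text \<open>The Sobolev inequality for a cut-off first derivative bounds it by L1 norms, and the L2
  estimate bounds these. Both the assumption and the conclusion are linear in \<open>A\<close>, so
  the passage from L2 to L1 has to respect this scaling.\<close>

lemma gradient_estimate:
  "\<exists>C\<ge>0. \<forall>a\<in>Sol. \<forall>A>0. (\<forall>x\<in>ball z R. \<forall>j<r. cmod (a j x) \<le> A) \<longrightarrow>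
    (\<forall>x\<in>cball z (R / 2). \<forall>b\<in>Basis. \<forall>j<r. cmod (ddir b (a j) x) \<le> C * A)"
proof -
  \<comment> \<open>One derivative for the gradient, and one in each coordinate direction for the
    Sobolev inequality.\<close>
  define N where "N = Suc DIM('e)"
  obtain w :: "'e list" where w: "distinct w" "set w = Basis"
    using finite_distinct_list[OF finite_Basis] by blast
  have lw: "length w = DIM('e)" using w distinct_card by metis
  define \<rho>1 where "\<rho>1 = R * 2 / 3"
  define \<rho>2 where "\<rho>2 = R * 3 / 4"
  have rh: "0 < \<rho>1" "\<rho>1 < \<rho>2" "\<rho>2 < R" "0 < \<rho>2" "R / 2 < \<rho>1" using R by (auto simp: \<rho>1_def \<rho>2_def)
  let ?K = "cball z \<rho>2"
  have KS: "?K \<subseteq> ball z R" using rh by auto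
  obtain \<zeta> :: "'e \<Rightarrow> complex" where \<zeta>: "smooth_on UNIV \<zeta>" "\<And>x. dist z x \<le> \<rho>1 \<Longrightarrow> \<zeta> x = 1"
    "\<And>x. \<rho>2 \<le> dist z x \<Longrightarrow> \<zeta> x = 0"
    using bump_exists[OF rh(1,2), of z] by blast
  obtain C0 where C0: "C0 \<ge> 0" "\<And>a A u j. a \<in> Sol \<Longrightarrow> (\<forall>x\<in>ball z R. \<forall>j<r. cmod (a j x) \<le> A) \<Longrightarrow>
      u \<in> words N \<Longrightarrow> j < r \<Longrightarrow> (\<integral>x. indicator ?K x * (cmod (pd u (a j) x))\<^sup>2 \<partial>lborel) \<le> C0 * A\<^sup>2"
    using l2_estimate[OF rh(4,3), of N] by blast
  have opw: "op (length v + k) (\<lambda>a. pd v (g a))" if "op k g" "set v \<subseteq> Basis" for g v k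
    using that(2) by (induction v) (auto intro: dop_ddir_Basis that(1))
  have opG: "op N (\<lambda>a. pd w (\<lambda>x. \<zeta> x * pd [b] (a j) x))" if "b \<in> Basis" "j < r" for b j
  proof -
    have "op 1 (\<lambda>a x. \<zeta> x * pd [b] (a j) x)"
      by (intro dop_mult dop_pd) (use that \<zeta>(1) smooth_on_subset in \<open>auto simp: words_def\<close>)
    from opw[OF this, of w] show ?thesis using w by (simp add: N_def lw)
  qed
  define c where "c b j = (SOME C. C \<ge> 0 \<and>
      (\<forall>a\<in>Sol. \<forall>x\<in>?K. cmod (pd w (\<lambda>x. \<zeta> x * pd [b] (a j) x) x) \<le> C * jet_norm r N a x))" for b j
  have c: "c b j \<ge> 0 \<and>
      (\<forall>a\<in>Sol. \<forall>x\<in>?K. cmod (pd w (\<lambda>x. \<zeta> x * pd [b] (a j) x) x) \<le> c b j * jet_norm r N a x)"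
    if "(b, j) \<in> Basis \<times> {..<r}" for b j
    unfolding c_def by (rule someI_ex) (use dop_bound[OF compact_cball KS opG] that in blast)
  define C1 where "C1 = (\<Sum>(b, j)\<in>(Basis :: 'e set) \<times> {..<r}. c b j)"
  have C1: "C1 \<ge> 0" unfolding C1_def using c by (intro sum_nonneg) auto
  define V :: real where "V = (\<integral>x. indicator ?K x \<partial>(lborel :: 'e measure))"
  have iV: "integrable lborel (\<lambda>x. indicator ?K x :: real)"
    using borel_integrable_compact[of ?K "\<lambda>_. 1::real"] by simp
  have V: "V \<ge> 0" unfolding V_def by (rule integral_nonneg_AE) auto
  define M where "M = real (card (words N \<times> {..<r} :: ('e list \<times> nat) set))"
  define C where "C = C1 * (M * (V + C0))"
  show ?thesis
  proof (intro exI[of _ C] conjI ballI allI impI)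
    show "C \<ge> 0" unfolding C_def M_def using C1 V C0(1) by simp
    fix a A x b j
    assume a: "a \<in> Sol" and A0: "0 < A" and A: "\<forall>x\<in>ball z R. \<forall>j<r. cmod (a j x) \<le> A"
      and x: "x \<in> cball z (R / 2)" and b: "b \<in> (Basis :: 'e set)" and j: "j < r"
    let ?\<phi> = "\<lambda>x. \<zeta> x * pd [b] (a j) x"
    have t: "test_function ?\<phi>"
      by (rule test_function_cutoff[OF \<zeta>(1,3) rh(3) smooth_on_pd[OF smooth[OF a j]]])
    have off: "pd w ?\<phi> y = 0" if "y \<notin> ?K" for y
    proof -
      have z: "pd v ?\<phi> y = 0" if "y \<in> - ?K" for y v
        using that
      proof (induction v arbitrary: y)
        case (Cons d v)
        have "ddir d (pd v ?\<phi>) y = ddir d (\<lambda>_. 0) y"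
          by (rule ddir_cong_open[of "- ?K"]) (use Cons in auto)
        then show ?case by simp
      qed (use \<zeta>(3) in auto)
      show ?thesis by (rule z) (use that in auto)
    qed
    have cb: "c b j \<le> C1"
      unfolding C1_def
      using member_le_sum[of "(b, j)" "(Basis :: 'e set) \<times> {..<r}" "\<lambda>(b, j). c b j"] c b j by auto
    have pt: "cmod (pd w ?\<phi> y) \<le> C1 * (\<Sum>(u, j)\<in>words N \<times> {..<r}. indicator ?K y * cmod (pd u (a j) y))" for y
    proof (cases "y \<in> ?K")
      case True
      then have "cmod (pd w ?\<phi> y) \<le> c b j * jet_norm r N a y" using c a b j by auto
      also have "\<dots> \<le> C1 * jet_norm r N a y" using cb by (intro mult_right_mono) auto
      finally show ?thesis using True by (simp add: jet_norm_def)
    next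
      case False
      show ?thesis
        unfolding off[OF False] norm_zero by (intro mult_nonneg_nonneg C1 sum_nonneg) auto
    qed
    have ii: "integrable lborel (\<lambda>x. case p of (u, j) \<Rightarrow> indicator ?K x * cmod (pd u (a j) x))"
      if "p \<in> words N \<times> {..<r}" for p
      using that integrable_pd_square(2)[OF a _ rh(3)] by auto
    have l1: "(\<integral>x. (case p of (u, j) \<Rightarrow> indicator ?K x * cmod (pd u (a j) x)) \<partial>lborel) \<le> (V + C0) * A"
      if p: "p \<in> words N \<times> {..<r}" for p
    proof -
      obtain u i where ui: "p = (u, i)" "u \<in> words N" "i < r" using p by auto
      note i2 = integrable_pd_square(1)[OF a ui(3) rh(3), of u]
      have "(\<integral>x. indicator ?K x * cmod (pd u (a i) x) \<partial>lborel) \<le>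
        (\<integral>x. indicator ?K x * A + indicator ?K x * (cmod (pd u (a i) x))\<^sup>2 * (1 / A) \<partial>lborel)"
      proof (rule Bochner_Integration.integral_mono)
        show "integrable lborel (\<lambda>x. indicator ?K x * cmod (pd u (a i) x))"
          using ii[OF p] by (simp add: ui)
        show "integrable lborel (\<lambda>x. indicator ?K x * A + indicator ?K x * (cmod (pd u (a i) x))\<^sup>2 * (1 / A))"
          by (intro Bochner_Integration.integrable_add integrable_mult_left iV i2)
        fix x
        \<comment> \<open>Divided by \<open>A\<close> this gives t <= A + t^2 / A. The weight 1 / A
          turns the quadratic L2 bound into one that is linear in \<open>A\<close>, and is the
          reason for asking \<open>A > 0\<close>.\<close>
        have "t * A \<le> A * A + t * t" for t :: real
        proof -
          have "0 \<le> (A - t) * (A - t)" "0 \<le> A * A + t * t" by auto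
          moreover have "(A - t) * (A - t) = A * A + t * t - 2 * (t * A)" by (simp add: algebra_simps)
          ultimately show ?thesis by linarith
        qed
        then have "t \<le> A + t * t / A" for t :: real
          using A0 by (simp add: pos_le_divide_eq[symmetric] add_divide_distrib)
        then show "indicator ?K x * cmod (pd u (a i) x) \<le> indicator ?K x * A + indicator ?K x * (cmod (pd u (a i) x))\<^sup>2 * (1 / A)"
          by (auto simp: indicator_def power2_eq_square)
      qed
      also have "\<dots> = V * A + (\<integral>x. indicator ?K x * (cmod (pd u (a i) x))\<^sup>2 \<partial>lborel) * (1 / A)"
        unfolding V_def by (subst Bochner_Integration.integral_add)
          (intro integrable_mult_left iV i2 | simp only: integral_mult_left_zero)+
      also have "\<dots> \<le> V * A + (C0 * A\<^sup>2) * (1 / A)"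
        using C0(2)[OF a A ui(2,3)] A0 by (intro add_left_mono mult_right_mono) auto
      also have "\<dots> = (V + C0) * A" using A0 by (simp add: field_simps power2_eq_square)
      finally show ?thesis by (simp add: ui)
    qed
    have "cmod (?\<phi> x) \<le> (\<integral>y. cmod (pd w ?\<phi> y) \<partial>lborel)" by (rule sobolev[OF t w])
    also have "\<dots> \<le> (\<integral>y. C1 * (\<Sum>p\<in>words N \<times> {..<r}. case p of (u, j) \<Rightarrow> indicator ?K y * cmod (pd u (a j) y)) \<partial>lborel)"
      by (intro Bochner_Integration.integral_mono pt integrable_norm test_function_integrable test_function_pd t
          integrable_mult_right Bochner_Integration.integrable_sum ii)
    also have "\<dots> = C1 * (\<Sum>p\<in>words N \<times> {..<r}. \<integral>x. (case p of (u, j) \<Rightarrow> indicator ?K x * cmod (pd u (a j) x)) \<partial>lborel)"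
      by (simp only: integral_mult_right_zero Bochner_Integration.integral_sum[OF ii])
    also have "\<dots> \<le> C1 * (\<Sum>p\<in>(words N \<times> {..<r} :: ('e list \<times> nat) set). (V + C0) * A)"
      by (intro mult_left_mono sum_mono l1 C1)
    also have "\<dots> = C * A" by (simp add: C_def M_def mult_ac)
    finally show "cmod (ddir b (a j) x) \<le> C * A"
      using \<zeta>(2)[of x] x rh(5) by simp
  qed
qed

end

section \<open>Forms at a point\<close>

interpretation fs: vector_space fscale
  by unfold_locales (auto simp: fscale_def algebra_simps fun_eq_iff)

definition alt_form :: "nat \<Rightarrow> 'e::euclidean_space form \<Rightarrow> bool" where
  "alt_form k \<omega> \<longleftrightarrow> (\<forall>v w. (\<forall>i<k. v i = w i) \<longrightarrow> \<omega> v = \<omega> w) \<and>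
     (\<forall>v i. i < k \<longrightarrow> linear (\<lambda>x. \<omega> (v(i := x)))) \<and>
     (\<forall>v a b. a < k \<and> b < k \<and> a \<noteq> b \<and> v a = v b \<longrightarrow> \<omega> v = 0)"

lemma alt_form_cong: "alt_form k \<omega> \<Longrightarrow> (\<And>i. i < k \<Longrightarrow> v i = w i) \<Longrightarrow> \<omega> v = \<omega> w"
  and alt_form_linear: "alt_form k \<omega> \<Longrightarrow> i < k \<Longrightarrow> linear (\<lambda>x. \<omega> (v(i := x)))"
  and alt_form_eq_0: "alt_form k \<omega> \<Longrightarrow> a < k \<Longrightarrow> b < k \<Longrightarrow> a \<noteq> b \<Longrightarrow> v a = v b \<Longrightarrow> \<omega> v = 0"
  unfolding alt_form_def by blast+

text \<open>Polarisation: the form vanishes when the sum of the two arguments is put into both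
  slots.\<close>

lemma alt_form_transpose:
  assumes w: "alt_form k \<omega>" and ab: "a < k" "b < k" "a \<noteq> b"
  shows "\<omega> (v \<circ> Transposition.transpose a b) = - \<omega> v"
proof -
  define g where "g x y = \<omega> (v(a := x, b := y))" for x y
  have l1: "linear (\<lambda>x. g x y)" for y
    using alt_form_linear[OF w ab(1), of "v(b := y)"] ab(3) by (simp add: g_def fun_upd_twist)
  have l2: "linear (\<lambda>y. g x y)" for x
    using alt_form_linear[OF w ab(2), of "v(a := x)"] by (simp add: g_def)
  have z: "g x x = 0" for x
    unfolding g_def by (rule alt_form_eq_0[OF w ab]) (use ab(3) in auto)
  have "g (v a + v b) (v a + v b) = g (v a) (v a) + g (v a) (v b) + g (v b) (v a) + g (v b) (v b)"
    using linear_add[OF l1] linear_add[OF l2] by (simp add: add_ac)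
  then have "g (v b) (v a) = - g (v a) (v b)" by (simp add: z eq_neg_iff_add_eq_0 add.commute)
  moreover have "v \<circ> Transposition.transpose a b = v(a := v b, b := v a)"
    by (auto simp: fun_eq_iff Transposition.transpose_def)
  moreover have "v(a := v a, b := v b) = v" by simp
  ultimately show ?thesis unfolding g_def by simp
qed

lemma alt_form_permutes:
  assumes w: "alt_form k \<omega>" and p: "p permutes {..<k}"
  shows "\<omega> (v \<circ> p) = of_int (sign p) * \<omega> v"
proof -
  have "\<forall>v. \<omega> (v \<circ> p) = of_int (sign p) * \<omega> v" using p finite_lessThan
  proof (induction p rule: permutes_induct)
    case id
    then show ?case by simp
  next
    case (swap a b p)
    have pp: "permutation p" by (rule permutes_imp_permutation[OF finite_lessThan swap(4)])
    show ?case
    proof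
      fix v :: "nat \<Rightarrow> 'a"
      have "\<omega> (v \<circ> (Transposition.transpose a b \<circ> p)) = of_int (sign p) * \<omega> (v \<circ> Transposition.transpose a b)"
        using spec[OF swap(5), of "v \<circ> Transposition.transpose a b"] by (simp only: o_assoc)
      also have "\<dots> = of_int (sign (Transposition.transpose a b \<circ> p)) * \<omega> v"
        using alt_form_transpose[OF w, of a b v] swap(1-3)
        by (simp add: sign_compose[OF permutation_swap_id pp] sign_swap_id)
      finally show "\<omega> (v \<circ> (Transposition.transpose a b \<circ> p)) = of_int (sign (Transposition.transpose a b \<circ> p)) * \<omega> v" .
    qed
  qed
  then show ?thesis by blast
qed

lemma alt_form_add: "alt_form k \<omega> \<Longrightarrow> alt_form k \<eta> \<Longrightarrow> alt_form k (\<omega> + \<eta>)"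
proof -
  assume w: "alt_form k \<omega>" and e: "alt_form k \<eta>"
  show ?thesis
    unfolding alt_form_def
  proof (intro conjI allI impI)
    fix v w :: "nat \<Rightarrow> 'a" assume "\<forall>i<k. v i = w i"
    then show "(\<omega> + \<eta>) v = (\<omega> + \<eta>) w"
      using alt_form_cong[OF w, of v w] alt_form_cong[OF e, of v w] by simp
  next
    fix v :: "nat \<Rightarrow> 'a" and i assume "i < k"
    then show "linear (\<lambda>x. (\<omega> + \<eta>) (v(i := x)))"
      using linear_compose_add[OF alt_form_linear[OF w] alt_form_linear[OF e], of i i v v] by simp
  next
    fix v :: "nat \<Rightarrow> 'a" and a b assume "a < k \<and> b < k \<and> a \<noteq> b \<and> v a = v b"
    then show "(\<omega> + \<eta>) v = 0" using alt_form_eq_0[OF w, of a b v] alt_form_eq_0[OF e, of a b v] by simp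
  qed
qed

lemma alt_form_scale:
  assumes "alt_form k \<omega>"
  shows "alt_form k (fscale c \<omega>)"
proof -
  have "linear (\<lambda>x. c * \<omega> (v(i := x)))" if "i < k" for v i
    using linear_compose[OF alt_form_linear[OF assms that], of "(*) c"]
    by (simp add: o_def bounded_linear.linear bounded_linear_mult_right)
  then show ?thesis
    unfolding alt_form_def fscale_def
  proof (intro conjI allI impI)
    show "c * \<omega> v = c * \<omega> w" if "\<forall>i<k. v i = w i" for v w
      using alt_form_cong[OF assms, of v w] that by simp
    show "c * \<omega> v = 0" if "a < k \<and> b < k \<and> a \<noteq> b \<and> v a = v b" for v a b
      using alt_form_eq_0[OF assms, of a b v] that by simp
  qed
qed

lemma alt_form_zero: "alt_form k 0"
  unfolding alt_form_def by (simp add: linear_zero)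

text \<open>Isolates the one factor that reads argument \<open>s\<close>, which is the factor with
  index \<open>inv \<sigma> s\<close>. Linearity and type of a wedge product in that argument are
  read off from it.\<close>

lemma permutes_prod_slot:
  fixes v :: "nat \<Rightarrow> 'e"
  assumes "\<sigma> permutes {..<k}" "s < k"
  shows "(\<Prod>i<k. (\<alpha> i ((v(s := x)) (\<sigma> i)) :: complex)) =
    \<alpha> (inv \<sigma> s) x * (\<Prod>i\<in>{..<k} - {inv \<sigma> s}. \<alpha> i (v (\<sigma> i)))"
proof -
  have i: "inv \<sigma> s < k" using assms permutes_in_image permutes_inv by fastforce
  have e: "\<sigma> (inv \<sigma> s) = s" using assms(1) permutes_inverses(1) by metis
  have ne: "\<sigma> i \<noteq> s" if "i \<noteq> inv \<sigma> s" for i using assms(1) that permutes_inverses(2) by metis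
  have "(\<Prod>i<k. \<alpha> i ((v(s := x)) (\<sigma> i))) =
    \<alpha> (inv \<sigma> s) ((v(s := x)) (\<sigma> (inv \<sigma> s))) * (\<Prod>i\<in>{..<k} - {inv \<sigma> s}. \<alpha> i ((v(s := x)) (\<sigma> i)))"
    using i by (intro prod.remove) auto
  also have "(\<Prod>i\<in>{..<k} - {inv \<sigma> s}. \<alpha> i ((v(s := x)) (\<sigma> i))) = (\<Prod>i\<in>{..<k} - {inv \<sigma> s}. \<alpha> i (v (\<sigma> i)))"
    by (rule prod.cong) (use ne in auto)
  finally show ?thesis by (simp add: e)
qed

lemma alt_form_wedge:
  assumes lin: "\<And>i. i < k \<Longrightarrow> linear (\<alpha> i)"
  shows "alt_form k (wedge k \<alpha>)"
  unfolding alt_form_def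
proof (intro conjI allI impI)
  fix v w :: "nat \<Rightarrow> 'a" assume "\<forall>i<k. v i = w i"
  then have "\<alpha> i (v (\<sigma> i)) = \<alpha> i (w (\<sigma> i))" if "\<sigma> permutes {..<k}" "i < k" for \<sigma> i
    using that permutes_in_image by fastforce
  then show "wedge k \<alpha> v = wedge k \<alpha> w" unfolding wedge_def by simp
next
  fix v :: "nat \<Rightarrow> 'a" and s assume s: "s < k"
  have "linear (\<lambda>x. of_int (sign \<sigma>) * (\<Prod>i<k. \<alpha> i ((v(s := x)) (\<sigma> i))))" if "\<sigma> permutes {..<k}" for \<sigma>
  proof -
    have i: "inv \<sigma> s < k" using s that permutes_in_image permutes_inv by fastforce
    let ?P = "\<Prod>i\<in>{..<k} - {inv \<sigma> s}. \<alpha> i (v (\<sigma> i))"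
    have "linear (\<lambda>x. (of_int (sign \<sigma>) * ?P) * \<alpha> (inv \<sigma> s) x)"
      using linear_compose[OF lin[OF i], of "(*) (of_int (sign \<sigma>) * ?P)"]
      by (simp add: o_def bounded_linear.linear bounded_linear_mult_right)
    then show ?thesis unfolding permutes_prod_slot[OF that s] by (simp add: mult_ac)
  qed
  then show "linear (\<lambda>x. wedge k \<alpha> (v(s := x)))"
    unfolding wedge_def by (intro linear_compose_sum) auto
next
  fix v :: "nat \<Rightarrow> 'a" and a b assume ab: "a < k \<and> b < k \<and> a \<noteq> b \<and> v a = v b"
  let ?t = "Transposition.transpose a b"
  have t: "?t permutes {..<k}" using ab by (intro permutes_swap_id) auto
  have vt: "v (?t l) = v l" for l using ab by (auto simp: Transposition.transpose_def)
  let ?f = "\<lambda>\<sigma>. of_int (sign \<sigma>) * (\<Prod>i<k. \<alpha> i (v (\<sigma> i)))"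
  \<comment> \<open>Composing every permutation with the transposition changes all signs and no
    product, so the sum is its own negative.\<close>
  have "wedge k \<alpha> v = (\<Sum>\<sigma> | \<sigma> permutes {..<k}. ?f (?t \<circ> \<sigma>))"
    unfolding wedge_def by (rule setum_permutations_compose_left[OF t])
  also have "\<dots> = (\<Sum>\<sigma> | \<sigma> permutes {..<k}. - ?f \<sigma>)"
  proof (rule sum.cong)
    fix \<sigma> assume "\<sigma> \<in> {\<sigma>. \<sigma> permutes {..<k}}"
    then have "permutation \<sigma>" using permutation_permutes finite_lessThan by blast
    then have "sign (?t \<circ> \<sigma>) = - sign \<sigma>"
      using ab by (simp add: sign_compose[OF permutation_swap_id] sign_swap_id)
    then show "?f (?t \<circ> \<sigma>) = - ?f \<sigma>" by (simp add: vt)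
  qed simp
  also have "\<dots> = - wedge k \<alpha> v" unfolding wedge_def by (simp add: sum_negf)
  finally show "wedge k \<alpha> v = 0" by simp
qed

lemma wedge_permute:
  assumes "\<pi> permutes {..<k}"
  shows "wedge k (\<alpha> \<circ> \<pi>) = fscale (of_int (sign \<pi>)) (wedge k \<alpha>)"
proof
  fix v :: "nat \<Rightarrow> 'a"
  have pp: "permutation \<pi>" using permutation_permutes finite_lessThan assms by blast
  have "wedge k (\<alpha> \<circ> \<pi>) v = (\<Sum>\<sigma> | \<sigma> permutes {..<k}. of_int (sign (\<sigma> \<circ> \<pi>)) * (\<Prod>i<k. \<alpha> (\<pi> i) (v (\<sigma> (\<pi> i)))))"
    unfolding wedge_def by (subst sum_permutations_compose_right[OF assms]) simp
  also have "\<dots> = (\<Sum>\<sigma> | \<sigma> permutes {..<k}. of_int (sign \<pi>) * (of_int (sign \<sigma>) * (\<Prod>i<k. \<alpha> i (v (\<sigma> i)))))"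
  proof (rule sum.cong)
    fix \<sigma> assume "\<sigma> \<in> {\<sigma>. \<sigma> permutes {..<k}}"
    then have "permutation \<sigma>" using permutation_permutes finite_lessThan by blast
    moreover have "(\<Prod>i<k. \<alpha> (\<pi> i) (v (\<sigma> (\<pi> i)))) = (\<Prod>i<k. \<alpha> i (v (\<sigma> i)))"
      by (rule prod.reindex_bij_betw[of \<pi> "{..<k}" "{..<k}" "\<lambda>i. \<alpha> i (v (\<sigma> i))"]) (rule permutes_imp_bij[OF assms])
    ultimately show "of_int (sign (\<sigma> \<circ> \<pi>)) * (\<Prod>i<k. \<alpha> (\<pi> i) (v (\<sigma> (\<pi> i)))) =
        of_int (sign \<pi>) * (of_int (sign \<sigma>) * (\<Prod>i<k. \<alpha> i (v (\<sigma> i))))"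
      by (simp add: sign_compose pp)
  qed simp
  finally show "wedge k (\<alpha> \<circ> \<pi>) v = fscale (of_int (sign \<pi>)) (wedge k \<alpha>) v"
    by (simp add: fscale_def wedge_def sum_distrib_left)
qed

lemma wedge_add_slot:
  assumes "i < k" "\<alpha> i = (\<lambda>x. \<beta> x + \<gamma> x)"
  shows "wedge k \<alpha> = wedge k (\<alpha>(i := \<beta>)) + wedge k (\<alpha>(i := \<gamma>))"
proof
  fix v :: "nat \<Rightarrow> 'a"
  have "(\<Prod>l<k. \<alpha> l (v (\<sigma> l))) = (\<Prod>l<k. (\<alpha>(i := \<beta>)) l (v (\<sigma> l))) + (\<Prod>l<k. (\<alpha>(i := \<gamma>)) l (v (\<sigma> l)))" for \<sigma>
  proof -
    have r: "(\<Prod>l<k. a l) = a i * (\<Prod>l\<in>{..<k} - {i}. a l)" for a :: "nat \<Rightarrow> complex"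
      using assms by (intro prod.remove) auto
    have c: "(\<Prod>l\<in>{..<k} - {i}. (\<alpha>(i := \<delta>)) l (v (\<sigma> l))) = (\<Prod>l\<in>{..<k} - {i}. \<alpha> l (v (\<sigma> l)))" for \<delta>
      by (rule prod.cong) auto
    show ?thesis unfolding r[of "\<lambda>l. \<alpha> l (v (\<sigma> l))"] r[of "\<lambda>l. (\<alpha>(i := _)) l (v (\<sigma> l))"] c
      by (simp add: assms(2) distrib_right)
  qed
  then show "wedge k \<alpha> v = (wedge k (\<alpha>(i := \<beta>)) + wedge k (\<alpha>(i := \<gamma>))) v"
    unfolding wedge_def by (simp add: distrib_left sum.distrib)
qed

section \<open>Existence of the decomposition into types\<close>

lemma T10_linear: "\<alpha> \<in> T10 j \<Longrightarrow> linear \<alpha>" and T01_linear: "\<alpha> \<in> T01 j \<Longrightarrow> linear \<alpha>"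
  by (auto simp: T10_def T01_def)

lemma T10_T01_split:
  assumes j: "linear j" "\<And>v. j (j v) = - v" and a: "linear (\<alpha> :: 'e::euclidean_space \<Rightarrow> complex)"
  shows "\<exists>\<beta>\<in>T10 j. \<exists>\<gamma>\<in>T01 j. \<alpha> = (\<lambda>x. \<beta> x + \<gamma> x)"
proof (intro bexI)
  have l: "linear (\<lambda>x. c * \<alpha> (j x))" for c
    using linear_compose[OF linear_compose[OF j(1) a], of "(*) c"]
    by (simp add: o_def bounded_linear.linear bounded_linear_mult_right)
  have l2: "linear (\<lambda>x. (1/2) * \<alpha> x)"
    using linear_compose[OF a, of "(*) (1/2)"] by (simp add: o_def bounded_linear.linear bounded_linear_mult_right)
  show "\<alpha> = (\<lambda>x. ((1/2) * \<alpha> x + (- \<i>/2) * \<alpha> (j x)) + ((1/2) * \<alpha> x + (\<i>/2) * \<alpha> (j x)))" by (simp add: fun_eq_iff)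
  show "(\<lambda>x. (1/2) * \<alpha> x + (- \<i>/2) * \<alpha> (j x)) \<in> T10 j" "(\<lambda>x. (1/2) * \<alpha> x + (\<i>/2) * \<alpha> (j x)) \<in> T01 j"
    unfolding T10_def T01_def
    using linear_compose_add[OF l2 l, of "- \<i>/2"] linear_compose_add[OF l2 l, of "\<i>/2"]
    by (auto simp: j(2) linear_neg[OF a] algebra_simps)
qed

lemma alt_form_expand:
  fixes \<omega> :: "'e::euclidean_space form"
  assumes w: "alt_form k \<omega>"
  shows "m \<le> k \<Longrightarrow> \<omega> v = (\<Sum>f\<in>PiE {..<m} (\<lambda>_. Basis). (\<Prod>i<m. of_real (v i \<bullet> f i)) * \<omega> (\<lambda>l. if l < m then f l else v l))"
proof (induction m)
  case 0
  then show ?case by simp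
next
  case (Suc m)
  then have m: "m < k" by simp
  have s: "\<omega> u = (\<Sum>b\<in>Basis. of_real (u m \<bullet> b) * \<omega> (u(m := b)))" for u :: "nat \<Rightarrow> 'e"
  proof -
    have l: "linear (\<lambda>x. \<omega> (u(m := x)))" by (rule alt_form_linear[OF w m])
    have "\<omega> u = \<omega> (u(m := (\<Sum>b\<in>Basis. (u m \<bullet> b) *\<^sub>R b)))" by (simp add: euclidean_representation)
    also have "\<dots> = (\<Sum>b\<in>Basis. (u m \<bullet> b) *\<^sub>R \<omega> (u(m := b)))"
      by (simp add: linear_sum[OF l] linear_scale[OF l])
    finally show ?thesis by (simp add: scaleR_conv_of_real)
  qed
  have "{..<Suc m} = insert m {..<m}" by auto
  then have P: "PiE {..<Suc m} (\<lambda>_. Basis) = (\<lambda>(b, f). f(m := b)) ` (Basis \<times> PiE {..<m} (\<lambda>_. Basis :: 'e set))"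
    by (simp add: PiE_insert_eq)
  have inj: "inj_on (\<lambda>(b, f). f(m := b)) (Basis \<times> PiE {..<m} (\<lambda>_. Basis :: 'e set))"
    by (rule inj_combinator) auto
  let ?F = "\<lambda>m f. (\<Prod>i<m. of_real (v i \<bullet> f i)) * \<omega> (\<lambda>l. if l < m then f l else v l)"
  have "(\<Sum>f\<in>PiE {..<Suc m} (\<lambda>_. Basis). ?F (Suc m) f) =
    (\<Sum>(b, f)\<in>Basis \<times> PiE {..<m} (\<lambda>_. Basis). ?F (Suc m) (f(m := b)))"
    unfolding P by (subst sum.reindex[OF inj]) (simp add: case_prod_unfold)
  also have "\<dots> = (\<Sum>f\<in>PiE {..<m} (\<lambda>_. Basis). \<Sum>b\<in>Basis. ?F (Suc m) (f(m := b)))"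
    by (subst sum.swap) (simp add: sum.cartesian_product)
  also have "\<dots> = (\<Sum>f\<in>PiE {..<m} (\<lambda>_. Basis). ?F m f)"
  proof (rule sum.cong)
    fix f :: "nat \<Rightarrow> 'e"
    let ?u = "\<lambda>l. if l < m then f l else v l"
    have e: "(\<lambda>l. if l < Suc m then (f(m := b)) l else v l) = ?u(m := b)" for b
      by (auto simp: fun_eq_iff less_Suc_eq)
    have "(\<Sum>b\<in>Basis. ?F (Suc m) (f(m := b))) =
      (\<Prod>i<m. of_real (v i \<bullet> f i)) * (\<Sum>b\<in>Basis. of_real (?u m \<bullet> b) * \<omega> (?u(m := b)))"
      unfolding e by (simp add: sum_distrib_left mult_ac)
    then show "(\<Sum>b\<in>Basis. ?F (Suc m) (f(m := b))) = ?F m f" by (subst s[of ?u]) simp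
  qed simp
  finally show ?case using Suc by simp
qed

text \<open>The expansion in the basis is averaged over all permutations of the arguments, which
  turns its products into wedge products. The sum runs over all index maps and not only the
  increasing ones, hence the factor 1/k!.\<close>

lemma alt_form_wedge_expand:
  fixes \<omega> :: "'e::euclidean_space form"
  assumes w: "alt_form k \<omega>"
  shows "\<omega> = fscale (1 / of_nat (fact k)) (\<Sum>f\<in>PiE {..<k} (\<lambda>_. Basis). fscale (\<omega> f) (wedge k (\<lambda>i x. of_real (x \<bullet> f i))))"
proof
  fix v :: "nat \<Rightarrow> 'e"
  have e: "\<omega> u = (\<Sum>f\<in>PiE {..<k} (\<lambda>_. Basis). (\<Prod>i<k. of_real (u i \<bullet> f i)) * \<omega> f)" for u
  proof -
    have "\<omega> (\<lambda>l. if l < k then f l else u l) = \<omega> f" for f by (rule alt_form_cong[OF w]) simp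
    then show ?thesis using alt_form_expand[OF w order_refl, of u] by simp
  qed
  have sg: "of_int (sign \<sigma>) * of_int (sign \<sigma>) = (1::complex)" for \<sigma> :: "nat \<Rightarrow> nat"
    by (simp add: sign_def)
  have "of_nat (fact k) * \<omega> v = (\<Sum>\<sigma> | \<sigma> permutes {..<k}. \<omega> v)"
    by (simp add: card_permutations[of "{..<k}" k])
  also have "\<dots> = (\<Sum>\<sigma> | \<sigma> permutes {..<k}. of_int (sign \<sigma>) * \<omega> (v \<circ> \<sigma>))"
    by (rule sum.cong) (use sg in \<open>auto simp: alt_form_permutes[OF w] mult.assoc[symmetric]\<close>)
  also have "\<dots> = (\<Sum>\<sigma> | \<sigma> permutes {..<k}. \<Sum>f\<in>PiE {..<k} (\<lambda>_. Basis).
      \<omega> f * (of_int (sign \<sigma>) * (\<Prod>i<k. of_real (v (\<sigma> i) \<bullet> f i))))"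
    by (subst e) (simp add: sum_distrib_left mult_ac)
  also have "\<dots> = (\<Sum>f\<in>PiE {..<k} (\<lambda>_. Basis). \<omega> f * wedge k (\<lambda>i x. of_real (x \<bullet> f i)) v)"
    unfolding wedge_def by (subst sum.swap) (simp add: sum_distrib_left)
  finally have "of_nat (fact k) * \<omega> v = (\<Sum>f\<in>PiE {..<k} (\<lambda>_. Basis). \<omega> f * wedge k (\<lambda>i x. of_real (x \<bullet> f i)) v)" .
  moreover have "(\<Sum>f\<in>F. fscale (\<omega> f) (g f)) v = (\<Sum>f\<in>F. \<omega> f * g f v)" for F g
    by (induction F rule: infinite_finite_induct) (auto simp: fscale_def)
  ultimately show "\<omega> v = fscale (1 / of_nat (fact k)) (\<Sum>f\<in>PiE {..<k} (\<lambda>_. Basis). fscale (\<omega> f) (wedge k (\<lambda>i x. of_real (x \<bullet> f i)))) v"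
    by (simp add: fscale_def field_simps)
qed

text \<open>The existence half of the description in \<open>proj_pq\<close>.\<close>

definition decomposable :: "('e::euclidean_space \<Rightarrow> 'e) \<Rightarrow> nat \<Rightarrow> 'e form \<Rightarrow> bool" where
  "decomposable j k \<omega> \<longleftrightarrow> (\<exists>\<tau>. (\<forall>a\<le>k. \<tau> a \<in> Lambda_pq j a (k - a)) \<and> \<omega> = (\<Sum>a\<le>k. \<tau> a))"

lemma decomposable_zero: "decomposable j k 0"
  unfolding decomposable_def by (intro exI[of _ "\<lambda>_. 0"]) (simp add: Lambda_pq_def fs.span_zero)

lemma decomposable_add: "decomposable j k \<omega> \<Longrightarrow> decomposable j k \<eta> \<Longrightarrow> decomposable j k (\<omega> + \<eta>)"
proof -
  assume "decomposable j k \<omega>" "decomposable j k \<eta>"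
  then obtain \<tau> \<tau>' where "\<forall>a\<le>k. \<tau> a \<in> Lambda_pq j a (k - a)" "\<omega> = (\<Sum>a\<le>k. \<tau> a)"
    "\<forall>a\<le>k. \<tau>' a \<in> Lambda_pq j a (k - a)" "\<eta> = (\<Sum>a\<le>k. \<tau>' a)" unfolding decomposable_def by blast
  then show ?thesis unfolding decomposable_def
    by (intro exI[of _ "\<lambda>a. \<tau> a + \<tau>' a"]) (simp add: Lambda_pq_def fs.span_add sum.distrib)
qed

lemma decomposable_scale: "decomposable j k \<omega> \<Longrightarrow> decomposable j k (fscale c \<omega>)"
proof -
  assume "decomposable j k \<omega>"
  then obtain \<tau> where "\<forall>a\<le>k. \<tau> a \<in> Lambda_pq j a (k - a)" "\<omega> = (\<Sum>a\<le>k. \<tau> a)" unfolding decomposable_def by blast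
  then show ?thesis unfolding decomposable_def
    by (intro exI[of _ "\<lambda>a. fscale c (\<tau> a)"]) (simp add: Lambda_pq_def fs.span_scale fs.scale_sum_right)
qed

lemma decomposable_sum: "(\<And>i. i \<in> I \<Longrightarrow> decomposable j k (g i)) \<Longrightarrow> decomposable j k (\<Sum>i\<in>I. g i)"
  by (induction I rule: infinite_finite_induct) (auto intro: decomposable_zero decomposable_add)

text \<open>\<open>Lambda_pq\<close> asks for the (1,0)-factors in front, so a mixed wedge product
  has to be sorted; \<open>S\<close> is the set of positions of these factors.\<close>

lemma sorting_permutation:
  assumes "S \<subseteq> {..<k}"
  shows "\<exists>\<pi>. \<pi> permutes {..<k} \<and> (\<forall>i<k. \<pi> i \<in> S \<longleftrightarrow> i < card S)"
proof -
  have fS: "finite S" using assms finite_subset by blast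
  have cS: "card S \<le> k" using card_mono[OF _ assms] by simp
  obtain f where f: "bij_betw f {..<card S} S"
    using finite_same_card_bij[of "{..<card S}" S] fS by auto
  have "card {card S..<k} = card ({..<k} - S)" using assms fS by (simp add: card_Diff_subset)
  then obtain g where g: "bij_betw g {card S..<k} ({..<k} - S)"
    using finite_same_card_bij[of "{card S..<k}" "{..<k} - S"] by auto
  define \<pi> where "\<pi> i = (if i < card S then f i else if i < k then g i else i)" for i
  have "bij_betw \<pi> ({..<card S} \<union> {card S..<k}) (S \<union> ({..<k} - S))"
  proof (rule bij_betw_combine)
    show "bij_betw \<pi> {..<card S} S" using f by (rule bij_betw_cong[THEN iffD1, rotated]) (simp add: \<pi>_def)
    show "bij_betw \<pi> {card S..<k} ({..<k} - S)" using g by (rule bij_betw_cong[THEN iffD1, rotated]) (simp add: \<pi>_def)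
  qed auto
  moreover have "{..<card S} \<union> {card S..<k} = {..<k}" using cS by auto
  moreover have "S \<union> ({..<k} - S) = {..<k}" using assms by auto
  ultimately have "bij_betw \<pi> {..<k} {..<k}" by simp
  then have "\<pi> permutes {..<k}" by (rule bij_imp_permutes) (use cS in \<open>auto simp: \<pi>_def\<close>)
  moreover have "\<pi> i \<in> S \<longleftrightarrow> i < card S" if "i < k" for i
    using that bij_betwE[OF f] bij_betwE[OF g] by (auto simp: \<pi>_def)
  ultimately show ?thesis by blast
qed

lemma wedge_decomposable_pure:
  assumes "\<And>i. i < k \<Longrightarrow> \<alpha> i \<in> T10 j \<or> \<alpha> i \<in> T01 j"
  shows "decomposable j k (wedge k \<alpha>)"
proof -
  define S where "S = {i. i < k \<and> \<alpha> i \<in> T10 j}"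
  have S: "S \<subseteq> {..<k}" by (auto simp: S_def)
  obtain \<pi> where \<pi>: "\<pi> permutes {..<k}" "\<And>i. i < k \<Longrightarrow> \<pi> i \<in> S \<longleftrightarrow> i < card S"
    using sorting_permutation[OF S] by blast
  have cS: "card S \<le> k" using card_mono[OF _ S] by simp
  have in10: "(\<alpha> \<circ> \<pi>) i \<in> T10 j" if "i < card S" for i
    using \<pi>(2)[of i] that cS by (auto simp: S_def)
  have in01: "(\<alpha> \<circ> \<pi>) i \<in> T01 j" if "card S \<le> i" "i < k" for i
  proof -
    have "\<pi> i < k" using \<pi>(1) that(2) permutes_in_image by fastforce
    then show ?thesis using \<pi>(2)[OF that(2)] that(1) assms[of "\<pi> i"] by (auto simp: S_def)
  qed
  let ?W = "wedge k (\<alpha> \<circ> \<pi>)"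
  have "?W \<in> Lambda_pq j (card S) (k - card S)"
    unfolding Lambda_pq_def
    by (rule fs.span_base, rule CollectI, rule exI[of _ "\<alpha> \<circ> \<pi>"]) (use cS in10 in01 in auto)
  then have "decomposable j k ?W"
    unfolding decomposable_def
    by (intro exI[of _ "\<lambda>a. if a = card S then ?W else 0"])
      (use cS in \<open>auto simp: Lambda_pq_def fs.span_zero\<close>)
  then have "decomposable j k (fscale (of_int (sign \<pi>)) ?W)" by (rule decomposable_scale)
  moreover have "fscale (of_int (sign \<pi>)) ?W = wedge k \<alpha>"
    unfolding wedge_permute[OF \<pi>(1)] by (simp add: fscale_def fun_eq_iff sign_def)
  ultimately show ?thesis by simp
qed

lemma wedge_decomposable:
  assumes j: "linear j" "\<And>v. j (j v) = - v" and lin: "\<And>i. i < k \<Longrightarrow> linear (\<alpha> i)"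
  shows "decomposable j k (wedge k \<alpha>)"
proof -
  \<comment> \<open>The factors are split into their two types one at a time; \<open>m\<close>
    counts the factors that are not yet of pure type.\<close>
  have "decomposable j k (wedge k \<alpha>)"
    if "m \<le> k" "\<And>i. i < m \<Longrightarrow> linear (\<alpha> i)" "\<And>i. m \<le> i \<Longrightarrow> i < k \<Longrightarrow> \<alpha> i \<in> T10 j \<or> \<alpha> i \<in> T01 j" for m \<alpha>
    using that
  proof (induction m arbitrary: \<alpha>)
    case 0
    then show ?case by (intro wedge_decomposable_pure) auto
  next
    case (Suc m)
    obtain \<beta> \<gamma> where bg: "\<beta> \<in> T10 j" "\<gamma> \<in> T01 j" "\<alpha> m = (\<lambda>x. \<beta> x + \<gamma> x)"
      using T10_T01_split[OF j Suc.prems(2)[of m]] by blast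
    have "decomposable j k (wedge k (\<alpha>(m := \<beta>)))" "decomposable j k (wedge k (\<alpha>(m := \<gamma>)))"
      by (rule Suc.IH; use Suc.prems bg in auto)+
    then show ?case
      using wedge_add_slot[of m k \<alpha> \<beta> \<gamma>] bg(3) Suc.prems(1) decomposable_add by (metis Suc_le_lessD)
  qed
  from this[of k \<alpha>] lin show ?thesis by auto
qed

lemma alt_form_decomposable:
  assumes j: "linear j" "\<And>v. j (j v) = - v" and w: "alt_form k \<omega>"
  shows "decomposable j k \<omega>"
proof -
  have "linear (\<lambda>x. complex_of_real (x \<bullet> b))" for b :: 'a
    using bounded_linear_compose[OF bounded_linear_of_real bounded_linear_inner_left] by (rule bounded_linear.linear)
  then show ?thesis
    by (subst alt_form_wedge_expand[OF w]) (intro decomposable_scale decomposable_sum wedge_decomposable j)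
qed

subsection \<open>Projections in the arguments\<close>

definition slot :: "('e \<Rightarrow> 'e) \<Rightarrow> complex \<Rightarrow> nat \<Rightarrow> 'e form \<Rightarrow> 'e form" where
  "slot j c i \<omega> = (\<lambda>v. (\<omega> v + c * \<omega> (v(i := j (v i)))) / 2)"

text \<open>With \<open>c i = -\<i>\<close> the \<open>i\<close>-th argument is replaced by its (1,0)-part, with \<open>c i = \<i>\<close> by its
  (0,1)-part.\<close>
definition tproj :: "('e \<Rightarrow> 'e) \<Rightarrow> (nat \<Rightarrow> complex) \<Rightarrow> nat set \<Rightarrow> 'e form \<Rightarrow> 'e form" where
  "tproj j c I \<omega> = Finite_Set.fold (\<lambda>i. slot j (c i) i) \<omega> I"

interpretation slot: comp_fun_commute "\<lambda>i. slot j (c i) i"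
proof
  fix i l
  have "slot j (c l) l (slot j (c i) i \<omega>) v = slot j (c i) i (slot j (c l) l \<omega>) v" if "i \<noteq> l" for \<omega> v
    using that unfolding slot_def by (simp add: fun_upd_twist field_simps)
  then show "slot j (c l) l \<circ> slot j (c i) i = slot j (c i) i \<circ> slot j (c l) l"
    by (cases "i = l") (auto simp: fun_eq_iff)
qed

lemma tproj_empty [simp]: "tproj j c {} \<omega> = \<omega>"
  by (simp add: tproj_def)

lemma tproj_insert: "finite I \<Longrightarrow> i \<notin> I \<Longrightarrow> tproj j c (insert i I) \<omega> = slot j (c i) i (tproj j c I \<omega>)"
  unfolding tproj_def by (rule slot.fold_insert)

lemma tproj_add: "finite I \<Longrightarrow> tproj j c I (\<omega> + \<eta>) = tproj j c I \<omega> + tproj j c I \<eta>"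
  by (induction I rule: finite_induct) (auto simp: tproj_insert slot_def fun_eq_iff field_simps)

lemma tproj_scale: "finite I \<Longrightarrow> tproj j c I (fscale a \<omega>) = fscale a (tproj j c I \<omega>)"
  by (induction I rule: finite_induct) (auto simp: tproj_insert slot_def fscale_def fun_eq_iff field_simps)

lemma tproj_zero: "finite I \<Longrightarrow> tproj j c I 0 = 0"
  by (induction I rule: finite_induct) (auto simp: tproj_insert slot_def fun_eq_iff)

lemma tproj_sum: "finite I \<Longrightarrow> tproj j c I (\<Sum>a\<in>K. \<tau> a) = (\<Sum>a\<in>K. tproj j c I (\<tau> a))"
  by (induction K rule: infinite_finite_induct) (auto simp: tproj_zero tproj_add)

text \<open>If \<open>j\<close> acts on argument \<open>i\<close> by the scalar
  \<open>\<tau> i\<close>, the slot operator is multiplication by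
  \<open>(1 + c i * \<tau> i) / 2\<close>. For scalars from {\<i>, -\<i>} this is 0 when
  \<open>\<tau> i = c i\<close> and 1 when they are opposite, so wedge products are eigenvectors
  summand by summand.\<close>

lemma tproj_typed:
  assumes "finite I" "\<And>i v. i \<in> I \<Longrightarrow> \<omega> (v(i := j (v i))) = \<tau> i * \<omega> v"
  shows "tproj j c I \<omega> = (\<lambda>v. (\<Prod>i\<in>I. (1 + c i * \<tau> i) / 2) * \<omega> v)"
  using assms
  by (induction I rule: finite_induct) (auto simp: tproj_insert slot_def fun_eq_iff field_simps)

lemma tproj_local:
  assumes "finite I" "I \<subseteq> {..<k}" "\<And>v w. (\<And>i. i < k \<Longrightarrow> v i = w i) \<Longrightarrow> \<omega> v = \<omega> w"
  shows "(\<And>i. i < k \<Longrightarrow> v i = w i) \<Longrightarrow> tproj j c I \<omega> v = tproj j c I \<omega> w"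
  using assms(1,2)
proof (induction I arbitrary: v w rule: finite_induct)
  case empty
  then show ?case using assms(3)[of v w] by simp
next
  case (insert i I)
  have "tproj j c I \<omega> v = tproj j c I \<omega> w"
    by (rule insert.IH) (use insert.prems in auto)
  moreover have "tproj j c I \<omega> (v(i := j (v i))) = tproj j c I \<omega> (w(i := j (w i)))"
    by (rule insert.IH) (use insert.prems in auto)
  ultimately show ?case unfolding tproj_insert[OF insert.hyps] slot_def by (simp only:)
qed

lemma tproj_linear_slot:
  assumes j: "linear j" and "finite I" "\<And>v. linear (\<lambda>x. \<omega> (v(s := x)) :: complex)"
  shows "linear (\<lambda>x. tproj j c I \<omega> (v(s := x)))"
  using assms(2)
proof (induction I arbitrary: v rule: finite_induct)
  case empty
  show ?case unfolding tproj_empty by (rule assms(3))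
next
  case (insert i I)
  let ?g = "tproj j c I \<omega>"
  have m: "linear (\<lambda>x. a * f x)" if "linear f" for a and f :: "'a \<Rightarrow> complex"
    using linear_compose[OF that, of "(*) a"] by (simp add: o_def bounded_linear.linear bounded_linear_mult_right)
  have l: "linear (\<lambda>x. ?g ((v(s := x))(i := j ((v(s := x)) i))))"
  proof (cases "i = s")
    case True
    have e: "(v(s := x))(i := j ((v(s := x)) i)) = v(s := j x)" for x using True by simp
    show ?thesis using linear_compose[OF j insert.IH[of v]] unfolding e o_def .
  next
    case False
    have e: "(v(s := x))(i := j ((v(s := x)) i)) = (v(i := j (v i)))(s := x)" for x
      using False by (simp add: fun_upd_twist)
    show ?thesis unfolding e by (rule insert.IH)
  qed
  have "linear (\<lambda>x. (1/2) * ?g (v(s := x)) + (c i / 2) * ?g ((v(s := x))(i := j ((v(s := x)) i))))"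
    by (intro linear_compose_add m insert.IH l)
  moreover have "(1/2) * a + (c i / 2) * b = (a + c i * b) / 2" for a b by (simp add: add_divide_distrib)
  ultimately show ?case unfolding tproj_insert[OF insert.hyps] slot_def by (simp only:)
qed

text \<open>For \<open>c s\<close> with square -1, the operator (1 + c s J)/2 maps into the
  eigenspace of J with eigenvalue \<open>- c s\<close>; the other slots do not interfere.\<close>

lemma tproj_type:
  assumes j: "\<And>v. j (j v) = - v" and "finite I" "s \<in> I" and lin: "linear j" "\<And>v. linear (\<lambda>x. \<omega> (v(s := x)) :: complex)"
    and c: "c s * c s = - 1"
  shows "tproj j c I \<omega> (v(s := j (v s))) = - c s * tproj j c I \<omega> v"
proof -
  let ?g = "tproj j c (I - {s}) \<omega>"
  have f: "finite (I - {s})" using assms by simp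
  have l: "linear (\<lambda>x. ?g (v(s := x)))" by (rule tproj_linear_slot[OF lin(1) f lin(2)])
  have e: "tproj j c I \<omega> = slot j (c s) s ?g"
    using tproj_insert[OF f, of s j c \<omega>] assms(3) by (simp add: insert_absorb)
  have n: "?g (v(s := - v s)) = - ?g v" using linear_neg[OF l, of "v s"] by simp
  have "c s * (c s * x) = - x" for x by (simp only: mult.assoc[symmetric] c) simp
  then show ?thesis unfolding e slot_def by (simp add: j n distrib_left diff_divide_distrib add_divide_distrib)
qed

lemma tproj_permute:
  assumes "bij \<sigma>" "finite I"
  shows "tproj j c I (\<lambda>v. \<omega> (v \<circ> \<sigma>)) = (\<lambda>v. tproj j (c \<circ> \<sigma>) (inv \<sigma> ` I) \<omega> (v \<circ> \<sigma>))"
  using assms(2)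
proof (induction I rule: finite_induct)
  case empty
  then show ?case by simp
next
  case (insert s I)
  have inj: "inj (inv \<sigma>)" using assms(1) bij_imp_bij_inv bij_is_inj by blast
  have s: "\<sigma> (inv \<sigma> s) = s" using assms(1) by (simp add: bij_is_surj surj_f_inv_f)
  have u: "v(s := x) \<circ> \<sigma> = (v \<circ> \<sigma>)(inv \<sigma> s := x)" for v :: "nat \<Rightarrow> 'a" and x
    using assms(1) s by (auto simp: fun_eq_iff bij_is_inj inv_f_f)
  have "inv \<sigma> s \<notin> inv \<sigma> ` I" using insert.hyps(2) inj by (simp add: inj_image_mem_iff)
  then have i: "tproj j (c \<circ> \<sigma>) (inv \<sigma> ` insert s I) \<omega> =
      slot j (c s) (inv \<sigma> s) (tproj j (c \<circ> \<sigma>) (inv \<sigma> ` I) \<omega>)"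
    using insert.hyps(1) by (simp add: tproj_insert s)
  have vs: "(v \<circ> \<sigma>) (inv \<sigma> s) = v s" for v :: "nat \<Rightarrow> 'a" by (simp add: s)
  show ?case
    unfolding tproj_insert[OF insert.hyps] i insert.IH slot_def u vs ..
qed

lemma tproj_alt_form_permute:
  assumes w: "alt_form k \<omega>" and p: "\<sigma> permutes {..<k}"
  shows "tproj j (c \<circ> \<sigma>) {..<k} \<omega> (v \<circ> \<sigma>) = of_int (sign \<sigma>) * tproj j c {..<k} \<omega> v"
proof -
  have "(\<lambda>v. \<omega> (v \<circ> \<sigma>)) = fscale (of_int (sign \<sigma>)) \<omega>"
    by (simp add: fun_eq_iff alt_form_permutes[OF w p] fscale_def)
  moreover have "inv \<sigma> ` {..<k} = {..<k}" using p permutes_inv permutes_image by blast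
  ultimately have "fscale (of_int (sign \<sigma>)) (tproj j c {..<k} \<omega>) = (\<lambda>v. tproj j (c \<circ> \<sigma>) {..<k} \<omega> (v \<circ> \<sigma>))"
    using tproj_permute[OF permutes_bij[OF p], of "{..<k}" j c \<omega>] by (simp add: tproj_scale)
  then show ?thesis by (simp add: fscale_def fun_eq_iff)
qed

lemma tproj_alt_form_eq_0:
  assumes w: "alt_form k \<omega>" and ab: "a < k" "b < k" "a \<noteq> b" "v a = v b" "c a = c b"
  shows "tproj j c {..<k} \<omega> v = 0"
proof -
  let ?t = "Transposition.transpose a b"
  have t: "?t permutes {..<k}" using ab by (intro permutes_swap_id) auto
  have "c \<circ> ?t = c" "v \<circ> ?t = v" using ab by (auto simp: fun_eq_iff Transposition.transpose_def)
  then show ?thesis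
    using tproj_alt_form_permute[OF w t, of j c v] ab by (simp add: sign_swap_id)
qed

text \<open>An intrinsic description of (k,0)-forms: alternating and complex linear in each
  argument. It can be checked on values and passes to pullbacks, whereas \<open>Lambda_pq\<close> is
  a span; in top degree the two agree by \<open>holo_form_iff_Lambda\<close>.\<close>

definition holo_form :: "('e::euclidean_space \<Rightarrow> 'e) \<Rightarrow> nat \<Rightarrow> 'e form \<Rightarrow> bool" where
  "holo_form j k \<omega> \<longleftrightarrow> alt_form k \<omega> \<and> (\<forall>v i. i < k \<longrightarrow> \<omega> (v(i := j (v i))) = \<i> * \<omega> v)"

lemma holo_form_alt: "holo_form j k \<omega> \<Longrightarrow> alt_form k \<omega>"
  and holo_form_type: "holo_form j k \<omega> \<Longrightarrow> i < k \<Longrightarrow> \<omega> (v(i := j (v i))) = \<i> * \<omega> v"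
  by (auto simp: holo_form_def)

lemma holo_form_add: "holo_form j k \<omega> \<Longrightarrow> holo_form j k \<eta> \<Longrightarrow> holo_form j k (\<omega> + \<eta>)"
  by (simp add: holo_form_def alt_form_add distrib_left)

lemma holo_form_scale: "holo_form j k \<omega> \<Longrightarrow> holo_form j k (fscale c \<omega>)"
  unfolding holo_form_def using alt_form_scale[of k \<omega> c] by (auto simp: fscale_def)

lemma holo_form_zero: "holo_form j k 0"
  by (simp add: holo_form_def alt_form_zero)

lemma holo_form_tproj:
  assumes j: "linear j" "\<And>v. j (j v) = - v" and w: "alt_form k \<omega>"
  shows "holo_form j k (tproj j (\<lambda>_. - \<i>) {..<k} \<omega>)"
  unfolding holo_form_def alt_form_def
proof (intro conjI allI impI)
  let ?g = "tproj j (\<lambda>_. - \<i>) {..<k} \<omega>"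
  show "?g v = ?g v'" if "\<forall>i<k. v i = v' i" for v v'
  proof (rule tproj_local[OF finite_lessThan order_refl])
    show "\<omega> u = \<omega> u'" if "\<And>i. i < k \<Longrightarrow> u i = u' i" for u u' by (rule alt_form_cong[OF w that])
    show "v i = v' i" if "i < k" for i using that \<open>\<forall>i<k. v i = v' i\<close> by blast
  qed
  show "linear (\<lambda>x. ?g (v(i := x)))" if "i < k" for v i
    by (rule tproj_linear_slot[OF j(1) finite_lessThan alt_form_linear[OF w that]])
  show "?g v = 0" if "a < k \<and> b < k \<and> a \<noteq> b \<and> v a = v b" for v a b
    by (rule tproj_alt_form_eq_0[OF w, of a b]) (use that in auto)
  show "?g (v(i := j (v i))) = \<i> * ?g v" if "i < k" for v i
    using tproj_type[of j "{..<k}" i \<omega> "\<lambda>_. - \<i>" v] j that alt_form_linear[OF w that] by simp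
qed

lemma wedge_product_type:
  fixes v :: "nat \<Rightarrow> 'e"
  assumes \<sigma>: "\<sigma> permutes {..<k}" and s: "s < k"
    and t: "\<And>i x. i < k \<Longrightarrow> \<alpha> i (j x) = \<tau> i * \<alpha> i x"
  shows "(\<Prod>i<k. (\<alpha> i ((v(s := j (v s))) (\<sigma> i)) :: complex)) = \<tau> (inv \<sigma> s) * (\<Prod>i<k. \<alpha> i (v (\<sigma> i)))"
proof -
  have i: "inv \<sigma> s < k" using \<sigma> s permutes_in_image permutes_inv by fastforce
  have "(\<Prod>i<k. \<alpha> i (v (\<sigma> i))) = (\<Prod>i<k. \<alpha> i ((v(s := v s)) (\<sigma> i)))" by simp
  also have "\<dots> = \<alpha> (inv \<sigma> s) (v s) * (\<Prod>i\<in>{..<k} - {inv \<sigma> s}. \<alpha> i (v (\<sigma> i)))"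
    by (rule permutes_prod_slot[OF \<sigma> s])
  finally show ?thesis
    unfolding permutes_prod_slot[OF \<sigma> s, of \<alpha> v "j (v s)"] t[OF i] by simp
qed

lemma holo_form_wedge:
  assumes "\<And>i. i < k \<Longrightarrow> \<alpha> i \<in> T10 j"
  shows "holo_form j k (wedge k \<alpha>)"
proof -
  have "wedge k \<alpha> (v(s := j (v s))) = \<i> * wedge k \<alpha> v" if "s < k" for v s
  proof -
    have "(\<Prod>i<k. \<alpha> i ((v(s := j (v s))) (\<sigma> i))) = \<i> * (\<Prod>i<k. \<alpha> i (v (\<sigma> i)))" if "\<sigma> permutes {..<k}" for \<sigma>
      by (rule wedge_product_type[OF that \<open>s < k\<close>, of \<alpha> j "\<lambda>_. \<i>"]) (use assms in \<open>auto simp: T10_def\<close>)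
    then show ?thesis unfolding wedge_def by (simp add: sum_distrib_left mult_ac)
  qed
  moreover have "alt_form k (wedge k \<alpha>)" using assms by (intro alt_form_wedge T10_linear) auto
  ultimately show ?thesis by (simp add: holo_form_def)
qed

lemma Lambda_p0_holo: "\<omega> \<in> Lambda_pq j p 0 \<Longrightarrow> holo_form j p \<omega>"
  unfolding Lambda_pq_def
proof (induction rule: fs.span_induct_alt)
  case base
  then show ?case by (rule holo_form_zero)
next
  case (step c x y)
  then have "holo_form j p x" by (auto intro: holo_form_wedge)
  then show ?case by (intro holo_form_add holo_form_scale step(2))
qed

text \<open>The projection onto type (p,1) in closed form: the summand \<open>i\<close> makes
  argument \<open>i\<close> of type (0,1) and all the others of type (1,0).\<close>

definition proj_p1 :: "('e \<Rightarrow> 'e) \<Rightarrow> nat \<Rightarrow> 'e form \<Rightarrow> 'e form" where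
  "proj_p1 j p \<omega> = (\<Sum>i<Suc p. tproj j (\<lambda>l. if l = i then \<i> else - \<i>) {..<Suc p} \<omega>)"

lemma proj_p1_add: "proj_p1 j p (\<omega> + \<eta>) = proj_p1 j p \<omega> + proj_p1 j p \<eta>"
  by (simp only: proj_p1_def tproj_add finite_lessThan sum.distrib)

lemma proj_p1_scale: "proj_p1 j p (fscale c \<omega>) = fscale c (proj_p1 j p \<omega>)"
  by (simp only: proj_p1_def tproj_scale finite_lessThan fs.scale_sum_right)

lemma proj_p1_sum: "proj_p1 j p (\<Sum>a\<in>K. \<tau> a) = (\<Sum>a\<in>K. proj_p1 j p (\<tau> a))"
  unfolding proj_p1_def by (simp only: tproj_sum finite_lessThan) (rule sum.swap)

text \<open>Each permutation contributes a product on which all slots act by 0 or 1. Such a product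
  survives exactly if it has a single (0,1)-factor, at index \<open>p\<close>, and then only in the
  summand whose distinguished argument is \<open>\<sigma> p\<close>.\<close>

lemma proj_p1_wedge:
  assumes a: "a \<le> Suc p" and \<alpha>: "\<And>i. i < a \<Longrightarrow> \<alpha> i \<in> T10 j" "\<And>i. a \<le> i \<Longrightarrow> i < Suc p \<Longrightarrow> \<alpha> i \<in> T01 j"
  shows "proj_p1 j p (wedge (Suc p) \<alpha>) = (if a = p then wedge (Suc p) \<alpha> else 0)"
proof -
  define \<tau> where "\<tau> i = (if i < a then \<i> else - \<i>)" for i :: nat
  have t: "\<alpha> i (j x) = \<tau> i * \<alpha> i x" if "i < Suc p" for i x
    using that \<alpha>[of i] by (auto simp: \<tau>_def T10_def T01_def)
  define h where "h \<sigma> = (\<lambda>v. \<Prod>i<Suc p. \<alpha> i (v (\<sigma> i)))" for \<sigma> :: "nat \<Rightarrow> nat"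
  have W: "wedge (Suc p) \<alpha> = (\<Sum>\<sigma> | \<sigma> permutes {..<Suc p}. fscale (of_int (sign \<sigma>)) (h \<sigma>))"
  proof -
    have "(\<Sum>\<sigma>\<in>F. fscale (g \<sigma>) (h \<sigma>)) v = (\<Sum>\<sigma>\<in>F. g \<sigma> * h \<sigma> v)" for F g v
      by (induction F rule: infinite_finite_induct) (auto simp: fscale_def)
    then show ?thesis by (simp add: fun_eq_iff wedge_def h_def)
  qed
  have hp: "proj_p1 j p (h \<sigma>) = (if a = p then h \<sigma> else 0)" if \<sigma>: "\<sigma> permutes {..<Suc p}" for \<sigma>
  proof -
    have b: "bij_betw (inv \<sigma>) {..<Suc p} {..<Suc p}" by (rule permutes_imp_bij[OF permutes_inv[OF \<sigma>]])
    define c where "c i = (\<Prod>s<Suc p. (1 + (if s = i then \<i> else - \<i>) * \<tau> (inv \<sigma> s)) / 2)" for i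
    have ty: "tproj j (\<lambda>l. if l = i then \<i> else - \<i>) {..<Suc p} (h \<sigma>) = (\<lambda>v. c i * h \<sigma> v)" for i
      unfolding c_def
    proof (rule tproj_typed[OF finite_lessThan])
      fix s and v :: "nat \<Rightarrow> 'a" assume "s \<in> {..<Suc p}"
      then show "h \<sigma> (v(s := j (v s))) = \<tau> (inv \<sigma> s) * h \<sigma> v"
        unfolding h_def by (intro wedge_product_type[OF \<sigma>, of s \<alpha> j \<tau> v]) (simp_all only: t lessThan_iff)
    qed
    have c: "c i = (if a = p \<and> i = \<sigma> p then 1 else 0)" if i: "i < Suc p" for i
    proof (cases "a = p \<and> i = \<sigma> p")
      case True
      have "(1 + (if s = i then \<i> else - \<i>) * \<tau> (inv \<sigma> s)) / 2 = 1" if "s < Suc p" for s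
      proof -
        have "inv \<sigma> s < Suc p" using bij_betwE[OF b] that by blast
        moreover have "inv \<sigma> s = p \<longleftrightarrow> s = i" using True \<sigma> by (metis permutes_inverses)
        ultimately show ?thesis using True by (auto simp: \<tau>_def less_Suc_eq)
      qed
      then show ?thesis using True unfolding c_def by (simp del: prod.lessThan_Suc)
    next
      case False
      \<comment> \<open>One factor vanishes: either argument \<open>i\<close>, made of type (0,1),
        feeds a (1,0)-covector, or some other argument, made of type (1,0), feeds a
        (0,1)-covector.\<close>
      have "\<exists>s<Suc p. (1 + (if s = i then \<i> else - \<i>) * \<tau> (inv \<sigma> s)) / 2 = 0"
      proof (cases "a \<le> inv \<sigma> i")
        case True
        have il: "inv \<sigma> i < Suc p" using bij_betwE[OF b] i by blast
        have "a < p \<or> inv \<sigma> i < p"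
        proof (rule ccontr)
          assume "\<not> (a < p \<or> inv \<sigma> i < p)"
          then have "inv \<sigma> i = p" "a = p" using True il a by auto
          then show False using False \<sigma> by (metis permutes_inverses(1))
        qed
        \<comment> \<open>A (0,1)-covector that is not fed by argument \<open>i\<close>. Its
          argument \<open>\<sigma> q\<close> is projected to the wrong type.\<close>
        define q where "q = (if inv \<sigma> i = p then a else p)"
        have q: "q < Suc p" "a \<le> q" "q \<noteq> inv \<sigma> i"
          using True il \<open>a < p \<or> inv \<sigma> i < p\<close> by (auto simp: q_def)
        have "\<sigma> q < Suc p" using \<sigma> q(1) permutes_in_image by fastforce
        moreover have "\<sigma> q \<noteq> i" using q(3) \<sigma> by (metis permutes_inverses(2))
        moreover have "inv \<sigma> (\<sigma> q) = q" using \<sigma> by (metis permutes_inverses(2))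
        ultimately show ?thesis using q(2) by (intro exI[of _ "\<sigma> q"]) (auto simp: \<tau>_def)
      next
        case False
        then show ?thesis using i by (intro exI[of _ i]) (auto simp: \<tau>_def)
      qed
      then show ?thesis using False unfolding c_def by (metis (no_types, lifting) finite_lessThan lessThan_iff prod_zero)
    qed
    have sp: "\<sigma> p < Suc p" using \<sigma> permutes_in_image by fastforce
    have "(\<Sum>i<Suc p. (\<lambda>v. c i * h \<sigma> v)) = fscale (\<Sum>i<Suc p. c i) (h \<sigma>)"
      by (simp only: fs.scale_sum_left) (simp only: fscale_def)
    also have "(\<Sum>i<Suc p. c i) = (if a = p then 1 else 0)"
    proof -
      have "(\<Sum>i<Suc p. c i) = (\<Sum>i<Suc p. if a = p \<and> i = \<sigma> p then 1 else 0)"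
        by (rule sum.cong) (use c in auto)
      also have "\<dots> = (if a = p then 1 else 0)"
        using sp by (cases "a = p") (auto simp del: sum.lessThan_Suc)
      finally show ?thesis .
    qed
    finally show ?thesis unfolding proj_p1_def ty by (simp add: fscale_def fun_eq_iff)
  qed
  show ?thesis
    unfolding W proj_p1_sum proj_p1_scale using hp by (simp add: sum.neutral)
qed

lemma proj_p1_Lambda:
  assumes "a \<le> Suc p" "\<omega> \<in> Lambda_pq j a (Suc p - a)"
  shows "proj_p1 j p \<omega> = (if a = p then \<omega> else 0)"
  using assms(2) unfolding Lambda_pq_def
proof (induction rule: fs.span_induct_alt)
  case base
  have "proj_p1 j p (0 :: 'a form) = 0" using proj_p1_scale[of j p 0 0] by (simp only: fs.scale_zero_left)
  then show ?case by (simp only: if_cancel)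
next
  case (step c x y)
  then obtain \<alpha> where \<alpha>: "x = wedge (Suc p) \<alpha>" "\<forall>i<a. \<alpha> i \<in> T10 j" "\<forall>i. a \<le> i \<and> i < Suc p \<longrightarrow> \<alpha> i \<in> T01 j"
    using assms(1) by auto
  have "proj_p1 j p x = (if a = p then x else 0)"
    unfolding \<alpha>(1) by (rule proj_p1_wedge[OF assms(1)]) (use \<alpha> in auto)
  then show ?case unfolding proj_p1_add proj_p1_scale step(2)
    by (simp only: if_distrib[of "fscale c"] fs.scale_zero_right add_0_left split: if_split) simp
qed

text \<open>\<open>proj_p1\<close> kills every component except the one of type (p,1), so it
  computes that component from any decomposition; this gives the uniqueness in the description, and
  \<open>alt_form_decomposable\<close> the existence.\<close>

theorem proj_pq_eq:
  assumes j: "linear j" "\<And>v. j (j v) = - v" and w: "alt_form (Suc p) \<omega>"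
  shows "proj_pq j p 1 \<omega> = proj_p1 j p \<omega>"
proof -
  have u: "\<tau> p = proj_p1 j p \<omega>"
    if t: "\<forall>a\<le>Suc p. \<tau> a \<in> Lambda_pq j a (Suc p - a)" "\<omega> = (\<Sum>a\<le>Suc p. \<tau> a)" for \<tau>
  proof -
    have "proj_p1 j p \<omega> = (\<Sum>a\<le>Suc p. proj_p1 j p (\<tau> a))" unfolding t(2) by (rule proj_p1_sum)
    also have "\<dots> = (\<Sum>a\<le>Suc p. if a = p then \<tau> a else 0)"
      by (rule sum.cong[OF refl], rule proj_p1_Lambda) (use t(1) in auto)
    also have "\<dots> = \<tau> p" by simp
    finally show ?thesis ..
  qed
  obtain \<tau> where t: "\<forall>a\<le>Suc p. \<tau> a \<in> Lambda_pq j a (Suc p - a)" "\<omega> = (\<Sum>a\<le>Suc p. \<tau> a)"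
    using alt_form_decomposable[OF j w] unfolding decomposable_def by blast
  show ?thesis
    unfolding proj_pq_def
  proof (rule the_equality)
    show "\<exists>\<tau>. (\<forall>a\<le>p + 1. \<tau> a \<in> Lambda_pq j a (p + 1 - a)) \<and> \<omega> = sum \<tau> {..p + 1} \<and> proj_p1 j p \<omega> = \<tau> p"
      using t u by (intro exI[of _ \<tau>]) simp
  qed (use u in auto)
qed

subsection \<open>Forms of top holomorphic degree\<close>

text \<open>With \<open>j\<close> as multiplication by \<i> the space is a complex vector space. A
  complex basis \<open>B\<close> together with its image under \<open>j\<close> is a real basis, so
  \<open>B\<close> has n elements, and the covectors are its complex coordinates.\<close>

lemma complex_basis_exists:
  fixes j :: "'e::euclidean_space \<Rightarrow> 'e"
  assumes j: "linear j" "\<And>v. j (j v) = - v" and n: "DIM('e) = 2 * n"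
  shows "\<exists>(b :: nat \<Rightarrow> 'e) \<epsilon>. (\<forall>i<n. \<epsilon> i \<in> T10 j) \<and> (\<forall>i<n. \<forall>l<n. \<epsilon> i (b l) = (if i = l then 1 else 0)) \<and>
    (\<forall>v. v = (\<Sum>i<n. Re (\<epsilon> i v) *\<^sub>R b i + Im (\<epsilon> i v) *\<^sub>R j (b i)))"
proof -
  let ?sc = "\<lambda>c v. Re c *\<^sub>R v + Im c *\<^sub>R j v"
  interpret C: vector_space ?sc
    by unfold_locales
      (auto simp: algebra_simps linear_add[OF j(1)] linear_scale[OF j(1)] j(2))
  obtain B where "C.independent B" "UNIV \<subseteq> C.span B"
    by (rule C.maximal_independent_subset[of UNIV])
  then have B: "C.independent B" "C.span B = UNIV" by auto
  have sum0: "(\<forall>b\<in>F. u b = 0)" if "finite F" "F \<subseteq> B" "(\<Sum>b\<in>F. ?sc (u b) b) = 0" for F u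
    using C.independentD[OF B(1) that(1,2)] that(3) by blast
  have "independent B"
    unfolding real_vector.dependent_explicit
  proof (intro notI, elim exE conjE)
    fix F u assume F: "finite F" "F \<subseteq> B" "(\<Sum>v\<in>F. u v *\<^sub>R v) = 0" "\<exists>v\<in>F. u v \<noteq> (0::real)"
    then have "(\<Sum>b\<in>F. ?sc (complex_of_real (u b)) b) = 0" by simp
    from sum0[OF F(1,2) this] F(4) show False by auto
  qed
  then have fB: "finite B" using independent_bound by blast
  have inj_j: "inj_on j S" for S by (metis (no_types, lifting) inj_onI j(2) minus_minus)
  have disj: "B \<inter> j ` B = {}"
  proof (rule ccontr)
    assume "B \<inter> j ` B \<noteq> {}"
    then obtain b b' where b: "b \<in> B" "b' \<in> B" "b = j b'" by blast
    show False
    proof (cases "b = b'")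
      case True
      have "b \<noteq> 0" using B(1) b(1) C.dependent_zero by blast
      have "- b = j (j b)" by (simp add: j(2))
      also have "\<dots> = b" using True b(3) by simp
      finally have "b + b = 0" by (metis add.left_inverse)
      then have "2 *\<^sub>R b = 0" by (simp only: scaleR_2)
      then show False using \<open>b \<noteq> 0\<close> by simp
    next
      case False
      have "(\<Sum>x\<in>{b, b'}. ?sc (if x = b then 1 else - \<i>) x) = 0" using False b(3) by simp
      then show False using sum0[of "{b, b'}" "\<lambda>x. if x = b then 1 else - \<i>"] b by auto
    qed
  qed
  have rep: "v = (\<Sum>b\<in>B. ?sc (C.representation B v b) b)" for v
    using C.sum_representation_eq[OF B(1) _ fB subset_refl, of v] B(2) by simp
  let ?D = "B \<union> j ` B"
  have spanD: "span ?D = UNIV"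
  proof -
    have "v \<in> span ?D" for v
      by (subst rep) (intro span_sum span_add span_scale span_base; auto)
    then show ?thesis by blast
  qed
  have indD: "independent ?D"
    unfolding real_vector.dependent_explicit
  proof (intro notI, elim exE conjE)
    fix F u assume F: "finite F" "F \<subseteq> ?D" "(\<Sum>v\<in>F. u v *\<^sub>R v) = 0" "\<exists>v\<in>F. u v \<noteq> (0::real)"
    define w where "w v = (if v \<in> F then u v else 0)" for v
    have "0 = (\<Sum>v\<in>?D. w v *\<^sub>R v)"
      unfolding w_def using F fB by (subst sum.mono_neutral_right[of ?D F]) auto
    also have "\<dots> = (\<Sum>b\<in>B. w b *\<^sub>R b) + (\<Sum>b\<in>j ` B. w b *\<^sub>R b)"
      using fB disj by (intro sum.union_disjoint) auto
    also have "(\<Sum>b\<in>j ` B. w b *\<^sub>R b) = (\<Sum>b\<in>B. w (j b) *\<^sub>R j b)"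
      by (simp add: sum.reindex[OF inj_j])
    also have "(\<Sum>b\<in>B. w b *\<^sub>R b) + \<dots> = (\<Sum>b\<in>B. ?sc (Complex (w b) (w (j b))) b)"
      by (simp add: sum.distrib)
    finally have "(\<Sum>b\<in>B. ?sc (Complex (w b) (w (j b))) b) = 0" by (rule sym)
    then have "\<forall>b\<in>B. Complex (w b) (w (j b)) = 0" by (rule sum0[OF fB subset_refl])
    then have "w b = 0 \<and> w (j b) = 0" if "b \<in> B" for b using that by (simp add: Complex_eq_0)
    then have "\<forall>v\<in>?D. w v = 0" by blast
    then show False using F(2,4) by (auto simp: w_def split: if_splits)
  qed
  have "card ?D = DIM('e)"
    using real_vector.dim_eq_card[OF _ indD, of UNIV] spanD by simp
  moreover have "card ?D = 2 * card B"
    using fB disj by (subst card_Un_disjoint) (auto simp: card_image[OF inj_j])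
  ultimately have "card B = n" using n by simp
  then obtain b where b: "bij_betw b {..<n} B"
    using fB finite_same_card_bij[of "{..<n}" B] by auto
  define \<epsilon> where "\<epsilon> i v = C.representation B v (b i)" for i v
  have bB: "b i \<in> B" if "i < n" for i using b that bij_betwE by blast
  have inS: "v \<in> C.span B" for v using B(2) by simp
  show ?thesis
  proof (intro exI[of _ b] exI[of _ \<epsilon>] conjI allI impI)
    fix i l assume "i < n" "l < n"
    then show "\<epsilon> i (b l) = (if i = l then 1 else 0)"
      using C.representation_basis[OF B(1) bB] b by (auto simp: \<epsilon>_def bij_betw_def inj_on_def)
  next
    fix i assume i: "i < n"
    have sc: "C.representation B (?sc c v) x = c * C.representation B v x" for c v x
      using C.representation_scale[OF B(1) inS] by simp
    have ad: "\<epsilon> i (x + y) = \<epsilon> i x + \<epsilon> i y" for x y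
      unfolding \<epsilon>_def using C.representation_add[OF B(1) inS inS] by simp
    have "\<epsilon> i (r *\<^sub>R x) = r *\<^sub>R \<epsilon> i x" for r x
      unfolding \<epsilon>_def using sc[of "complex_of_real r" x] by (simp add: scaleR_conv_of_real)
    with ad have "linear (\<epsilon> i)" by (rule linearI)
    moreover have "\<epsilon> i (j v) = \<i> * \<epsilon> i v" for v
      unfolding \<epsilon>_def using sc[of \<i> v] by simp
    ultimately show "\<epsilon> i \<in> T10 j" by (simp add: T10_def)
  next
    fix v
    show "v = (\<Sum>i<n. Re (\<epsilon> i v) *\<^sub>R b i + Im (\<epsilon> i v) *\<^sub>R j (b i))"
      unfolding \<epsilon>_def by (subst sum.reindex_bij_betw[OF b]) (rule rep)
  qed
qed

text \<open>In complex dimension n, complex multilinearity reduces all values of an alternating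
  n-form to values on members of a complex basis, and these are 0 or plus or minus the single value
  at \<open>b\<close>.\<close>

lemma holo_form_vanish:
  assumes w: "holo_form j n \<omega>" and z: "\<omega> b = 0"
    and rep: "\<And>v. v = (\<Sum>i<n. Re (\<epsilon> i v) *\<^sub>R b i + Im (\<epsilon> i v) *\<^sub>R j (b i))"
  shows "\<omega> v = 0"
proof -
  note a = holo_form_alt[OF w]
  have base: "\<omega> v = 0" if "\<forall>l<n. \<exists>i<n. v l = b i" for v
  proof -
    define f where "f l = (SOME i. i < n \<and> v l = b i)" for l
    have f: "f l < n \<and> v l = b (f l)" if "l < n" for l
      unfolding f_def by (rule someI_ex) (use that \<open>\<forall>l<n. \<exists>i<n. v l = b i\<close> in blast)
    show ?thesis
    proof (cases "inj_on f {..<n}")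
      case False
      then obtain x y where "x < n" "y < n" "x \<noteq> y" "f x = f y" by (auto simp: inj_on_def)
      then show ?thesis using f by (intro alt_form_eq_0[OF a, of x y]) auto
    next
      case True
      define p where "p l = (if l < n then f l else l)" for l
      have "f ` {..<n} = {..<n}" using True f by (intro endo_inj_surj) auto
      moreover have "p ` {..<n} = f ` {..<n}" by (rule image_cong) (auto simp: p_def)
      moreover have "inj_on p {..<n}" using True by (simp add: p_def inj_on_def)
      ultimately have "bij_betw p {..<n} {..<n}" by (simp add: bij_betw_def)
      then have "p permutes {..<n}" by (rule bij_imp_permutes) (simp add: p_def)
      then have "\<omega> (b \<circ> p) = 0" using alt_form_permutes[OF a] z by simp
      moreover have "\<omega> v = \<omega> (b \<circ> p)" by (rule alt_form_cong[OF a]) (use f in \<open>simp add: p_def\<close>)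
      ultimately show ?thesis by simp
    qed
  qed
  \<comment> \<open>The arguments from \<open>m\<close> on are already basis vectors. Expanding
    argument \<open>m - 1\<close> brings in \<open>b i\<close> and \<open>j (b i)\<close>, and the
    latter contributes only a factor \<i>.\<close>
  have gen: "\<omega> v = 0" if "m \<le> n" "\<forall>l. m \<le> l \<and> l < n \<longrightarrow> (\<exists>i<n. v l = b i)" for m v
    using that
  proof (induction m arbitrary: v)
    case 0
    then show ?case using base by simp
  next
    case (Suc m)
    then have m: "m < n" by simp
    have l: "linear (\<lambda>x. \<omega> (v(m := x)))" by (rule alt_form_linear[OF a m])
    have zb: "\<omega> (v(m := b i)) = 0" if "i < n" for i
    proof (rule Suc.IH)
      show "\<forall>l. m \<le> l \<and> l < n \<longrightarrow> (\<exists>i'<n. (v(m := b i)) l = b i')"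
      proof (intro allI impI)
        fix l assume l: "m \<le> l \<and> l < n"
        show "\<exists>i'<n. (v(m := b i)) l = b i'"
        proof (cases "l = m")
          case True
          then show ?thesis using that by auto
        next
          case False
          then show ?thesis using Suc.prems(2) l by auto
        qed
      qed
    qed (use m in simp)
    have zj: "\<omega> (v(m := j (b i))) = 0" if "i < n" for i
      using holo_form_type[OF w m, of "v(m := b i)"] zb[OF that] by simp
    have "\<omega> v = \<omega> (v(m := (\<Sum>i<n. Re (\<epsilon> i (v m)) *\<^sub>R b i + Im (\<epsilon> i (v m)) *\<^sub>R j (b i))))"
      using rep[of "v m"] by simp
    also have "\<dots> = (\<Sum>i<n. Re (\<epsilon> i (v m)) *\<^sub>R \<omega> (v(m := b i)) + Im (\<epsilon> i (v m)) *\<^sub>R \<omega> (v(m := j (b i))))"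
      by (simp add: linear_sum[OF l] linear_add[OF l] linear_scale[OF l])
    also have "\<dots> = 0" using zb zj by simp
    finally show ?case .
  qed
  show ?thesis by (rule gen[of n]) auto
qed

text \<open>Top holomorphic forms make up a line. Its generator is the wedge product of the dual
  complex basis, which has value 1 on that basis; any other form minus its multiple of the generator
  vanishes there and hence everywhere.\<close>

lemma holo_form_generator:
  fixes j :: "'e::euclidean_space \<Rightarrow> 'e"
  assumes j: "linear j" "\<And>v. j (j v) = - v" and n: "DIM('e) = 2 * n"
  shows "\<exists>\<kappa>. \<kappa> \<in> Lambda_pq j n 0 \<and> \<kappa> \<noteq> 0 \<and> (\<forall>\<omega>. holo_form j n \<omega> \<longrightarrow> (\<exists>c. \<omega> = fscale c \<kappa>))"
proof -
  obtain b \<epsilon> where eps: "\<And>i. i < n \<Longrightarrow> \<epsilon> i \<in> T10 j"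
    and dual: "\<And>i l. i < n \<Longrightarrow> l < n \<Longrightarrow> \<epsilon> i (b l) = (if i = l then 1 else 0)"
    and rep: "\<And>v. v = (\<Sum>i<n. Re (\<epsilon> i v) *\<^sub>R b i + Im (\<epsilon> i v) *\<^sub>R j (b i))"
    using complex_basis_exists[OF j n] by blast
  let ?k = "wedge n \<epsilon>"
  have k: "?k \<in> Lambda_pq j n 0"
    unfolding Lambda_pq_def by (rule fs.span_base) (use eps in auto)
  have z: "(\<Prod>i<n. \<epsilon> i (b (\<sigma> i))) = (if \<sigma> = id then 1 else 0)" if s: "\<sigma> permutes {..<n}" for \<sigma>
  proof (cases "\<sigma> = id")
    case False
    then obtain i where i: "\<sigma> i \<noteq> i" by (auto simp: fun_eq_iff)
    then have "i < n" using s permutes_not_in by fastforce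
    moreover have "\<sigma> i < n" using s \<open>i < n\<close> permutes_in_image by fastforce
    ultimately show ?thesis using False i dual by (auto intro!: prod_zero bexI[of _ i])
  qed (use dual in simp)
  have "?k b = (\<Sum>\<sigma> | \<sigma> permutes {..<n}. if \<sigma> = id then 1 else 0)"
    unfolding wedge_def by (rule sum.cong) (auto simp: z)
  also have "\<dots> = 1"
    by (subst sum.delta) (auto simp: finite_permutations permutes_id)
  finally have kb: "?k b = 1" .
  have "\<omega> = fscale (\<omega> b) ?k" if w: "holo_form j n \<omega>" for \<omega>
  proof -
    have h: "holo_form j n (\<omega> + fscale (- \<omega> b) ?k)"
      by (intro holo_form_add w holo_form_scale Lambda_p0_holo k)
    have "(\<omega> + fscale (- \<omega> b) ?k) v = 0" for v
      by (rule holo_form_vanish[OF h _ rep]) (simp add: fscale_def kb)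
    then have "\<omega> + fscale (- \<omega> b) ?k = 0" by (intro ext) (simp only: zero_fun_apply)
    then have "\<omega> = - fscale (- \<omega> b) ?k" by (simp only: eq_neg_iff_add_eq_0)
    then show ?thesis by (simp only: fs.scale_minus_left minus_minus)
  qed
  moreover have "?k \<noteq> 0" using kb by (metis zero_fun_apply zero_neq_one)
  ultimately show ?thesis using k by blast
qed

lemma holo_form_iff_Lambda:
  fixes j :: "'e::euclidean_space \<Rightarrow> 'e"
  assumes "linear j" "\<And>v. j (j v) = - v" "DIM('e) = 2 * n"
  shows "holo_form j n \<omega> \<longleftrightarrow> \<omega> \<in> Lambda_pq j n 0"
proof
  assume w: "holo_form j n \<omega>"
  obtain \<kappa> where k: "\<kappa> \<in> Lambda_pq j n 0" "\<And>\<omega>. holo_form j n \<omega> \<Longrightarrow> \<exists>c. \<omega> = fscale c \<kappa>"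
    using holo_form_generator[OF assms] by blast
  obtain c where c: "\<omega> = fscale c \<kappa>" using k(2)[OF w] by blast
  show "\<omega> \<in> Lambda_pq j n 0"
    unfolding c using k(1) unfolding Lambda_pq_def by (rule fs.span_scale)
qed (rule Lambda_p0_holo)

lemma holo_form_proportional:
  fixes j :: "'e::euclidean_space \<Rightarrow> 'e"
  assumes "linear j" "\<And>v. j (j v) = - v" "DIM('e) = 2 * n"
    and k: "holo_form j n \<kappa>" "\<kappa> \<noteq> 0" and w: "holo_form j n \<omega>"
  shows "\<exists>c. \<omega> = fscale c \<kappa>"
proof -
  obtain \<kappa>0 where g: "\<And>\<omega>. holo_form j n \<omega> \<Longrightarrow> \<exists>c. \<omega> = fscale c \<kappa>0"
    using holo_form_generator[OF assms(1-3)] by blast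
  obtain c d where c: "\<kappa> = fscale c \<kappa>0" and d: "\<omega> = fscale d \<kappa>0" using g k w by metis
  have "c \<noteq> 0" using c k(2) by (auto simp: fscale_def fun_eq_iff)
  then have "\<omega> = fscale (d / c) \<kappa>" unfolding c d by (simp add: fscale_def)
  then show ?thesis ..
qed

definition kpow :: "nat \<Rightarrow> 'e form \<Rightarrow> 'e multiform" where
  "kpow m \<kappa> = (\<lambda>v. \<Prod>i<m. \<kappa> (v i))"

lemma kpow_nonzero: "\<kappa> w \<noteq> 0 \<Longrightarrow> kpow m \<kappa> (\<lambda>_. w) \<noteq> 0"
  by (simp add: kpow_def)

lemma kpow_scale: "kpow m (fscale c \<kappa>) = fscale (c ^ m) (kpow m \<kappa>)"
  by (simp add: kpow_def fscale_def fun_eq_iff prod.distrib)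

lemma K_fibre_iff:
  fixes j :: "'e::euclidean_space \<Rightarrow> 'e"
  assumes j: "linear j" "\<And>v. j (j v) = - v" "DIM('e) = 2 * n"
    and k: "holo_form j n \<kappa>" "\<kappa> \<noteq> 0"
  shows "t \<in> K_fibre j n m \<longleftrightarrow> (\<exists>c. t = fscale c (kpow m \<kappa>))"
proof
  assume "t \<in> K_fibre j n m"
  then show "\<exists>c. t = fscale c (kpow m \<kappa>)"
    unfolding K_fibre_def
  proof (induction rule: fs.span_induct_alt)
    case base
    show ?case by (intro exI[of _ 0]) (simp add: fscale_def fun_eq_iff)
  next
    case (step c x y)
    then obtain \<omega> d where x: "x = (\<lambda>v. \<Prod>i<m. \<omega> i (v i))" "\<forall>i<m. \<omega> i \<in> Lambda_pq j n 0"
      and y: "y = fscale d (kpow m \<kappa>)" by auto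
    have "\<exists>a. \<omega> i = fscale a \<kappa>" if "i < m" for i
      using holo_form_proportional[OF j k] x(2) that Lambda_p0_holo by blast
    then obtain a where a: "\<And>i. i < m \<Longrightarrow> \<omega> i = fscale (a i) \<kappa>" by metis
    have "x = fscale (\<Prod>i<m. a i) (kpow m \<kappa>)"
      unfolding x(1) using a by (simp add: fscale_def kpow_def fun_eq_iff prod.distrib)
    then have "fscale c x + y = fscale (c * (\<Prod>i<m. a i) + d) (kpow m \<kappa>)"
      unfolding y by (simp only: fs.scale_left_distrib fs.scale_scale)
    then show ?case ..
  qed
next
  assume "\<exists>c. t = fscale c (kpow m \<kappa>)"
  moreover have "kpow m \<kappa> \<in> K_fibre j n m"
    unfolding K_fibre_def
    by (rule fs.span_base) (use k holo_form_iff_Lambda[OF j] in \<open>auto simp: kpow_def\<close>)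
  ultimately show "t \<in> K_fibre j n m"
    unfolding K_fibre_def by (auto intro: fs.span_scale)
qed

lemma K_fibre_subspace: "fs.subspace (K_fibre j n m)"
  unfolding K_fibre_def by (rule fs.subspace_span)

interpretation fs1: vector_space "\<lambda>c (t :: 'u \<Rightarrow> 'a \<Rightarrow> complex) u. fscale c (t u)"
  by unfold_locales (auto simp: fscale_def algebra_simps fun_eq_iff)

lemma T01_add: "\<alpha> \<in> T01 j \<Longrightarrow> \<beta> \<in> T01 j \<Longrightarrow> (\<lambda>u. \<alpha> u + \<beta> u) \<in> T01 j"
  by (simp add: T01_def linear_compose_add algebra_simps)

lemma T01_scale: "\<alpha> \<in> T01 j \<Longrightarrow> (\<lambda>u. c * \<alpha> u) \<in> T01 j"
  using linear_compose[of \<alpha> "(*) c"]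
  by (simp add: T01_def o_def bounded_linear.linear bounded_linear_mult_right mult_ac)

text \<open>Since the fibre of the power is a line, a sum of tensors collapses to a single one. The
  covector \<open>\<theta>\<close> then carries all the information.\<close>

lemma T01_tensor_K_iff:
  fixes j :: "'e::euclidean_space \<Rightarrow> 'e"
  assumes j: "linear j" "\<And>v. j (j v) = - v" "DIM('e) = 2 * n"
    and k: "holo_form j n \<kappa>" "\<kappa> \<noteq> 0"
  shows "t \<in> T01_tensor j fscale (K_fibre j n m) \<longleftrightarrow> (\<exists>\<theta>\<in>T01 j. t = (\<lambda>u. fscale (\<theta> u) (kpow m \<kappa>)))"
proof
  assume "t \<in> T01_tensor j fscale (K_fibre j n m)"
  then show "\<exists>\<theta>\<in>T01 j. t = (\<lambda>u. fscale (\<theta> u) (kpow m \<kappa>))"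
    unfolding T01_tensor_def
  proof (induction rule: fs1.span_induct_alt)
    case base
    have "(\<lambda>_. 0) \<in> T01 j" by (simp add: T01_def linear_zero)
    moreover have "0 = (\<lambda>u::'e. fscale 0 (kpow m \<kappa>))" by (simp add: fscale_def fun_eq_iff)
    ultimately show ?case by (intro bexI[of _ "\<lambda>_. 0"])
  next
    case (step c x y)
    then obtain \<alpha> e \<theta> where x: "x = (\<lambda>u. fscale (\<alpha> u) e)" "\<alpha> \<in> T01 j" "e \<in> K_fibre j n m"
      and y: "\<theta> \<in> T01 j" "y = (\<lambda>u. fscale (\<theta> u) (kpow m \<kappa>))" by blast
    obtain a where a: "e = fscale a (kpow m \<kappa>)" using K_fibre_iff[OF j k] x(3) by blast
    have "(\<lambda>u. fscale c (x u)) + y = (\<lambda>u. fscale ((c * a) * \<alpha> u + \<theta> u) (kpow m \<kappa>))"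
      unfolding x(1) y(2) a by (simp add: fscale_def fun_eq_iff algebra_simps)
    then show ?case by (intro bexI[of _ "\<lambda>u. (c * a) * \<alpha> u + \<theta> u"] T01_add T01_scale x y)
  qed
next
  assume "\<exists>\<theta>\<in>T01 j. t = (\<lambda>u. fscale (\<theta> u) (kpow m \<kappa>))"
  moreover have "kpow m \<kappa> \<in> K_fibre j n m"
    unfolding K_fibre_iff[OF j k] by (intro exI[of _ 1]) simp
  ultimately show "t \<in> T01_tensor j fscale (K_fibre j n m)"
    unfolding T01_tensor_def by (auto intro!: fs1.span_base)
qed

subsection \<open>The isomorphism of (0,1)-forms with values in the canonical bundle and (n,1)-forms\<close>

text \<open>Extracts \<open>\<beta> \<otimes> \<omega>\<close> from \<open>\<beta> \<and> \<omega>\<close>: the first argument is made of type (0,1), the others of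
  type (1,0).\<close>
definition unwedge :: "('e \<Rightarrow> 'e) \<Rightarrow> nat \<Rightarrow> 'e form \<Rightarrow> 'e \<Rightarrow> 'e multiform" where
  "unwedge j n \<eta> u = (\<lambda>v. tproj j (\<lambda>l. if l = 0 then \<i> else - \<i>) {..<Suc n} \<eta> (case_nat u (v 0)))"

text \<open>The cycle that brings argument \<open>i\<close> to the front and keeps the order of the
  others; its sign is the coefficient in \<open>wedge01\<close>.\<close>

definition cycle_to :: "nat \<Rightarrow> nat \<Rightarrow> nat" where
  "cycle_to i l = (if l = 0 then i else if l \<le> i then l - 1 else l)"

lemma cycle_to_Suc: "cycle_to (Suc i) = Transposition.transpose i (Suc i) \<circ> cycle_to i"
  by (auto simp: fun_eq_iff cycle_to_def Transposition.transpose_def)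

lemma cycle_to_permutes: "i < k \<Longrightarrow> cycle_to i permutes {..<k} \<and> sign (cycle_to i) = (- 1) ^ i"
proof (induction i)
  case 0
  have "cycle_to 0 = id" by (auto simp: fun_eq_iff cycle_to_def)
  then show ?case by (simp only: permutes_id sign_id power_0)
next
  case (Suc i)
  then have p: "cycle_to i permutes {..<k}" and s: "sign (cycle_to i) = (- 1) ^ i" by auto
  have t: "Transposition.transpose i (Suc i) permutes {..<k}"
    by (rule permutes_swap_id) (use Suc in auto)
  have pp: "permutation (cycle_to i)" by (rule permutes_imp_permutation[OF finite_lessThan p])
  show ?case
    unfolding cycle_to_Suc sign_compose[OF permutation_swap_id pp] s sign_swap_id
    by (rule conjI[OF permutes_compose[OF p t]]) simp
qed

lemma case_nat_omit: "case_nat (v i) (omit i v) = v \<circ> cycle_to i"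
  by (auto simp: fun_eq_iff cycle_to_def omit_def split: nat.split)

text \<open>Moving argument \<open>i\<close> to the front carries the projection that makes it (0,1)
  into the one used by \<open>unwedge\<close>, at the cost of the sign of the cycle. So the two sums
  agree term by term.\<close>

lemma wedge01_unwedge:
  assumes w: "alt_form (Suc n) \<eta>"
  shows "wedge01 n (unwedge j n \<eta>) = proj_p1 j n \<eta>"
proof
  fix v :: "nat \<Rightarrow> 'a"
  let ?c = "\<lambda>i l. if l = i then \<i> else - \<i>"
  have e: "tproj j (?c i) {..<Suc n} \<eta> v = (- 1) ^ i * unwedge j n \<eta> (v i) (\<lambda>_. omit i v)"
    if i: "i < Suc n" for i
  proof -
    have p: "cycle_to i permutes {..<Suc n}" "sign (cycle_to i) = (- 1) ^ i"
      using cycle_to_permutes[OF i] by auto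
    have c: "?c i \<circ> cycle_to i = ?c 0" by (auto simp: fun_eq_iff cycle_to_def)
    have "unwedge j n \<eta> (v i) (\<lambda>_. omit i v) = (- 1) ^ i * tproj j (?c i) {..<Suc n} \<eta> v"
      unfolding unwedge_def case_nat_omit
      using tproj_alt_form_permute[OF w p(1), of j "?c i" v] unfolding c p(2) by simp
    then show ?thesis by (simp add: mult.assoc[symmetric] power_add[symmetric] mult_2[symmetric])
  qed
  have "(\<Sum>i\<in>F. g i) v = (\<Sum>i\<in>F. g i v)" for F and g :: "nat \<Rightarrow> 'a form"
    by (induction F rule: infinite_finite_induct) auto
  then show "wedge01 n (unwedge j n \<eta>) v = proj_p1 j n \<eta> v"
    unfolding wedge01_def proj_p1_def lessThan_Suc_atMost[symmetric] using e by simp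
qed

text \<open>The type \<open>\<tau>\<close> is left open because two cases are used: for a
  (0,1)-covector the factor is 1 and \<open>unwedge\<close> recovers the tensor, for a
  (1,0)-covector it is 0 and the product is annihilated.\<close>

lemma unwedge_wedge01:
  assumes k: "holo_form j n \<kappa>" and t: "\<And>u. \<theta> (j u) = \<tau> * \<theta> u"
  shows "unwedge j n (wedge01 n (\<lambda>u. fscale (\<theta> u) (kpow 1 \<kappa>))) = (\<lambda>u. fscale ((1 + \<i> * \<tau>) / 2 * \<theta> u) (kpow 1 \<kappa>))"
proof (intro ext)
  fix u :: 'a and v :: "nat \<Rightarrow> nat \<Rightarrow> 'a"
  let ?c = "\<lambda>l. if l = 0 then \<i> else - \<i>"
  define h where "h i v = \<theta> (v i) * \<kappa> (omit i v)" for i and v :: "nat \<Rightarrow> 'a"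
  have W: "wedge01 n (\<lambda>u. fscale (\<theta> u) (kpow 1 \<kappa>)) = (\<Sum>i<Suc n. fscale ((- 1) ^ i) (h i))"
  proof -
    have "(\<Sum>i\<in>F. g i) v = (\<Sum>i\<in>F. g i v)" for F v and g :: "nat \<Rightarrow> 'a form"
      by (induction F rule: infinite_finite_induct) auto
    then show ?thesis
      by (simp add: fun_eq_iff wedge01_def fscale_def kpow_def h_def lessThan_Suc_atMost del: sum.lessThan_Suc)
  qed
  have ty: "h i (v(s := j (v s))) = (if s = i then \<tau> else \<i>) * h i v" if "s < Suc n" "i < Suc n" for s i v
  proof (cases "s = i")
    case True
    have "omit i (v(i := x)) = omit i v" for x by (auto simp: omit_def fun_eq_iff)
    then show ?thesis using t True by (simp add: h_def)
  next
    case False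
    define s' where "s' = (if s < i then s else s - 1)"
    have o: "omit i (v(s := x)) = (omit i v)(s' := x)" for x
      using False by (auto simp: omit_def fun_eq_iff s'_def)
    have "omit i v s' = v s" using False by (auto simp: omit_def s'_def)
    moreover have "s' < n" using False that by (auto simp: s'_def)
    ultimately show ?thesis using False holo_form_type[OF k, of s' "omit i v"] by (simp add: h_def o)
  qed
  \<comment> \<open>In the summands with i > 0 the first argument goes into \<open>\<kappa>\<close>,
    which is of type (1,0), while the projection makes this argument (0,1).\<close>
  have th: "tproj j ?c {..<Suc n} (h i) = (if i = 0 then fscale ((1 + \<i> * \<tau>) / 2) (h i) else 0)" if "i < Suc n" for i
  proof -
    have "tproj j ?c {..<Suc n} (h i) = (\<lambda>v. (\<Prod>s<Suc n. (1 + ?c s * (if s = i then \<tau> else \<i>)) / 2) * h i v)"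
      by (rule tproj_typed) (use ty that in auto)
    moreover have "(\<Prod>s<Suc n. (1 + ?c s * (if s = i then \<tau> else \<i>)) / 2) = (if i = 0 then (1 + \<i> * \<tau>) / 2 else 0)"
    proof (cases "i = 0")
      case True
      have "(\<Prod>s<Suc n. (1 + ?c s * (if s = i then \<tau> else \<i>)) / 2) =
        (1 + \<i> * \<tau>) / 2 * (\<Prod>s\<in>{..<Suc n} - {0}. (1 + ?c s * (if s = i then \<tau> else \<i>)) / 2)"
        using True by (subst prod.remove[of _ 0]) (auto simp del: prod.lessThan_Suc)
      also have "(\<Prod>s\<in>{..<Suc n} - {0}. (1 + ?c s * (if s = i then \<tau> else \<i>)) / 2) = 1"
        by (rule prod.neutral) (use True in auto)
      finally show ?thesis using True by simp
    next
      case False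
      then show ?thesis by (simp del: prod.lessThan_Suc) (intro bexI[of _ 0]; simp)
    qed
    ultimately show ?thesis by (simp only:) (simp add: fun_eq_iff fscale_def)
  qed
  have "tproj j ?c {..<Suc n} (\<Sum>i<Suc n. fscale ((- 1) ^ i) (h i)) =
      (\<Sum>i<Suc n. fscale ((- 1) ^ i) (if i = 0 then fscale ((1 + \<i> * \<tau>) / 2) (h i) else 0))"
    unfolding tproj_sum[OF finite_lessThan] tproj_scale[OF finite_lessThan]
    by (rule sum.cong) (use th in \<open>auto simp only: lessThan_iff\<close>)
  also have "\<dots> = fscale ((1 + \<i> * \<tau>) / 2) (h 0)"
    by (subst sum.remove[of _ 0]) (auto simp: fs.scale_zero_right intro!: sum.neutral)
  finally show "unwedge j n (wedge01 n (\<lambda>u. fscale (\<theta> u) (kpow 1 \<kappa>))) u v =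
      fscale ((1 + \<i> * \<tau>) / 2 * \<theta> u) (kpow 1 \<kappa>) v"
    unfolding unwedge_def W
    by (simp add: h_def fscale_def kpow_def) (simp add: omit_def)
qed

text \<open>With the (0,1)-argument \<open>u\<close> fixed, the remaining arguments form a
  holomorphic n-form and hence a multiple of \<open>\<kappa>\<close>. Evaluating at a point where
  \<open>\<kappa>\<close> does not vanish shows how the multiple depends on
  \<open>u\<close>.\<close>

lemma unwedge_in_T01_tensor:
  fixes j :: "'e::euclidean_space \<Rightarrow> 'e"
  assumes j: "linear j" "\<And>v. j (j v) = - v" "DIM('e) = 2 * n"
    and w: "alt_form (Suc n) \<eta>"
  shows "unwedge j n \<eta> \<in> T01_tensor j fscale (K_fibre j n 1)"
proof -
  obtain \<kappa> where k: "holo_form j n \<kappa>" "\<kappa> \<noteq> 0"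
    using holo_form_generator[OF j] Lambda_p0_holo by blast
  let ?c = "\<lambda>l. if l = 0 then \<i> else - \<i>"
  define F where "F u = (\<lambda>v. tproj j ?c {..<Suc n} \<eta> (case_nat u v))" for u
  have up: "case_nat u (v(i := x)) = (case_nat u v)(Suc i := x)" for u x and v :: "nat \<Rightarrow> 'e" and i
    by (auto simp: fun_eq_iff split: nat.split)
  have up0: "case_nat x v = (case_nat u v)(0 := x)" for u x and v :: "nat \<Rightarrow> 'e"
    by (auto simp: fun_eq_iff split: nat.split)
  have lin: "linear (\<lambda>x. tproj j ?c {..<Suc n} \<eta> (v(i := x)))" if "i < Suc n" for v i
    by (rule tproj_linear_slot[OF j(1) finite_lessThan alt_form_linear[OF w that]])
  have ty: "tproj j ?c {..<Suc n} \<eta> (v(i := j (v i))) = - ?c i * tproj j ?c {..<Suc n} \<eta> v" if "i < Suc n" for v i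
    by (rule tproj_type) (use j that alt_form_linear[OF w that] in auto)
  have F: "holo_form j n (F u)" for u
    unfolding holo_form_def alt_form_def
  proof (intro conjI allI impI)
    fix v v' :: "nat \<Rightarrow> 'e" assume vv: "\<forall>i<n. v i = v' i"
    show "F u v = F u v'"
      unfolding F_def
    proof (rule tproj_local[OF finite_lessThan order_refl])
      show "\<eta> x = \<eta> y" if "\<And>i. i < Suc n \<Longrightarrow> x i = y i" for x y by (rule alt_form_cong[OF w that])
      show "case_nat u v i = case_nat u v' i" if "i < Suc n" for i
        using that vv by (cases i) auto
    qed
  next
    fix v :: "nat \<Rightarrow> 'e" and i assume i: "i < n"
    show "linear (\<lambda>x. F u (v(i := x)))" unfolding F_def up by (rule lin) (use i in simp)
    show "F u (v(i := j (v i))) = \<i> * F u v"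
      unfolding F_def up using ty[of "Suc i" "case_nat u v"] i by simp
  next
    fix v :: "nat \<Rightarrow> 'e" and a b assume "a < n \<and> b < n \<and> a \<noteq> b \<and> v a = v b"
    then show "F u v = 0"
      unfolding F_def by (intro tproj_alt_form_eq_0[OF w, of "Suc a" "Suc b"]) auto
  qed
  obtain w0 where w0: "\<kappa> w0 \<noteq> 0" using k(2) by (auto simp: fun_eq_iff)
  define \<theta> where "\<theta> u = F u w0 / \<kappa> w0" for u
  have Fk: "F u = fscale (\<theta> u) \<kappa>" for u
  proof -
    obtain c where c: "F u = fscale c \<kappa>" using holo_form_proportional[OF j k F] by blast
    then have "F u w0 = c * \<kappa> w0" by (simp add: fscale_def)
    then have "c = \<theta> u" using w0 by (simp add: \<theta>_def)
    then show ?thesis using c by simp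
  qed
  have "linear \<theta>"
  proof -
    have "linear (\<lambda>u. F u w0)" unfolding F_def
      using lin[of 0 "case_nat 0 w0"] by (simp add: up0[of _ w0 0, symmetric])
    from linear_compose[OF this, of "\<lambda>x. x * (1 / \<kappa> w0)"] show ?thesis
      unfolding \<theta>_def[abs_def] by (simp add: o_def bounded_linear.linear bounded_linear_mult_left bounded_linear_divide)
  qed
  moreover have "\<theta> (j u) = - \<i> * \<theta> u" for u
  proof -
    have "F (j u) w0 = - \<i> * F u w0"
      unfolding F_def using ty[of 0 "case_nat u w0"] by (simp add: up0[of "j u" w0 u, symmetric])
    then show ?thesis by (simp add: \<theta>_def)
  qed
  ultimately have "\<theta> \<in> T01 j" by (simp add: T01_def)
  moreover have "unwedge j n \<eta> = (\<lambda>u. fscale (\<theta> u) (kpow 1 \<kappa>))"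
  proof (intro ext)
    fix u and v :: "nat \<Rightarrow> nat \<Rightarrow> 'e"
    have "unwedge j n \<eta> u v = F u (v 0)" by (simp add: unwedge_def F_def)
    then show "unwedge j n \<eta> u v = fscale (\<theta> u) (kpow 1 \<kappa>) v" by (simp add: Fk fscale_def kpow_def)
  qed
  ultimately show ?thesis unfolding T01_tensor_K_iff[OF j k] by blast
qed

text \<open>Computes the description in \<open>dbar_K\<close>: \<open>unwedge\<close> undoes
  \<open>wedge01\<close> on the tensor product, which gives uniqueness, and \<open>wedge01\<close>
  after \<open>unwedge\<close> is the type projection, which gives existence.\<close>

theorem the_unwedge:
  fixes j :: "'e::euclidean_space \<Rightarrow> 'e"
  assumes j: "linear j" "\<And>v. j (j v) = - v" "DIM('e) = 2 * n"
    and w: "alt_form (Suc n) \<eta>"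
  shows "(THE t. t \<in> T01_tensor j fscale (K_fibre j n 1) \<and> wedge01 n t = proj_pq j n 1 \<eta>) = unwedge j n \<eta>"
proof (rule the_equality)
  show "unwedge j n \<eta> \<in> T01_tensor j fscale (K_fibre j n 1) \<and> wedge01 n (unwedge j n \<eta>) = proj_pq j n 1 \<eta>"
    using unwedge_in_T01_tensor[OF j w] wedge01_unwedge[OF w] proj_pq_eq[OF j(1,2) w] by simp
  obtain \<kappa> where k: "holo_form j n \<kappa>" "\<kappa> \<noteq> 0"
    using holo_form_generator[OF j] Lambda_p0_holo by blast
  have inv: "unwedge j n (wedge01 n t) = t" if tt: "t \<in> T01_tensor j fscale (K_fibre j n 1)" for t
  proof -
    obtain \<theta> where t: "\<theta> \<in> T01 j" "t = (\<lambda>u. fscale (\<theta> u) (kpow 1 \<kappa>))"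
      using tt T01_tensor_K_iff[OF j k, of t 1] by blast
    have "\<theta> (j u) = - \<i> * \<theta> u" for u using t(1) by (simp add: T01_def)
    from unwedge_wedge01[where \<theta> = \<theta>, OF k(1) this] show ?thesis unfolding t(2) by simp
  qed
  fix t assume "t \<in> T01_tensor j fscale (K_fibre j n 1) \<and> wedge01 n t = proj_pq j n 1 \<eta>"
  then show "t = unwedge j n \<eta>"
    using inv[of t] inv[OF unwedge_in_T01_tensor[OF j w]] wedge01_unwedge[OF w] proj_pq_eq[OF j(1,2) w] by metis
qed

section \<open>Calculus on manifolds\<close>

lemma chartD:
  assumes "smooth_atlas A" "c \<in> A"
  shows open_chart: "open (fst c)" and open_chart_image: "open (snd c ` fst c)"
    and inj_on_chart: "inj_on (snd c) (fst c)"
    and continuous_on_chart: "continuous_on (fst c) (snd c)"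
    and continuous_on_chart_inv: "continuous_on (snd c ` fst c) (chart_inv c)"
proof -
  obtain U \<phi> where c: "c = (U, \<phi>)" by (cases c)
  obtain \<psi> where o: "open U" "open (\<phi> ` U)" and h: "homeomorphism U (\<phi> ` U) \<phi> \<psi>"
    using assms unfolding smooth_atlas_def c by blast
  have inj: "inj_on \<phi> U" using h unfolding homeomorphism_def by (metis inj_on_inverseI)
  then show "open (fst c)" "open (snd c ` fst c)" "inj_on (snd c) (fst c)"
    "continuous_on (fst c) (snd c)"
    using o h by (auto simp: c homeomorphism_def)
  have "continuous_on (\<phi> ` U) \<psi>" using h by (simp add: homeomorphism_def)
  moreover have "\<psi> z = chart_inv c z" if z: "z \<in> \<phi> ` U" for z
  proof -
    obtain x where x: "x \<in> U" "z = \<phi> x" using z by blast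
    then have "\<psi> z = x" using h by (simp add: homeomorphism_def)
    then show ?thesis using x inj by (simp add: chart_inv_def c)
  qed
  ultimately show "continuous_on (snd c ` fst c) (chart_inv c)"
    unfolding c by (simp cong: continuous_on_cong)
qed

lemma chart_inv_chart: "smooth_atlas A \<Longrightarrow> c \<in> A \<Longrightarrow> x \<in> fst c \<Longrightarrow> chart_inv c (snd c x) = x"
  by (simp add: chart_inv_def inj_on_chart)

lemma chart_chart_inv: "z \<in> snd c ` fst c \<Longrightarrow> snd c (chart_inv c z) = z"
  and chart_inv_in: "z \<in> snd c ` fst c \<Longrightarrow> chart_inv c z \<in> fst c"
  by (auto simp: chart_inv_def f_inv_into_f inv_into_into)

lemma chart_image_Int:
  assumes "smooth_atlas A" "c \<in> A"
  shows "snd c ` (W \<inter> fst c) = {z \<in> snd c ` fst c. chart_inv c z \<in> W}"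
proof (intro set_eqI iffI)
  fix z assume "z \<in> snd c ` (W \<inter> fst c)"
  then obtain x where "x \<in> W" "x \<in> fst c" "z = snd c x" by blast
  then show "z \<in> {z \<in> snd c ` fst c. chart_inv c z \<in> W}" by (simp add: chart_inv_chart[OF assms])
next
  fix z assume "z \<in> {z \<in> snd c ` fst c. chart_inv c z \<in> W}"
  then have z: "z \<in> snd c ` fst c" "chart_inv c z \<in> W" by auto
  then show "z \<in> snd c ` (W \<inter> fst c)"
    using chart_chart_inv[OF z(1)] chart_inv_in[OF z(1)] by (metis IntI imageI)
qed

lemma open_chart_image_Int:
  assumes "smooth_atlas A" "c \<in> A" "open W"
  shows "open (snd c ` (W \<inter> fst c))" "open (snd c ` (fst c \<inter> W))"
proof -
  have "open (snd c ` fst c \<inter> chart_inv c -` W)"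
    by (rule continuous_open_preimage[OF continuous_on_chart_inv open_chart_image]) (use assms in auto)
  moreover have "snd c ` fst c \<inter> chart_inv c -` W = snd c ` (W \<inter> fst c)"
    unfolding chart_image_Int[OF assms(1,2)] by blast
  ultimately show "open (snd c ` (W \<inter> fst c))" by simp
  then show "open (snd c ` (fst c \<inter> W))" by (simp add: Int_commute)
qed

lemma open_chart_inv_image:
  assumes "smooth_atlas A" "c \<in> A" "open T" "T \<subseteq> snd c ` fst c"
  shows "open (chart_inv c ` T)"
proof -
  have "chart_inv c ` T = fst c \<inter> snd c -` T"
  proof
    show "chart_inv c ` T \<subseteq> fst c \<inter> snd c -` T"
      using assms(4) by (auto simp: chart_chart_inv subset_iff intro: chart_inv_in)
    show "fst c \<inter> snd c -` T \<subseteq> chart_inv c ` T"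
    proof
      fix x assume "x \<in> fst c \<inter> snd c -` T"
      then show "x \<in> chart_inv c ` T" by (intro image_eqI[of _ _ "snd c x"]) (simp_all add: chart_inv_chart[OF assms(1,2)])
    qed
  qed
  moreover have "open (fst c \<inter> snd c -` T)"
    by (rule continuous_open_preimage[OF continuous_on_chart open_chart]) (use assms in auto)
  ultimately show ?thesis by simp
qed

lemma smooth_transition:
  "smooth_atlas A \<Longrightarrow> c \<in> A \<Longrightarrow> d \<in> A \<Longrightarrow> smooth_on (snd c ` (fst c \<inter> fst d)) (\<lambda>z. snd d (chart_inv c z))"
  unfolding smooth_atlas_def by (simp add: o_def)

lemma at_chart:
  assumes "smooth_atlas A"
  shows at_chart_in: "at_chart A x \<in> A" and in_at_chart: "x \<in> fst (at_chart A x)"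
proof -
  have "\<exists>c. c \<in> A \<and> x \<in> fst c" using assms unfolding smooth_atlas_def by blast
  then have "at_chart A x \<in> A \<and> x \<in> fst (at_chart A x)" unfolding at_chart_def by (rule someI_ex)
  then show "at_chart A x \<in> A" "x \<in> fst (at_chart A x)" by auto
qed

text \<open>The differential of the coordinate change from \<open>c\<close> to \<open>d\<close>.
  Both conversions of components are instances, and their rules reduce to the cocycle
  identity.\<close>

definition trans_d :: "('x, 'e::euclidean_space) chart \<Rightarrow> ('x, 'e) chart \<Rightarrow> 'x \<Rightarrow> 'e \<Rightarrow> 'e" where
  "trans_d c d x v = ddir v (\<lambda>z. snd d (chart_inv c z)) (snd c x)"

lemma from_chart_eq: "from_chart A c x = trans_d c (at_chart A x) x"
  and to_chart_eq: "to_chart A c x = trans_d (at_chart A x) c x"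
  by (simp_all add: fun_eq_iff from_chart_def to_chart_def trans_d_def ddir_def o_def)

context
  fixes A :: "('x::{t2_space,second_countable_topology}, 'e::euclidean_space) atlas"
  assumes A: "smooth_atlas A"
begin

lemmas chart_inv_chart' [simp] = chart_inv_chart[OF A]

lemma transition_differentiable:
  assumes "c \<in> A" "d \<in> A" "x \<in> fst c" "x \<in> fst d"
  shows "(\<lambda>z. snd d (chart_inv c z)) differentiable (at (snd c x))"
  using smooth_on_differentiable[OF smooth_transition[OF A assms(1,2)]] assms by blast

lemma linear_trans_d: "c \<in> A \<Longrightarrow> d \<in> A \<Longrightarrow> x \<in> fst c \<Longrightarrow> x \<in> fst d \<Longrightarrow> linear (trans_d c d x)"
  unfolding trans_d_def[abs_def] by (rule linear_ddir[OF transition_differentiable])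

lemma trans_d_self:
  assumes "c \<in> A" "x \<in> fst c"
  shows "trans_d c c x v = v"
proof -
  have "ddir v (\<lambda>z. snd c (chart_inv c z)) (snd c x) = ddir v (\<lambda>z. z) (snd c x)"
    by (rule ddir_cong_open[OF open_chart_image[OF A assms(1)]]) (use assms in \<open>auto simp: chart_chart_inv\<close>)
  also have "\<dots> = v" by (rule ddir_eqI[OF has_derivative_ident])
  finally show ?thesis by (simp add: trans_d_def)
qed

lemma ddir_chart_change:
  assumes c: "c \<in> A" "x \<in> fst c" and d: "d \<in> A" "x \<in> fst d"
    and f: "(\<lambda>z. f (chart_inv d z)) differentiable (at (snd d x))"
  shows "ddir v (\<lambda>z. f (chart_inv c z)) (snd c x) = ddir (trans_d c d x v) (\<lambda>z. f (chart_inv d z)) (snd d x)"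
    and "(\<lambda>z. f (chart_inv c z)) differentiable (at (snd c x))"
proof -
  let ?S = "snd c ` (fst c \<inter> fst d)"
  have S: "open ?S" "snd c x \<in> ?S"
    using open_chart_image_Int(2)[OF A c(1) open_chart[OF A d(1)]] c d by auto
  have cong: "f (chart_inv c z) = f (chart_inv d (snd d (chart_inv c z)))" if "z \<in> ?S" for z
    using that A c d by auto
  have f': "(\<lambda>z. f (chart_inv d z)) differentiable (at (snd d (chart_inv c (snd c x))))"
    using f A c by simp
  note comp = ddir_compose(1,2)[OF transition_differentiable[OF c(1) d(1) c(2) d(2)] f']
  have "ddir v (\<lambda>z. f (chart_inv c z)) (snd c x) = ddir v (\<lambda>z. f (chart_inv d (snd d (chart_inv c z)))) (snd c x)"
    by (rule ddir_cong_open[OF S cong])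
  also have "\<dots> = ddir (trans_d c d x v) (\<lambda>z. f (chart_inv d z)) (snd d x)"
    using comp(2) A c by (simp add: trans_d_def)
  finally show "ddir v (\<lambda>z. f (chart_inv c z)) (snd c x) = ddir (trans_d c d x v) (\<lambda>z. f (chart_inv d z)) (snd d x)" .
  show "(\<lambda>z. f (chart_inv c z)) differentiable (at (snd c x))"
    by (rule differentiable_transform_open[OF S _ comp(1)]) (use cong in simp)
qed

lemma trans_d_compose:
  assumes "c \<in> A" "x \<in> fst c" "d \<in> A" "x \<in> fst d" "k \<in> A" "x \<in> fst k"
  shows "trans_d d k x (trans_d c d x v) = trans_d c k x v"
  using ddir_chart_change(1)[OF assms(1-4) transition_differentiable[OF assms(3,5,4,6)], of v]
  by (simp add: trans_d_def)

lemma from_to_chart: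
  assumes "c \<in> A" "x \<in> fst c"
  shows "from_chart A c x (to_chart A c x v) = v" "to_chart A c x (from_chart A c x v) = v"
  using assms at_chart[OF A, of x]
  by (simp_all add: from_chart_eq to_chart_eq trans_d_compose trans_d_self)

lemma linear_from_chart: "c \<in> A \<Longrightarrow> x \<in> fst c \<Longrightarrow> linear (from_chart A c x)"
  and linear_to_chart: "c \<in> A \<Longrightarrow> x \<in> fst c \<Longrightarrow> linear (to_chart A c x)"
  using at_chart[OF A, of x] by (simp_all add: from_chart_eq to_chart_eq linear_trans_d)

section \<open>Smooth functions and cut-off functions on the manifold\<close>

lemma smooth_funD: "smooth_fun A W f \<Longrightarrow> c \<in> A \<Longrightarrow> smooth_on (snd c ` (W \<inter> fst c)) (\<lambda>z. f (chart_inv c z))"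
  unfolding smooth_fun_def by (simp add: o_def)

lemma smooth_funI:
  "(\<And>c. c \<in> A \<Longrightarrow> smooth_on (snd c ` (W \<inter> fst c)) (\<lambda>z. f (chart_inv c z))) \<Longrightarrow> smooth_fun A W f"
  unfolding smooth_fun_def by (simp add: o_def)

lemma smooth_fun_subset: "smooth_fun A W f \<Longrightarrow> V \<subseteq> W \<Longrightarrow> smooth_fun A V f"
  unfolding smooth_fun_def by (meson Int_mono image_mono order_refl smooth_on_subset)

lemma smooth_fun_cong:
  assumes "open W" "\<And>x. x \<in> W \<Longrightarrow> f x = g x" "smooth_fun A W f"
  shows "smooth_fun A W g"
proof (rule smooth_funI)
  fix c assume c: "c \<in> A"
  show "smooth_on (snd c ` (W \<inter> fst c)) (\<lambda>z. g (chart_inv c z))"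
    by (rule smooth_on_cong[OF open_chart_image_Int(1)[OF A c assms(1)] _ smooth_funD[OF assms(3) c]])
      (use assms(2) A c in auto)
qed

lemma smooth_fun_local:
  assumes "\<And>x. x \<in> W \<Longrightarrow> \<exists>V. open V \<and> x \<in> V \<and> smooth_fun A V f"
  shows "smooth_fun A W f"
proof (rule smooth_funI, rule smooth_on_local)
  fix c z assume c: "c \<in> A" and "z \<in> snd c ` (W \<inter> fst c)"
  then obtain x where x: "x \<in> W" "x \<in> fst c" "z = snd c x" by blast
  obtain V where V: "open V" "x \<in> V" "smooth_fun A V f" using assms[OF x(1)] by blast
  then show "\<exists>T. open T \<and> z \<in> T \<and> smooth_on T (\<lambda>z. f (chart_inv c z))"
    using open_chart_image_Int(1)[OF A c V(1)] smooth_funD[OF V(3) c] x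
    by (intro exI[of _ "snd c ` (V \<inter> fst c)"]) auto
qed

text \<open>A single chart suffices as a test, because the other charts differ from it by smooth
  transition maps.\<close>

lemma smooth_fun_chartI:
  assumes c: "c \<in> A" and W: "open W" "W \<subseteq> fst c" and f: "smooth_on (snd c ` W) (\<lambda>z. f (chart_inv c z))"
  shows "smooth_fun A W f"
proof (rule smooth_funI)
  fix d assume d: "d \<in> A"
  have Wc: "W \<inter> fst c = W" using W by blast
  let ?S = "snd d ` (W \<inter> fst d)"
  have S: "open ?S" by (rule open_chart_image_Int(1)[OF A d W(1)])
  have "smooth_on ?S (\<lambda>z. f (chart_inv c (snd c (chart_inv d z))))"
  proof (rule smooth_on_compose[OF S _ f])
    show "open (snd c ` W)" using open_chart_image_Int(1)[OF A c W(1)] Wc by simp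
    show "smooth_on ?S (\<lambda>z. snd c (chart_inv d z))"
      by (rule smooth_on_subset[OF smooth_transition[OF A d c]]) (use W in auto)
    show "(\<lambda>z. snd c (chart_inv d z)) ` ?S \<subseteq> snd c ` W" using A d by auto
  qed
  then show "smooth_on ?S (\<lambda>z. f (chart_inv d z))"
    by (rule smooth_on_cong[OF S, rotated]) (use A c d W in auto)
qed

lemma smooth_fun_const: "smooth_fun A W (\<lambda>_. k)"
  by (rule smooth_funI) (rule smooth_on_const)

lemma smooth_fun_add: "open W \<Longrightarrow> smooth_fun A W f \<Longrightarrow> smooth_fun A W g \<Longrightarrow> smooth_fun A W (\<lambda>x. f x + g x)"
  by (rule smooth_funI) (rule smooth_on_add[OF open_chart_image_Int(1)[OF A] smooth_funD smooth_funD])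

lemma smooth_fun_mult:
  fixes f g :: "'x \<Rightarrow> complex"
  shows "open W \<Longrightarrow> smooth_fun A W f \<Longrightarrow> smooth_fun A W g \<Longrightarrow> smooth_fun A W (\<lambda>x. f x * g x)"
  by (rule smooth_funI) (rule smooth_on_mult[OF open_chart_image_Int(1)[OF A] smooth_funD smooth_funD])

lemma smooth_fun_inverse:
  fixes f :: "'x \<Rightarrow> complex"
  assumes "open W" "smooth_fun A W f" "\<And>x. x \<in> W \<Longrightarrow> f x \<noteq> 0"
  shows "smooth_fun A W (\<lambda>x. inverse (f x))"
proof (rule smooth_funI)
  fix c assume c: "c \<in> A"
  show "smooth_on (snd c ` (W \<inter> fst c)) (\<lambda>z. inverse (f (chart_inv c z)))"
    by (rule smooth_on_inverse[OF open_chart_image_Int(1)[OF A c assms(1)] smooth_funD[OF assms(2) c]])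
      (use assms(3) A c in auto)
qed

lemma smooth_fun_divide:
  fixes f g :: "'x \<Rightarrow> complex"
  shows "open W \<Longrightarrow> smooth_fun A W f \<Longrightarrow> smooth_fun A W g \<Longrightarrow> (\<And>x. x \<in> W \<Longrightarrow> g x \<noteq> 0) \<Longrightarrow>
    smooth_fun A W (\<lambda>x. f x / g x)"
  unfolding divide_inverse by (intro smooth_fun_mult smooth_fun_inverse)

lemma smooth_fun_prod:
  fixes f :: "'i \<Rightarrow> 'x \<Rightarrow> complex"
  shows "open W \<Longrightarrow> (\<And>i. i \<in> I \<Longrightarrow> smooth_fun A W (f i)) \<Longrightarrow> smooth_fun A W (\<lambda>x. \<Prod>i\<in>I. f i x)"
  by (induction I rule: infinite_finite_induct) (auto intro: smooth_fun_const smooth_fun_mult)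

lemma smooth_fun_power:
  fixes f :: "'x \<Rightarrow> complex"
  shows "open W \<Longrightarrow> smooth_fun A W f \<Longrightarrow> smooth_fun A W (\<lambda>x. f x ^ k)"
  by (induction k) (auto intro: smooth_fun_const smooth_fun_mult)

lemma smooth_fun_continuous:
  assumes W: "open W" and f: "smooth_fun A W f"
  shows "continuous_on W f"
proof -
  have "isCont f x" if x: "x \<in> W" for x
  proof -
    let ?c = "at_chart A x"
    note c = at_chart[OF A, of x]
    have "continuous_on (snd ?c ` (W \<inter> fst ?c)) (\<lambda>z. f (chart_inv ?c z))"
      by (rule smooth_on_continuous[OF smooth_funD[OF f c(1)]])
    then have "continuous_on (W \<inter> fst ?c) (\<lambda>y. f (chart_inv ?c (snd ?c y)))"
      by (rule continuous_on_compose2[OF _ continuous_on_subset[OF continuous_on_chart[OF A c(1)]]]) auto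
    then have "continuous_on (W \<inter> fst ?c) f"
      by (rule continuous_on_cong[THEN iffD1, OF refl, rotated]) (use c in auto)
    then show ?thesis
      using continuous_on_eq_continuous_at[of "W \<inter> fst ?c" f] W open_chart[OF A c(1)] x c by auto
  qed
  then show ?thesis by (simp add: continuous_at_imp_continuous_on)
qed

text \<open>A Euclidean bump function carried over by a chart and extended by zero. Both sets are
  recorded: being 1 on the open \<open>N\<close> makes the function invisible to derivatives there,
  and vanishing off the closed \<open>K\<close> permits products with local data to be extended by
  zero.\<close>

lemma cutoff_exists:
  assumes V: "open V" "x0 \<in> V"
  shows "\<exists>(\<zeta> :: 'x \<Rightarrow> complex) N K. smooth_fun A UNIV \<zeta> \<and> open N \<and> x0 \<in> N \<and> N \<subseteq> K \<and> closed K \<and> K \<subseteq> V \<and>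
    (\<forall>x\<in>N. \<zeta> x = 1) \<and> (\<forall>x. x \<notin> K \<longrightarrow> \<zeta> x = 0)"
proof -
  let ?c = "at_chart A x0"
  note c = at_chart[OF A, of x0]
  let ?S = "snd ?c ` (V \<inter> fst ?c)"
  have "open ?S" "snd ?c x0 \<in> ?S" using open_chart_image_Int(1)[OF A c(1) V(1)] c V by auto
  then obtain R where R: "R > 0" "cball (snd ?c x0) R \<subseteq> ?S" using open_contains_cball by blast
  obtain \<rho> :: "'e \<Rightarrow> complex" where \<rho>: "smooth_on UNIV \<rho>" "\<And>z. dist (snd ?c x0) z \<le> R / 2 \<Longrightarrow> \<rho> z = 1"
    "\<And>z. R \<le> dist (snd ?c x0) z \<Longrightarrow> \<rho> z = 0"
    using bump_exists[of "R / 2" R "snd ?c x0"] R by auto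
  define K where "K = chart_inv ?c ` cball (snd ?c x0) R"
  define N where "N = chart_inv ?c ` ball (snd ?c x0) (R / 2)"
  define \<zeta> where "\<zeta> x = (if x \<in> K then \<rho> (snd ?c x) else 0)" for x
  have Sc: "?S \<subseteq> snd ?c ` fst ?c" by blast
  have inV: "chart_inv ?c z \<in> V \<inter> fst ?c" if "z \<in> ?S" for z using that A c by auto
  have KV: "K \<subseteq> V \<inter> fst ?c" using inV R(2) by (auto simp: K_def)
  have "compact K"
    unfolding K_def
    by (intro compact_continuous_image continuous_on_subset[OF continuous_on_chart_inv[OF A c(1)]]) (use R Sc in auto)
  \<comment> \<open>The Hausdorff property enters here: closedness of \<open>K\<close> in the whole
    manifold is what makes the extension by zero smooth.\<close>
  then have K: "closed K" by (rule compact_imp_closed)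
  have N: "open N" unfolding N_def
    by (rule open_chart_inv_image[OF A c(1) open_ball]) (use R Sc in force)
  have x0: "x0 \<in> N" unfolding N_def
    by (rule image_eqI[of _ _ "snd ?c x0"]) (use A c R in auto)
  have NK: "N \<subseteq> K" using R(1) by (auto simp: N_def K_def)
  have onS: "snd ?c (chart_inv ?c z) = z" if "z \<in> ?S" for z using that Sc by (auto simp: chart_chart_inv)
  have z1: "\<zeta> x = 1" if "x \<in> N" for x
  proof -
    obtain z where z: "z \<in> ball (snd ?c x0) (R / 2)" "x = chart_inv ?c z" using \<open>x \<in> N\<close> unfolding N_def by blast
    then have "z \<in> ?S" using R by (auto intro!: subsetD[OF R(2)])
    then show ?thesis using z NK that onS \<rho>(2) by (auto simp: \<zeta>_def)
  qed
  have zero: "\<rho> (snd ?c x) = 0" if "x \<in> fst ?c" "x \<notin> K" for x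
  proof (rule \<rho>(3), rule ccontr)
    assume "\<not> R \<le> dist (snd ?c x0) (snd ?c x)"
    then have "x \<in> K" unfolding K_def using A c that by (intro image_eqI[of _ _ "snd ?c x"]) auto
    then show False using that by blast
  qed
  have s1: "smooth_fun A (fst ?c) \<zeta>"
  proof (rule smooth_fun_cong[OF open_chart[OF A c(1)]])
    show "smooth_fun A (fst ?c) (\<lambda>x. \<rho> (snd ?c x))"
    proof (rule smooth_fun_chartI[OF c(1) open_chart[OF A c(1)] subset_refl])
      have "smooth_on (snd ?c ` fst ?c) \<rho>" using \<rho>(1) smooth_on_subset by blast
      then show "smooth_on (snd ?c ` fst ?c) (\<lambda>z. \<rho> (snd ?c (chart_inv ?c z)))"
        by (rule smooth_on_cong[OF open_chart_image[OF A c(1)], rotated]) (simp add: chart_chart_inv)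
    qed
  qed (use zero in \<open>auto simp: \<zeta>_def\<close>)
  have s2: "smooth_fun A (- K) \<zeta>"
    by (rule smooth_fun_cong[OF _ _ smooth_fun_const[of _ 0]]) (use K in \<open>auto simp: \<zeta>_def\<close>)
  have "smooth_fun A UNIV \<zeta>"
  proof (rule smooth_fun_local)
    fix x
    show "\<exists>V. open V \<and> x \<in> V \<and> smooth_fun A V \<zeta>"
    proof (cases "x \<in> K")
      case True
      then show ?thesis using s1 KV open_chart[OF A c(1)] by blast
    next
      case False
      then show ?thesis using s2 K by blast
    qed
  qed
  moreover have "\<forall>x. x \<notin> K \<longrightarrow> \<zeta> x = 0" by (simp add: \<zeta>_def)
  moreover have "K \<subseteq> V" using KV by blast
  ultimately show ?thesis
    using N x0 NK K z1 by (intro exI[of _ \<zeta>] exI[of _ N] exI[of _ K]) simp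
qed

lemma smooth_fun_extend:
  fixes \<zeta> f :: "'x \<Rightarrow> complex"
  assumes "smooth_fun A UNIV \<zeta>" "closed K" "\<And>x. x \<notin> K \<Longrightarrow> \<zeta> x = 0" "open W"
    and U: "open U" "W \<inter> K \<subseteq> U" and f: "smooth_fun A (W \<inter> U) f"
  shows "smooth_fun A W (\<lambda>x. if x \<in> U then \<zeta> x * f x else 0)"
proof (rule smooth_fun_local)
  fix x assume x: "x \<in> W"
  show "\<exists>V. open V \<and> x \<in> V \<and> smooth_fun A V (\<lambda>x. if x \<in> U then \<zeta> x * f x else 0)"
  proof (cases "x \<in> K")
    case True
    have "smooth_fun A (W \<inter> U) (\<lambda>x. \<zeta> x * f x)"
      by (intro smooth_fun_mult f smooth_fun_subset[OF assms(1)]) (use assms in auto)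
    then have "smooth_fun A (W \<inter> U) (\<lambda>x. if x \<in> U then \<zeta> x * f x else 0)"
      by (rule smooth_fun_cong[rotated 2]) (use assms in auto)
    then show ?thesis using True x assms by (intro exI[of _ "W \<inter> U"]) auto
  next
    case False
    have "smooth_fun A (- K) (\<lambda>x. if x \<in> U then \<zeta> x * f x else 0)"
      by (rule smooth_fun_cong[OF _ _ smooth_fun_const[of _ 0]]) (use assms in auto)
    then show ?thesis using False assms by (intro exI[of _ "- K"]) auto
  qed
qed

section \<open>The differential of a function and its (0,1)-part\<close>

definition dfun :: "('x \<Rightarrow> complex) \<Rightarrow> 'x \<Rightarrow> 'e \<Rightarrow> complex" where
  "dfun f x u = ddir u (\<lambda>z. f (chart_inv (at_chart A x) z)) (snd (at_chart A x) x)"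

lemma smooth_fun_differentiable:
  "smooth_fun A W f \<Longrightarrow> x \<in> W \<Longrightarrow> c \<in> A \<Longrightarrow> x \<in> fst c \<Longrightarrow>
    (\<lambda>z. f (chart_inv c z)) differentiable (at (snd c x))"
  using smooth_on_differentiable[OF smooth_funD] by blast

lemma dfun_from_chart:
  assumes "smooth_fun A W f" "x \<in> W" "c \<in> A" "x \<in> fst c"
  shows "dfun f x (from_chart A c x w) = ddir w (\<lambda>z. f (chart_inv c z)) (snd c x)"
  unfolding dfun_def from_chart_eq
  using ddir_chart_change(1)[OF assms(3,4) at_chart[OF A] smooth_fun_differentiable[OF assms(1,2) at_chart[OF A]]]
  by simp

lemma linear_dfun: "smooth_fun A W f \<Longrightarrow> x \<in> W \<Longrightarrow> linear (dfun f x)"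
  unfolding dfun_def[abs_def] by (rule linear_ddir[OF smooth_fun_differentiable]) (auto simp: at_chart[OF A])

lemma dfun_cong:
  assumes "open W" "x \<in> W" "\<And>y. y \<in> W \<Longrightarrow> f y = g y"
  shows "dfun f x = dfun g x"
proof
  fix u
  show "dfun f x u = dfun g x u"
    unfolding dfun_def
    by (rule ddir_cong_open[OF open_chart_image_Int(1)[OF A at_chart_in[OF A] assms(1)]])
      (use assms at_chart[OF A] A in auto)
qed

lemma dfun_const: "dfun (\<lambda>_. k) x u = 0"
  by (simp add: dfun_def)

lemma dfun_mult:
  assumes "smooth_fun A W f" "smooth_fun A W g" "x \<in> W"
  shows "dfun (\<lambda>x. f x * g x) x u = f x * dfun g x u + dfun f x u * g x"
  unfolding dfun_def
  using ddir_mult[OF smooth_fun_differentiable[OF assms(1,3) at_chart[OF A]] smooth_fun_differentiable[OF assms(2,3) at_chart[OF A]]]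
  by (simp add: A at_chart[OF A])

lemma dfun_add:
  assumes "smooth_fun A W f" "smooth_fun A W g" "x \<in> W"
  shows "dfun (\<lambda>x. f x + g x) x u = dfun f x u + dfun g x u"
  unfolding dfun_def
  by (rule ddir_add[OF smooth_fun_differentiable[OF assms(1,3) at_chart[OF A]] smooth_fun_differentiable[OF assms(2,3) at_chart[OF A]]])

text \<open>For a function the projection onto type (0,1) has a single summand with a single slot,
  so the abstract definition reduces to (df + \<i> df J)/2.\<close>

lemma dbar_fun_eq:
  assumes j: "linear (J x)" "\<And>v. J x (J x v) = - v" and f: "smooth_fun A W f" "x \<in> W"
  shows "dbar_fun A J f x u = (dfun f x u + \<i> * dfun f x (J x u)) / 2"
proof -
  let ?\<eta> = "ext_d A 0 (\<lambda>x v. f x) x"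
  have e: "?\<eta> v = dfun f x (v 0)" for v
    by (simp add: ext_d_def Let_def dfun_def ddir_def)
  have l: "linear (dfun f x)" by (rule linear_dfun[OF f])
  have a: "alt_form (Suc 0) ?\<eta>"
    unfolding alt_form_def e using l by auto
  have "dbar_fun A J f x u = proj_pq (J x) 0 1 ?\<eta> (\<lambda>_. u)"
    by (simp add: dbar_fun_def dbar_def)
  also have "\<dots> = proj_p1 (J x) 0 ?\<eta> (\<lambda>_. u)" by (simp only: proj_pq_eq[OF j a])
  also have "\<dots> = slot (J x) \<i> 0 ?\<eta> (\<lambda>_. u)"
  proof -
    have "{..<Suc 0} = insert 0 ({} :: nat set)" by auto
    then show ?thesis unfolding proj_p1_def by (simp add: tproj_insert)
  qed
  also have "\<dots> = (dfun f x u + \<i> * dfun f x (J x u)) / 2" by (simp add: slot_def e)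
  finally show ?thesis .
qed

end

section \<open>Finite dimensionality\<close>

text \<open>Induction over the functionals: passing to the kernel of one of them lowers the
  dimension by at most one, and when none is left the separation hypothesis says that the space is
  zero. Linearity is asked on \<open>H\<close> only, since frame coefficients are meaningful only
  for vectors in the fibres.\<close>

lemma finite_dimensional_by_functionals:
  assumes "vector_space sc" "finite I"
  shows "module.subspace sc H \<Longrightarrow>
    (\<And>i s t. i \<in> I \<Longrightarrow> s \<in> H \<Longrightarrow> t \<in> H \<Longrightarrow> fn i (s + t) = fn i s + (fn i t :: complex)) \<Longrightarrow>
    (\<And>i s k. i \<in> I \<Longrightarrow> s \<in> H \<Longrightarrow> fn i (sc k s) = k * fn i s) \<Longrightarrow>
    (\<And>s. s \<in> H \<Longrightarrow> (\<forall>i\<in>I. fn i s = 0) \<Longrightarrow> s = 0) \<Longrightarrow> finite_dimensional_subspace sc H"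
  using assms(2)
proof (induction I arbitrary: H rule: finite_induct)
  case empty
  interpret vs: vector_space sc by (rule assms(1))
  have "H = {0}" using empty.prems(1,4) vs.subspace_0 by auto
  then show ?case unfolding finite_dimensional_subspace_def by (intro exI[of _ "{}"]) simp
next
  case (insert i I)
  interpret vs: vector_space sc by (rule assms(1))
  note H = insert.prems
  define H' where "H' = {s \<in> H. fn i s = 0}"
  have z: "fn i 0 = 0" using H(3)[of i 0 0] vs.subspace_0[OF H(1)] by simp
  have "vs.subspace H'"
    unfolding H'_def by (rule vs.subspaceI) (use H z vs.subspace_0 vs.subspace_add vs.subspace_scale in auto)
  then have "finite_dimensional_subspace sc H'"
    by (rule insert.IH) (use H in \<open>auto simp: H'_def\<close>)
  then obtain B where B: "finite B" "vs.span B = H'" unfolding finite_dimensional_subspace_def by blast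
  show ?case
  proof (cases "H' = H")
    case True
    then show ?thesis using B unfolding finite_dimensional_subspace_def by blast
  next
    case False
    then obtain s0 where s0: "s0 \<in> H" "fn i s0 \<noteq> 0" by (auto simp: H'_def)
    have "vs.span (insert s0 B) = H"
    proof
      have "insert s0 B \<subseteq> H" using B(2) s0(1) vs.span_superset[of B] by (auto simp: H'_def)
      then show "vs.span (insert s0 B) \<subseteq> H" by (rule vs.span_minimal[OF _ H(1)])
      show "H \<subseteq> vs.span (insert s0 B)"
      proof
        fix s assume s: "s \<in> H"
        let ?k = "fn i s / fn i s0"
        have m: "sc (- ?k) s0 \<in> H" by (rule vs.subspace_scale[OF H(1) s0(1)])
        have "fn i (s + sc (- ?k) s0) = 0"
          using H(2)[OF _ s m, of i] H(3)[OF _ s0(1), of i "- ?k"] s0(2) by simp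
        then have "s + sc (- ?k) s0 \<in> vs.span B"
          unfolding B(2) H'_def using vs.subspace_add[OF H(1) s m] by simp
        then show "s \<in> vs.span (insert s0 B)"
          unfolding vs.span_insert by (auto intro!: exI[of _ ?k])
      qed
    qed
    then show ?thesis
      using B(1) unfolding finite_dimensional_subspace_def by blast
  qed
qed

section \<open>The almost complex structure in coordinates\<close>

locale almost_complex =
  fixes A :: "('x::{t2_space,second_countable_topology}, 'e::euclidean_space) atlas"
    and J :: "'x \<Rightarrow> 'e \<Rightarrow> 'e"
  assumes A: "smooth_atlas A" and acs: "almost_complex_structure A J"
begin

lemma linear_J: "linear (J x)" and J_J: "J x (J x v) = - v"
  and smooth_J: "c \<in> A \<Longrightarrow> smooth_fun A (fst c) (\<lambda>x. to_chart A c x (J x (from_chart A c x w)))"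
  using acs unfolding almost_complex_structure_def by auto

text \<open>The structure read in the fixed chart \<open>c\<close>. The vector precedes the point,
  so that \<open>Jc c w\<close> is the map whose smoothness is in question.\<close>

definition Jc :: "('x, 'e) chart \<Rightarrow> 'e \<Rightarrow> 'e \<Rightarrow> 'e" where
  "Jc c w z = to_chart A c (chart_inv c z) (J (chart_inv c z) (from_chart A c (chart_inv c z) w))"

lemma smooth_Jc: "c \<in> A \<Longrightarrow> smooth_on (snd c ` fst c) (Jc c w)"
  using smooth_funD[OF A smooth_J] unfolding Jc_def by fastforce

lemma J_from_chart:
  assumes "c \<in> A" "x \<in> fst c"
  shows "J x (from_chart A c x w) = from_chart A c x (Jc c w (snd c x))"
  using assms by (simp add: Jc_def chart_inv_chart[OF A] from_to_chart[OF A])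

lemma dbar_fun_formula:
  "smooth_fun A W f \<Longrightarrow> x \<in> W \<Longrightarrow> dbar_fun A J f x u = (dfun A f x u + \<i> * dfun A f x (J x u)) / 2"
  by (rule dbar_fun_eq[OF A linear_J J_J])

lemma dbar_fun_from_chart:
  assumes "smooth_fun A W f" "x \<in> W" "c \<in> A" "x \<in> fst c"
  shows "dbar_fun A J f x (from_chart A c x w) =
    (ddir w (\<lambda>z. f (chart_inv c z)) (snd c x) + \<i> * ddir (Jc c w (snd c x)) (\<lambda>z. f (chart_inv c z)) (snd c x)) / 2"
  by (simp only: dbar_fun_formula[OF assms(1,2)] J_from_chart[OF assms(3,4)] dfun_from_chart[OF A assms])

lemma dbar_fun_cong:
  assumes "open W" "x \<in> W" "\<And>y. y \<in> W \<Longrightarrow> f y = g y" "smooth_fun A W f"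
  shows "dbar_fun A J f x u = dbar_fun A J g x u"
  by (simp only: dbar_fun_formula[OF assms(4,2)] dbar_fun_formula[OF smooth_fun_cong[OF A assms(1,3,4)] assms(2)]
      dfun_cong[OF A assms(1,2), of f g, OF assms(3)])

lemma dbar_fun_const: "dbar_fun A J (\<lambda>_. k) x u = 0"
  using dbar_fun_formula[OF smooth_fun_const[OF A, of UNIV k], of x u] by (simp add: dfun_const[OF A])

lemma dbar_fun_mult:
  assumes "smooth_fun A W f" "smooth_fun A W g" "open W" "x \<in> W"
  shows "dbar_fun A J (\<lambda>x. f x * g x) x u = f x * dbar_fun A J g x u + dbar_fun A J f x u * g x"
  unfolding dbar_fun_formula[OF smooth_fun_mult[OF A assms(3,1,2)] assms(4)]
    dbar_fun_formula[OF assms(1,4)] dbar_fun_formula[OF assms(2,4)] dfun_mult[OF A assms(1,2,4)]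
  by (simp add: field_simps)

lemma dbar_fun_add:
  assumes "smooth_fun A W f" "smooth_fun A W g" "open W" "x \<in> W"
  shows "dbar_fun A J (\<lambda>x. f x + g x) x u = dbar_fun A J f x u + dbar_fun A J g x u"
  unfolding dbar_fun_formula[OF smooth_fun_add[OF A assms(3,1,2)] assms(4)]
    dbar_fun_formula[OF assms(1,4)] dbar_fun_formula[OF assms(2,4)] dfun_add[OF A assms(1,2,4)]
  by (simp add: field_simps)

end

section \<open>Sections and their coefficients in local frames\<close>

definition fcoef :: "('x, 'v::ab_group_add) cbundle \<Rightarrow> nat \<Rightarrow> (nat \<Rightarrow> 'x \<Rightarrow> 'v) \<Rightarrow> 'x \<Rightarrow> 'v \<Rightarrow> nat \<Rightarrow> complex" where
  "fcoef E r e x v = (THE a. (\<forall>i\<ge>r. a i = 0) \<and> v = (\<Sum>i<r. smul E (a i) (e i x)))"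

locale complex_bundle = almost_complex A J
  for A :: "('x::{t2_space,second_countable_topology}, 'e::euclidean_space) atlas" and J +
  fixes E :: "('x, 'v::ab_group_add) cbundle"
  assumes E: "complex_vector_bundle A E"
begin

sublocale vs: vector_space "smul E"
  using E unfolding complex_vector_bundle_def by blast

lemma subspace_fibre: "vs.subspace (fibre E x)"
  using E unfolding complex_vector_bundle_def by blast

lemma frame_facts:
  assumes "(U, r, e) \<in> frames E"
  shows open_frame: "open U" and frame_in: "x \<in> U \<Longrightarrow> i < r \<Longrightarrow> e i x \<in> fibre E x"
    and frame_ex1: "x \<in> U \<Longrightarrow> v \<in> fibre E x \<Longrightarrow> \<exists>!a. (\<forall>i\<ge>r. a i = 0) \<and> v = (\<Sum>i<r. smul E (a i) (e i x))"
proof -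
  have "local_frame (fibre E) (smul E) (U, r, e)"
    using E assms unfolding complex_vector_bundle_def by blast
  then show "open U" "x \<in> U \<Longrightarrow> i < r \<Longrightarrow> e i x \<in> fibre E x"
    "x \<in> U \<Longrightarrow> v \<in> fibre E x \<Longrightarrow> \<exists>!a. (\<forall>i\<ge>r. a i = 0) \<and> v = (\<Sum>i<r. smul E (a i) (e i x))"
    unfolding local_frame_def by auto
qed

lemma frame_at: "\<exists>U r e. (U, r, e) \<in> frames E \<and> x \<in> U"
proof -
  have "x \<in> (\<Union>fr\<in>frames E. fst fr)" using E unfolding complex_vector_bundle_def by blast
  then obtain fr where "fr \<in> frames E" "x \<in> fst fr" by blast
  then show ?thesis by (cases fr) auto
qed

lemma fcoef_eq:
  assumes "(U, r, e) \<in> frames E" "x \<in> U" "v \<in> fibre E x"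
  shows "v = (\<Sum>i<r. smul E (fcoef E r e x v i) (e i x))"
  using theI'[OF frame_ex1[OF assms]] unfolding fcoef_def by blast

lemma fcoef_unique:
  assumes "(U, r, e) \<in> frames E" "x \<in> U" "v = (\<Sum>i<r. smul E (a i) (e i x))" "i < r"
  shows "fcoef E r e x v i = a i"
proof -
  have v: "v \<in> fibre E x"
    unfolding assms(3) using frame_in[OF assms(1,2)]
    by (intro vs.subspace_sum subspace_fibre vs.subspace_scale) auto
  have "fcoef E r e x v = (\<lambda>i. if i < r then a i else 0)"
    unfolding fcoef_def
    by (rule the1_equality[OF frame_ex1[OF assms(1,2) v]]) (use assms(3) in auto)
  then show ?thesis using assms(4) by simp
qed

lemma fcoef_add:
  assumes "(U, r, e) \<in> frames E" "x \<in> U" "v \<in> fibre E x" "w \<in> fibre E x" "i < r"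
  shows "fcoef E r e x (v + w) i = fcoef E r e x v i + fcoef E r e x w i"
  by (rule fcoef_unique[OF assms(1,2) _ assms(5)])
    (use fcoef_eq[OF assms(1-3)] fcoef_eq[OF assms(1,2,4)] in \<open>simp add: vs.scale_left_distrib sum.distrib\<close>)

lemma fcoef_scale:
  assumes "(U, r, e) \<in> frames E" "x \<in> U" "v \<in> fibre E x" "i < r"
  shows "fcoef E r e x (smul E k v) i = k * fcoef E r e x v i"
proof (rule fcoef_unique[OF assms(1,2) _ assms(4)])
  have "smul E k v = smul E k (\<Sum>i<r. smul E (fcoef E r e x v i) (e i x))"
    using fcoef_eq[OF assms(1-3)] by simp
  then show "smul E k v = (\<Sum>i<r. smul E (k * fcoef E r e x v i) (e i x))"
    by (simp add: vs.scale_sum_right)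
qed

lemma fcoef_frame_change:
  assumes f: "(U, r, e) \<in> frames E" "x \<in> U" "(U', r', e') \<in> frames E" "x \<in> U'" and v: "v \<in> fibre E x" and i: "i < r"
  shows "fcoef E r e x v i = (\<Sum>l<r'. fcoef E r' e' x v l * fcoef E r e x (e' l x) i)"
proof (rule fcoef_unique[OF f(1,2) _ i])
  have "v = (\<Sum>l<r'. smul E (fcoef E r' e' x v l) (\<Sum>i<r. smul E (fcoef E r e x (e' l x) i) (e i x)))"
    using fcoef_eq[OF f(3,4) v] fcoef_eq[OF f(1,2) frame_in[OF f(3,4)]] by simp
  also have "\<dots> = (\<Sum>i<r. smul E (\<Sum>l<r'. fcoef E r' e' x v l * fcoef E r e x (e' l x) i) (e i x))"
    by (simp add: vs.scale_sum_right vs.scale_sum_left) (rule sum.swap)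
  finally show "v = (\<Sum>i<r. smul E (\<Sum>l<r'. fcoef E r' e' x v l * fcoef E r e x (e' l x) i) (e i x))" .
qed

lemma smooth_fcoef:
  assumes f: "(U, r, e) \<in> frames E" and W: "open W" "W \<subseteq> U" and s: "smooth_coeffs A (smul E) W r e s" and i: "i < r"
  shows "smooth_fun A W (\<lambda>x. fcoef E r e x (s x) i)"
proof -
  obtain a where a: "\<forall>i<r. smooth_fun A W (a i)" "\<forall>x\<in>W. s x = (\<Sum>i<r. smul E (a i x) (e i x))"
    using s unfolding smooth_coeffs_def by blast
  show ?thesis
  proof (rule smooth_fun_cong[OF A W(1)])
    show "a i x = fcoef E r e x (s x) i" if "x \<in> W" for x
      using fcoef_unique[OF f _ _ i, of x "s x" "\<lambda>i. a i x"] a(2) W(2) that by auto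
  qed (use a i in blast)
qed

lemma sectionD_fibre: "s \<in> sections A E \<Longrightarrow> s x \<in> fibre E x"
  and sectionD_coeffs: "s \<in> sections A E \<Longrightarrow> (U, r, e) \<in> frames E \<Longrightarrow> smooth_coeffs A (smul E) U r e s"
  unfolding sections_def by auto

lemma smooth_section_fcoef:
  "s \<in> sections A E \<Longrightarrow> (U, r, e) \<in> frames E \<Longrightarrow> i < r \<Longrightarrow> smooth_fun A U (\<lambda>x. fcoef E r e x (s x) i)"
  using smooth_fcoef[OF _ open_frame subset_refl sectionD_coeffs] by blast

lemma sections_mult:
  assumes f: "smooth_fun A UNIV f" and s: "s \<in> sections A E"
  shows "(\<lambda>x. smul E (f x) (s x)) \<in> sections A E"
  unfolding sections_def
proof (intro CollectI conjI allI ballI, goal_cases)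
  case (1 x)
  then show ?case by (intro vs.subspace_scale subspace_fibre sectionD_fibre s)
next
  case (2 fr)
  obtain U r e where fr: "fr = (U, r, e)" "(U, r, e) \<in> frames E" using 2 by (cases fr) auto
  obtain a where a: "\<forall>i<r. smooth_fun A U (a i)" "\<forall>x\<in>U. s x = (\<Sum>i<r. smul E (a i x) (e i x))"
    using sectionD_coeffs[OF s fr(2)] unfolding smooth_coeffs_def by blast
  show ?case
    unfolding fr(1) prod.case smooth_coeffs_def
  proof (intro exI[of _ "\<lambda>i x. f x * a i x"] conjI allI impI ballI)
    show "smooth_fun A U (\<lambda>x. f x * a i x)" if "i < r" for i
      by (rule smooth_fun_mult[OF A open_frame[OF fr(2)] smooth_fun_subset[OF A f]]) (use a that in auto)
    show "smul E (f x) (s x) = (\<Sum>i<r. smul E (f x * a i x) (e i x))" if "x \<in> U" for x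
      using a(2) that by (simp add: vs.scale_sum_right)
  qed
qed

lemma sections_add:
  assumes s: "s \<in> sections A E" and t: "t \<in> sections A E"
  shows "(\<lambda>x. s x + t x) \<in> sections A E"
  unfolding sections_def
proof (intro CollectI conjI allI ballI, goal_cases)
  case (1 x)
  then show ?case by (intro vs.subspace_add subspace_fibre sectionD_fibre s t)
next
  case (2 fr)
  obtain U r e where fr: "fr = (U, r, e)" "(U, r, e) \<in> frames E" using 2 by (cases fr) auto
  obtain a where a: "\<forall>i<r. smooth_fun A U (a i)" "\<forall>x\<in>U. s x = (\<Sum>i<r. smul E (a i x) (e i x))"
    using sectionD_coeffs[OF s fr(2)] unfolding smooth_coeffs_def by blast
  obtain b where b: "\<forall>i<r. smooth_fun A U (b i)" "\<forall>x\<in>U. t x = (\<Sum>i<r. smul E (b i x) (e i x))"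
    using sectionD_coeffs[OF t fr(2)] unfolding smooth_coeffs_def by blast
  show ?case
    unfolding fr(1) prod.case smooth_coeffs_def
  proof (intro exI[of _ "\<lambda>i x. a i x + b i x"] conjI allI impI ballI)
    show "smooth_fun A U (\<lambda>x. a i x + b i x)" if "i < r" for i
      by (rule smooth_fun_add[OF A open_frame[OF fr(2)]]) (use a b that in auto)
    show "s x + t x = (\<Sum>i<r. smul E (a i x + b i x) (e i x))" if "x \<in> U" for x
      using a(2) b(2) that by (simp add: vs.scale_left_distrib sum.distrib)
  qed
qed

lemma sections_zero: "(\<lambda>_. 0) \<in> sections A E"
  unfolding sections_def smooth_coeffs_def
  using vs.subspace_0[OF subspace_fibre] smooth_fun_const[OF A]
  by (auto intro!: exI[of _ "\<lambda>_ _. 0"])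

lemma sections_sum: "(\<And>i. i \<in> I \<Longrightarrow> s i \<in> sections A E) \<Longrightarrow> (\<lambda>x. \<Sum>i\<in>I. s i x) \<in> sections A E"
  by (induction I rule: infinite_finite_induct) (auto intro: sections_zero sections_add)

text \<open>Operators are defined on global sections only; a member of a local frame becomes
  available to them through a cut-off function supported in the domain of the frame.\<close>

lemma cut_section:
  assumes f: "(U, r, e) \<in> frames E" "i < r"
    and z: "smooth_fun A UNIV \<zeta>" "closed K" "K \<subseteq> U" "\<And>x. x \<notin> K \<Longrightarrow> \<zeta> x = 0"
  shows "(\<lambda>x. if x \<in> U then smul E (\<zeta> x) (e i x) else 0) \<in> sections A E"
  unfolding sections_def
proof (intro CollectI conjI allI ballI, goal_cases)
  case (1 x)
  then show ?case
    using frame_in[OF f(1) _ f(2)] vs.subspace_0[OF subspace_fibre] by (auto intro: vs.subspace_scale subspace_fibre)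
next
  case (2 fr)
  obtain U' r' e' where fr: "fr = (U', r', e')" "(U', r', e') \<in> frames E" using 2 by (cases fr) auto
  have "smooth_coeffs A (smul E) (U' \<inter> U) r' e' (e i)"
    using E fr(2) f unfolding complex_vector_bundle_def by blast
  then obtain b where b: "\<forall>l<r'. smooth_fun A (U' \<inter> U) (b l)" "\<forall>x\<in>U' \<inter> U. e i x = (\<Sum>l<r'. smul E (b l x) (e' l x))"
    unfolding smooth_coeffs_def by blast
  show ?case
    unfolding fr(1) prod.case smooth_coeffs_def
  proof (intro exI[of _ "\<lambda>l x. if x \<in> U then \<zeta> x * b l x else 0"] conjI allI impI ballI)
    show "smooth_fun A U' (\<lambda>x. if x \<in> U then \<zeta> x * b l x else 0)" if "l < r'" for l
      by (rule smooth_fun_extend[OF A z(1,2,4) open_frame[OF fr(2)] open_frame[OF f(1)]]) (use b that z in auto)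
    show "(if x \<in> U then smul E (\<zeta> x) (e i x) else 0) = (\<Sum>l<r'. smul E (if x \<in> U then \<zeta> x * b l x else 0) (e' l x))"
      if "x \<in> U'" for x
      using b(2) that by (simp add: vs.scale_sum_right)
  qed
qed

end

section \<open>The local form of a pseudoholomorphic structure, and the finite net\<close>

locale pseudoholomorphic_bundle = complex_bundle A J E
  for A :: "('x::{t2_space,second_countable_topology}, 'e::euclidean_space) atlas" and J
    and E :: "('x, 'v::ab_group_add) cbundle" +
  fixes D
  assumes D: "pseudoholomorphic_structure A J E D"
begin

lemma D_add: "s \<in> sections A E \<Longrightarrow> t \<in> sections A E \<Longrightarrow> D (\<lambda>x. s x + t x) = (\<lambda>x u. D s x u + D t x u)"
  and D_scale: "s \<in> sections A E \<Longrightarrow> D (\<lambda>x. smul E k (s x)) = (\<lambda>x u. smul E k (D s x u))"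
  and D_sections01: "s \<in> sections A E \<Longrightarrow> D s \<in> sections01 A J E"
  and D_mult: "smooth_fun A UNIV f \<Longrightarrow> s \<in> sections A E \<Longrightarrow> D (\<lambda>x. smul E (f x) (s x)) =
    (\<lambda>x u. smul E (dbar_fun A J f x u) (s x) + smul E (f x) (D s x u))"
  using D unfolding pseudoholomorphic_structure_def differential_operator_def by blast+

lemma D_zero: "D (\<lambda>_. 0) = (\<lambda>_ _. 0)"
  using D_scale[OF sections_zero, of 0] by simp

lemma D_sum: "(\<And>i. i \<in> I \<Longrightarrow> s i \<in> sections A E) \<Longrightarrow> D (\<lambda>x. \<Sum>i\<in>I. s i x) = (\<lambda>x u. \<Sum>i\<in>I. D (s i) x u)"
  by (induction I rule: infinite_finite_induct) (auto simp: D_zero D_add sections_sum)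

text \<open>Locally \<open>D\<close> is determined by its values on finitely many global sections.\<close>
lemma D_local_formula:
  assumes f: "(U, r, e) \<in> frames E" and z: "smooth_fun A UNIV \<zeta>" "closed K" "K \<subseteq> U" "\<And>x. x \<notin> K \<Longrightarrow> \<zeta> x = 0"
    and N: "open N" "N \<subseteq> K" "\<And>x. x \<in> N \<Longrightarrow> \<zeta> x = 1" and s: "s \<in> sections A E" and x: "x \<in> N"
  shows "D s x u = (\<Sum>i<r. smul E (dbar_fun A J (\<lambda>x. fcoef E r e x (s x) i) x u) (e i x) +
    smul E (fcoef E r e x (s x) i) (D (\<lambda>x. if x \<in> U then smul E (\<zeta> x) (e i x) else 0) x u))"
proof -
  define es where "es i = (\<lambda>x. if x \<in> U then smul E (\<zeta> x) (e i x) else 0)" for i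
  define g where "g i = (\<lambda>x. if x \<in> U then \<zeta> x * fcoef E r e x (s x) i else 0)" for i
  have es: "es i \<in> sections A E" if "i < r" for i unfolding es_def by (rule cut_section[OF f that z])
  have g: "smooth_fun A UNIV (g i)" if "i < r" for i
    unfolding g_def
    by (rule smooth_fun_extend[OF A z(1,2,4) open_UNIV open_frame[OF f]])
      (use z smooth_section_fcoef[OF s f that] in auto)
  have xU: "x \<in> U" using x N z by blast
  \<comment> \<open>The square is needed because one factor globalises the coefficient and the other
    the frame element. As \<open>\<zeta>\<close> is 1 near \<open>x\<close>, its square has dbar
    zero there and the operator does not notice it.\<close>
  have "(\<lambda>x. smul E (\<zeta> x * \<zeta> x) (s x)) = (\<lambda>x. \<Sum>i<r. smul E (g i x) (es i x))"
  proof
    fix y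
    show "smul E (\<zeta> y * \<zeta> y) (s y) = (\<Sum>i<r. smul E (g i y) (es i y))"
    proof (cases "y \<in> U")
      case True
      have "smul E (\<zeta> y * \<zeta> y) (s y) = smul E (\<zeta> y * \<zeta> y) (\<Sum>i<r. smul E (fcoef E r e y (s y) i) (e i y))"
        using fcoef_eq[OF f True sectionD_fibre[OF s]] by simp
      also have "\<dots> = (\<Sum>i<r. smul E (g i y) (es i y))"
        unfolding vs.scale_sum_right using True by (intro sum.cong) (auto simp: g_def es_def mult_ac)
      finally show ?thesis .
    next
      case False
      then have "\<zeta> y = 0" using z by blast
      then show ?thesis using False by (simp add: g_def)
    qed
  qed
  moreover have "D (\<lambda>x. smul E (\<zeta> x * \<zeta> x) (s x)) x u = D s x u"
  proof -
    have "dbar_fun A J (\<lambda>x. \<zeta> x * \<zeta> x) x u = dbar_fun A J (\<lambda>_. 1) x u"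
      by (rule dbar_fun_cong[OF N(1) x, symmetric]) (use N smooth_fun_const[OF A] in auto)
    then have "dbar_fun A J (\<lambda>x. \<zeta> x * \<zeta> x) x u = 0" by (simp only: dbar_fun_const)
    then show ?thesis
      using D_mult[OF smooth_fun_mult[OF A open_UNIV z(1) z(1)] s] N(3)[OF x] by simp
  qed
  moreover have "D (\<lambda>x. \<Sum>i<r. smul E (g i x) (es i x)) x u =
      (\<Sum>i<r. smul E (dbar_fun A J (g i) x u) (es i x) + smul E (g i x) (D (es i) x u))"
  proof -
    have "D (\<lambda>x. \<Sum>i<r. smul E (g i x) (es i x)) = (\<lambda>x u. \<Sum>i<r. D (\<lambda>x. smul E (g i x) (es i x)) x u)"
      by (rule D_sum) (use sections_mult g es in auto)
    then show ?thesis using D_mult[OF g es] by simp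
  qed
  ultimately have "D s x u = (\<Sum>i<r. smul E (dbar_fun A J (g i) x u) (es i x) + smul E (g i x) (D (es i) x u))"
    by simp
  also have "\<dots> = (\<Sum>i<r. smul E (dbar_fun A J (\<lambda>x. fcoef E r e x (s x) i) x u) (e i x) +
    smul E (fcoef E r e x (s x) i) (D (es i) x u))"
  proof (rule sum.cong[OF refl])
    fix i assume "i \<in> {..<r}"
    then have i: "i < r" by simp
    have "dbar_fun A J (g i) x u = dbar_fun A J (\<lambda>x. fcoef E r e x (s x) i) x u"
      by (rule dbar_fun_cong[OF N(1) x]) (use N z smooth_fun_subset[OF A g[OF i]] in \<open>auto simp: g_def\<close>)
    then show "smul E (dbar_fun A J (g i) x u) (es i x) + smul E (g i x) (D (es i) x u) =
      smul E (dbar_fun A J (\<lambda>x. fcoef E r e x (s x) i) x u) (e i x) + smul E (fcoef E r e x (s x) i) (D (es i) x u)"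
      using xU N(3)[OF x] by (simp add: es_def g_def)
  qed
  finally show ?thesis by (simp add: es_def)
qed

text \<open>The product rule applied to the frame expansion gives a zeroth order perturbation of the
  Cauchy-Riemann system. What matters is that \<open>N\<close> and the coefficients
  \<open>\<Theta>\<close> are chosen before the section.\<close>

lemma local_equation:
  assumes f: "(U, r, e) \<in> frames E" and c: "c \<in> A" and x0: "x0 \<in> U" "x0 \<in> fst c"
  shows "\<exists>N \<Theta>. open N \<and> x0 \<in> N \<and> N \<subseteq> U \<inter> fst c \<and> (\<forall>w. \<forall>i<r. \<forall>l<r. smooth_fun A N (\<Theta> w i l)) \<and>
    (\<forall>s\<in>H0 A E D. \<forall>x\<in>N. \<forall>w. \<forall>l<r. dbar_fun A J (\<lambda>x. fcoef E r e x (s x) l) x (from_chart A c x w) +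
      (\<Sum>i<r. fcoef E r e x (s x) i * \<Theta> w i l x) = 0)"
proof -
  let ?V = "U \<inter> fst c"
  have V: "open ?V" "x0 \<in> ?V" using open_frame[OF f] open_chart[OF A c] x0 by auto
  obtain \<zeta> :: "'x \<Rightarrow> complex" and N K where z: "smooth_fun A UNIV \<zeta>" "closed K" "K \<subseteq> ?V"
    "\<And>x. x \<notin> K \<Longrightarrow> \<zeta> x = 0" and N: "open N" "N \<subseteq> K" "\<And>x. x \<in> N \<Longrightarrow> \<zeta> x = 1" "x0 \<in> N"
    using cutoff_exists[OF A V] by blast
  define es where "es i = (\<lambda>x. if x \<in> U then smul E (\<zeta> x) (e i x) else 0)" for i
  have KU: "K \<subseteq> U" using z by blast
  have es: "es i \<in> sections A E" if "i < r" for i unfolding es_def by (rule cut_section[OF f that z(1,2) KU z(4)])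
  define P where "P w i b \<longleftrightarrow> (\<forall>l<r. smooth_fun A ?V (b l)) \<and>
    (\<forall>x\<in>?V. D (es i) x (from_chart A c x w) = (\<Sum>l<r. smul E (b l x) (e l x)))" for w i b
  \<comment> \<open>Frame coefficients of the operator applied to the cut-off frame elements,
    contracted with the coordinate field of \<open>w\<close>.\<close>
  define \<Theta> where "\<Theta> w i = (SOME b. P w i b)" for w i
  have T: "P w i (\<Theta> w i)" if "i < r" for w i
    unfolding \<Theta>_def
  proof (rule someI_ex[where P = "P w i"])
    have "smooth_coeffs A (smul E) ?V r e (\<lambda>x. D (es i) x (from_chart A c x w))"
      using D_sections01[OF es[OF that]] f c unfolding sections01_def by blast
    then show "\<exists>b. P w i b" unfolding smooth_coeffs_def P_def by blast
  qed
  show ?thesis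
  proof (intro exI[of _ N] exI[of _ \<Theta>] conjI allI impI ballI N(1,4))
    show NV: "N \<subseteq> ?V" using N z by blast
    show "smooth_fun A N (\<Theta> w i l)" if "i < r" "l < r" for w i l
      using T[OF that(1), of w] that(2) smooth_fun_subset[OF A _ NV] unfolding P_def by blast
    fix s x w l assume s: "s \<in> H0 A E D" and x: "x \<in> N" and l: "l < r"
    have ss: "s \<in> sections A E" and s0: "D s x u = 0" for u using s by (auto simp: H0_def)
    let ?u = "from_chart A c x w"
    let ?f = "\<lambda>i. fcoef E r e x (s x) i"
    let ?d = "\<lambda>i. dbar_fun A J (\<lambda>x. fcoef E r e x (s x) i) x ?u"
    have xU: "x \<in> U" using x NV by blast
    have "0 = (\<Sum>i<r. smul E (?d i) (e i x) + smul E (?f i) (D (es i) x ?u))"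
      using D_local_formula[OF f z(1,2) KU z(4) N(1-3) ss x, of ?u] s0 by (simp add: es_def)
    also have "\<dots> = (\<Sum>i<r. smul E (?d i) (e i x)) + (\<Sum>i<r. smul E (?f i) (\<Sum>l<r. smul E (\<Theta> w i l x) (e l x)))"
    proof -
      have "D (es i) x ?u = (\<Sum>l<r. smul E (\<Theta> w i l x) (e l x))" if "i < r" for i
        using T[OF that, of w] x NV unfolding P_def by blast
      then show ?thesis unfolding sum.distrib by simp
    qed
    also have "(\<Sum>i<r. smul E (?f i) (\<Sum>l<r. smul E (\<Theta> w i l x) (e l x))) =
      (\<Sum>l<r. smul E (\<Sum>i<r. ?f i * \<Theta> w i l x) (e l x))"
      by (simp add: vs.scale_sum_right vs.scale_sum_left) (rule sum.swap)
    finally have "0 = (\<Sum>l<r. smul E (?d l + (\<Sum>i<r. ?f i * \<Theta> w i l x)) (e l x))"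
      by (simp add: vs.scale_left_distrib sum.distrib)
    from fcoef_unique[OF f xU this l] have "fcoef E r e x 0 l = ?d l + (\<Sum>i<r. ?f i * \<Theta> w i l x)" .
    moreover have "fcoef E r e x 0 l = 0"
      by (rule fcoef_unique[OF f xU _ l, of 0 "\<lambda>_. 0"]) simp
    ultimately show "?d l + (\<Sum>i<r. ?f i * \<Theta> w i l x) = 0" by simp
  qed
qed

text \<open>The outcome of the interior estimate in the form in which the net argument uses it:
  \<open>L\<close> is common to all elements of \<open>H0 A E D\<close>.\<close>

definition patch :: "'x set \<Rightarrow> nat \<Rightarrow> (nat \<Rightarrow> 'x \<Rightarrow> 'v) \<Rightarrow> ('x, 'e) chart \<Rightarrow> 'e \<Rightarrow> real \<Rightarrow> real \<Rightarrow> bool" where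
  "patch U r e c z R L \<longleftrightarrow> (U, r, e) \<in> frames E \<and> c \<in> A \<and> R > 0 \<and> cball z R \<subseteq> snd c ` (U \<inter> fst c) \<and> L \<ge> 0 \<and>
    (\<forall>s\<in>H0 A E D. \<forall>B>0. (\<forall>y\<in>cball z R. \<forall>i<r. cmod (fcoef E r e (chart_inv c y) (s (chart_inv c y)) i) \<le> B) \<longrightarrow>
      (\<forall>y\<in>cball z (R / 2). \<forall>y'\<in>cball z (R / 2). \<forall>i<r.
        cmod (fcoef E r e (chart_inv c y) (s (chart_inv c y)) i - fcoef E r e (chart_inv c y') (s (chart_inv c y')) i)
          \<le> L * B * dist y y'))"

text \<open>Around any point a ball is chosen so small that J is nearly constant in the chart; there
  the gradient estimate applies and integrates to a Lipschitz bound on the half ball.\<close>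

lemma patch_exists: "\<exists>U r e c z R L. patch U r e c z R L \<and> x0 \<in> chart_inv c ` ball z (R / 2)"
proof -
  obtain U r e where f: "(U, r, e) \<in> frames E" "x0 \<in> U" using frame_at by blast
  define c where "c = at_chart A x0"
  have c: "c \<in> A" "x0 \<in> fst c" using at_chart[OF A, of x0] by (auto simp: c_def)
  from local_equation[OF f(1) c(1) f(2) c(2)] obtain N \<Theta> where
    N: "open N" "x0 \<in> N" "N \<subseteq> U \<inter> fst c" and
    T0: "\<forall>w. \<forall>i<r. \<forall>l<r. smooth_fun A N (\<Theta> w i l)" and
    eq0: "\<forall>s\<in>H0 A E D. \<forall>x\<in>N. \<forall>w. \<forall>l<r.
      dbar_fun A J (\<lambda>x. fcoef E r e x (s x) l) x (from_chart A c x w) + (\<Sum>i<r. fcoef E r e x (s x) i * \<Theta> w i l x) = 0"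
    by (elim exE conjE)
  have T: "smooth_fun A N (\<Theta> w i l)" if "i < r" "l < r" for w i l using T0 that by blast
  have eq: "dbar_fun A J (\<lambda>x. fcoef E r e x (s x) l) x (from_chart A c x w) + (\<Sum>i<r. fcoef E r e x (s x) i * \<Theta> w i l x) = 0"
    if "s \<in> H0 A E D" "x \<in> N" "l < r" for s x w l using eq0 that by blast
  define z where "z = snd c x0"
  let ?S = "snd c ` N"
  have Nc: "N \<inter> fst c = N" using N by blast
  have S: "open ?S" "z \<in> ?S" using open_chart_image_Int(1)[OF A c(1) N(1)] N(2) by (auto simp: Nc z_def)
  have Sc: "?S \<subseteq> snd c ` fst c" using N by blast
  have sW: "smooth_on ?S (Jc c b)" for b by (rule smooth_on_subset[OF smooth_Jc[OF c(1)] Sc])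
  \<comment> \<open>The oscillation of J that \<open>cr_ball\<close> permits.\<close>
  define \<epsilon> where "\<epsilon> = 1 / (2 * real DIM('e))"
  have "\<epsilon> > 0" by (simp add: \<epsilon>_def)
  have "isCont (Jc c b) z" for b
    using smooth_on_continuous[OF sW] S continuous_on_eq_continuous_at by blast
  then have ev: "\<forall>\<^sub>F y in nhds z. dist (Jc c b y) (Jc c b z) < \<epsilon>" for b
    using tendstoD[OF _ \<open>\<epsilon> > 0\<close>] unfolding continuous_at tendsto_at_iff_tendsto_nhds by blast
  have "\<forall>\<^sub>F y in nhds z. \<forall>b\<in>Basis. dist (Jc c b y) (Jc c b z) < \<epsilon>"
    by (rule eventually_ball_finite) (use ev in auto)
  then obtain R1 where R1: "R1 > 0" "\<And>y b. dist y z < R1 \<Longrightarrow> b \<in> Basis \<Longrightarrow> dist (Jc c b y) (Jc c b z) < \<epsilon>"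
    unfolding eventually_nhds_metric by blast
  obtain R2 where R2: "R2 > 0" "cball z R2 \<subseteq> ?S" using S open_contains_cball by blast
  define R where "R = min R1 R2"
  have RS: "R > 0" "cball z R \<subseteq> ?S" using R1 R2 by (auto simp: R_def)
  then have bS: "ball z R \<subseteq> ?S" by (meson ball_subset_cball order_trans)
  \<comment> \<open>All elements of \<open>H0 A E D\<close> at once, so that a single interpretation
    of \<open>cr_ball\<close> yields a constant independent of the section.\<close>
  define Sol where "Sol = (\<lambda>s i y. fcoef E r e (chart_inv c y) (s (chart_inv c y)) i) ` H0 A E D"
  have inN: "chart_inv c y \<in> N" "chart_inv c y \<in> fst c" "snd c (chart_inv c y) = y" if "y \<in> ?S" for y
    using that N chart_inv_chart[OF A c(1)] by auto
  have sec: "s \<in> sections A E" if "s \<in> H0 A E D" for s using that by (simp add: H0_def)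
  have smN: "smooth_fun A N (\<lambda>x. fcoef E r e x (s x) i)" if "s \<in> H0 A E D" "i < r" for s i
    by (rule smooth_fun_subset[OF A smooth_section_fcoef[OF sec f(1)]]) (use that N in auto)
  have smS: "smooth_on ?S (\<lambda>y. fcoef E r e (chart_inv c y) (s (chart_inv c y)) i)" if "s \<in> H0 A E D" "i < r" for s i
    using smooth_funD[OF A smN[OF that] c(1)] by (simp add: Nc)
  interpret cr_ball z R Sol r "Jc c"
  proof
    show "open (ball z R)" "R > 0" using RS by auto
    show "smooth_on (ball z R) (a j)" if "a \<in> Sol" "j < r" for a j
      using that smooth_on_subset[OF smS bS] by (auto simp: Sol_def)
    show "smooth_on (ball z R) (Jc c b)" for b by (rule smooth_on_subset[OF sW bS])
    show "\<bar>(Jc c b x - Jc c b z) \<bullet> d\<bar> \<le> 1 / real (2 * DIM('e))"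
      if "x \<in> ball z R" "b \<in> Basis" "d \<in> Basis" for x b d
    proof -
      have "\<bar>(Jc c b x - Jc c b z) \<bullet> d\<bar> \<le> norm (Jc c b x - Jc c b z)" using Basis_le_norm[OF that(3)] by blast
      also have "\<dots> \<le> \<epsilon>" using R1(2)[of x b] that by (simp add: R_def dist_norm norm_minus_commute)
      finally show ?thesis by (simp add: \<epsilon>_def)
    qed
    fix b :: 'e and j assume b: "b \<in> Basis" and j: "j < r"
    \<comment> \<open>The factor -2 arises because \<open>dbar_fun\<close> contains the 1/2 of the
      (0,1)-projection, which the system omits, and because the term with \<open>\<Theta>\<close>
      changes sides.\<close>
    have d: "dop (ball z R) Sol r 0 (\<lambda>a y. \<Sum>i<r. (- 2 * \<Theta> b i j (chart_inv c y)) * pd [] (a i) y)"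
    proof (rule dop_sum, rule dop_mult)
      fix i assume "i \<in> {..<r}"
      then have i: "i < r" by simp
      have "smooth_on ?S (\<lambda>y. \<Theta> b i j (chart_inv c y))"
        using smooth_funD[OF A T[OF i j, of b] c(1)] by (simp add: Nc)
      then show "smooth_on (ball z R) (\<lambda>y. - 2 * \<Theta> b i j (chart_inv c y))"
        by (intro smooth_on_mult smooth_on_const open_ball smooth_on_subset[OF _ bS])
      show "dop (ball z R) Sol r 0 (\<lambda>a. pd [] (a i))" by (rule dop_pd) (use i in \<open>auto simp: words_def\<close>)
    qed
    show "dop (ball z R) Sol r 0 (\<lambda>a x. ddir b (a j) x + \<i> * ddir (Jc c b x) (a j) x)"
    proof (rule dop_cong[OF d])
      fix a y assume "a \<in> Sol" and "y \<in> ball z R"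
      then obtain s where s: "s \<in> H0 A E D" and a: "a = (\<lambda>i y. fcoef E r e (chart_inv c y) (s (chart_inv c y)) i)"
        and y: "y \<in> ?S" using bS by (auto simp: Sol_def)
      let ?x = "chart_inv c y"
      have h1: "dbar_fun A J (\<lambda>x. fcoef E r e x (s x) j) ?x (from_chart A c ?x b) =
        (ddir b (a j) y + \<i> * ddir (Jc c b y) (a j) y) / 2"
        using dbar_fun_from_chart[OF smN[OF s j] inN(1)[OF y] c(1) inN(2)[OF y], of b] by (simp add: inN(3)[OF y] a)
      have h2: "(\<Sum>i<r. (- 2 * \<Theta> b i j ?x) * pd [] (a i) y) = - 2 * (\<Sum>i<r. fcoef E r e ?x (s ?x) i * \<Theta> b i j ?x)"
        by (simp add: a sum_distrib_left mult_ac)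
      have half: "- 2 * t = q" if "p + t = 0" "p = q / 2" for p q t :: complex
        using that by (simp add: add_eq_0_iff)
      show "(\<Sum>i<r. (- 2 * \<Theta> b i j ?x) * pd [] (a i) y) = ddir b (a j) y + \<i> * ddir (Jc c b y) (a j) y"
        unfolding h2 by (rule half[OF eq[OF s inN(1)[OF y] j, of b] h1])
    qed
  qed
  obtain C where C: "C \<ge> 0" "\<And>a B x b j. a \<in> Sol \<Longrightarrow> B > 0 \<Longrightarrow> \<forall>x\<in>ball z R. \<forall>j<r. cmod (a j x) \<le> B \<Longrightarrow>
      x \<in> cball z (R / 2) \<Longrightarrow> b \<in> Basis \<Longrightarrow> j < r \<Longrightarrow> cmod (ddir b (a j) x) \<le> C * B"
    using gradient_estimate by blast
  \<comment> \<open>The gradient estimate bounds each of the \<open>DIM('e)\<close> partial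
    derivatives by \<open>C\<close> times the bound, and the derivative in direction
    \<open>v\<close> has coordinates of size at most \<open>norm v\<close>.\<close>
  define L where "L = real DIM('e) * C"
  have "patch U r e c z R L"
    unfolding patch_def
  proof (intro conjI ballI allI impI)
    show "(U, r, e) \<in> frames E" "c \<in> A" "R > 0" "L \<ge> 0" using f c RS C(1) by (auto simp: L_def)
    show "cball z R \<subseteq> snd c ` (U \<inter> fst c)" using RS(2) N(3) by blast
    fix s B y y' i
    assume s: "s \<in> H0 A E D" and B: "B > 0"
      "\<forall>y\<in>cball z R. \<forall>i<r. cmod (fcoef E r e (chart_inv c y) (s (chart_inv c y)) i) \<le> B"
      and y: "y \<in> cball z (R / 2)" "y' \<in> cball z (R / 2)" and i: "i < r"
    define a where "a = (\<lambda>i y. fcoef E r e (chart_inv c y) (s (chart_inv c y)) i)"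
    have a: "a \<in> Sol" using s by (auto simp: Sol_def a_def)
    have half: "cball z (R / 2) \<subseteq> ball z R" using RS(1) by auto
    have g: "cmod (ddir b (a i) x) \<le> C * B" if "x \<in> cball z (R / 2)" "b \<in> Basis" for x b
      by (rule C(2)[OF a B(1) _ that i]) (use B(2) in \<open>auto simp: a_def\<close>)
    have df: "a i differentiable (at x)" if "x \<in> cball z (R / 2)" for x
      unfolding a_def by (rule smooth_on_differentiable[OF smS[OF s i]]) (use that half bS in blast)
    have on: "onorm (\<lambda>v. ddir v (a i) x) \<le> L * B" if x: "x \<in> cball z (R / 2)" for x
    proof (rule onorm_bound)
      show "0 \<le> L * B" using C(1) B(1) by (simp add: L_def)
      fix v
      have "cmod (ddir v (a i) x) \<le> (\<Sum>b\<in>Basis. cmod ((v \<bullet> b) *\<^sub>R ddir b (a i) x))"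
        unfolding ddir_expand[OF df[OF x], of v] by (rule norm_sum)
      also have "\<dots> \<le> (\<Sum>b\<in>(Basis :: 'e set). norm v * (C * B))"
      proof (rule sum_mono)
        fix b :: 'e assume b: "b \<in> Basis"
        show "cmod ((v \<bullet> b) *\<^sub>R ddir b (a i) x) \<le> norm v * (C * B)"
          unfolding norm_scaleR using g[OF x b] Basis_le_norm[OF b] by (intro mult_mono) auto
      qed
      also have "\<dots> = L * B * norm v" by (simp add: L_def mult_ac)
      finally show "cmod (ddir v (a i) x) \<le> L * B * norm v" .
    qed
    have "norm (a i y - a i y') \<le> L * B * norm (y - y')"
      by (rule differentiable_bound[OF convex_cball _ on, of z "R / 2" "a i"])
        (use y df in \<open>auto intro: has_derivative_at_withinI differentiable_has_ddir\<close>)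
    then show "cmod (fcoef E r e (chart_inv c y) (s (chart_inv c y)) i - fcoef E r e (chart_inv c y') (s (chart_inv c y')) i)
        \<le> L * B * dist y y'"
      by (simp add: a_def dist_norm)
  qed
  moreover have "x0 \<in> chart_inv c ` ball z (R / 2)"
    by (rule image_eqI[of _ _ z]) (use RS c in \<open>auto simp: z_def chart_inv_chart[OF A]\<close>)
  ultimately show ?thesis by blast
qed

lemma patchD:
  assumes "patch U r e c z R L"
  shows "(U, r, e) \<in> frames E" "c \<in> A" "R > 0" "cball z R \<subseteq> snd c ` (U \<inter> fst c)" "L \<ge> 0"
  using assms unfolding patch_def by simp_all

lemma patch_lipschitz:
  assumes "patch U r e c z R L" "s \<in> H0 A E D" "B > 0"
    "\<And>y i. y \<in> cball z R \<Longrightarrow> i < r \<Longrightarrow> cmod (fcoef E r e (chart_inv c y) (s (chart_inv c y)) i) \<le> B"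
    "y \<in> cball z (R / 2)" "y' \<in> cball z (R / 2)" "i < r"
  shows "cmod (fcoef E r e (chart_inv c y) (s (chart_inv c y)) i - fcoef E r e (chart_inv c y') (s (chart_inv c y')) i)
        \<le> L * B * dist y y'"
proof -
  have h: "\<forall>s\<in>H0 A E D. \<forall>B>0. (\<forall>y\<in>cball z R. \<forall>i<r. cmod (fcoef E r e (chart_inv c y) (s (chart_inv c y)) i) \<le> B) \<longrightarrow>
      (\<forall>y\<in>cball z (R / 2). \<forall>y'\<in>cball z (R / 2). \<forall>i<r.
        cmod (fcoef E r e (chart_inv c y) (s (chart_inv c y)) i - fcoef E r e (chart_inv c y') (s (chart_inv c y')) i)
          \<le> L * B * dist y y')"
    using assms(1) unfolding patch_def by (elim conjE)
  show ?thesis by (rule h[rule_format, OF assms(2,3) _ assms(5-7)]) (use assms(4) in blast)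
qed

lemma patch_set:
  assumes p: "patch U r e c z R L" and q: "q \<le> R"
  shows "chart_inv c ` cball z q \<subseteq> U" "compact (chart_inv c ` cball z q)" "open (chart_inv c ` ball z q)"
proof -
  have sub: "cball z q \<subseteq> snd c ` (U \<inter> fst c)" using patchD(4)[OF p] q by force
  then show "chart_inv c ` cball z q \<subseteq> U" using chart_inv_chart[OF A patchD(2)[OF p]] by fastforce
  have sub': "cball z q \<subseteq> snd c ` fst c" using sub by blast
  show "compact (chart_inv c ` cball z q)"
    by (intro compact_continuous_image compact_cball continuous_on_subset[OF continuous_on_chart_inv[OF A patchD(2)[OF p]] sub'])
  show "open (chart_inv c ` ball z q)"
    by (rule open_chart_inv_image[OF A patchD(2)[OF p] open_ball]) (use sub' in force)
qed

lemma bounded_on_compact: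
  fixes f :: "'i \<Rightarrow> 'x \<Rightarrow> complex"
  assumes "compact K" "finite I" "\<And>i. i \<in> I \<Longrightarrow> continuous_on K (f i)"
  shows "\<exists>M\<ge>0. \<forall>x\<in>K. \<forall>i\<in>I. cmod (f i x) \<le> M"
proof -
  have "continuous_on K (\<lambda>x. \<Sum>i\<in>I. cmod (f i x))"
    by (intro continuous_on_sum continuous_on_norm assms)
  then have "compact ((\<lambda>x. \<Sum>i\<in>I. cmod (f i x)) ` K)" using assms(1) by (rule compact_continuous_image)
  then have "bounded ((\<lambda>x. \<Sum>i\<in>I. cmod (f i x)) ` K)" by (rule compact_imp_bounded)
  then obtain M where M: "\<And>x. x \<in> K \<Longrightarrow> norm (\<Sum>i\<in>I. cmod (f i x)) \<le> M"
    unfolding bounded_iff by blast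
  have "cmod (f i x) \<le> max M 0" if "x \<in> K" "i \<in> I" for x i
  proof -
    have "cmod (f i x) \<le> (\<Sum>i\<in>I. cmod (f i x))"
      by (rule member_le_sum) (use that assms in auto)
    also have "\<dots> \<le> M" using M[OF that(1)] by simp
    finally show ?thesis by simp
  qed
  then show ?thesis by (intro exI[of _ "max M 0"]) auto
qed

text \<open>If \<open>s\<close> vanishes on a sufficiently fine net, then every bound for its coefficients on the small
  balls can be halved: the bound carries over to the big balls with a constant, there it bounds the
  gradient, and the net is fine.\<close>
lemma determined_by_finite_set:
  assumes comp: "compact (UNIV :: 'x set)"
  shows "\<exists>P. finite P \<and> (\<forall>s\<in>H0 A E D. (\<forall>x\<in>P. s x = 0) \<longrightarrow> s = (\<lambda>_. 0))"
proof -
  have "\<forall>x0. \<exists>p. (case p of (U, r, e, c, z, R, L) \<Rightarrow> patch U r e c z R L \<and> x0 \<in> chart_inv c ` ball z (R / 2))"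
    using patch_exists by (simp only: split_paired_Ex prod.case) blast
  then obtain p where p: "\<And>x0. (case p x0 of (U, r, e, c, z, R, L) \<Rightarrow> patch U r e c z R L \<and> x0 \<in> chart_inv c ` ball z (R / 2))"
    using choice[of "\<lambda>x0 p. (case p of (U, r, e, c, z, R, L) \<Rightarrow> patch U r e c z R L \<and> x0 \<in> chart_inv c ` ball z (R / 2))"] by blast
  define U where "U x = fst (p x)" for x
  define r where "r x = fst (snd (p x))" for x
  define e where "e x = fst (snd (snd (p x)))" for x
  define c where "c x = fst (snd (snd (snd (p x))))" for x
  define z where "z x = fst (snd (snd (snd (snd (p x)))))" for x
  define R where "R x = fst (snd (snd (snd (snd (snd (p x))))))" for x
  define L where "L x = snd (snd (snd (snd (snd (snd (p x))))))" for x
  have pt: "patch (U x) (r x) (e x) (c x) (z x) (R x) (L x)" and inx: "x \<in> chart_inv (c x) ` ball (z x) (R x / 2)" for x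
    using p[of x] by (simp_all add: U_def r_def e_def c_def z_def R_def L_def case_prod_unfold)
  \<comment> \<open>The estimate consumes bounds on the big sets \<open>K\<close> and yields results
    on the closed half balls \<open>K'\<close>; the open half balls \<open>G\<close> are there for
    compactness of the manifold.\<close>
  define K where "K x = chart_inv (c x) ` cball (z x) (R x)" for x
  define K' where "K' x = chart_inv (c x) ` cball (z x) (R x / 2)" for x
  define G where "G x = chart_inv (c x) ` ball (z x) (R x / 2)" for x
  have Rpos: "R x > 0" for x by (rule patchD(3)[OF pt])
  have KU: "K x \<subseteq> U x" "K' x \<subseteq> U x" and cK: "compact (K x)" "compact (K' x)" and oG: "open (G x)" and GK: "G x \<subseteq> K' x" for x
    using patch_set[OF pt, of "R x" x] patch_set[OF pt, of "R x / 2" x] Rpos[of x]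
    by (auto simp: K_def K'_def G_def)
  obtain F where F: "finite F" "UNIV \<subseteq> (\<Union>x\<in>F. G x)"
  proof (rule compactE_image[OF comp, of UNIV G])
    show "UNIV \<subseteq> \<Union> (range G)" using inx unfolding G_def by blast
  qed (use oG that in auto)
  have cover: "\<exists>y\<in>F. q \<in> K' y" for q using F(2) GK by blast
  have smc: "smooth_fun A (U x \<inter> U y) (\<lambda>q. fcoef E (r x) (e x) q (e y l q) i)" if "l < r y" "i < r x" for x y l i
  proof (rule smooth_fcoef[OF patchD(1)[OF pt] _ _ _ that(2)])
    show "open (U x \<inter> U y)" using open_frame patchD(1)[OF pt] by blast
    show "smooth_coeffs A (smul E) (U x \<inter> U y) (r x) (e x) (e y l)"
      using E patchD(1)[OF pt, of x] patchD(1)[OF pt, of y] that unfolding complex_vector_bundle_def by blast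
  qed auto
  \<comment> \<open>A bound for the frame change from patch \<open>y\<close> to patch
    \<open>x\<close>. It exists because \<open>K x\<close> and \<open>K' y\<close> are compact and
    lie inside the domains of the two frames.\<close>
  define Q where "Q x y M \<longleftrightarrow> M \<ge> 0 \<and> (\<forall>q\<in>K x \<inter> K' y. \<forall>(l, i)\<in>{..<r y} \<times> {..<r x}. cmod (fcoef E (r x) (e x) q (e y l q) i) \<le> M)"
    for x y and M :: real
  define m where "m x y = (SOME M. Q x y M)" for x y
  have m: "Q x y (m x y)" for x y
    unfolding m_def
  proof (rule someI_ex[where P = "Q x y"])
    have "\<exists>M\<ge>0. \<forall>q\<in>K x \<inter> K' y. \<forall>j\<in>{..<r y} \<times> {..<r x}. cmod ((\<lambda>j q. fcoef E (r x) (e x) q (e y (fst j) q) (snd j)) j q) \<le> M"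
    proof (rule bounded_on_compact)
      show "compact (K x \<inter> K' y)" using cK by (intro compact_Int)
      fix j assume j: "j \<in> {..<r y} \<times> {..<r x}"
      have o: "open (U x \<inter> U y)" using open_frame patchD(1)[OF pt] by blast
      show "continuous_on (K x \<inter> K' y) (\<lambda>q. fcoef E (r x) (e x) q (e y (fst j) q) (snd j))"
        by (rule continuous_on_subset[OF smooth_fun_continuous[OF A o smc]]) (use j KU in auto)
    qed simp
    then show "\<exists>M. Q x y M" unfolding Q_def by auto
  qed
  \<comment> \<open>Dominates the loss in passing from the half balls to a big ball: a coefficient
    there is a sum of \<open>r y\<close> terms, each at most \<open>m x y\<close> times the old
    bound.\<close>
  define M where "M = 1 + (\<Sum>x\<in>F. \<Sum>y\<in>F. r y * m x y)"
  have m0: "m x y \<ge> 0" for x y using m unfolding Q_def by blast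
  have M: "r y * m x y \<le> M" "M \<ge> 1" if "x \<in> F" "y \<in> F" for x y
  proof -
    have "r y * m x y \<le> (\<Sum>y\<in>F. r y * m x y)"
      by (rule member_le_sum[OF that(2), of "\<lambda>y. r y * m x y"]) (use m0 F in auto)
    also have "\<dots> \<le> (\<Sum>x\<in>F. \<Sum>y\<in>F. r y * m x y)"
      by (rule member_le_sum[OF that(1), of "\<lambda>x. \<Sum>y\<in>F. r y * m x y"]) (use m0 F in \<open>auto intro: sum_nonneg\<close>)
    finally show "r y * m x y \<le> M" by (simp add: M_def)
    show "M \<ge> 1" using m0 by (auto simp: M_def intro!: sum_nonneg)
  qed
  have M1: "M \<ge> 1" using m0 by (auto simp: M_def intro!: sum_nonneg)
  define Lm where "Lm = 1 + (\<Sum>x\<in>F. L x)"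
  have L0: "L x \<ge> 0" for x by (rule patchD(5)[OF pt])
  have Lm: "Lm \<ge> 1" using L0 by (auto simp: Lm_def intro!: sum_nonneg)
  have LLm: "L x \<le> Lm" if "x \<in> F" for x
    using member_le_sum[OF that, of L] L0 F by (auto simp: Lm_def)
  \<comment> \<open>The mesh for which \<open>Lm * (M * B) * \<delta>\<close> equals
    \<open>B / 2\<close>. It does not involve the section or its bound, so one net serves every
    round of halving.\<close>
  define \<delta> where "\<delta> = 1 / (2 * Lm * M)"
  have d: "\<delta> > 0" using Lm M1 by (simp add: \<delta>_def)
  have "\<exists>Z. finite Z \<and> Z \<subseteq> cball (z x) (R x / 2) \<and> cball (z x) (R x / 2) \<subseteq> (\<Union>w\<in>Z. ball w \<delta>)" for x
  proof -
    have "\<forall>e>0. \<exists>k. finite k \<and> k \<subseteq> cball (z x) (R x / 2) \<and> cball (z x) (R x / 2) \<subseteq> (\<Union>w\<in>k. ball w e)"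
      by (rule seq_compact_imp_totally_bounded[OF compact_imp_seq_compact[OF compact_cball]])
    then show ?thesis using d by blast
  qed
  then have "\<forall>x. \<exists>Z. finite Z \<and> Z \<subseteq> cball (z x) (R x / 2) \<and> cball (z x) (R x / 2) \<subseteq> (\<Union>w\<in>Z. ball w \<delta>)" ..
  from choice[OF this] obtain Z where "\<forall>x. finite (Z x) \<and> Z x \<subseteq> cball (z x) (R x / 2) \<and>
    cball (z x) (R x / 2) \<subseteq> (\<Union>w\<in>Z x. ball w \<delta>)" ..
  then have Z: "finite (Z x)" "Z x \<subseteq> cball (z x) (R x / 2)"
    "cball (z x) (R x / 2) \<subseteq> (\<Union>w\<in>Z x. ball w \<delta>)" for x by blast+
  define P where "P = (\<Union>x\<in>F. chart_inv (c x) ` Z x)"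
  define f where "f s x q i = fcoef E (r x) (e x) q (s q) i" for s x q i
  define bd where "bd s B \<longleftrightarrow> (\<forall>x\<in>F. \<forall>q\<in>K' x. \<forall>i<r x. cmod (f s x q i) \<le> B)" for s B
  have halve: "bd s (B / 2)" if s: "s \<in> H0 A E D" and sP: "\<forall>x\<in>P. s x = 0" and B: "B > 0" "bd s B" for s B
  proof -
    have ss: "s \<in> sections A E" using s by (simp add: H0_def)
    have big: "cmod (f s x q i) \<le> M * B" if x: "x \<in> F" and q: "q \<in> K x" and i: "i < r x" for x q i
    proof -
      obtain y where y: "y \<in> F" "q \<in> K' y" using cover by blast
      have qU: "q \<in> U x" "q \<in> U y" using KU q y by blast+
      have "cmod (f s x q i) = cmod (\<Sum>l<r y. f s y q l * fcoef E (r x) (e x) q (e y l q) i)"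
        unfolding f_def
        using fcoef_frame_change[OF patchD(1)[OF pt] qU(1) patchD(1)[OF pt] qU(2) sectionD_fibre[OF ss] i] by simp
      also have "\<dots> \<le> (\<Sum>l<r y. B * m x y)"
      proof (rule order_trans[OF norm_sum], rule sum_mono)
        fix l assume l: "l \<in> {..<r y}"
        have "cmod (f s y q l) \<le> B" using B(2) y l unfolding bd_def by blast
        moreover have "cmod (fcoef E (r x) (e x) q (e y l q) i) \<le> m x y"
          using m[of x y] q y(2) l i unfolding Q_def by blast
        ultimately show "norm (f s y q l * fcoef E (r x) (e x) q (e y l q) i) \<le> B * m x y"
          unfolding norm_mult using B(1) by (intro mult_mono) auto
      qed
      also have "\<dots> = (r y * m x y) * B" by simp
      also have "\<dots> \<le> M * B" using M(1)[OF x y(1)] B(1) by (intro mult_right_mono) auto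
      finally show ?thesis .
    qed
    show ?thesis
      unfolding bd_def
    proof (intro ballI allI impI)
      fix x q i assume x: "x \<in> F" and q: "q \<in> K' x" and i: "i < r x"
      obtain w where w: "w \<in> cball (z x) (R x / 2)" "q = chart_inv (c x) w" using q unfolding K'_def by blast
      obtain v where v: "v \<in> Z x" "w \<in> ball v \<delta>" using Z(3)[of x] w(1) by blast
      have vc: "v \<in> cball (z x) (R x / 2)" using Z(2) v(1) by blast
      let ?v = "chart_inv (c x) v"
      have vP: "s ?v = 0" using sP x v(1) by (auto simp: P_def)
      have vU: "?v \<in> U x" using KU(2)[of x] vc unfolding K'_def by blast
      have v0: "fcoef E (r x) (e x) ?v (s ?v) i = 0"
        by (rule fcoef_unique[OF patchD(1)[OF pt] vU _ i, of _ "\<lambda>_. 0"]) (simp add: vP)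
      have "cmod (fcoef E (r x) (e x) q (s q) i - fcoef E (r x) (e x) ?v (s ?v) i) \<le> L x * (M * B) * dist w v"
        unfolding w(2)
      proof (rule patch_lipschitz[OF pt s _ _ w(1) vc i])
        show "M * B > 0" using M1 B by simp
        show "cmod (fcoef E (r x) (e x) (chart_inv (c x) y) (s (chart_inv (c x) y)) i) \<le> M * B"
          if "y \<in> cball (z x) (R x)" "i < r x" for y i
          using big[OF x _ that(2), of "chart_inv (c x) y"] that(1) unfolding K_def f_def by blast
      qed
      also have "\<dots> \<le> Lm * (M * B) * \<delta>"
        using LLm[OF x] L0[of x] M1 B(1) v(2) by (intro mult_mono) (auto simp: dist_commute)
      also have "\<dots> = B / 2" using Lm M1 by (simp add: \<delta>_def)
      finally show "cmod (f s x q i) \<le> B / 2" by (simp add: v0 f_def)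
    qed
  qed
  show ?thesis
  proof (intro exI[of _ P] conjI ballI impI)
    show "finite P" unfolding P_def using F Z by blast
    fix s assume s: "s \<in> H0 A E D" and sP: "\<forall>x\<in>P. s x = 0"
    have ss: "s \<in> sections A E" using s by (simp add: H0_def)
    have "\<exists>B\<ge>0. \<forall>q\<in>K' x. \<forall>i\<in>{..<r x}. cmod (f s x q i) \<le> B" for x
    proof (rule bounded_on_compact[where f = "\<lambda>i q. f s x q i", OF cK(2) finite_lessThan])
      fix i assume i: "i \<in> {..<r x}"
      show "continuous_on (K' x) (\<lambda>q. f s x q i)"
        unfolding f_def
        by (rule continuous_on_subset[OF smooth_fun_continuous[OF A open_frame smooth_section_fcoef[OF ss]] KU(2)])
          (use i patchD(1)[OF pt] in auto)
    qed
    then obtain b where b: "\<And>x. b x \<ge> 0" "\<And>x. \<forall>q\<in>K' x. \<forall>i\<in>{..<r x}. cmod (f s x q i) \<le> b x" by metis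
    define B where "B = 1 + (\<Sum>x\<in>F. b x)"
    have B: "B > 0" unfolding B_def using b(1) by (intro add_pos_nonneg sum_nonneg) auto
    have "bd s B"
      unfolding bd_def
    proof (intro ballI allI impI)
      fix x q i assume h: "x \<in> F" "q \<in> K' x" "i < r x"
      have "cmod (f s x q i) \<le> b x" using b(2) h by blast
      also have "\<dots> \<le> B" using member_le_sum[OF h(1), of b] b(1) F by (auto simp: B_def)
      finally show "cmod (f s x q i) \<le> B" .
    qed
    then have small: "bd s (B / 2 ^ k)" for k
    proof (induction k)
      case (Suc k)
      from halve[OF s sP _ Suc.IH[OF Suc.prems]] B show ?case by (simp add: mult.commute)
    qed simp
    show "s = (\<lambda>_. 0)"
    proof
      fix q
      obtain x where x: "x \<in> F" "q \<in> K' x" using cover by blast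
      have z0: "f s x q i = 0" if i: "i < r x" for i
      proof -
        have le: "cmod (f s x q i) \<le> B / 2 ^ k" for k using small x i unfolding bd_def by blast
        have "(\<lambda>k. B * (1 / 2) ^ k) \<longlonglongrightarrow> B * 0" by (intro tendsto_mult tendsto_const LIMSEQ_realpow_zero) auto
        then have "(\<lambda>k. B / 2 ^ k) \<longlonglongrightarrow> 0" by (simp add: power_one_over field_simps)
        then have "cmod (f s x q i) \<le> 0" by (rule LIMSEQ_le_const) (use le in blast)
        then show ?thesis by simp
      qed
      have "s q = (\<Sum>i<r x. smul E (f s x q i) (e x i q))"
        unfolding f_def by (rule fcoef_eq[OF patchD(1)[OF pt] _ sectionD_fibre[OF ss]]) (use KU x in blast)
      then show "s q = 0" using z0 by simp
    qed
  qed
qed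

section \<open>The space of holomorphic sections as a vector space\<close>

lemma vector_space_sections: "vector_space (section_scale E)"
  by unfold_locales
    (auto simp: section_scale_def fun_eq_iff vs.scale_right_distrib vs.scale_left_distrib)

lemma subspace_H0: "module.subspace (section_scale E) (H0 A E D)"
proof -
  interpret sv: vector_space "section_scale E" by (rule vector_space_sections)
  show ?thesis
  proof (rule sv.subspaceI)
    show "0 \<in> H0 A E D"
      using sections_zero D_zero by (simp add: H0_def zero_fun_def)
    show "s + t \<in> H0 A E D" if "s \<in> H0 A E D" "t \<in> H0 A E D" for s t
      using that sections_add[of s t] D_add[of s t] by (simp add: H0_def plus_fun_def)
    show "section_scale E k s \<in> H0 A E D" if "s \<in> H0 A E D" for k s
      using that sections_mult[OF smooth_fun_const[OF A], of s k] D_scale[of s k] by (simp add: H0_def section_scale_def)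
  qed
qed

text \<open>The separating functionals are the coefficients of the values at the points of the net,
  each taken in some frame around its point.\<close>

theorem finite_dimensional_H0:
  assumes "compact (UNIV :: 'x set)"
  shows "finite_dimensional_subspace (section_scale E) (H0 A E D)"
proof -
  obtain P where P: "finite P" "\<And>s. s \<in> H0 A E D \<Longrightarrow> \<forall>x\<in>P. s x = 0 \<Longrightarrow> s = (\<lambda>_. 0)"
    using determined_by_finite_set[OF assms] by blast
  have "\<forall>x. \<exists>p. (case p of (U, r, e) \<Rightarrow> (U, r, e) \<in> frames E \<and> x \<in> U)"
    using frame_at by (simp only: split_paired_Ex prod.case) blast
  then obtain p where p: "\<And>x. (case p x of (U, r, e) \<Rightarrow> (U, r, e) \<in> frames E \<and> x \<in> U)"
    using choice[of "\<lambda>x p. (case p of (U, r, e) \<Rightarrow> (U, r, e) \<in> frames E \<and> x \<in> U)"] by blast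
  define U where "U x = fst (p x)" for x
  define r where "r x = fst (snd (p x))" for x
  define e where "e x = snd (snd (p x))" for x
  have f: "(U x, r x, e x) \<in> frames E" "x \<in> U x" for x
    using p[of x] by (simp_all add: U_def r_def e_def case_prod_unfold)
  define fn where "fn i s = (case i of (x, l) \<Rightarrow> fcoef E (r x) (e x) x (s x) l)" for i s
  have fib: "s x \<in> fibre E x" if "s \<in> H0 A E D" for s x using that sectionD_fibre by (auto simp: H0_def)
  show ?thesis
  proof (rule finite_dimensional_by_functionals[OF vector_space_sections _ subspace_H0, of "SIGMA x:P. {..<r x}" fn])
    show "finite (SIGMA x:P. {..<r x})" using P(1) by blast
    show "fn i (s + t) = fn i s + fn i t" if "i \<in> (SIGMA x:P. {..<r x})" "s \<in> H0 A E D" "t \<in> H0 A E D" for i s t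
      using that by (auto simp: fn_def fcoef_add[OF f fib fib])
    show "fn i (section_scale E k s) = k * fn i s" if "i \<in> (SIGMA x:P. {..<r x})" "s \<in> H0 A E D" for i k s
      using that by (auto simp: fn_def section_scale_def fcoef_scale[OF f fib])
    show "s = 0" if s: "s \<in> H0 A E D" and z: "\<forall>i\<in>(SIGMA x:P. {..<r x}). fn i s = 0" for s
    proof -
      have "s x = 0" if x: "x \<in> P" for x
      proof -
        have "fcoef E (r x) (e x) x (s x) l = 0" if "l < r x" for l
          using z x that by (auto simp: fn_def)
        then show ?thesis using fcoef_eq[OF f fib[OF s], of x] by simp
      qed
      then have "s = (\<lambda>_. 0)" using P(2)[OF s] by blast
      then show ?thesis by (simp add: zero_fun_def)
    qed
  qed
qed

end

section \<open>The exterior derivative in coordinates\<close>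

text \<open>On the left \<open>x\<close> stands at position \<open>a\<close>, on the right at
  position \<open>b - 1\<close>, and the other arguments come in the same order;
  \<open>b - a - 1\<close> adjacent transpositions lead from one list to the other.\<close>

lemma alt_form_omit_shift:
  assumes w: "alt_form k \<omega>" and ab: "a < b" "b \<le> k"
  shows "\<omega> (omit b (v(a := x))) = (- 1) ^ (b - a - 1) * \<omega> (omit a (v(b := x)))"
  using ab
proof (induction "b - a - 1" arbitrary: b v)
  case 0
  then have b: "b = Suc a" by simp
  have e: "omit b (v(a := x)) = omit a (v(b := x))" by (auto simp: fun_eq_iff omit_def b)
  have z: "b - a - 1 = 0" by (simp add: b)
  show ?case unfolding e z by (simp only: power_0 mult_1_left)
next
  case (Suc m)
  then obtain b' where b: "b = Suc b'" "a < b'" by (cases b) auto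
  let ?t = "Transposition.transpose (b' - 1) b'"
  \<comment> \<open>Overwriting one entry makes omission of \<open>b'\<close> from \<open>v'\<close>
    the same as omission of \<open>b\<close> from \<open>v\<close>, so the induction hypothesis for
    \<open>b'\<close> applies; one transposition restores the original order.\<close>
  define v' where "v' = v(Suc b' := v b')"
  have e1: "omit b (v(a := x)) = omit b' (v'(a := x))"
    using b by (auto simp: fun_eq_iff omit_def v'_def)
  have e2: "omit a (v'(b' := x)) = omit a (v(b := x)) \<circ> ?t"
    using b by (auto simp: fun_eq_iff omit_def v'_def Transposition.transpose_def)
  have "\<omega> (omit b (v(a := x))) = (- 1) ^ (b' - a - 1) * \<omega> (omit a (v'(b' := x)))"
    unfolding e1 by (rule Suc.hyps(1)) (use Suc.hyps(2) Suc.prems b in auto)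
  also have "\<omega> (omit a (v'(b' := x))) = - \<omega> (omit a (v(b := x)))"
    unfolding e2 by (rule alt_form_transpose[OF w]) (use b Suc.prems in auto)
  also have "(- 1) ^ (b' - a - 1) * - \<omega> (omit a (v(b := x))) = (- 1) ^ (b - a - 1) * \<omega> (omit a (v(b := x)))"
  proof -
    have "b - a - 1 = Suc (b' - a - 1)" using b by simp
    then show ?thesis by simp
  qed
  finally show ?case .
qed

lemma omit_upd_same: "omit i (v(i := x)) = omit i v"
  by (auto simp: fun_eq_iff omit_def)

lemma omit_upd:
  assumes "s \<noteq> i"
  shows "omit i (v(s := x)) = (omit i v)((if s < i then s else s - 1) := x)"
    and "omit i v (if s < i then s else s - 1) = v s"
  using assms by (auto simp: fun_eq_iff omit_def)

text \<open>This is the shape of an exterior derivative. If two arguments coincide, every summand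
  that keeps both of them vanishes, and the two summands that omit one of them cancel.\<close>

lemma alt_form_alternating_sum:
  fixes B :: "'e::euclidean_space \<Rightarrow> 'e form"
  assumes a: "\<And>u. alt_form k (B u)" and l: "\<And>w. linear (\<lambda>u. B u w)"
  shows "alt_form (Suc k) (\<lambda>v. \<Sum>i\<le>k. (- 1) ^ i * B (v i) (omit i v))"
  unfolding alt_form_def
proof (intro conjI allI impI)
  fix v w :: "nat \<Rightarrow> 'e" assume vw: "\<forall>i<Suc k. v i = w i"
  have "B (v i) (omit i v) = B (w i) (omit i w)" if "i \<le> k" for i
  proof -
    have "B (v i) (omit i v) = B (v i) (omit i w)"
      by (rule alt_form_cong[OF a]) (use vw that in \<open>auto simp: omit_def\<close>)
    then show ?thesis using vw that by simp
  qed
  then show "(\<Sum>i\<le>k. (- 1) ^ i * B (v i) (omit i v)) = (\<Sum>i\<le>k. (- 1) ^ i * B (w i) (omit i w))"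
    by (intro sum.cong) auto
next
  fix v :: "nat \<Rightarrow> 'e" and s assume s: "s < Suc k"
  show "linear (\<lambda>x. \<Sum>i\<le>k. (- 1) ^ i * B ((v(s := x)) i) (omit i (v(s := x))))"
  proof (rule linear_compose_sum, rule ballI)
    fix i assume i: "i \<in> {..k}"
    have "linear (\<lambda>x. B ((v(s := x)) i) (omit i (v(s := x))))"
    proof (cases "s = i")
      case True
      then show ?thesis using l[of "omit i v"] by (simp add: omit_upd_same)
    next
      case False
      have "(if s < i then s else s - 1) < k" using False s i by auto
      then show ?thesis using alt_form_linear[OF a] False by (simp add: omit_upd(1))
    qed
    from linear_compose[OF this, of "(*) ((- 1) ^ i)"]
    show "linear (\<lambda>x. (- 1) ^ i * B ((v(s := x)) i) (omit i (v(s := x))))"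
      by (simp add: o_def bounded_linear.linear bounded_linear_mult_right)
  qed
next
  have main: "(\<Sum>i\<le>k. (- 1) ^ i * B (v i) (omit i v)) = 0" if ab: "a < b" "b \<le> k" and vab: "v a = v b"
    for v :: "nat \<Rightarrow> 'e" and a b
  proof -
    have z: "B (v i) (omit i v) = 0" if i: "i \<in> {..k} - {a, b}" for i
    proof -
      have ne: "a \<noteq> i" "b \<noteq> i" using i by auto
      show ?thesis
        by (rule alt_form_eq_0[OF a, of "if a < i then a else a - 1" "if b < i then b else b - 1"])
          (use ne i ab vab omit_upd(2)[OF ne(1), of v] omit_upd(2)[OF ne(2), of v] in \<open>auto split: if_splits\<close>)
    qed
    have "v(a := v a) = v" "v(b := v a) = v" using vab by auto
    then have "B (v b) (omit b v) = (- 1) ^ (b - a - 1) * B (v a) (omit a v)"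
      using alt_form_omit_shift[OF a ab, of "v b" v "v a"] vab by simp
    then have "(- 1) ^ b * B (v b) (omit b v) = - ((- 1) ^ a * B (v a) (omit a v))"
    proof -
      obtain d where b: "b = Suc (a + d)" using less_imp_Suc_add[OF ab(1)] by blast
      have "(- 1) ^ b * (- 1) ^ (b - a - 1) = - ((- 1) ^ a :: complex)"
        unfolding b by (simp add: power_add mult.assoc[symmetric])
      then show ?thesis
        unfolding \<open>B (v b) (omit b v) = _\<close> by (metis mult.assoc mult_minus_left)
    qed
    moreover have "(\<Sum>i\<le>k. (- 1) ^ i * B (v i) (omit i v)) = (\<Sum>i\<in>{a, b}. (- 1) ^ i * B (v i) (omit i v))"
      by (rule sum.mono_neutral_right) (use ab z in auto)
    ultimately show ?thesis using ab by simp
  qed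
  fix v :: "nat \<Rightarrow> 'e" and a b assume "a < Suc k \<and> b < Suc k \<and> a \<noteq> b \<and> v a = v b"
  then show "(\<Sum>i\<le>k. (- 1) ^ i * B (v i) (omit i v)) = 0"
    using main[of a b v] main[of b a v] by (cases "a < b") auto
qed

definition form_field :: "'e::euclidean_space set \<Rightarrow> nat \<Rightarrow> ('e \<Rightarrow> 'e form) \<Rightarrow> bool" where
  "form_field T k \<Omega> \<longleftrightarrow> open T \<and> (\<forall>y\<in>T. alt_form k (\<Omega> y)) \<and> (\<forall>w. smooth_on T (\<lambda>y. \<Omega> y w))"

lemma form_fieldD:
  assumes "form_field T k \<Omega>"
  shows "open T" "y \<in> T \<Longrightarrow> alt_form k (\<Omega> y)" "smooth_on T (\<lambda>y. \<Omega> y w)"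
  using assms unfolding form_field_def by auto

text \<open>The exterior derivative on an open subset of Euclidean space; \<open>ext_d\<close> is
  this operator in the chart chosen at the point.\<close>

definition ed :: "nat \<Rightarrow> ('e::euclidean_space \<Rightarrow> 'e form) \<Rightarrow> 'e \<Rightarrow> 'e form" where
  "ed k \<Omega> z = (\<lambda>v. \<Sum>i\<le>k. (- 1) ^ i * ddir (v i) (\<lambda>y. \<Omega> y (omit i v)) z)"

lemma ed_cong:
  assumes "open T" "z \<in> T" "\<And>y w. y \<in> T \<Longrightarrow> \<Omega> y w = \<Omega>' y w"
  shows "ed k \<Omega> z = ed k \<Omega>' z"
  unfolding ed_def
  by (intro ext sum.cong refl arg_cong2[where f = "(*)"] ddir_cong_open[OF assms(1,2)] assms(3))

lemma alt_form_ddir: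
  assumes f: "form_field T k \<Omega>" and z: "z \<in> T"
  shows "alt_form k (\<lambda>w. ddir u (\<lambda>y. \<Omega> y w) z)"
proof -
  note o = form_fieldD(1)[OF f]
  have df: "(\<lambda>y. \<Omega> y w) differentiable (at z)" for w
    by (rule smooth_on_differentiable[OF form_fieldD(3)[OF f] z])
  show ?thesis
    unfolding alt_form_def
  proof (intro conjI allI impI)
    fix v w :: "nat \<Rightarrow> 'a" assume vw: "\<forall>i<k. v i = w i"
    show "ddir u (\<lambda>y. \<Omega> y v) z = ddir u (\<lambda>y. \<Omega> y w) z"
      by (rule ddir_cong_open[OF o z]) (rule alt_form_cong[OF form_fieldD(2)[OF f]], use vw in auto)
  next
    fix v :: "nat \<Rightarrow> 'a" and i assume i: "i < k"
    have l: "linear (\<lambda>x. \<Omega> y (v(i := x)))" if "y \<in> T" for y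
      by (rule alt_form_linear[OF form_fieldD(2)[OF f that] i])
    show "linear (\<lambda>x. ddir u (\<lambda>y. \<Omega> y (v(i := x))) z)"
    proof (rule linearI)
      fix x x' :: 'a and c :: real
      have "ddir u (\<lambda>y. \<Omega> y (v(i := x + x'))) z = ddir u (\<lambda>y. \<Omega> y (v(i := x)) + \<Omega> y (v(i := x'))) z"
        by (rule ddir_cong_open[OF o z]) (rule linear_add[OF l])
      then show "ddir u (\<lambda>y. \<Omega> y (v(i := x + x'))) z =
          ddir u (\<lambda>y. \<Omega> y (v(i := x))) z + ddir u (\<lambda>y. \<Omega> y (v(i := x'))) z"
        by (simp only: ddir_add[OF df df])
      have "ddir u (\<lambda>y. \<Omega> y (v(i := c *\<^sub>R x))) z = ddir u (\<lambda>y. c *\<^sub>R \<Omega> y (v(i := x))) z"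
        by (rule ddir_cong_open[OF o z]) (rule linear_scale[OF l])
      then show "ddir u (\<lambda>y. \<Omega> y (v(i := c *\<^sub>R x))) z = c *\<^sub>R ddir u (\<lambda>y. \<Omega> y (v(i := x))) z"
        by (simp only: ddir_linear_comp[OF bounded_linear_scaleR_right df])
    qed
  next
    fix v :: "nat \<Rightarrow> 'a" and a b assume ab: "a < k \<and> b < k \<and> a \<noteq> b \<and> v a = v b"
    have "ddir u (\<lambda>y. \<Omega> y v) z = ddir u (\<lambda>_. 0) z"
      by (rule ddir_cong_open[OF o z]) (rule alt_form_eq_0[OF form_fieldD(2)[OF f], of _ a b], use ab in auto)
    then show "ddir u (\<lambda>y. \<Omega> y v) z = 0" by simp
  qed
qed

lemma alt_form_ed:
  assumes "form_field T k \<Omega>" "z \<in> T"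
  shows "alt_form (Suc k) (ed k \<Omega> z)"
  unfolding ed_def
  by (rule alt_form_alternating_sum[OF alt_form_ddir[OF assms]])
    (rule linear_ddir[OF smooth_on_differentiable[OF form_fieldD(3)[OF assms(1)] assms(2)]])

lemma form_field_expand:
  fixes \<Omega> :: "'e::euclidean_space \<Rightarrow> 'e form"
  assumes f: "form_field T k \<Omega>" and y: "y \<in> T"
  shows "\<Omega> y w = (\<Sum>f\<in>PiE {..<k} (\<lambda>_. Basis). (\<Prod>i<k. of_real (w i \<bullet> f i)) * \<Omega> y f)"
proof -
  note a = form_fieldD(2)[OF f y]
  have "\<Omega> y (\<lambda>l. if l < k then f l else w l) = \<Omega> y f" for f by (rule alt_form_cong[OF a]) simp
  then show ?thesis using alt_form_expand[OF a order_refl, of w] by simp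
qed

lemma smooth_form_eval:
  fixes \<Omega> :: "'e::euclidean_space \<Rightarrow> 'e form" and g :: "'f::euclidean_space \<Rightarrow> 'e"
  assumes f: "form_field T k \<Omega>" and S: "open S" and g: "smooth_on S g" "g ` S \<subseteq> T"
    and W: "\<And>i. i < k \<Longrightarrow> smooth_on S (\<lambda>y. W y i)"
  shows "smooth_on S (\<lambda>y. \<Omega> (g y) (W y))"
proof -
  have "smooth_on S (\<lambda>y. \<Sum>f\<in>PiE {..<k} (\<lambda>_. Basis). (\<Prod>i<k. of_real (W y i \<bullet> f i)) * \<Omega> (g y) f)"
    by (intro smooth_on_sum smooth_on_mult S smooth_on_prod smooth_on_linear_comp[OF bounded_linear_of_real]
        smooth_on_linear_comp[OF bounded_linear_inner_left] W
        smooth_on_compose[OF S form_fieldD(1)[OF f] form_fieldD(3)[OF f] g]) simp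
  then show ?thesis
    by (rule smooth_on_cong[OF S, rotated]) (use form_field_expand[OF f] g(2) in \<open>auto simp: image_subset_iff\<close>)
qed

text \<open>Expand the arguments in the standard basis.\<close>
lemma ddir_form_eval:
  fixes \<Omega> :: "'e::euclidean_space \<Rightarrow> 'e form" and g :: "'f::euclidean_space \<Rightarrow> 'e"
  assumes f: "form_field T k \<Omega>" and S: "open S" "z \<in> S" and g: "smooth_on S g" "g ` S \<subseteq> T"
    and W: "\<And>i. i < k \<Longrightarrow> smooth_on S (\<lambda>y. W y i)"
  shows "ddir u (\<lambda>y. \<Omega> (g y) (W y)) z = ddir (ddir u g z) (\<lambda>y. \<Omega> y (W z)) (g z) +
    (\<Sum>l<k. \<Omega> (g z) ((W z)(l := ddir u (\<lambda>y. W y l) z)))"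
proof -
  let ?F = "PiE {..<k} (\<lambda>_. Basis :: 'e set)"
  define W' where "W' l = ddir u (\<lambda>y. W y l) z" for l
  have gz: "g z \<in> T" using g(2) S(2) by blast
  have Wd: "((\<lambda>y. complex_of_real (W y i \<bullet> b)) has_derivative (\<lambda>u. of_real (ddir u (\<lambda>y. W y i) z \<bullet> b))) (at z)"
    if "i < k" for i b
    by (intro bounded_linear.has_derivative[OF bounded_linear_of_real]
        bounded_linear.has_derivative[OF bounded_linear_inner_left] smooth_on_has_derivative[OF W[OF that] S(2)])
  have prd: "ddir u (\<lambda>y. \<Prod>i<k. complex_of_real (W y i \<bullet> f i)) z =
      (\<Sum>l<k. of_real (W' l \<bullet> f l) * (\<Prod>i\<in>{..<k} - {l}. of_real (W z i \<bullet> f i)))"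
    and prd2: "(\<lambda>y. \<Prod>i<k. complex_of_real (W y i \<bullet> f i)) differentiable (at z)" for f
  proof -
    have "((\<lambda>y. \<Prod>i<k. complex_of_real (W y i \<bullet> f i)) has_derivative
      (\<lambda>u. \<Sum>l<k. of_real (ddir u (\<lambda>y. W y l) z \<bullet> f l) * (\<Prod>i\<in>{..<k} - {l}. of_real (W z i \<bullet> f i)))) (at z)"
      by (rule has_derivative_prod) (use Wd in auto)
    then show "ddir u (\<lambda>y. \<Prod>i<k. complex_of_real (W y i \<bullet> f i)) z =
      (\<Sum>l<k. of_real (W' l \<bullet> f l) * (\<Prod>i\<in>{..<k} - {l}. of_real (W z i \<bullet> f i)))"
      "(\<lambda>y. \<Prod>i<k. complex_of_real (W y i \<bullet> f i)) differentiable (at z)"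
      unfolding W'_def by (rule ddir_eqI, rule differentiableI)
  qed
  have Od: "(\<lambda>y. \<Omega> y f) differentiable (at (g z))" for f
    by (rule smooth_on_differentiable[OF form_fieldD(3)[OF f] gz])
  have gd: "g differentiable (at z)" by (rule smooth_on_differentiable[OF g(1) S(2)])
  note comp = ddir_compose(1,2)[OF gd Od]
  have "ddir u (\<lambda>y. \<Omega> (g y) (W y)) z = ddir u (\<lambda>y. \<Sum>f\<in>?F. (\<Prod>i<k. of_real (W y i \<bullet> f i)) * \<Omega> (g y) f) z"
    by (rule ddir_cong_open[OF S]) (use form_field_expand[OF f] g(2) in \<open>auto simp: image_subset_iff\<close>)
  also have "\<dots> = (\<Sum>f\<in>?F. (\<Prod>i<k. of_real (W z i \<bullet> f i)) * ddir (ddir u g z) (\<lambda>y. \<Omega> y f) (g z) +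
      (\<Sum>l<k. of_real (W' l \<bullet> f l) * (\<Prod>i\<in>{..<k} - {l}. of_real (W z i \<bullet> f i))) * \<Omega> (g z) f)"
    by (subst ddir_sum[OF differentiable_mult[OF prd2 comp(1)]])
      (simp add: ddir_mult[OF prd2 comp(1)] comp(2) prd)
  also have "\<dots> = (\<Sum>f\<in>?F. (\<Prod>i<k. of_real (W z i \<bullet> f i)) * ddir (ddir u g z) (\<lambda>y. \<Omega> y f) (g z)) +
      (\<Sum>f\<in>?F. \<Sum>l<k. (of_real (W' l \<bullet> f l) * (\<Prod>i\<in>{..<k} - {l}. of_real (W z i \<bullet> f i))) * \<Omega> (g z) f)"
    by (simp add: sum.distrib sum_distrib_right)
  also have "(\<Sum>f\<in>?F. (\<Prod>i<k. of_real (W z i \<bullet> f i)) * ddir (ddir u g z) (\<lambda>y. \<Omega> y f) (g z)) =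
      ddir (ddir u g z) (\<lambda>y. \<Omega> y (W z)) (g z)"
  proof -
    have "ddir (ddir u g z) (\<lambda>y. \<Omega> y (W z)) (g z) =
        ddir (ddir u g z) (\<lambda>y. \<Sum>f\<in>?F. (\<Prod>i<k. of_real (W z i \<bullet> f i)) * \<Omega> y f) (g z)"
      by (rule ddir_cong_open[OF form_fieldD(1)[OF f] gz]) (rule form_field_expand[OF f])
    then show ?thesis
      by (subst (asm) ddir_sum) (auto simp: ddir_cmult[OF Od] intro: differentiable_mult Od)
  qed
  also have "(\<Sum>f\<in>?F. \<Sum>l<k. (of_real (W' l \<bullet> f l) * (\<Prod>i\<in>{..<k} - {l}. of_real (W z i \<bullet> f i))) * \<Omega> (g z) f) =
      (\<Sum>l<k. \<Omega> (g z) ((W z)(l := W' l)))"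
  proof (subst sum.swap, rule sum.cong[OF refl])
    fix l assume l: "l \<in> {..<k}"
    have "(\<Prod>i<k. complex_of_real (((W z)(l := W' l)) i \<bullet> f i)) =
      of_real (W' l \<bullet> f l) * (\<Prod>i\<in>{..<k} - {l}. of_real (W z i \<bullet> f i))" for f
    proof -
      have "(\<Prod>i<k. complex_of_real (((W z)(l := W' l)) i \<bullet> f i)) =
        of_real (((W z)(l := W' l)) l \<bullet> f l) * (\<Prod>i\<in>{..<k} - {l}. of_real (((W z)(l := W' l)) i \<bullet> f i))"
        using l by (intro prod.remove) auto
      also have "(\<Prod>i\<in>{..<k} - {l}. complex_of_real (((W z)(l := W' l)) i \<bullet> f i)) = (\<Prod>i\<in>{..<k} - {l}. of_real (W z i \<bullet> f i))"
        by (rule prod.cong) auto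
      finally show ?thesis by simp
    qed
    then show "(\<Sum>f\<in>?F. of_real (W' l \<bullet> f l) * (\<Prod>i\<in>{..<k} - {l}. of_real (W z i \<bullet> f i)) * \<Omega> (g z) f) =
      \<Omega> (g z) ((W z)(l := W' l))"
      by (subst form_field_expand[OF f gz]) simp
  qed
  finally show ?thesis by (simp only: W'_def)
qed

text \<open>The exterior derivative commutes with pullbacks: the terms with second derivatives of \<open>g\<close>
  cancel in pairs.\<close>
lemma ed_pullback:
  fixes \<Omega> :: "'e::euclidean_space \<Rightarrow> 'e form" and g :: "'f::euclidean_space \<Rightarrow> 'e"
  assumes f: "form_field T k \<Omega>" and S: "open S" "z \<in> S" and g: "smooth_on S g" "g ` S \<subseteq> T"
  shows "ed k (\<lambda>y w. \<Omega> (g y) (\<lambda>l. ddir (w l) g y)) z v = ed k \<Omega> (g z) (\<lambda>l. ddir (v l) g z)"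
proof -
  define V where "V l = ddir (v l) g z" for l
  define H where "H i m = ddir (v i) (ddir (v m) g) z" for i m
  have H: "H i m = H m i" for i m unfolding H_def by (rule ddir_commute[OF S(1) g(1) S(2)])
  have gz: "g z \<in> T" using g(2) S(2) by blast
  note a = form_fieldD(2)[OF f gz]
  \<comment> \<open>The index in the full list of the entry at position \<open>l\<close> after
    \<open>i\<close> has been omitted. It runs through all indices other than \<open>i\<close>, so
    the second derivatives are indexed by ordered pairs of distinct indices.\<close>
  define sk where "sk i l = (if l < i then l else Suc l)" for i l :: nat
  define X where "X i m = (- 1) ^ i * \<Omega> (g z) (omit i (V(m := H i m)))" for i m
  have anti: "X i m = - X m i" if im: "i < m" "m \<le> k" for i m
  proof -
    have e1: "\<Omega> (g z) (omit m (V(i := H i m))) = (- 1) ^ (m - i - 1) * \<Omega> (g z) (omit i (V(m := H i m)))"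
      by (rule alt_form_omit_shift[OF a im])
    obtain d where m: "m = Suc (i + d)" using less_imp_Suc_add[OF im(1)] by blast
    have e2: "(- 1) ^ m * (- 1) ^ (m - i - 1) = - ((- 1) ^ i :: complex)"
      unfolding m by (simp add: power_add mult.assoc[symmetric])
    have "X m i = ((- 1) ^ m * (- 1) ^ (m - i - 1)) * \<Omega> (g z) (omit i (V(m := H i m)))"
      unfolding X_def H[of m i] by (simp only: e1 mult.assoc)
    also have "\<dots> = - X i m" unfolding e2 X_def by (simp only: mult_minus_left)
    finally show ?thesis by (simp only: minus_minus)
  qed
  have anti': "X i m = - X m i" if "i \<le> k" "m \<le> k" "i \<noteq> m" for i m
    using anti[of i m] anti[of m i] that by (cases "i < m") auto
  have tm: "ddir (v i) (\<lambda>y. \<Omega> (g y) (\<lambda>l. ddir (omit i v l) g y)) z =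
      ddir (V i) (\<lambda>y. \<Omega> y (omit i V)) (g z) + (\<Sum>l<k. \<Omega> (g z) (omit i (V(sk i l := H i (sk i l)))))" if i: "i \<le> k" for i
  proof -
    have o1: "(\<lambda>l. ddir (omit i v l) g z) = omit i V" by (auto simp: fun_eq_iff omit_def V_def)
    have o2: "(omit i V)(l := ddir (v i) (ddir (omit i v l) g) z) = omit i (V(sk i l := H i (sk i l)))" for l
      by (auto simp: fun_eq_iff omit_def sk_def H_def)
    have "ddir (v i) (\<lambda>y. \<Omega> (g y) (\<lambda>l. ddir (omit i v l) g y)) z =
      ddir (ddir (v i) g z) (\<lambda>y. \<Omega> y (\<lambda>l. ddir (omit i v l) g z)) (g z) +
      (\<Sum>l<k. \<Omega> (g z) ((\<lambda>l. ddir (omit i v l) g z)(l := ddir (v i) (\<lambda>y. ddir (omit i v l) g y) z)))"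
      by (rule ddir_form_eval[OF f S g]) (rule smooth_onD_ddir[OF g(1)])
    then show ?thesis unfolding o1 o2 V_def .
  qed
  have "ed k (\<lambda>y w. \<Omega> (g y) (\<lambda>l. ddir (w l) g y)) z v = ed k \<Omega> (g z) V + (\<Sum>i\<le>k. \<Sum>l<k. X i (sk i l))"
    unfolding ed_def X_def by (simp add: tm distrib_left sum.distrib sum_distrib_left)
  also have "(\<Sum>i\<le>k. \<Sum>l<k. X i (sk i l)) = (\<Sum>i\<le>k. \<Sum>m\<le>k. if i = m then 0 else X i m)"
  proof (rule sum.cong[OF refl])
    fix i assume i: "i \<in> {..k}"
    have "bij_betw (sk i) {..<k} ({..k} - {i})"
      unfolding bij_betw_def
    proof
      show "inj_on (sk i) {..<k}" by (auto simp: inj_on_def sk_def split: if_splits)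
      show "sk i ` {..<k} = {..k} - {i}"
      proof
        show "{..k} - {i} \<subseteq> sk i ` {..<k}"
        proof
          fix m assume m: "m \<in> {..k} - {i}"
          show "m \<in> sk i ` {..<k}"
            by (rule image_eqI[of _ _ "if m < i then m else m - 1"]) (use m i in \<open>auto simp: sk_def\<close>)
        qed
      qed (auto simp: sk_def)
    qed
    from sum.reindex_bij_betw[OF this, of "X i"]
    have "(\<Sum>l<k. X i (sk i l)) = (\<Sum>m\<in>{..k} - {i}. X i m)" .
    also have "\<dots> = (\<Sum>m\<le>k. if i = m then 0 else X i m)"
      using i by (subst sum.remove[of "{..k}" i]) (auto intro!: sum.cong)
    finally show "(\<Sum>l<k. X i (sk i l)) = (\<Sum>m\<le>k. if i = m then 0 else X i m)" .
  qed
  also have "\<dots> = 0"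
  proof -
    let ?Y = "\<Sum>i\<le>k. \<Sum>m\<le>k. if i = m then 0 else X i m"
    have "?Y = (\<Sum>i\<le>k. \<Sum>m\<le>k. - (if m = i then 0 else X m i))"
    proof (rule sum.cong[OF refl], rule sum.cong[OF refl])
      fix i m assume "i \<in> {..k}" "m \<in> {..k}"
      then show "(if i = m then 0 else X i m) = - (if m = i then 0 else X m i)"
        using anti'[of i m] by (cases "i = m") simp_all
    qed
    also have "\<dots> = - (\<Sum>i\<le>k. \<Sum>m\<le>k. if m = i then 0 else X m i)" by (simp only: sum_negf)
    also have "(\<Sum>i\<le>k. \<Sum>m\<le>k. if m = i then 0 else X m i) = ?Y" by (rule sum.swap)
    finally show ?thesis by simp
  qed
  finally show ?thesis by (simp add: V_def[abs_def])
qed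

section \<open>Naturality and smoothness of the type projections\<close>

lemma tproj_conj:
  assumes "finite I" "\<And>x. h (j x) = j' (h x)"
  shows "tproj j c I (\<lambda>v. \<eta> (\<lambda>l. h (v l))) = (\<lambda>v. tproj j' c I \<eta> (\<lambda>l. h (v l)))"
  using assms(1)
proof (induction I rule: finite_induct)
  case (insert i I)
  have "(\<lambda>l. h ((v(i := j (v i))) l)) = (\<lambda>l. h (v l))(i := j' (h (v i)))" for v
    by (auto simp: fun_eq_iff assms(2))
  then show ?case unfolding tproj_insert[OF insert.hyps] insert.IH slot_def by simp
qed simp

text \<open>A slot inserts a vector that moves with the point. Linearity in that slot lets this
  vector be expanded in the basis, which leaves fixed arguments and smooth coefficients.\<close>

lemma smooth_tproj:
  fixes \<eta> :: "'e::euclidean_space \<Rightarrow> 'e form"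
  assumes S: "open S" and j: "\<And>z. z \<in> S \<Longrightarrow> linear (\<lambda>w. j w z)" "\<And>w. smooth_on S (j w)"
    and \<eta>: "\<And>v. smooth_on S (\<lambda>z. \<eta> z v)" "\<And>z v s. z \<in> S \<Longrightarrow> s \<in> I0 \<Longrightarrow> linear (\<lambda>x. \<eta> z (v(s := x)))"
    and I: "finite I" "I \<subseteq> I0"
  shows "smooth_on S (\<lambda>z. tproj (\<lambda>w. j w z) c I (\<eta> z) v)"
  using I
proof (induction I arbitrary: v rule: finite_induct)
  case empty
  then show ?case using \<eta>(1) by simp
next
  case (insert i I)
  let ?g = "\<lambda>z. tproj (\<lambda>w. j w z) c I (\<eta> z)"
  have IH: "smooth_on S (\<lambda>z. ?g z v)" for v using insert by auto
  have l: "linear (\<lambda>x. ?g z (v(i := x)))" if "z \<in> S" for z v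
    by (rule tproj_linear_slot[OF j(1)[OF that] insert.hyps(1) \<eta>(2)[OF that]]) (use insert in auto)
  have "smooth_on S (\<lambda>z. (1 / 2) * (?g z v + c i * (\<Sum>b\<in>Basis. of_real (j (v i) z \<bullet> b) * ?g z (v(i := b)))))"
    by (intro smooth_on_mult smooth_on_add smooth_on_const smooth_on_sum S IH
        smooth_on_linear_comp[OF bounded_linear_of_real] smooth_on_linear_comp[OF bounded_linear_inner_left] j(2))
  then show ?case
  proof (rule smooth_on_cong[OF S, rotated])
    fix z assume z: "z \<in> S"
    have "?g z (v(i := j (v i) z)) = ?g z (v(i := (\<Sum>b\<in>Basis. (j (v i) z \<bullet> b) *\<^sub>R b)))"
      by (simp add: euclidean_representation)
    also have "\<dots> = (\<Sum>b\<in>Basis. of_real (j (v i) z \<bullet> b) * ?g z (v(i := b)))"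
      by (simp add: linear_sum[OF l[OF z]] linear_scale[OF l[OF z]] scaleR_conv_of_real)
    finally show "(1 / 2) * (?g z v + c i * (\<Sum>b\<in>Basis. of_real (j (v i) z \<bullet> b) * ?g z (v(i := b)))) =
        tproj (\<lambda>w. j w z) c (insert i I) (\<eta> z) v"
      unfolding tproj_insert[OF insert.hyps] slot_def by simp
  qed
qed

section \<open>The canonical bundle\<close>

definition smooth_form :: "('x, 'e::euclidean_space) atlas \<Rightarrow> 'x set \<Rightarrow> ('x \<Rightarrow> 'e form) \<Rightarrow> bool" where
  "smooth_form A W \<omega> \<longleftrightarrow> (\<forall>c\<in>A. \<forall>w. smooth_fun A (W \<inter> fst c) (\<lambda>x. \<omega> x (\<lambda>l. from_chart A c x (w l))))"

definition cform :: "('x, 'e::euclidean_space) atlas \<Rightarrow> ('x, 'e) chart \<Rightarrow> ('x \<Rightarrow> 'e form) \<Rightarrow> 'e \<Rightarrow> 'e form" where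
  "cform A c \<omega> z w = \<omega> (chart_inv c z) (\<lambda>l. from_chart A c (chart_inv c z) (w l))"

lemma ext_d_eq: "ext_d A k \<omega> x = ed k (cform A (at_chart A x) \<omega>) (snd (at_chart A x) x)"
  by (simp add: fun_eq_iff ext_d_def Let_def ed_def ddir_def cform_def)

lemma alt_form_compose:
  assumes w: "alt_form k \<omega>" and h: "linear h"
  shows "alt_form k (\<lambda>v. \<omega> (\<lambda>l. h (v l)))"
  unfolding alt_form_def
proof (intro conjI allI impI)
  show "\<omega> (\<lambda>l. h (v l)) = \<omega> (\<lambda>l. h (v' l))" if "\<forall>i<k. v i = v' i" for v v'
    by (rule alt_form_cong[OF w]) (use that in simp)
  show "linear (\<lambda>x. \<omega> (\<lambda>l. h ((v(i := x)) l)))" if "i < k" for v i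
  proof -
    have "(\<lambda>l. h ((v(i := x)) l)) = (\<lambda>l. h (v l))(i := h x)" for x by (auto simp: fun_eq_iff)
    then show ?thesis using linear_compose[OF h alt_form_linear[OF w that]] by (simp add: o_def)
  qed
  show "\<omega> (\<lambda>l. h (v l)) = 0" if "a < k \<and> b < k \<and> a \<noteq> b \<and> v a = v b" for v a b
    by (rule alt_form_eq_0[OF w, of a b]) (use that in auto)
qed

lemma form_field_cform:
  assumes A: "smooth_atlas A" and c: "c \<in> A" and W: "open W" and sm: "smooth_form A W \<omega>"
    and a: "\<And>x. x \<in> W \<Longrightarrow> alt_form k (\<omega> x)"
  shows "form_field (snd c ` (W \<inter> fst c)) k (cform A c \<omega>)"
  unfolding form_field_def
proof (intro conjI ballI allI)
  show "open (snd c ` (W \<inter> fst c))" by (rule open_chart_image_Int(1)[OF A c W])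
  fix w
  have "smooth_on (snd c ` ((W \<inter> fst c) \<inter> fst c)) (\<lambda>z. \<omega> (chart_inv c z) (\<lambda>l. from_chart A c (chart_inv c z) (w l)))"
    using sm c unfolding smooth_form_def by (intro smooth_funD[OF A _ c]) blast
  then show "smooth_on (snd c ` (W \<inter> fst c)) (\<lambda>y. cform A c \<omega> y w)"
    unfolding cform_def by (simp only: Int_assoc Int_absorb)
next
  fix y assume "y \<in> snd c ` (W \<inter> fst c)"
  then obtain x where x: "x \<in> W" "x \<in> fst c" "y = snd c x" by blast
  then show "alt_form k (cform A c \<omega> y)"
    unfolding cform_def
    using alt_form_compose[OF a linear_from_chart[OF A c]] by (simp add: chart_inv_chart[OF A c])
qed

text \<open>Serves two purposes: with \<open>G\<close> the identity it changes the chart, with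
  \<open>G\<close> a diffeomorphism it gives naturality of the exterior derivative. In both cases
  \<open>g\<close> is the coordinate expression of \<open>G\<close>.\<close>

lemma ed_pullback_chart:
  fixes A :: "('x::{t2_space,second_countable_topology}, 'e::euclidean_space) atlas"
    and B :: "('y::{t2_space,second_countable_topology}, 'f::euclidean_space) atlas"
  assumes A: "smooth_atlas A" and B: "smooth_atlas B" and c: "c \<in> A" and d: "d \<in> B"
    and W: "open W" "smooth_form A W \<omega>" "\<And>x. x \<in> W \<Longrightarrow> alt_form k (\<omega> x)"
    and V: "open V" "y \<in> V" "V \<subseteq> fst d" "\<And>q. q \<in> V \<Longrightarrow> G q \<in> W \<inter> fst c"
    and g: "smooth_on (snd d ` V) g" "\<And>q. q \<in> V \<Longrightarrow> g (snd d q) = snd c (G q)"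
    and e: "\<And>q w. q \<in> V \<Longrightarrow> \<omega>' q (\<lambda>l. from_chart B d q (w l)) =
      \<omega> (G q) (\<lambda>l. from_chart A c (G q) (ddir (w l) g (snd d q)))"
  shows "ed k (cform B d \<omega>') (snd d y) v = ed k (cform A c \<omega>) (snd c (G y)) (\<lambda>l. ddir (v l) g (snd d y))"
proof -
  have Vd: "V \<inter> fst d = V" using V by blast
  have S: "open (snd d ` V)" "snd d y \<in> snd d ` V"
    using open_chart_image_Int(1)[OF B d V(1)] V(2) by (auto simp: Vd)
  have gT: "g ` (snd d ` V) \<subseteq> snd c ` (W \<inter> fst c)" using g(2) V(4) by auto
  have e1: "ed k (cform B d \<omega>') (snd d y) = ed k (\<lambda>y w. cform A c \<omega> (g y) (\<lambda>l. ddir (w l) g y)) (snd d y)"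
  proof (rule ed_cong[OF S])
    fix z w assume "z \<in> snd d ` V"
    then obtain q where q: "q \<in> V" "z = snd d q" by blast
    have qd: "chart_inv d z = q" using q V(3) chart_inv_chart[OF B d] by auto
    have gq: "chart_inv c (g z) = G q" using g(2)[OF q(1)] q(2) V(4)[OF q(1)] chart_inv_chart[OF A c] by auto
    show "cform B d \<omega>' z w = cform A c \<omega> (g z) (\<lambda>l. ddir (w l) g z)"
      unfolding cform_def qd gq using e[OF q(1)] q(2) by simp
  qed
  have e2: "ed k (\<lambda>y w. cform A c \<omega> (g y) (\<lambda>l. ddir (w l) g y)) (snd d y) v =
      ed k (cform A c \<omega>) (g (snd d y)) (\<lambda>l. ddir (v l) g (snd d y))"
    by (rule ed_pullback[OF form_field_cform[OF A c W] S g(1) gT])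
  show ?thesis by (simp only: e1 e2 g(2)[OF V(2)])
qed

lemma trans_d_from_chart:
  assumes A: "smooth_atlas A" and "c \<in> A" "d \<in> A" "x \<in> fst c" "x \<in> fst d"
  shows "from_chart A d x w = from_chart A c x (trans_d d c x w)"
  using assms at_chart[OF A, of x] by (simp add: from_chart_eq trans_d_compose[OF A])

text \<open>The definition uses the chart chosen at \<open>x\<close>, which changes with
  \<open>x\<close> without any continuity. A chart that stays fixed is required before smoothness in
  \<open>x\<close> can be discussed.\<close>

lemma ext_d_chart:
  assumes A: "smooth_atlas A" and c: "c \<in> A" "x \<in> fst c" and W: "open W" "x \<in> W" "smooth_form A W \<omega>"
    and a: "\<And>x. x \<in> W \<Longrightarrow> alt_form k (\<omega> x)"
  shows "ext_d A k \<omega> x v = ed k (cform A c \<omega>) (snd c x) (\<lambda>l. to_chart A c x (v l))"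
proof -
  let ?d = "at_chart A x"
  note d = at_chart[OF A, of x]
  let ?V = "W \<inter> (fst c \<inter> fst ?d)"
  have "ed k (cform A ?d \<omega>) (snd ?d x) v = ed k (cform A c \<omega>) (snd c x)
      (\<lambda>l. ddir (v l) (\<lambda>z. snd c (chart_inv ?d z)) (snd ?d x))"
  proof (rule ed_pullback_chart[OF A A c(1) d(1) W(1,3) a, where V = ?V])
    show "open ?V" using W open_chart[OF A c(1)] open_chart[OF A d(1)] by blast
    show "smooth_on (snd ?d ` ?V) (\<lambda>z. snd c (chart_inv ?d z))"
      by (rule smooth_on_subset[OF smooth_transition[OF A d(1) c(1)]]) auto
    show "snd c (chart_inv ?d (snd ?d q)) = snd c q" if "q \<in> ?V" for q
      using that by (simp add: chart_inv_chart[OF A d(1)])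
    show "\<omega> q (\<lambda>l. from_chart A ?d q (w l)) =
        \<omega> q (\<lambda>l. from_chart A c q (ddir (w l) (\<lambda>z. snd c (chart_inv ?d z)) (snd ?d q)))"
      if "q \<in> ?V" for q w
      using that trans_d_from_chart[OF A c(1) d(1), of q] by (simp add: trans_d_def)
  qed (use W c d in auto)
  then show ?thesis by (simp add: ext_d_eq to_chart_eq trans_d_def)
qed

lemma smooth_trans_d:
  assumes A: "smooth_atlas A" and c: "c \<in> A" and d: "d \<in> A"
  shows "smooth_on (snd c ` (fst c \<inter> fst d)) (\<lambda>z. trans_d d c (chart_inv c z) w)"
proof -
  let ?S = "snd c ` (fst c \<inter> fst d)" and ?T = "snd d ` (fst d \<inter> fst c)"
  have o: "open ?S" "open ?T"
    using open_chart_image_Int(2)[OF A c open_chart[OF A d]] open_chart_image_Int(2)[OF A d open_chart[OF A c]] by auto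
  show ?thesis
    unfolding trans_d_def
    by (rule smooth_on_compose[OF o smooth_onD_ddir[OF smooth_transition[OF A d c]] smooth_transition[OF A c d]])
      (auto simp: chart_inv_chart[OF A c])
qed

lemma smooth_formI_chart:
  assumes A: "smooth_atlas A" and c: "c \<in> A" and W: "open W" "W \<subseteq> fst c"
    and sm: "\<And>w. smooth_fun A W (\<lambda>x. \<omega> x (\<lambda>l. from_chart A c x (w l)))"
    and a: "\<And>x. x \<in> W \<Longrightarrow> alt_form k (\<omega> x)"
  shows "smooth_form A W \<omega>"
  unfolding smooth_form_def
proof (intro ballI allI)
  fix d w assume d: "d \<in> A"
  let ?V = "W \<inter> fst d"
  have V: "open ?V" "?V \<subseteq> fst c" using W open_chart[OF A d] by auto
  have Wc: "W \<inter> fst c = W" "?V \<inter> fst c = ?V" using W by auto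
  have f: "form_field (snd c ` W) k (cform A c \<omega>)"
    unfolding form_field_def
  proof (intro conjI ballI allI)
    show "open (snd c ` W)" using open_chart_image_Int(1)[OF A c W(1)] by (simp add: Wc)
    show "smooth_on (snd c ` W) (\<lambda>y. cform A c \<omega> y w)" for w
      unfolding cform_def using smooth_funD[OF A sm c] by (simp add: Wc)
    fix y assume "y \<in> snd c ` W"
    then obtain x where x: "x \<in> W" "y = snd c x" by blast
    then show "alt_form k (cform A c \<omega> y)"
      unfolding cform_def
      using alt_form_compose[OF a linear_from_chart[OF A c]] W by (auto simp: chart_inv_chart[OF A c])
  qed
  have S: "open (snd c ` ?V)" using open_chart_image_Int(1)[OF A c V(1)] by (simp add: Wc)
  have "smooth_on (snd c ` ?V) (\<lambda>z. cform A c \<omega> z (\<lambda>l. trans_d d c (chart_inv c z) (w l)))"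
    by (rule smooth_form_eval[OF f S smooth_on_id])
      (use W in \<open>auto intro!: smooth_on_subset[OF smooth_trans_d[OF A c d]]\<close>)
  then have "smooth_on (snd c ` ?V) (\<lambda>z. \<omega> (chart_inv c z) (\<lambda>l. from_chart A d (chart_inv c z) (w l)))"
  proof (rule smooth_on_cong[OF S, rotated])
    fix z assume "z \<in> snd c ` ?V"
    then have q: "chart_inv c z \<in> ?V" using V(2) by (auto simp: chart_inv_chart[OF A c])
    then show "cform A c \<omega> z (\<lambda>l. trans_d d c (chart_inv c z) (w l)) =
        \<omega> (chart_inv c z) (\<lambda>l. from_chart A d (chart_inv c z) (w l))"
      unfolding cform_def using V(2) trans_d_from_chart[OF A c d, of "chart_inv c z"] by auto
  qed
  then show "smooth_fun A ?V (\<lambda>x. \<omega> x (\<lambda>l. from_chart A d x (w l)))"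
    by (rule smooth_fun_chartI[OF A c V])
qed

lemma smooth_form_subset: "smooth_form A W \<omega> \<Longrightarrow> smooth_atlas A \<Longrightarrow> V \<subseteq> W \<Longrightarrow> smooth_form A V \<omega>"
  unfolding smooth_form_def by (meson Int_mono order_refl smooth_fun_subset)

section \<open>Smooth multiforms and their coefficients\<close>

lemma smooth_tensor_subset: "smooth_tensor A W t \<Longrightarrow> smooth_atlas A \<Longrightarrow> V \<subseteq> W \<Longrightarrow> smooth_tensor A V t"
  unfolding smooth_tensor_def by (meson Int_mono order_refl smooth_fun_subset)

lemma smooth_tensor_local:
  assumes A: "smooth_atlas A" and "\<And>x. x \<in> W \<Longrightarrow> \<exists>V. open V \<and> x \<in> V \<and> smooth_tensor A V t"
  shows "smooth_tensor A W t"
  unfolding smooth_tensor_def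
proof (intro ballI allI, rule smooth_fun_local[OF A])
  fix c w x assume c: "c \<in> A" and x: "x \<in> W \<inter> fst c"
  obtain V where V: "open V" "x \<in> V" "smooth_tensor A V t" using assms(2) x by blast
  then show "\<exists>V. open V \<and> x \<in> V \<and> smooth_fun A V (\<lambda>x. t x (\<lambda>i l. from_chart A c x (w i l)))"
    using c x open_chart[OF A c] unfolding smooth_tensor_def by (intro exI[of _ "V \<inter> fst c"]) auto
qed

lemma smooth_tensor_cong:
  assumes A: "smooth_atlas A" and W: "open W" "\<And>x. x \<in> W \<Longrightarrow> t x = t' x" and t: "smooth_tensor A W t"
  shows "smooth_tensor A W t'"
  unfolding smooth_tensor_def
proof (intro ballI allI)
  fix c w assume c: "c \<in> A"
  show "smooth_fun A (W \<inter> fst c) (\<lambda>x. t' x (\<lambda>i l. from_chart A c x (w i l)))"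
    by (rule smooth_fun_cong[OF A, of _ "\<lambda>x. t x (\<lambda>i l. from_chart A c x (w i l))"])
      (use W t c open_chart[OF A c] in \<open>auto simp: smooth_tensor_def\<close>)
qed

lemma smooth_tensor_scale:
  assumes A: "smooth_atlas A" and W: "open W" and f: "smooth_fun A W f" and t: "smooth_tensor A W t"
  shows "smooth_tensor A W (\<lambda>x. fscale (f x) (t x))"
  unfolding smooth_tensor_def fscale_def
proof (intro ballI allI)
  fix c w assume c: "c \<in> A"
  show "smooth_fun A (W \<inter> fst c) (\<lambda>x. f x * t x (\<lambda>i l. from_chart A c x (w i l)))"
    by (rule smooth_fun_mult[OF A _ smooth_fun_subset[OF A f]])
      (use W t c open_chart[OF A c] in \<open>auto simp: smooth_tensor_def\<close>)
qed

lemma smooth_tensor_kpow: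
  assumes A: "smooth_atlas A" and W: "open W" and k: "smooth_form A W \<kappa>"
  shows "smooth_tensor A W (\<lambda>x. kpow m (\<kappa> x))"
  unfolding smooth_tensor_def kpow_def
proof (intro ballI allI)
  fix c w assume c: "c \<in> A"
  show "smooth_fun A (W \<inter> fst c) (\<lambda>x. \<Prod>i<m. \<kappa> x (\<lambda>l. from_chart A c x (w i l)))"
    by (rule smooth_fun_prod[OF A]) (use W k c open_chart[OF A c] in \<open>auto simp: smooth_form_def\<close>)
qed

lemma nonzero_from_chart:
  fixes t :: "'e::euclidean_space multiform"
  assumes A: "smooth_atlas A" and c: "c \<in> A" "x \<in> fst c" and t: "t \<noteq> 0"
  shows "\<exists>w. t (\<lambda>i l. from_chart A c x (w i l)) \<noteq> 0"
proof -
  obtain W where W: "t W \<noteq> 0" using t by (auto simp: fun_eq_iff)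
  have "t (\<lambda>i l. from_chart A c x (to_chart A c x (W i l))) \<noteq> 0"
    using W by (simp add: from_to_chart[OF A c])
  then show ?thesis by (rule exI[of _ "\<lambda>i l. to_chart A c x (W i l)"])
qed

text \<open>Near each point some component of \<open>b\<close> in a chart does not vanish, and there
  the coefficient is a quotient of two smooth components.\<close>

lemma smooth_coefficient:
  assumes A: "smooth_atlas A" and W: "open W" and b: "smooth_tensor A W b" "\<And>x. x \<in> W \<Longrightarrow> b x \<noteq> 0"
    and t: "smooth_tensor A W t" and e: "\<And>x. x \<in> W \<Longrightarrow> t x = fscale (a x) (b x)"
  shows "smooth_fun A W a"
proof (rule smooth_fun_local[OF A])
  fix x assume x: "x \<in> W"
  let ?c = "at_chart A x"
  note c = at_chart[OF A, of x]
  obtain w where w: "b x (\<lambda>i l. from_chart A ?c x (w i l)) \<noteq> 0"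
    using nonzero_from_chart[OF A c b(2)[OF x]] by blast
  let ?V = "W \<inter> fst ?c"
  have V: "open ?V" using W open_chart[OF A c(1)] by blast
  let ?f = "\<lambda>x. b x (\<lambda>i l. from_chart A ?c x (w i l))" and ?g = "\<lambda>x. t x (\<lambda>i l. from_chart A ?c x (w i l))"
  have sf: "smooth_fun A ?V ?f" "smooth_fun A ?V ?g" using b(1) t c unfolding smooth_tensor_def by blast+
  let ?N = "?V \<inter> ?f -` (- {0})"
  have N: "open ?N" by (rule continuous_open_preimage[OF smooth_fun_continuous[OF A V sf(1)] V]) auto
  have "smooth_fun A ?N (\<lambda>x. ?g x / ?f x)"
    by (rule smooth_fun_divide[OF A N smooth_fun_subset[OF A sf(2)] smooth_fun_subset[OF A sf(1)]]) auto
  then have "smooth_fun A ?N a"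
    by (rule smooth_fun_cong[OF A N, rotated]) (use e in \<open>auto simp: fscale_def\<close>)
  then show "\<exists>V. open V \<and> x \<in> V \<and> smooth_fun A V a" using N x c w by (intro exI[of _ ?N]) auto
qed

locale canonical = almost_complex A J
  for A :: "('x::{t2_space,second_countable_topology}, 'e::euclidean_space) atlas" and J +
  fixes n :: nat
  assumes dim: "DIM('e) = 2 * n"
begin

text \<open>A nowhere zero smooth local section of the canonical bundle, that is, a local frame of
  it.\<close>

definition kform :: "'x set \<Rightarrow> ('x \<Rightarrow> 'e form) \<Rightarrow> bool" where
  "kform U \<kappa> \<longleftrightarrow> open U \<and> (\<forall>x\<in>U. holo_form (J x) n (\<kappa> x) \<and> \<kappa> x \<noteq> 0) \<and> smooth_form A U \<kappa>"

lemma kformD: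
  assumes "kform U \<kappa>"
  shows "open U" "x \<in> U \<Longrightarrow> holo_form (J x) n (\<kappa> x)" "x \<in> U \<Longrightarrow> \<kappa> x \<noteq> 0" "smooth_form A U \<kappa>"
    "x \<in> U \<Longrightarrow> alt_form n (\<kappa> x)"
  using assms holo_form_alt unfolding kform_def by auto

lemma to_chart_J:
  assumes c: "c \<in> A" "z \<in> snd c ` fst c"
  shows "to_chart A c (chart_inv c z) (J (chart_inv c z) v) = Jc c (to_chart A c (chart_inv c z) v) z"
  unfolding Jc_def by (simp add: from_to_chart[OF A c(1) chart_inv_in[OF c(2)]])

lemma linear_Jc:
  assumes c: "c \<in> A" "z \<in> snd c ` fst c"
  shows "linear (\<lambda>w. Jc c w z)"
  unfolding Jc_def
  using linear_compose[OF linear_compose[OF linear_from_chart[OF A c(1) chart_inv_in[OF c(2)]] linear_J]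
      linear_to_chart[OF A c(1) chart_inv_in[OF c(2)]]]
  by (simp add: o_def)

text \<open>A generator at \<open>x0\<close> is continued with constant components in a chart and
  projected to type (n,0) at each point. The projection is smooth and leaves the generator at
  \<open>x0\<close> unchanged, so the result is nonzero nearby.\<close>

lemma kform_exists: "\<exists>U \<kappa>. kform U \<kappa> \<and> x0 \<in> U"
proof -
  obtain \<kappa>0 where k0: "holo_form (J x0) n \<kappa>0" "\<kappa>0 \<noteq> 0"
    using holo_form_generator[OF linear_J J_J dim, of x0] Lambda_p0_holo by blast
  define c where "c = at_chart A x0"
  have c: "c \<in> A" "x0 \<in> fst c" using at_chart[OF A, of x0] by (auto simp: c_def)
  define \<Omega> where "\<Omega> x v = \<kappa>0 (\<lambda>l. from_chart A c x0 (to_chart A c x (v l)))" for x v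
  define \<kappa> where "\<kappa> x = tproj (J x) (\<lambda>_. - \<i>) {..<n} (\<Omega> x)" for x
  have Om: "alt_form n (\<Omega> x)" if "x \<in> fst c" for x
    unfolding \<Omega>_def
    by (rule alt_form_compose[OF alt_form_compose[OF holo_form_alt[OF k0(1)] linear_from_chart[OF A c]] linear_to_chart[OF A c(1) that]])
  have hol: "holo_form (J x) n (\<kappa> x)" if "x \<in> fst c" for x
    unfolding \<kappa>_def by (rule holo_form_tproj[OF linear_J J_J Om[OF that]])
  have k_x0: "\<kappa> x0 = \<kappa>0"
  proof -
    have O0: "\<Omega> x0 = \<kappa>0" by (simp add: fun_eq_iff \<Omega>_def from_to_chart[OF A c])
    have "tproj (J x0) (\<lambda>_. - \<i>) {..<n} \<kappa>0 = (\<lambda>v. (\<Prod>i<n. (1 + - \<i> * \<i>) / 2) * \<kappa>0 v)"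
      by (rule tproj_typed) (use holo_form_type[OF k0(1)] in auto)
    then show ?thesis unfolding \<kappa>_def O0 by (simp add: fun_eq_iff)
  qed
  note O = open_chart[OF A c(1)]
  \<comment> \<open>The coordinate expression of \<open>\<Omega>\<close>. It is constant in
    \<open>z\<close>, so the point enters \<open>\<kappa>\<close> through J alone.\<close>
  define \<eta> where "\<eta> z w = \<kappa>0 (\<lambda>l. from_chart A c x0 (w l))" for z :: 'e and w
  have a0: "alt_form n (\<eta> z)" for z
    unfolding \<eta>_def by (rule alt_form_compose[OF holo_form_alt[OF k0(1)] linear_from_chart[OF A c]])
  have sm: "smooth_fun A (fst c) (\<lambda>x. \<kappa> x (\<lambda>l. from_chart A c x (w l)))" for w
  proof (rule smooth_fun_chartI[OF A c(1) O subset_refl])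
    have "smooth_on (snd c ` fst c) (\<lambda>z. tproj (\<lambda>w. Jc c w z) (\<lambda>_. - \<i>) {..<n} (\<eta> z) w)"
    proof (rule smooth_tproj[OF open_chart_image[OF A c(1)], of _ _ "{..<n}"])
      show "linear (\<lambda>x. \<eta> z (v(s := x)))" if "s \<in> {..<n}" for z v s
        using alt_form_linear[OF a0] that by blast
      show "smooth_on (snd c ` fst c) (\<lambda>z. \<eta> z v)" for v unfolding \<eta>_def by (rule smooth_on_const)
    qed (use linear_Jc[OF c(1)] smooth_Jc[OF c(1)] in auto)
    then show "smooth_on (snd c ` fst c) (\<lambda>z. \<kappa> (chart_inv c z) (\<lambda>l. from_chart A c (chart_inv c z) (w l)))"
    proof (rule smooth_on_cong[OF open_chart_image[OF A c(1)], rotated])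
      fix z assume z: "z \<in> snd c ` fst c"
      let ?q = "chart_inv c z"
      note q = chart_inv_in[OF z]
      have "tproj (J ?q) (\<lambda>_. - \<i>) {..<n} (\<lambda>v. \<eta> z (\<lambda>l. to_chart A c ?q (v l))) =
        (\<lambda>v. tproj (\<lambda>w. Jc c w z) (\<lambda>_. - \<i>) {..<n} (\<eta> z) (\<lambda>l. to_chart A c ?q (v l)))"
        by (rule tproj_conj) (use to_chart_J[OF c(1) z] in auto)
      moreover have "\<Omega> ?q = (\<lambda>v. \<eta> z (\<lambda>l. to_chart A c ?q (v l)))" by (simp add: fun_eq_iff \<Omega>_def \<eta>_def)
      ultimately show "tproj (\<lambda>w. Jc c w z) (\<lambda>_. - \<i>) {..<n} (\<eta> z) w = \<kappa> ?q (\<lambda>l. from_chart A c ?q (w l))"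
        unfolding \<kappa>_def by (simp only: from_to_chart[OF A c(1) q])
    qed
  qed
  have smf: "smooth_form A (fst c) \<kappa>"
    by (rule smooth_formI_chart[OF A c(1) O subset_refl sm holo_form_alt[OF hol]])
  obtain v0 where v0: "\<kappa>0 v0 \<noteq> 0" using k0(2) by (auto simp: fun_eq_iff)
  let ?f = "\<lambda>x. \<kappa> x (\<lambda>l. from_chart A c x (to_chart A c x0 (v0 l)))"
  let ?U = "fst c \<inter> ?f -` (- {0})"
  have U: "open ?U" by (rule continuous_open_preimage[OF smooth_fun_continuous[OF A O sm] O]) auto
  have "kform ?U \<kappa>"
    unfolding kform_def using U hol smooth_form_subset[OF smf A] by (auto simp: fun_eq_iff)
  moreover have "x0 \<in> ?U" using c v0 by (simp add: k_x0 from_to_chart[OF A c])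
  ultimately show ?thesis by blast
qed

lemma K_fibre_kform:
  "kform U \<kappa> \<Longrightarrow> x \<in> U \<Longrightarrow> t \<in> K_fibre (J x) n m \<longleftrightarrow> (\<exists>a. t = fscale a (kpow m (\<kappa> x)))"
  by (rule K_fibre_iff[OF linear_J J_J dim kformD(2,3)])

lemma kpow_ne_0: "(\<kappa> :: 'e form) \<noteq> 0 \<Longrightarrow> kpow m \<kappa> \<noteq> 0"
proof -
  assume "\<kappa> \<noteq> 0"
  then obtain w where "\<kappa> w \<noteq> 0" by (auto simp: fun_eq_iff)
  then have "kpow m \<kappa> (\<lambda>_. w) \<noteq> 0" by (rule kpow_nonzero)
  then show ?thesis by (metis zero_fun_apply)
qed

lemma fscale_cancel: "(b :: 'i \<Rightarrow> complex) \<noteq> 0 \<Longrightarrow> fscale c b = fscale d b \<longleftrightarrow> c = d"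
  by (simp add: fs.scale_cancel_right)

lemma K_frame:
  assumes k: "kform U \<kappa>"
  shows "(U, 1, \<lambda>_ x. kpow m (\<kappa> x)) \<in> frames (K_power A J n m)"
proof -
  have "\<exists>!a::nat \<Rightarrow> complex. (\<forall>i\<ge>1. a i = 0) \<and> v = (\<Sum>i<1. fscale (a i) (kpow m (\<kappa> x)))"
    if x: "x \<in> U" and v: "v \<in> K_fibre (J x) n m" for x v
  proof -
    have nz: "kpow m (\<kappa> x) \<noteq> 0" by (rule kpow_ne_0[OF kformD(3)[OF k x]])
    obtain a where a: "v = fscale a (kpow m (\<kappa> x))" using v K_fibre_kform[OF k x] by blast
    show ?thesis
    proof (rule ex1I[of _ "\<lambda>i::nat. if i = 0 then a else 0"])
      show "(\<forall>i\<ge>(1::nat). (if i = 0 then a else 0) = 0) \<and> v = (\<Sum>i<(1::nat). fscale (if i = 0 then a else 0) (kpow m (\<kappa> x)))"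
        by (simp add: a)
      fix b :: "nat \<Rightarrow> complex" assume b: "(\<forall>i\<ge>1. b i = 0) \<and> v = (\<Sum>i<1. fscale (b i) (kpow m (\<kappa> x)))"
      then have "fscale a (kpow m (\<kappa> x)) = fscale (b 0) (kpow m (\<kappa> x))" using a by simp
      then have "b 0 = a" using fscale_cancel[OF nz] by simp
      then show "b = (\<lambda>i. if i = 0 then a else 0)" using b by (auto simp: fun_eq_iff)
    qed
  qed
  moreover have "kpow m (\<kappa> x) \<in> K_fibre (J x) n m" if "x \<in> U" for x
    unfolding K_fibre_kform[OF k that] by (intro exI[of _ 1]) simp
  ultimately show ?thesis
    using kformD(1)[OF k] smooth_tensor_kpow[OF A kformD(1,4)[OF k]]
    unfolding K_power_def local_frame_def by simp
qed

text \<open>\<open>K_power\<close> admits every smooth local frame, and comparison with the line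
  spanned by the power of a local generator forces rank one. A point of \<open>U\<close> must be at
  hand, since over the empty set any number counts as a rank.\<close>

lemma K_frame_facts:
  assumes "(U, r, e) \<in> frames (K_power A J n m)"
  shows "open U" "x \<in> U \<Longrightarrow> r = 1" "x \<in> U \<Longrightarrow> e 0 x \<in> K_fibre (J x) n m"
    "i < r \<Longrightarrow> smooth_tensor A U (e i)" "x \<in> U \<Longrightarrow> e 0 x \<noteq> 0"
proof -
  have lf: "local_frame (\<lambda>x. K_fibre (J x) n m) fscale (U, r, e)" and sm: "\<forall>i<r. smooth_tensor A U (e i)"
    using assms by (auto simp: K_power_def)
  show "open U" using lf by (simp add: local_frame_def)
  show "i < r \<Longrightarrow> smooth_tensor A U (e i)" using sm by blast
  have *: "r = 1 \<and> e 0 x \<in> K_fibre (J x) n m \<and> e 0 x \<noteq> 0" if x: "x \<in> U"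
  proof -
    have eV: "e i x \<in> K_fibre (J x) n m" if "i < r" for i using lf x that by (auto simp: local_frame_def)
    have uq: "\<exists>!a. (\<forall>i\<ge>r. a i = 0) \<and> v = (\<Sum>i<r. fscale (a i) (e i x))" if "v \<in> K_fibre (J x) n m" for v
      using lf x that by (auto simp: local_frame_def)
    obtain V \<kappa> where k: "kform V \<kappa>" "x \<in> V" using kform_exists by blast
    let ?k = "kpow m (\<kappa> x)"
    have nz: "?k \<noteq> 0" by (rule kpow_ne_0[OF kformD(3)[OF k]])
    have kV: "?k \<in> K_fibre (J x) n m" unfolding K_fibre_kform[OF k] by (intro exI[of _ 1]) simp
    have zV: "0 \<in> K_fibre (J x) n m" by (rule fs.subspace_0[OF K_fibre_subspace])
    have ind: "a = (\<lambda>_. 0)" if "\<forall>i\<ge>r. a i = 0" "0 = (\<Sum>i<r. fscale (a i) (e i x))" for a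
    proof -
      have "0 = (\<Sum>i<r. fscale 0 (e i x))" by (simp add: fs.scale_zero_left)
      then show ?thesis
        using ex1_implies_ex[OF uq[OF zV]] the1_equality[OF uq[OF zV], of a] the1_equality[OF uq[OF zV], of "\<lambda>_. 0"] that
        by simp
    qed
    have "r \<noteq> 0"
    proof
      assume r: "r = 0"
      obtain a where "?k = (\<Sum>i<r. fscale (a i) (e i x))" using uq[OF kV] by blast
      then show False using nz by (simp add: r)
    qed
    have e0: "e 0 x \<noteq> 0"
    proof
      assume e0: "e 0 x = 0"
      have "0 = (\<Sum>i<r. fscale (if i = 0 then 1 else 0) (e i x))"
        by (rule sym, rule sum.neutral) (simp add: e0 fs.scale_zero_left)
      then have "(\<lambda>i. if i = 0 then 1 else 0) = (\<lambda>_::nat. 0::complex)" by (intro ind) (use \<open>r \<noteq> 0\<close> in auto)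
      then have "(if (0::nat) = 0 then 1 else 0) = (0::complex)" by (rule fun_cong)
      then show False by simp
    qed
    have "r < 2"
    proof (rule ccontr)
      assume "\<not> r < 2"
      then have r: "0 < r" "1 < r" by auto
      obtain a b where ab: "e 0 x = fscale a ?k" "e 1 x = fscale b ?k"
        using eV[OF r(1)] eV[OF r(2)] unfolding K_fibre_kform[OF k] by blast
      have "a \<noteq> 0" using e0 ab(1) by (auto simp: fs.scale_zero_left)
      \<comment> \<open>Two multiples \<open>a\<close> and \<open>b\<close> of the same vector
        satisfy this relation, which contradicts uniqueness of coefficients.\<close>
      let ?c = "\<lambda>i::nat. if i = 0 then b else if i = 1 then - a else 0"
      have "(\<Sum>i<r. fscale (?c i) (e i x)) = (\<Sum>i\<in>{0, 1}. fscale (?c i) (e i x))"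
        by (rule sum.mono_neutral_right) (use r in \<open>auto simp: fs.scale_zero_left\<close>)
      also have "\<dots> = fscale (b * a) ?k + fscale (- a * b) ?k" by (simp add: ab ab(2)[unfolded One_nat_def])
      also have "\<dots> = 0" by (simp add: fs.scale_left_distrib[symmetric] mult.commute)
      finally have "?c = (\<lambda>_. 0)" by (intro ind) (use r in auto)
      then have "?c 1 = 0" by (rule fun_cong)
      then show False using \<open>a \<noteq> 0\<close> by simp
    qed
    then have "r = 1" using \<open>r \<noteq> 0\<close> by simp
    then show ?thesis using eV[of 0] e0 by simp
  qed
  then show "x \<in> U \<Longrightarrow> r = 1" "x \<in> U \<Longrightarrow> e 0 x \<in> K_fibre (J x) n m" "x \<in> U \<Longrightarrow> e 0 x \<noteq> 0" by blast+
qed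

lemma smooth_coeffs_K:
  assumes f: "(U, r, e) \<in> frames (K_power A J n m)" and W: "open W" "W \<subseteq> U"
    and t: "\<And>x. x \<in> W \<Longrightarrow> t x \<in> K_fibre (J x) n m" "smooth_tensor A W t"
  shows "smooth_coeffs A fscale W r e t"
\<comment> \<open>Over the empty set the rank is undetermined, but there is also nothing to
  expand.\<close>
proof (cases "W = {}")
  case True
  then show ?thesis unfolding smooth_coeffs_def by (auto simp: smooth_fun_def intro!: exI[of _ "\<lambda>_ _. 0"])
next
  case False
  then have r: "r = 1" using K_frame_facts(2)[OF f] W by blast
  have "\<exists>a. t x = fscale a (e 0 x)" if x: "x \<in> W" for x
  proof -
    have xU: "x \<in> U" using x W by blast
    obtain V \<kappa> where k: "kform V \<kappa>" "x \<in> V" using kform_exists by blast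
    obtain a b where ab: "t x = fscale a (kpow m (\<kappa> x))" "e 0 x = fscale b (kpow m (\<kappa> x))"
      using t(1)[OF x] K_frame_facts(3)[OF f xU] unfolding K_fibre_kform[OF k] by blast
    have "b \<noteq> 0" using K_frame_facts(5)[OF f xU] ab(2) by (auto simp: fs.scale_zero_left)
    then have "t x = fscale (a / b) (e 0 x)" by (simp add: ab)
    then show ?thesis ..
  qed
  then obtain a where a: "\<And>x. x \<in> W \<Longrightarrow> t x = fscale (a x) (e 0 x)" by metis
  have "smooth_fun A W a"
    by (rule smooth_coefficient[OF A W(1) smooth_tensor_subset[OF K_frame_facts(4)[OF f] A W(2)] _ t(2) a])
      (use r K_frame_facts(5)[OF f] W in auto)
  then show ?thesis
    unfolding smooth_coeffs_def r using a by (intro exI[of _ "\<lambda>_. a"]) simp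
qed

lemma bundle_K: "complex_vector_bundle A (K_power A J n m)"
proof -
  have s: "smul (K_power A J n m) = fscale" "fibre (K_power A J n m) = (\<lambda>x. K_fibre (J x) n m)"
    by (simp_all add: K_power_def)
  have lf: "local_frame (\<lambda>x. K_fibre (J x) n m) fscale fr" if "fr \<in> frames (K_power A J n m)" for fr
    using that by (auto simp: K_power_def)
  have tr: "smooth_coeffs A fscale (U \<inter> U') r e (e' l)"
    if f: "(U, r, e) \<in> frames (K_power A J n m)" and f': "(U', r', e') \<in> frames (K_power A J n m)" and l: "l < r'"
    for U r e U' r' e' l
  proof (rule smooth_coeffs_K[OF f])
    show "open (U \<inter> U')" using K_frame_facts(1)[OF f] K_frame_facts(1)[OF f'] by blast
    show "e' l x \<in> K_fibre (J x) n m" if "x \<in> U \<inter> U'" for x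
      using lf[OF f'] that l by (auto simp: local_frame_def)
    show "smooth_tensor A (U \<inter> U') (e' l)"
      by (rule smooth_tensor_subset[OF K_frame_facts(4)[OF f' l] A]) auto
  qed auto
  show ?thesis
    unfolding complex_vector_bundle_def s
  proof (intro conjI)
    show "vector_space fscale" by (rule fs.vector_space_axioms)
    show "\<forall>x. fs.subspace (K_fibre (J x) n m)" using K_fibre_subspace by blast
    show "\<forall>fr\<in>frames (K_power A J n m). local_frame (\<lambda>x. K_fibre (J x) n m) fscale fr" using lf by blast
    show "\<forall>(U, r, e)\<in>frames (K_power A J n m). \<forall>(U', r', e')\<in>frames (K_power A J n m).
        \<forall>l<r'. smooth_coeffs A fscale (U \<inter> U') r e (e' l)" using tr by blast
    show "\<Union> (fst ` frames (K_power A J n m)) = UNIV"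
    proof -
      have "x \<in> \<Union> (fst ` frames (K_power A J n m))" for x
        using kform_exists[of x] K_frame by (metis UN_I fst_conv)
      then show ?thesis by blast
    qed
  qed
qed

text \<open>Frees sections from the frames. Both conditions on the right can be verified near each
  point with any convenient local generator.\<close>

lemma sections_K_iff:
  "s \<in> sections A (K_power A J n m) \<longleftrightarrow> (\<forall>x. s x \<in> K_fibre (J x) n m) \<and> smooth_tensor A UNIV s"
proof
  assume s: "s \<in> sections A (K_power A J n m)"
  have 1: "\<forall>x. s x \<in> K_fibre (J x) n m" using s by (simp add: sections_def K_power_def)
  have "smooth_tensor A UNIV s"
  proof (rule smooth_tensor_local[OF A])
    fix x
    obtain U \<kappa> where k: "kform U \<kappa>" "x \<in> U" using kform_exists by blast
    have "smooth_coeffs A fscale U 1 (\<lambda>_ x. kpow m (\<kappa> x)) s"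
      using s K_frame[OF k(1)] by (auto simp: sections_def K_power_def)
    then obtain a where a: "smooth_fun A U (a 0)" "\<forall>x\<in>U. s x = fscale (a 0 x) (kpow m (\<kappa> x))"
      unfolding smooth_coeffs_def by auto
    have "smooth_tensor A U s"
      by (rule smooth_tensor_cong[OF A kformD(1)[OF k(1)] _ smooth_tensor_scale[OF A kformD(1)[OF k(1)] a(1)
              smooth_tensor_kpow[OF A kformD(1,4)[OF k(1)], of m]]]) (use a(2) in auto)
    then show "\<exists>V. open V \<and> x \<in> V \<and> smooth_tensor A V s" using k kformD(1) by blast
  qed
  with 1 show "(\<forall>x. s x \<in> K_fibre (J x) n m) \<and> smooth_tensor A UNIV s" by blast
next
  assume s: "(\<forall>x. s x \<in> K_fibre (J x) n m) \<and> smooth_tensor A UNIV s"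
  have "smooth_coeffs A fscale U r e s" if f: "(U, r, e) \<in> frames (K_power A J n m)" for U r e
    by (rule smooth_coeffs_K[OF f K_frame_facts(1)[OF f] subset_refl])
      (use s smooth_tensor_subset[OF _ A] in auto)
  then show "s \<in> sections A (K_power A J n m)" using s unfolding sections_def by (auto simp: K_power_def)
qed

end

section \<open>The operators on the powers of the canonical bundle\<close>

lemma ext_d_cong:
  assumes A: "smooth_atlas A" and W: "open W" "x \<in> W" and e: "\<And>y. y \<in> W \<Longrightarrow> \<omega> y = \<omega>' y"
  shows "ext_d A k \<omega> x = ext_d A k \<omega>' x"
  unfolding ext_d_eq
proof (rule ed_cong[OF open_chart_image_Int(1)[OF A at_chart_in[OF A] W(1)]])
  show "snd (at_chart A x) x \<in> snd (at_chart A x) ` (W \<inter> fst (at_chart A x))"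
    using W in_at_chart[OF A] by blast
  show "cform A (at_chart A x) \<omega> z w = cform A (at_chart A x) \<omega>' z w"
    if "z \<in> snd (at_chart A x) ` (W \<inter> fst (at_chart A x))" for z w
    using that by (auto simp: cform_def chart_inv_chart[OF A at_chart_in[OF A]] e)
qed

lemma alt_form_ext_d:
  assumes A: "smooth_atlas A" and W: "open W" "x \<in> W" "smooth_form A W \<omega>"
    and a: "\<And>x. x \<in> W \<Longrightarrow> alt_form k (\<omega> x)"
  shows "alt_form (Suc k) (ext_d A k \<omega> x)"
  unfolding ext_d_eq
  by (rule alt_form_ed[OF form_field_cform[OF A at_chart_in[OF A] W(1,3) a]])
    (use W in_at_chart[OF A] in auto)

lemma from_chart_at_chart: "smooth_atlas A \<Longrightarrow> from_chart A (at_chart A x) x v = v"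
  by (simp add: from_chart_eq trans_d_self[OF _ at_chart_in in_at_chart])

text \<open>The Leibniz rule, with dg \<and> \<omega> written as \<open>wedge01\<close>. It is
  computed in the chart chosen at \<open>x\<close>, where conversion of components at
  \<open>x\<close> itself is the identity.\<close>

lemma ext_d_mult:
  assumes A: "smooth_atlas A" and W: "open W" "x \<in> W" "smooth_form A W \<omega>" and g: "smooth_fun A W g"
    and a: "\<And>x. x \<in> W \<Longrightarrow> alt_form n (\<omega> x)"
  shows "ext_d A n (\<lambda>y. fscale (g y) (\<omega> y)) x =
    wedge01 n (\<lambda>u. fscale (dfun A g x u) (kpow 1 (\<omega> x))) + fscale (g x) (ext_d A n \<omega> x)"
proof
  fix v
  let ?c = "at_chart A x"
  let ?g = "\<lambda>z. g (chart_inv ?c z)" and ?z = "snd ?c x"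
  note c = at_chart[OF A, of x]
  have z: "?z \<in> snd ?c ` (W \<inter> fst ?c)" using W c by blast
  have ci: "chart_inv ?c ?z = x" by (rule chart_inv_chart[OF A c])
  have dg: "?g differentiable (at ?z)" by (rule smooth_fun_differentiable[OF A g W(2) c])
  have dw: "(\<lambda>z. cform A ?c \<omega> z w) differentiable (at ?z)" for w
    by (rule smooth_on_differentiable[OF form_fieldD(3)[OF form_field_cform[OF A c(1) W(1,3) a]] z]) auto
  have "ddir u (\<lambda>z. cform A ?c (\<lambda>y. fscale (g y) (\<omega> y)) z w) ?z =
      g x * ddir u (\<lambda>z. cform A ?c \<omega> z w) ?z + dfun A g x u * \<omega> x w" for u w
  proof -
    have "(\<lambda>z. cform A ?c (\<lambda>y. fscale (g y) (\<omega> y)) z w) = (\<lambda>z. ?g z * cform A ?c \<omega> z w)"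
      by (simp add: cform_def fscale_def)
    moreover have "cform A ?c \<omega> ?z w = \<omega> x w"
      unfolding cform_def ci from_chart_at_chart[OF A] ..
    ultimately show ?thesis by (simp only: ddir_mult[OF dg dw] ci dfun_def[OF A])
  qed
  then show "ext_d A n (\<lambda>y. fscale (g y) (\<omega> y)) x v =
    (wedge01 n (\<lambda>u. fscale (dfun A g x u) (kpow 1 (\<omega> x))) + fscale (g x) (ext_d A n \<omega> x)) v"
    by (simp add: ext_d_eq ed_def wedge01_def fscale_def kpow_def sum_distrib_left algebra_simps sum.distrib)
qed

lemma unwedge_add: "unwedge j n (\<eta> + \<eta>') u = unwedge j n \<eta> u + unwedge j n \<eta>' u"
  by (simp add: unwedge_def tproj_add fun_eq_iff)

lemma unwedge_scale: "unwedge j n (fscale a \<eta>) u = fscale a (unwedge j n \<eta> u)"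
  by (simp only: unwedge_def tproj_scale[OF finite_lessThan]) (simp add: fscale_def)

context canonical
begin

text \<open>The differential of \<open>g\<close> splits into \<open>p\<close> of type (1,0) and
  \<open>q\<close> of type (0,1). The product of \<open>p\<close> with an (n,0)-form has no
  (n,1)-part, so only dbar of \<open>g\<close> remains.\<close>

lemma unwedge_ext_d_mult:
  assumes W: "open W" "x \<in> W" "smooth_form A W \<omega>" and g: "smooth_fun A W g"
    and h: "\<And>x. x \<in> W \<Longrightarrow> holo_form (J x) n (\<omega> x)"
  shows "unwedge (J x) n (ext_d A n (\<lambda>y. fscale (g y) (\<omega> y)) x) u =
    fscale (dbar_fun A J g x u) (kpow 1 (\<omega> x)) + fscale (g x) (unwedge (J x) n (ext_d A n \<omega> x) u)"
proof -
  let ?d = "dfun A g x" and ?\<kappa> = "\<omega> x"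
  note lin = linear_dfun[OF A g W(2)]
  define p where "p u = (?d u - \<i> * ?d (J x u)) / 2" for u
  define q where "q u = (?d u + \<i> * ?d (J x u)) / 2" for u
  have q: "q u = dbar_fun A J g x u" for u unfolding q_def dbar_fun_formula[OF g W(2)] ..
  have p1: "p (J x u) = \<i> * p u" and q1: "q (J x u) = - \<i> * q u" for u
    by (simp_all add: p_def q_def J_J linear_neg[OF lin] field_simps)
  have "wedge01 n (\<lambda>u. fscale (?d u) (kpow 1 ?\<kappa>)) =
      wedge01 n (\<lambda>u. fscale (p u) (kpow 1 ?\<kappa>)) + wedge01 n (\<lambda>u. fscale (q u) (kpow 1 ?\<kappa>))"
    by (simp add: fun_eq_iff wedge01_def fscale_def p_def q_def field_simps sum.distrib[symmetric])
  moreover have "unwedge (J x) n (wedge01 n (\<lambda>u. fscale (p u) (kpow 1 ?\<kappa>))) u = 0"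
    unfolding unwedge_wedge01[where \<theta> = p, OF h[OF W(2)] p1] by (simp add: fs.scale_zero_left)
  moreover have "unwedge (J x) n (wedge01 n (\<lambda>u. fscale (q u) (kpow 1 ?\<kappa>))) u = fscale (q u) (kpow 1 ?\<kappa>)"
    unfolding unwedge_wedge01[where \<theta> = q, OF h[OF W(2)] q1] by simp
  moreover have "ext_d A n (\<lambda>y. fscale (g y) (\<omega> y)) x =
      wedge01 n (\<lambda>u. fscale (?d u) (kpow 1 ?\<kappa>)) + fscale (g x) (ext_d A n \<omega> x)"
    by (rule ext_d_mult[OF A W g holo_form_alt[OF h]])
  ultimately show ?thesis by (simp only: unwedge_add unwedge_scale q add_0)
qed

text \<open>The connection form of \<open>\<kappa>\<close>, that is, \<open>dbar \<kappa> = conn \<kappa> \<otimes> \<kappa>\<close>.\<close>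
definition conn :: "('x \<Rightarrow> 'e form) \<Rightarrow> 'x \<Rightarrow> 'e \<Rightarrow> complex" where
  "conn \<kappa> x = (SOME \<theta>. \<theta> \<in> T01 (J x) \<and> unwedge (J x) n (ext_d A n \<kappa> x) = (\<lambda>u. fscale (\<theta> u) (kpow 1 (\<kappa> x))))"

lemma conn:
  assumes k: "kform U \<kappa>" and x: "x \<in> U"
  shows "conn \<kappa> x \<in> T01 (J x)" "unwedge (J x) n (ext_d A n \<kappa> x) u = fscale (conn \<kappa> x u) (kpow 1 (\<kappa> x))"
proof -
  have "unwedge (J x) n (ext_d A n \<kappa> x) \<in> T01_tensor (J x) fscale (K_fibre (J x) n 1)"
    by (rule unwedge_in_T01_tensor[OF linear_J J_J dim alt_form_ext_d[OF A kformD(1)[OF k] x kformD(4,5)[OF k]]])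
  then have ex: "\<exists>\<theta>. \<theta> \<in> T01 (J x) \<and> unwedge (J x) n (ext_d A n \<kappa> x) = (\<lambda>u. fscale (\<theta> u) (kpow 1 (\<kappa> x)))"
    unfolding T01_tensor_K_iff[OF linear_J J_J dim kformD(2,3)[OF k x]] by blast
  note s = someI_ex[OF ex, folded conn_def]
  show "conn \<kappa> x \<in> T01 (J x)" using s by blast
  show "unwedge (J x) n (ext_d A n \<kappa> x) u = fscale (conn \<kappa> x u) (kpow 1 (\<kappa> x))"
    using s by (metis (no_types, lifting))
qed

text \<open>The gauge transformation of the connection form, found by computing dbar of
  \<open>\<kappa>'\<close> once with its own connection form and once by the Leibniz rule.\<close>

lemma conn_mult:
  assumes k: "kform U \<kappa>" and k': "kform U' \<kappa>'" and x: "x \<in> U" "x \<in> U'" and g: "smooth_fun A (U \<inter> U') g"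
    and e: "\<And>y. y \<in> U \<inter> U' \<Longrightarrow> \<kappa>' y = fscale (g y) (\<kappa> y)"
  shows "conn \<kappa>' x u * g x = dbar_fun A J g x u + g x * conn \<kappa> x u"
proof -
  let ?W = "U \<inter> U'"
  have W: "open ?W" "x \<in> ?W" using k k' x kformD(1) by auto
  have nz: "kpow 1 (\<kappa> x) \<noteq> 0" by (rule kpow_ne_0[OF kformD(3)[OF k x(1)]])
  have "fscale (conn \<kappa>' x u * g x) (kpow 1 (\<kappa> x)) = fscale (conn \<kappa>' x u) (kpow 1 (\<kappa>' x))"
    unfolding e[OF W(2)] kpow_scale by (simp add: fs.scale_scale)
  also have "\<dots> = unwedge (J x) n (ext_d A n \<kappa>' x) u" by (rule conn(2)[OF k' x(2), symmetric])
  also have "\<dots> = unwedge (J x) n (ext_d A n (\<lambda>y. fscale (g y) (\<kappa> y)) x) u"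
    by (simp only: ext_d_cong[OF A W, of \<kappa>' "\<lambda>y. fscale (g y) (\<kappa> y)", OF e])
  also have "\<dots> = fscale (dbar_fun A J g x u) (kpow 1 (\<kappa> x)) + fscale (g x) (fscale (conn \<kappa> x u) (kpow 1 (\<kappa> x)))"
    using unwedge_ext_d_mult[OF W smooth_form_subset[OF kformD(4)[OF k] A] g, of u] kformD(2)[OF k] conn(2)[OF k x(1)]
    by auto
  also have "\<dots> = fscale (dbar_fun A J g x u + g x * conn \<kappa> x u) (kpow 1 (\<kappa> x))"
    by (simp add: fs.scale_left_distrib fs.scale_scale)
  finally show ?thesis unfolding fscale_cancel[OF nz] .
qed

lemma smooth_dbar_fun:
  assumes c: "c \<in> A" and W: "open W" "W \<subseteq> fst c" and f: "smooth_fun A W f"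
  shows "smooth_fun A W (\<lambda>x. dbar_fun A J f x (from_chart A c x w))"
proof (rule smooth_fun_chartI[OF A c W])
  let ?S = "snd c ` W" and ?f = "\<lambda>z. f (chart_inv c z)"
  have S: "open ?S" using open_chart_image_Int(1)[OF A c W(1)] W(2) by (simp add: Int_absorb2)
  have sf: "smooth_on ?S ?f" using smooth_funD[OF A f c] W(2) by (simp add: Int_absorb2)
  have sJ: "smooth_on ?S (Jc c w)" by (rule smooth_on_subset[OF smooth_Jc[OF c]]) (use W in auto)
  have "smooth_on ?S (\<lambda>z. (ddir w ?f z + \<i> * (\<Sum>b\<in>Basis. of_real (Jc c w z \<bullet> b) * ddir b ?f z)) * (1/2))"
    by (intro smooth_on_bilinear[OF bounded_bilinear_mult] smooth_on_add smooth_on_sum S smooth_on_const smooth_onD_ddir sf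
        smooth_on_linear_comp[OF bounded_linear_compose[OF bounded_linear_of_real bounded_linear_inner_left]] sJ)
  then show "smooth_on ?S (\<lambda>z. dbar_fun A J f (chart_inv c z) (from_chart A c (chart_inv c z) w))"
  proof (rule smooth_on_cong[OF S, rotated])
    fix z assume "z \<in> ?S"
    then obtain x where x: "x \<in> W" "x \<in> fst c" "z = snd c x" using W by blast
    have d: "?f differentiable (at (snd c x))" by (rule smooth_fun_differentiable[OF A f x(1) c x(2)])
    show "(ddir w ?f z + \<i> * (\<Sum>b\<in>Basis. of_real (Jc c w z \<bullet> b) * ddir b ?f z)) * (1/2) =
        dbar_fun A J f (chart_inv c z) (from_chart A c (chart_inv c z) w)"
      unfolding x(3) chart_inv_chart[OF A c x(2)] dbar_fun_from_chart[OF f x(1) c x(2)] ddir_expand[OF d, of "Jc c w (snd c x)"]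
      by (simp add: scaleR_conv_of_real)
  qed
qed

lemma smooth_ed:
  assumes "form_field T k \<Omega>"
  shows "smooth_on T (\<lambda>z. ed k \<Omega> z v)"
  unfolding ed_def
  by (intro smooth_on_sum smooth_on_bilinear[OF bounded_bilinear_mult] smooth_on_const smooth_onD_ddir
      form_fieldD(3)[OF assms] form_fieldD(1)[OF assms])

text \<open>The connection form is chosen separately at each point. Smoothness follows because it is
  the quotient of a component of the unwedged exterior derivative by a component of
  \<open>\<kappa>\<close> that is nonzero near the point.\<close>

lemma smooth_conn:
  assumes k: "kform U \<kappa>" and c: "c \<in> A"
  shows "smooth_fun A (U \<inter> fst c) (\<lambda>x. conn \<kappa> x (from_chart A c x w))"
proof (rule smooth_fun_local[OF A])
  fix x0 assume x0: "x0 \<in> U \<inter> fst c"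
  let ?W = "U \<inter> fst c"
  have W: "open ?W" "?W \<subseteq> fst c" using kformD(1)[OF k] open_chart[OF A c] by auto
  let ?S = "snd c ` ?W" and ?\<tau> = "\<lambda>l::nat. if l = 0 then \<i> else - \<i>"
  let ?ed = "ed n (cform A c \<kappa>)"
  have S: "open ?S" by (rule open_chart_image_Int(1)[OF A c kformD(1)[OF k]])
  have ff: "form_field ?S n (cform A c \<kappa>)" by (rule form_field_cform[OF A c kformD(1,4,5)[OF k]])
  have sm: "smooth_fun A ?W (\<lambda>x. unwedge (J x) n (ext_d A n \<kappa> x) (from_chart A c x w) (\<lambda>i l. from_chart A c x (w' i l)))" for w'
  proof (rule smooth_fun_chartI[OF A c W])
    have "smooth_on ?S (\<lambda>z. tproj (\<lambda>w. Jc c w z) ?\<tau> {..<Suc n} (?ed z) (case_nat w (w' 0)))"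
    proof (rule smooth_tproj[OF S, of _ _ "{..<Suc n}"])
      show "linear (\<lambda>w. Jc c w z)" if "z \<in> ?S" for z by (rule linear_Jc[OF c]) (use that in auto)
      show "smooth_on ?S (Jc c w)" for w by (rule smooth_on_subset[OF smooth_Jc[OF c]]) auto
      show "linear (\<lambda>x. ?ed z (v(s := x)))" if "z \<in> ?S" "s \<in> {..<Suc n}" for z v s
        using alt_form_linear[OF alt_form_ed[OF ff that(1)]] that(2) by blast
    qed (use smooth_ed[OF ff] in auto)
    then show "smooth_on ?S (\<lambda>z. unwedge (J (chart_inv c z)) n (ext_d A n \<kappa> (chart_inv c z))
        (from_chart A c (chart_inv c z) w) (\<lambda>i l. from_chart A c (chart_inv c z) (w' i l)))"
    proof (rule smooth_on_cong[OF S, rotated])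
      fix z assume "z \<in> ?S"
      then obtain x where x: "x \<in> U" "x \<in> fst c" "z = snd c x" by blast
      have z: "chart_inv c z = x" "z \<in> snd c ` fst c" using x chart_inv_chart[OF A c] by auto
      have "ext_d A n \<kappa> x = (\<lambda>v. ?ed z (\<lambda>l. to_chart A c x (v l)))"
        using ext_d_chart[OF A c x(2) kformD(1)[OF k] x(1) kformD(4,5)[OF k]] x(3) by (auto simp: fun_eq_iff)
      moreover have "tproj (J x) ?\<tau> {..<Suc n} (\<lambda>v. ?ed z (\<lambda>l. to_chart A c x (v l))) =
          (\<lambda>v. tproj (\<lambda>w. Jc c w z) ?\<tau> {..<Suc n} (?ed z) (\<lambda>l. to_chart A c x (v l)))"
        by (rule tproj_conj) (use to_chart_J[OF c z(2)] z(1) in auto)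
      moreover have "(\<lambda>l. to_chart A c x (case_nat (from_chart A c x w) (\<lambda>l. from_chart A c x (w' 0 l)) l)) = case_nat w (w' 0)"
        by (auto simp: fun_eq_iff from_to_chart[OF A c x(2)] split: nat.split)
      ultimately show "tproj (\<lambda>w. Jc c w z) ?\<tau> {..<Suc n} (?ed z) (case_nat w (w' 0)) =
          unwedge (J (chart_inv c z)) n (ext_d A n \<kappa> (chart_inv c z))
            (from_chart A c (chart_inv c z) w) (\<lambda>i l. from_chart A c (chart_inv c z) (w' i l))"
        unfolding unwedge_def z(1) by (simp only:)
    qed
  qed
  have "kpow 1 (\<kappa> x0) \<noteq> 0" using x0 by (intro kpow_ne_0 kformD(3)[OF k]) auto
  then obtain w' where w': "kpow 1 (\<kappa> x0) (\<lambda>i l. from_chart A c x0 (w' i l)) \<noteq> 0"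
    using nonzero_from_chart[OF A c] x0 by blast
  let ?f = "\<lambda>x. kpow 1 (\<kappa> x) (\<lambda>i l. from_chart A c x (w' i l))"
  have sf: "smooth_fun A ?W ?f"
    using smooth_tensor_kpow[OF A kformD(1,4)[OF k]] c unfolding smooth_tensor_def by blast
  let ?N = "?W \<inter> ?f -` (- {0})"
  have N: "open ?N" by (rule continuous_open_preimage[OF smooth_fun_continuous[OF A W(1) sf] W(1)]) auto
  have "smooth_fun A ?N (\<lambda>x. unwedge (J x) n (ext_d A n \<kappa> x) (from_chart A c x w) (\<lambda>i l. from_chart A c x (w' i l)) / ?f x)"
    by (rule smooth_fun_divide[OF A N smooth_fun_subset[OF A sm] smooth_fun_subset[OF A sf]]) auto
  then have "smooth_fun A ?N (\<lambda>x. conn \<kappa> x (from_chart A c x w))"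
    by (rule smooth_fun_cong[OF A N, rotated]) (use conn(2)[OF k] in \<open>auto simp: fscale_def\<close>)
  then show "\<exists>V. open V \<and> x0 \<in> V \<and> smooth_fun A V (\<lambda>x. conn \<kappa> x (from_chart A c x w))"
    using N x0 w' by (intro exI[of _ ?N]) auto
qed

text \<open>The formula of the overview for a f \<kappa>^m, read off from an arbitrary local
  generator; by \<open>dK_unique\<close> the choice does not influence the value.\<close>

definition dK :: "nat \<Rightarrow> ('x \<Rightarrow> 'e multiform) \<Rightarrow> 'x \<Rightarrow> 'e \<Rightarrow> 'e multiform" where
  "dK m s x u = (SOME t. \<exists>U \<kappa> a. kform U \<kappa> \<and> x \<in> U \<and> smooth_fun A U a \<and>
     (\<forall>y\<in>U. s y = fscale (a y) (kpow m (\<kappa> y))) \<and>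
     t = fscale (dbar_fun A J a x u + of_nat m * a x * conn \<kappa> x u) (kpow m (\<kappa> x)))"

text \<open>The extra factor \<open>g x\<close> on both sides avoids the exponent
  \<open>m - 1\<close>, and with it the special case of exponent zero.\<close>

lemma dbar_fun_power:
  assumes "open W" "x \<in> W" "smooth_fun A W g"
  shows "dbar_fun A J (\<lambda>y. g y ^ m) x u * g x = of_nat m * g x ^ m * dbar_fun A J g x u"
proof (induction m)
  case 0
  then show ?case by (simp add: dbar_fun_const)
next
  case (Suc m)
  have "dbar_fun A J (\<lambda>y. g y ^ Suc m) x u = g x * dbar_fun A J (\<lambda>y. g y ^ m) x u + dbar_fun A J g x u * g x ^ m"
    unfolding power_Suc by (rule dbar_fun_mult[OF assms(3) smooth_fun_power[OF A assms(1,3)] assms(1,2)])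
  then have "dbar_fun A J (\<lambda>y. g y ^ Suc m) x u * g x =
      g x * (dbar_fun A J (\<lambda>y. g y ^ m) x u * g x) + dbar_fun A J g x u * g x ^ Suc m"
    by (simp add: algebra_simps)
  then show ?case unfolding Suc.IH by (simp add: algebra_simps)
qed

lemma kform_ratio:
  assumes k: "kform U \<kappa>" and k': "kform U' \<kappa>'"
  shows "\<exists>g. smooth_fun A (U \<inter> U') g \<and> (\<forall>y\<in>U \<inter> U'. \<kappa>' y = fscale (g y) (\<kappa> y) \<and> g y \<noteq> 0)"
proof -
  let ?W = "U \<inter> U'"
  have W: "open ?W" using k k' kformD(1) by auto
  have "\<exists>c. \<kappa>' y = fscale c (\<kappa> y)" if "y \<in> ?W" for y
    using holo_form_proportional[OF linear_J J_J dim kformD(2,3)[OF k] kformD(2)[OF k']] that by blast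
  then obtain g where g: "\<And>y. y \<in> ?W \<Longrightarrow> \<kappa>' y = fscale (g y) (\<kappa> y)" by metis
  have "smooth_fun A ?W g"
  proof (rule smooth_coefficient[OF A W])
    show "smooth_tensor A ?W (\<lambda>y. kpow 1 (\<kappa> y))" "smooth_tensor A ?W (\<lambda>y. kpow 1 (\<kappa>' y))"
      by (rule smooth_tensor_kpow[OF A W smooth_form_subset[OF kformD(4) A]], use k k' in auto)+
    show "kpow 1 (\<kappa> x) \<noteq> 0" if "x \<in> ?W" for x using kpow_ne_0 kformD(3)[OF k] that by blast
    show "kpow 1 (\<kappa>' x) = fscale (g x) (kpow 1 (\<kappa> x))" if "x \<in> ?W" for x
      unfolding g[OF that] kpow_scale by simp
  qed
  moreover have "g y \<noteq> 0" if "y \<in> ?W" for y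
  proof
    assume "g y = 0"
    then have "\<kappa>' y = 0" using g[OF that] by (simp add: fs.scale_zero_left)
    then show False using kformD(3)[OF k'] that by blast
  qed
  ultimately show ?thesis using g by blast
qed

text \<open>If \<kappa>' = g \<kappa> then a = a' g^m. Differentiating g^m produces m times dbar g,
  which is exactly compensated by the gauge term in m times the connection form. The identity is
  proved after multiplication by \<open>g x\<close>, which is nonzero.\<close>

lemma dK_unique:
  assumes k: "kform U \<kappa>" "x \<in> U" and a: "smooth_fun A U a" "\<And>y. y \<in> U \<Longrightarrow> s y = fscale (a y) (kpow m (\<kappa> y))"
    and k': "kform U' \<kappa>'" "x \<in> U'" and a': "smooth_fun A U' a'" "\<And>y. y \<in> U' \<Longrightarrow> s y = fscale (a' y) (kpow m (\<kappa>' y))"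
  shows "fscale (dbar_fun A J a' x u + of_nat m * a' x * conn \<kappa>' x u) (kpow m (\<kappa>' x)) =
    fscale (dbar_fun A J a x u + of_nat m * a x * conn \<kappa> x u) (kpow m (\<kappa> x))"
proof -
  let ?W = "U \<inter> U'"
  have W: "open ?W" "x \<in> ?W" using k k' kformD(1) by auto
  obtain g where g: "smooth_fun A ?W g" "\<And>y. y \<in> ?W \<Longrightarrow> \<kappa>' y = fscale (g y) (\<kappa> y)" "\<And>y. y \<in> ?W \<Longrightarrow> g y \<noteq> 0"
    using kform_ratio[OF k(1) k'(1)] by blast
  have sa: "smooth_fun A ?W a" "smooth_fun A ?W a'"
    using smooth_fun_subset[OF A a(1)] smooth_fun_subset[OF A a'(1)] by auto
  have e: "a y = a' y * g y ^ m" if y: "y \<in> ?W" for y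
  proof -
    have "fscale (a y) (kpow m (\<kappa> y)) = s y" by (rule a(2)[symmetric]) (use y in simp)
    also have "\<dots> = fscale (a' y) (kpow m (\<kappa>' y))" by (rule a'(2)) (use y in simp)
    also have "\<dots> = fscale (a' y * g y ^ m) (kpow m (\<kappa> y))" by (simp only: g(2)[OF y] kpow_scale fs.scale_scale)
    finally have "fscale (a y) (kpow m (\<kappa> y)) = fscale (a' y * g y ^ m) (kpow m (\<kappa> y))" .
    then show ?thesis using fscale_cancel[OF kpow_ne_0[OF kformD(3)[OF k(1)]]] y by blast
  qed
  have "dbar_fun A J a x u = dbar_fun A J (\<lambda>y. a' y * g y ^ m) x u"
    by (rule dbar_fun_cong[OF W e sa(1)])
  also have "\<dots> = a' x * dbar_fun A J (\<lambda>y. g y ^ m) x u + dbar_fun A J a' x u * g x ^ m"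
    by (rule dbar_fun_mult[OF sa(2) smooth_fun_power[OF A W(1) g(1)] W])
  finally have "(dbar_fun A J a x u + of_nat m * a x * conn \<kappa> x u) * g x =
      a' x * (dbar_fun A J (\<lambda>y. g y ^ m) x u * g x) + dbar_fun A J a' x u * g x ^ m * g x + of_nat m * a x * conn \<kappa> x u * g x"
    by (simp add: algebra_simps)
  also have "\<dots> = dbar_fun A J a' x u * g x ^ m * g x + of_nat m * a' x * g x ^ m * (dbar_fun A J g x u + g x * conn \<kappa> x u)"
    unfolding dbar_fun_power[OF W g(1)] e[OF W(2)] by (simp add: algebra_simps)
  also have "dbar_fun A J g x u + g x * conn \<kappa> x u = conn \<kappa>' x u * g x"
    by (rule conn_mult[OF k(1) k'(1) k(2) k'(2) g(1,2), symmetric])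
  also have "dbar_fun A J a' x u * g x ^ m * g x + of_nat m * a' x * g x ^ m * (conn \<kappa>' x u * g x) =
      (dbar_fun A J a' x u + of_nat m * a' x * conn \<kappa>' x u) * g x ^ m * g x"
    by (simp add: algebra_simps)
  finally have "dbar_fun A J a x u + of_nat m * a x * conn \<kappa> x u =
      (dbar_fun A J a' x u + of_nat m * a' x * conn \<kappa>' x u) * g x ^ m"
    using g(3)[OF W(2)] by simp
  then show ?thesis unfolding g(2)[OF W(2)] kpow_scale by (simp add: fs.scale_scale)
qed

lemma dK_eq:
  assumes k: "kform U \<kappa>" "x \<in> U" and a: "smooth_fun A U a" "\<forall>y\<in>U. s y = fscale (a y) (kpow m (\<kappa> y))"
  shows "dK m s x u = fscale (dbar_fun A J a x u + of_nat m * a x * conn \<kappa> x u) (kpow m (\<kappa> x))"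
  unfolding dK_def
proof (rule some_equality)
  show "\<exists>U \<kappa>' a'. kform U \<kappa>' \<and> x \<in> U \<and> smooth_fun A U a' \<and> (\<forall>y\<in>U. s y = fscale (a' y) (kpow m (\<kappa>' y))) \<and>
     fscale (dbar_fun A J a x u + of_nat m * a x * conn \<kappa> x u) (kpow m (\<kappa> x)) =
     fscale (dbar_fun A J a' x u + of_nat m * a' x * conn \<kappa>' x u) (kpow m (\<kappa>' x))"
    by (intro exI[of _ U] exI[of _ \<kappa>] exI[of _ a] conjI refl k a)
next
  fix t assume "\<exists>U \<kappa> a. kform U \<kappa> \<and> x \<in> U \<and> smooth_fun A U a \<and> (\<forall>y\<in>U. s y = fscale (a y) (kpow m (\<kappa> y))) \<and>
     t = fscale (dbar_fun A J a x u + of_nat m * a x * conn \<kappa> x u) (kpow m (\<kappa> x))"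
  then obtain U' \<kappa>' a' where k': "kform U' \<kappa>'" "x \<in> U'" "smooth_fun A U' a'"
    "\<And>y. y \<in> U' \<Longrightarrow> s y = fscale (a' y) (kpow m (\<kappa>' y))"
    and t: "t = fscale (dbar_fun A J a' x u + of_nat m * a' x * conn \<kappa>' x u) (kpow m (\<kappa>' x))"
    by (elim exE conjE) blast
  show "t = fscale (dbar_fun A J a x u + of_nat m * a x * conn \<kappa> x u) (kpow m (\<kappa> x))"
    unfolding t by (rule dK_unique[OF k a(1) _ k']) (use a(2) in blast)
qed

lemma section_coefficient:
  assumes s: "s \<in> sections A (K_power A J n m)" and k: "kform U \<kappa>"
  shows "\<exists>a. smooth_fun A U a \<and> (\<forall>y\<in>U. s y = fscale (a y) (kpow m (\<kappa> y)))"
proof -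
  have "\<exists>c. s y = fscale c (kpow m (\<kappa> y))" if "y \<in> U" for y
    using s K_fibre_kform[OF k that] unfolding sections_K_iff by blast
  then obtain a where a: "\<And>y. y \<in> U \<Longrightarrow> s y = fscale (a y) (kpow m (\<kappa> y))" by metis
  have "smooth_fun A U a"
    by (rule smooth_coefficient[OF A kformD(1)[OF k] smooth_tensor_kpow[OF A kformD(1,4)[OF k], of m]
          kpow_ne_0[OF kformD(3)[OF k]] smooth_tensor_subset[OF _ A, of UNIV s] a])
      (use s in \<open>auto simp: sections_K_iff\<close>)
  then show ?thesis using a by blast
qed

lemma K_simps: "smul (K_power A J n m) = fscale" "fibre (K_power A J n m) = (\<lambda>x. K_fibre (J x) n m)"
  by (simp_all add: K_power_def)

lemma dK_add:
  assumes s: "s \<in> sections A (K_power A J n m)" and t: "t \<in> sections A (K_power A J n m)"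
  shows "dK m (\<lambda>x. s x + t x) x u = dK m s x u + dK m t x u"
proof -
  obtain U \<kappa> where k: "kform U \<kappa>" "x \<in> U" using kform_exists by blast
  note U = kformD(1)[OF k(1)]
  obtain a where a: "smooth_fun A U a" "\<forall>y\<in>U. s y = fscale (a y) (kpow m (\<kappa> y))"
    using section_coefficient[OF s k(1)] by blast
  obtain b where b: "smooth_fun A U b" "\<forall>y\<in>U. t y = fscale (b y) (kpow m (\<kappa> y))"
    using section_coefficient[OF t k(1)] by blast
  have "s y + t y = fscale (a y + b y) (kpow m (\<kappa> y))" if "y \<in> U" for y
    using a(2)[rule_format, OF that] b(2)[rule_format, OF that] by (simp add: fs.scale_left_distrib)
  then show ?thesis
    unfolding dK_eq[OF k a] dK_eq[OF k b] fs.scale_left_distrib[symmetric]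
    by (subst dK_eq[OF k smooth_fun_add[OF A U a(1) b(1)]])
      (auto simp: dbar_fun_add[OF a(1) b(1) U k(2)] algebra_simps)
qed

lemma dK_mult:
  assumes s: "s \<in> sections A (K_power A J n m)" and f: "smooth_fun A UNIV f"
  shows "dK m (\<lambda>x. fscale (f x) (s x)) x u = fscale (dbar_fun A J f x u) (s x) + fscale (f x) (dK m s x u)"
proof -
  obtain U \<kappa> where k: "kform U \<kappa>" "x \<in> U" using kform_exists by blast
  note U = kformD(1)[OF k(1)]
  obtain a where a: "smooth_fun A U a" "\<forall>y\<in>U. s y = fscale (a y) (kpow m (\<kappa> y))"
    using section_coefficient[OF s k(1)] by blast
  have f': "smooth_fun A U f" by (rule smooth_fun_subset[OF A f]) simp
  have "fscale (f y) (s y) = fscale (f y * a y) (kpow m (\<kappa> y))" if "y \<in> U" for y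
    using a(2)[rule_format, OF that] by (simp add: fs.scale_scale)
  then show ?thesis
    unfolding dK_eq[OF k a] a(2)[rule_format, OF k(2)] fs.scale_scale fs.scale_left_distrib[symmetric]
    by (subst dK_eq[OF k smooth_fun_mult[OF A U f' a(1)]], blast)
      (simp only: dbar_fun_mult[OF f' a(1) U k(2)], simp add: algebra_simps)
qed

lemma dK_tensor:
  assumes s: "s \<in> sections A (K_power A J n 1)" and t: "t \<in> sections A (K_power A J n m)"
  shows "dK (Suc m) (\<lambda>x. tensor (s x) (t x)) x u = tensor (dK 1 s x u) (t x) + tensor (s x) (dK m t x u)"
proof -
  obtain U \<kappa> where k: "kform U \<kappa>" "x \<in> U" using kform_exists by blast
  note U = kformD(1)[OF k(1)]
  obtain a where a: "smooth_fun A U a" "\<forall>y\<in>U. s y = fscale (a y) (kpow 1 (\<kappa> y))"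
    using section_coefficient[OF s k(1)] by blast
  obtain b where b: "smooth_fun A U b" "\<forall>y\<in>U. t y = fscale (b y) (kpow m (\<kappa> y))"
    using section_coefficient[OF t k(1)] by blast
  have T: "tensor (fscale p (kpow 1 \<kappa>)) (fscale q (kpow m \<kappa>)) = fscale (p * q) (kpow (Suc m) \<kappa>)" for p q and \<kappa> :: "'e form"
    by (simp add: fun_eq_iff tensor_def fscale_def kpow_def prod.lessThan_Suc_shift del: prod.lessThan_Suc)
  have "tensor (s y) (t y) = fscale (a y * b y) (kpow (Suc m) (\<kappa> y))" if "y \<in> U" for y
    unfolding a(2)[rule_format, OF that] b(2)[rule_format, OF that] T ..
  then show ?thesis
    unfolding dK_eq[OF k a] dK_eq[OF k b] a(2)[rule_format, OF k(2)] b(2)[rule_format, OF k(2)] T fs.scale_left_distrib[symmetric]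
    by (subst dK_eq[OF k smooth_fun_mult[OF A U a(1) b(1)]])
      (auto simp: dbar_fun_mult[OF a(1) b(1) U k(2)] algebra_simps)
qed

lemma dK_sections01:
  assumes s: "s \<in> sections A (K_power A J n m)"
  shows "dK m s \<in> sections01 A J (K_power A J n m)"
  unfolding sections01_def K_simps
proof (intro CollectI conjI allI ballI)
  fix x
  obtain U \<kappa> where k: "kform U \<kappa>" "x \<in> U" using kform_exists by blast
  obtain a where a: "smooth_fun A U a" "\<forall>y\<in>U. s y = fscale (a y) (kpow m (\<kappa> y))"
    using section_coefficient[OF s k(1)] by blast
  have lin: "linear (dbar_fun A J a x)" "\<And>v. dbar_fun A J a x (J x v) = - \<i> * dbar_fun A J a x v"
  proof -
    note l = linear_dfun[OF A a(1) k(2)]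
    show "linear (dbar_fun A J a x)"
      by (rule linearI) (simp_all add: dbar_fun_formula[OF a(1) k(2)] linear_add[OF l] linear_add[OF linear_J]
          linear_cmul[OF l] linear_cmul[OF linear_J] field_simps scaleR_conv_of_real)
    show "dbar_fun A J a x (J x v) = - \<i> * dbar_fun A J a x v" for v
      by (simp add: dbar_fun_formula[OF a(1) k(2)] J_J linear_neg[OF l] field_simps)
  qed
  have "(\<lambda>u. dbar_fun A J a x u + of_nat m * a x * conn \<kappa> x u) \<in> T01 (J x)"
    by (rule T01_add[OF _ T01_scale[OF conn(1)[OF k]]]) (use lin in \<open>simp add: T01_def\<close>)
  then show "dK m s x \<in> T01_tensor (J x) fscale (K_fibre (J x) n m)"
    unfolding T01_tensor_K_iff[OF linear_J J_J dim kformD(2,3)[OF k]]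
    by (rule bexI[rotated]) (rule ext, rule dK_eq[OF k a])
next
  fix fr assume fr: "fr \<in> frames (K_power A J n m)"
  obtain U0 r e where e: "fr = (U0, r, e)" "(U0, r, e) \<in> frames (K_power A J n m)" using fr by (cases fr) auto
  have "smooth_coeffs A fscale (U0 \<inter> fst c) r e (\<lambda>x. dK m s x (from_chart A c x w))" if c: "c \<in> A" for c w
  proof (rule smooth_coeffs_K[OF e(2)])
    let ?t = "\<lambda>x. dK m s x (from_chart A c x w)"
    show "open (U0 \<inter> fst c)" using K_frame_facts(1)[OF e(2)] open_chart[OF A c] by blast
    show "?t x \<in> K_fibre (J x) n m" for x
    proof -
      obtain U \<kappa> where k: "kform U \<kappa>" "x \<in> U" using kform_exists by blast
      obtain a where a: "smooth_fun A U a" "\<forall>y\<in>U. s y = fscale (a y) (kpow m (\<kappa> y))"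
        using section_coefficient[OF s k(1)] by blast
      show ?thesis unfolding K_fibre_kform[OF k] by (rule exI) (rule dK_eq[OF k a])
    qed
    show "smooth_tensor A (U0 \<inter> fst c) ?t"
    proof (rule smooth_tensor_local[OF A])
      fix x assume x: "x \<in> U0 \<inter> fst c"
      obtain U \<kappa> where k: "kform U \<kappa>" "x \<in> U" using kform_exists by blast
      obtain a where a: "smooth_fun A U a" "\<forall>y\<in>U. s y = fscale (a y) (kpow m (\<kappa> y))"
        using section_coefficient[OF s k(1)] by blast
      let ?V = "U \<inter> fst c"
      have V: "open ?V" "?V \<subseteq> fst c" "?V \<subseteq> U" using kformD(1)[OF k(1)] open_chart[OF A c] by auto
      have sa: "smooth_fun A ?V a" by (rule smooth_fun_subset[OF A a(1) V(3)])
      have "smooth_tensor A ?V (\<lambda>y. fscale (dbar_fun A J a y (from_chart A c y w) +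
          of_nat m * a y * conn \<kappa> y (from_chart A c y w)) (kpow m (\<kappa> y)))"
        by (intro smooth_tensor_scale[OF A V(1)] smooth_fun_add[OF A V(1)] smooth_fun_mult[OF A V(1)] smooth_fun_const[OF A] sa
            smooth_conn[OF k(1) c] smooth_dbar_fun[OF c V(1,2) sa] smooth_tensor_kpow[OF A V(1)]
            smooth_form_subset[OF kformD(4)[OF k(1)] A V(3)])
      then have "smooth_tensor A ?V ?t"
        by (rule smooth_tensor_cong[OF A V(1), rotated]) (use dK_eq[OF k(1) _ a] in auto)
      then show "\<exists>V. open V \<and> x \<in> V \<and> smooth_tensor A V ?t" using V k(2) x by blast
    qed
  qed auto
  then show "case fr of (U, r, e) \<Rightarrow> \<forall>c\<in>A. \<forall>w. smooth_coeffs A fscale (U \<inter> fst c) r e (\<lambda>x. dK m s x (from_chart A c x w))"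
    unfolding e(1) by simp
qed

text \<open>The bridge to the given definition: \<open>the_unwedge\<close> computes its description,
  and the Leibniz rule turns the result into the local formula for the first power.\<close>

lemma dbar_K_eq:
  assumes s: "s \<in> sections A (K_power A J n 1)"
  shows "dbar_K A J n s x u = dK 1 s x u"
proof -
  obtain U \<kappa> where k: "kform U \<kappa>" "x \<in> U" using kform_exists by blast
  obtain a where a: "smooth_fun A U a" "\<forall>y\<in>U. s y = fscale (a y) (kpow 1 (\<kappa> y))"
    using section_coefficient[OF s k(1)] by blast
  note U = kformD(1)[OF k(1)]
  have ed: "ext_d A n (\<lambda>y v. s y (\<lambda>_. v)) x = ext_d A n (\<lambda>y. fscale (a y) (\<kappa> y)) x"
    by (rule ext_d_cong[OF A U k(2)]) (simp add: a(2) fun_eq_iff fscale_def kpow_def)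
  have "alt_form (Suc n) (ext_d A n (\<lambda>y. fscale (a y) (\<kappa> y)) x)"
  proof (rule alt_form_ext_d[OF A U k(2)])
    show "smooth_form A U (\<lambda>y. fscale (a y) (\<kappa> y))"
      unfolding smooth_form_def fscale_def
    proof (intro ballI allI)
      fix c w assume c: "c \<in> A"
      show "smooth_fun A (U \<inter> fst c) (\<lambda>x. a x * \<kappa> x (\<lambda>l. from_chart A c x (w l)))"
        by (rule smooth_fun_mult[OF A _ smooth_fun_subset[OF A a(1)]])
          (use kformD(4)[OF k(1)] c U open_chart[OF A c] in \<open>auto simp: smooth_form_def\<close>)
    qed
  qed (rule alt_form_scale[OF kformD(5)[OF k(1)]])
  then have "dbar_K A J n s x = unwedge (J x) n (ext_d A n (\<lambda>y. fscale (a y) (\<kappa> y)) x)"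
    unfolding dbar_K_def dbar_def add_0_right add_0 ed by (rule the_unwedge[OF linear_J J_J dim])
  then show ?thesis
    unfolding dK_eq[OF k a] using unwedge_ext_d_mult[OF U k(2) kformD(4)[OF k(1)] a(1) kformD(2)[OF k(1)], of u] conn(2)[OF k]
    by (simp add: fs.scale_left_distrib fs.scale_scale)
qed

text \<open>Agreement with \<open>dK\<close> is asked on sections only, because nothing is known
  elsewhere about an operator that comes from a choice.\<close>

lemma pseudoholomorphic_structureI:
  assumes D: "\<And>s. s \<in> sections A (K_power A J n m) \<Longrightarrow> D s = dK m s"
  shows "pseudoholomorphic_structure A J (K_power A J n m) D"
proof -
  interpret complex_bundle A J "K_power A J n m" by unfold_locales (rule bundle_K)
  let ?S = "sections A (K_power A J n m)"
  note add = sections_add and mult = sections_mult[unfolded K_simps]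
  have L: "D (\<lambda>x. fscale (f x) (s x)) = (\<lambda>x u. fscale (dbar_fun A J f x u) (s x) + fscale (f x) (D s x u))"
    if "smooth_fun A UNIV f" "s \<in> ?S" for f s
    unfolding D[OF mult[OF that]] D[OF that(2)] by (intro ext) (simp only: dK_mult[OF that(2,1)])
  have sc: "D (\<lambda>x. fscale c (s x)) = (\<lambda>x u. fscale c (D s x u))" if "s \<in> ?S" for c s
    using L[OF smooth_fun_const[OF A] that, of c] by (simp only: dbar_fun_const fs.scale_zero_left add_0)
  have ad: "D (\<lambda>x. s x + t x) = (\<lambda>x u. D s x u + D t x u)" if "s \<in> ?S" "t \<in> ?S" for s t
    unfolding D[OF add[OF that]] D[OF that(1)] D[OF that(2)] by (intro ext) (simp only: dK_add[OF that])
  \<comment> \<open>The commutator with multiplication by \<open>f\<close> is multiplication by dbar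
    of \<open>f\<close>, and this commutes with multiplication by \<open>g\<close>.\<close>
  have ord: "order_le (Suc 0) A (K_power A J n m) D"
    unfolding order_le.simps K_simps
  proof (intro allI impI, elim conjE)
    fix f g :: "'x \<Rightarrow> complex" and s assume f: "smooth_fun A UNIV f" and g: "smooth_fun A UNIV g" and s: "s \<in> ?S"
    show "(\<lambda>x u. D (\<lambda>x. fscale (f x) (fscale (g x) (s x))) x u - fscale (f x) (D (\<lambda>x. fscale (g x) (s x)) x u)) =
      (\<lambda>x u. fscale (g x) (D (\<lambda>x. fscale (f x) (s x)) x u - fscale (f x) (D s x u)))"
      unfolding L[OF f mult[OF g s]] L[OF g s] L[OF f s]
      by (simp add: fun_eq_iff fscale_def algebra_simps)
  qed
  show ?thesis
    unfolding pseudoholomorphic_structure_def differential_operator_def K_simps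
    using L sc ad ord D dK_sections01 by (intro conjI ballI allI impI exI[of _ "Suc 0"]) auto
qed

text \<open>By the local formula such an operator is determined by its value on a cut-off generator.
  With the squared cut-off function this generator is a tensor product of two global sections, on
  which the product rule prescribes the value.\<close>

lemma pseudoholomorphic_unique:
  assumes D: "pseudoholomorphic_structure A J (K_power A J n (Suc m)) D"
    and T: "\<And>s1 s2. s1 \<in> sections A (K_power A J n 1) \<Longrightarrow> s2 \<in> sections A (K_power A J n m) \<Longrightarrow>
      D (\<lambda>x. tensor (s1 x) (s2 x)) = (\<lambda>x u. tensor (dK 1 s1 x u) (s2 x) + tensor (s1 x) (dK m s2 x u))"
    and s: "s \<in> sections A (K_power A J n (Suc m))"
  shows "D s = dK (Suc m) s"
proof (rule ext, rule ext)
  fix x u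
  interpret D: pseudoholomorphic_bundle A J "K_power A J n (Suc m)" D
    by unfold_locales (rule bundle_K, rule D)
  interpret K: pseudoholomorphic_bundle A J "K_power A J n (Suc m)" "dK (Suc m)"
    by unfold_locales (rule pseudoholomorphic_structureI[OF refl])
  interpret E1: complex_bundle A J "K_power A J n 1" by unfold_locales (rule bundle_K)
  interpret Em: complex_bundle A J "K_power A J n m" by unfold_locales (rule bundle_K)
  obtain U \<kappa> where k: "kform U \<kappa>" "x \<in> U" using kform_exists by blast
  obtain \<zeta> :: "'x \<Rightarrow> complex" and N K where z: "smooth_fun A UNIV \<zeta>" "closed K" "K \<subseteq> U"
    "\<And>x. x \<notin> K \<Longrightarrow> \<zeta> x = 0" and N: "open N" "N \<subseteq> K" "\<And>x. x \<in> N \<Longrightarrow> \<zeta> x = 1" "x \<in> N"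
    using cutoff_exists[OF A kformD(1)[OF k(1)] k(2)] by blast
  define s1 where "s1 p = (\<lambda>y. if y \<in> U then fscale (\<zeta> y) (kpow p (\<kappa> y)) else 0)" for p
  have s1: "s1 p \<in> sections A (K_power A J n p)" for p
  proof -
    interpret Ep: complex_bundle A J "K_power A J n p" by unfold_locales (rule bundle_K)
    show ?thesis
      unfolding s1_def by (rule Ep.cut_section[OF K_frame[OF k(1)] zero_less_one z, unfolded K_simps])
  qed
  let ?\<zeta> = "\<lambda>x. \<zeta> x * \<zeta> x"
  have z2: "smooth_fun A UNIV ?\<zeta>" "\<And>x. x \<notin> K \<Longrightarrow> ?\<zeta> x = 0" "\<And>x. x \<in> N \<Longrightarrow> ?\<zeta> x = 1"
    using smooth_fun_mult[OF A open_UNIV z(1) z(1)] z(4) N(3) by auto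
  have tz: "(\<lambda>y. if y \<in> U then smul (K_power A J n (Suc m)) (?\<zeta> y) (kpow (Suc m) (\<kappa> y)) else 0) =
      (\<lambda>y. tensor (s1 1 y) (s1 m y))"
    unfolding K_simps s1_def
    by (auto simp: fun_eq_iff tensor_def fscale_def kpow_def prod.lessThan_Suc_shift simp del: prod.lessThan_Suc)
  have "D (\<lambda>y. tensor (s1 1 y) (s1 m y)) = dK (Suc m) (\<lambda>y. tensor (s1 1 y) (s1 m y))"
    unfolding T[OF s1 s1] by (intro ext) (rule fun_cong[OF dK_tensor[OF s1 s1, symmetric]])
  moreover note D.D_local_formula[of _ _ _ ?\<zeta>, OF K_frame[OF k(1)] z2(1) z(2,3) z2(2) N(1,2) z2(3) s N(4), of u, unfolded tz]
    K.D_local_formula[of _ _ _ ?\<zeta>, OF K_frame[OF k(1)] z2(1) z(2,3) z2(2) N(1,2) z2(3) s N(4), of u, unfolded tz]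
  ultimately show "D s x u = dK (Suc m) s x u" by (simp only: simp_thms implies_True_equals)

qed

text \<open>\<open>dK\<close> has the two properties, so the choice is not vacuous, and uniqueness
  then identifies whatever was chosen. The induction is needed because the product rule refers to
  the operator chosen for the preceding power.\<close>

lemma dbar_K_power_eq:
  "s \<in> sections A (K_power A J n (Suc m)) \<Longrightarrow> dbar_K_power A J n (Suc m) s = dK (Suc m) s"
proof (induction m arbitrary: s)
  case 0
  then show ?case by (simp add: fun_eq_iff dbar_K_eq)
next
  case (Suc m)
  let ?P = "\<lambda>D. pseudoholomorphic_structure A J (K_power A J n (Suc (Suc m))) D \<and>
     (\<forall>s1 \<in> sections A (K_power A J n 1). \<forall>s2 \<in> sections A (K_power A J n (Suc m)).
        D (\<lambda>x. tensor (s1 x) (s2 x)) =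
          (\<lambda>x u. tensor (dbar_K A J n s1 x u) (s2 x) +
                 tensor (s1 x) (dbar_K_power A J n (Suc m) s2 x u)))"
  have "?P (dK (Suc (Suc m)))"
    using pseudoholomorphic_structureI[OF refl] by (simp add: fun_eq_iff dK_tensor[unfolded One_nat_def] dbar_K_eq[unfolded One_nat_def] Suc.IH)
  then have ex: "\<exists>D. ?P D" by blast
  have P: "?P (dbar_K_power A J n (Suc (Suc m)))"
    unfolding dbar_K_power.simps(3) by (rule someI_ex[where P = ?P, OF ex])
  show ?case
    by (rule pseudoholomorphic_unique[OF conjunct1[OF P] _ Suc.prems])
      (use conjunct2[OF P] in \<open>simp add: fun_eq_iff dbar_K_eq[unfolded One_nat_def] Suc.IH\<close>)
qed

end

section \<open>Invariance under diffeomorphisms\<close>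

text \<open>The inverse is a parameter of its own, which makes the situation symmetric: each result
  is available for \<open>G\<close> by exchanging the roles.\<close>

locale diffeomorphism_pair =
  fixes A :: "('x::{t2_space,second_countable_topology}, 'e::euclidean_space) atlas"
    and B :: "('y::{t2_space,second_countable_topology}, 'f::euclidean_space) atlas"
    and F :: "'y \<Rightarrow> 'x" and G :: "'x \<Rightarrow> 'y"
  assumes A: "smooth_atlas A" and B: "smooth_atlas B" and F: "smooth_map B A F" and G: "smooth_map A B G"
    and GF: "G (F y) = y" and FG: "F (G x) = x"
begin

definition local_map :: "('x, 'e) chart \<Rightarrow> ('y, 'f) chart \<Rightarrow> 'f \<Rightarrow> 'e" where
  "local_map c d z = snd c (F (chart_inv d z))"

lemma open_vimage_F: "open U \<Longrightarrow> open (F -` U)"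
  using F by (simp add: smooth_map_def continuous_on_open_vimage[OF open_UNIV])

lemma smooth_local_map: "c \<in> A \<Longrightarrow> d \<in> B \<Longrightarrow> smooth_on (snd d ` (fst d \<inter> F -` fst c)) (local_map c d)"
  using F unfolding smooth_map_def local_map_def by (auto simp: o_def)

lemma local_map_chart: "d \<in> B \<Longrightarrow> q \<in> fst d \<Longrightarrow> local_map c d (snd d q) = snd c (F q)"
  by (simp add: local_map_def chart_inv_chart[OF B])

lemma local_map_differentiable:
  assumes "c \<in> A" "d \<in> B" "y \<in> fst d" "F y \<in> fst c"
  shows "local_map c d differentiable (at (snd d y))"
  by (rule smooth_on_differentiable[OF smooth_local_map[OF assms(1,2)]]) (use assms in auto)

lemma tangent_map_eq: "tangent_map B A F y w = ddir w (local_map (at_chart A (F y)) (at_chart B y)) (snd (at_chart B y) y)"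
  by (simp add: tangent_map_def ddir_def local_map_def[abs_def] o_def)

lemma linear_tangent_map: "linear (tangent_map B A F y)"
  using linear_ddir[OF local_map_differentiable[OF at_chart_in[OF A] at_chart_in[OF B] in_at_chart[OF B] in_at_chart[OF A]]]
  by (simp add: tangent_map_eq[abs_def])

text \<open>The tangent map is defined through the charts chosen at \<open>y\<close> and at its
  image; two chart changes allow any fixed pair of charts.\<close>

lemma tangent_map_from_chart:
  assumes c: "c \<in> A" "F y \<in> fst c" and d: "d \<in> B" "y \<in> fst d"
  shows "tangent_map B A F y (from_chart B d y w) = from_chart A c (F y) (ddir w (local_map c d) (snd d y))"
proof -
  let ?c = "at_chart A (F y)" and ?d = "at_chart B y"
  note ac = at_chart[OF A, of "F y"] and ad = at_chart[OF B, of y]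
  have "tangent_map B A F y (from_chart B d y w) = ddir (trans_d d ?d y w) (\<lambda>z. snd ?c (F (chart_inv ?d z))) (snd ?d y)"
    by (simp add: tangent_map_eq from_chart_eq local_map_def[abs_def])
  also have "\<dots> = ddir w (local_map ?c d) (snd d y)"
    using ddir_chart_change(1)[OF B d ad, of "\<lambda>q. snd ?c (F q)"] local_map_differentiable[OF ac(1) ad(1,2) ac(2)]
    by (simp add: local_map_def[abs_def])
  also have "\<dots> = ddir w (\<lambda>z. snd ?c (chart_inv c (local_map c d z))) (snd d y)"
  proof (rule ddir_cong_open)
    have O: "open (F -` fst c)" by (rule open_vimage_F[OF open_chart[OF A c(1)]])
    show "open (snd d ` (F -` fst c \<inter> fst d))" by (rule open_chart_image_Int(1)[OF B d(1) O])
    show "snd d y \<in> snd d ` (F -` fst c \<inter> fst d)" using c d by auto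
    show "local_map ?c d z = snd ?c (chart_inv c (local_map c d z))" if "z \<in> snd d ` (F -` fst c \<inter> fst d)" for z
      using that by (auto simp: local_map_chart[OF d(1)] chart_inv_chart[OF A c(1)])
  qed
  also have "\<dots> = ddir (ddir w (local_map c d) (snd d y)) (\<lambda>z. snd ?c (chart_inv c z)) (local_map c d (snd d y))"
    by (rule ddir_compose(2)[OF local_map_differentiable[OF c(1) d c(2)]])
      (use transition_differentiable[OF A c(1) ac(1) c(2) ac(2)] in \<open>simp add: local_map_chart[OF d]\<close>)
  also have "\<dots> = from_chart A c (F y) (ddir w (local_map c d) (snd d y))"
    by (simp add: from_chart_eq trans_d_def local_map_chart[OF d])
  finally show ?thesis .
qed

lemma chart_neighbourhood:
  assumes c: "c \<in> A" "F y \<in> fst c" and d: "d \<in> B" "y \<in> fst d" and U: "open U" "F y \<in> U"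
  defines "V \<equiv> F -` (U \<inter> fst c) \<inter> fst d"
  shows "open V" "y \<in> V" "V \<subseteq> fst d" "open (snd d ` V)" "smooth_on (snd d ` V) (local_map c d)"
    "local_map c d ` snd d ` V \<subseteq> snd c ` (U \<inter> fst c)"
proof -
  show V: "open V" "y \<in> V" "V \<subseteq> fst d"
    unfolding V_def using open_vimage_F[OF open_Int[OF U(1) open_chart[OF A c(1)]]] open_chart[OF B d(1)] assms by auto
  then show "open (snd d ` V)" using open_chart_image_Int(1)[OF B d(1) V(1)] by (simp add: Int_absorb2)
  show "smooth_on (snd d ` V) (local_map c d)"
    by (rule smooth_on_subset[OF smooth_local_map[OF c(1) d(1)]]) (auto simp: V_def)
  show "local_map c d ` snd d ` V \<subseteq> snd c ` (U \<inter> fst c)"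
    by (auto simp: V_def local_map_chart[OF d(1)])
qed

lemma smooth_fun_compose:
  assumes U: "open U" and f: "smooth_fun A U f"
  shows "smooth_fun B (F -` U) (\<lambda>y. f (F y))"
proof (rule smooth_fun_local[OF B])
  fix y assume y: "y \<in> F -` U"
  let ?c = "at_chart A (F y)" and ?d = "at_chart B y"
  note c = at_chart[OF A, of "F y"] and d = at_chart[OF B, of y]
  let ?V = "F -` (U \<inter> fst ?c) \<inter> fst ?d"
  have Uy: "F y \<in> U" using y by simp
  note V = chart_neighbourhood[OF c d U Uy]
  have "smooth_on (snd ?d ` ?V) (\<lambda>z. f (chart_inv ?c (local_map ?c ?d z)))"
    by (rule smooth_on_compose[OF V(4) open_chart_image_Int(1)[OF A c(1) U] smooth_funD[OF A f c(1)] V(5,6)])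
  then have "smooth_on (snd ?d ` ?V) (\<lambda>z. f (F (chart_inv ?d z)))"
    by (rule smooth_on_cong[OF V(4), rotated])
      (auto simp: local_map_chart[OF d(1)] chart_inv_chart[OF A c(1)] chart_inv_chart[OF B d(1)])
  then have "smooth_fun B ?V (\<lambda>y. f (F y))" by (rule smooth_fun_chartI[OF B d(1) V(1,3)])
  then show "\<exists>V. open V \<and> y \<in> V \<and> smooth_fun B V (\<lambda>y. f (F y))" using V(1,2) by blast
qed

lemma dfun_compose:
  assumes U: "open U" "F y \<in> U" and f: "smooth_fun A U f"
  shows "dfun B (\<lambda>y. f (F y)) y u = dfun A f (F y) (tangent_map B A F y u)"
proof -
  let ?c = "at_chart A (F y)" and ?d = "at_chart B y"
  note c = at_chart[OF A, of "F y"] and d = at_chart[OF B, of y]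
  note V = chart_neighbourhood[OF c d U]
  have "dfun B (\<lambda>y. f (F y)) y u = ddir u (\<lambda>z. f (chart_inv ?c (local_map ?c ?d z))) (snd ?d y)"
    unfolding dfun_def[OF B]
    by (rule ddir_cong_open[OF V(4)])
      (use V(2) in \<open>auto simp: local_map_chart[OF d(1)] chart_inv_chart[OF A c(1)] chart_inv_chart[OF B d(1)]\<close>)
  also have "\<dots> = ddir (ddir u (local_map ?c ?d) (snd ?d y)) (\<lambda>z. f (chart_inv ?c z)) (local_map ?c ?d (snd ?d y))"
    by (rule ddir_compose(2)[OF local_map_differentiable[OF c(1) d c(2)]])
      (use smooth_fun_differentiable[OF A f U(2) c] in \<open>simp add: local_map_chart[OF d]\<close>)
  finally show ?thesis by (simp add: dfun_def[OF A] tangent_map_eq local_map_chart[OF d])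
qed

lemma diffeomorphism_pair_sym: "diffeomorphism_pair B A G F"
  by unfold_locales (rule A B F G GF FG)+

section \<open>Pullback of forms and naturality of the exterior derivative\<close>

definition pull_form :: "('x \<Rightarrow> 'e form) \<Rightarrow> 'y \<Rightarrow> 'f form" where
  "pull_form \<omega> y v = \<omega> (F y) (\<lambda>l. tangent_map B A F y (v l))"

lemma smooth_form_pull_form:
  assumes U: "open U" and w: "smooth_form A U \<omega>" and a: "\<And>x. x \<in> U \<Longrightarrow> alt_form k (\<omega> x)"
  shows "smooth_form B (F -` U) (pull_form \<omega>)"
proof -
  have loc: "\<exists>V. open V \<and> y \<in> V \<and> smooth_form B V (pull_form \<omega>)" if y: "y \<in> F -` U" for y
  proof -
    let ?c = "at_chart A (F y)" and ?d = "at_chart B y"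
    note c = at_chart[OF A, of "F y"] and d = at_chart[OF B, of y]
    let ?V = "F -` (U \<inter> fst ?c) \<inter> fst ?d"
    have Uy: "F y \<in> U" using y by simp
    note V = chart_neighbourhood[OF c d U Uy]
    have "smooth_form B ?V (pull_form \<omega>)"
    proof (rule smooth_formI_chart[OF B d(1) V(1,3)])
      fix q assume "q \<in> ?V"
      then show "alt_form k (pull_form \<omega> q)"
        unfolding pull_form_def[abs_def] by (intro alt_form_compose[OF a linear_tangent_map]) auto
    next
      fix w
      have "smooth_on (snd ?d ` ?V) (\<lambda>z. cform A ?c \<omega> (local_map ?c ?d z) (\<lambda>l. ddir (w l) (local_map ?c ?d) z))"
        by (rule smooth_form_eval[OF form_field_cform[OF A c(1) U w a] V(4-6) smooth_onD_ddir[OF V(5)]])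
      then have "smooth_on (snd ?d ` ?V) (\<lambda>z. pull_form \<omega> (chart_inv ?d z) (\<lambda>l. from_chart B ?d (chart_inv ?d z) (w l)))"
        by (rule smooth_on_cong[OF V(4), rotated])
          (auto simp: cform_def pull_form_def local_map_chart[OF d(1)] chart_inv_chart[OF A c(1)]
            chart_inv_chart[OF B d(1)] tangent_map_from_chart[OF c(1) _ d(1)])
      then show "smooth_fun B ?V (\<lambda>x. pull_form \<omega> x (\<lambda>l. from_chart B ?d x (w l)))"
        by (rule smooth_fun_chartI[OF B d(1) V(1,3)])
    qed
    then show ?thesis using V(1,2) by blast
  qed
  show ?thesis
    unfolding smooth_form_def
  proof (intro ballI allI, rule smooth_fun_local[OF B])
    fix d w y assume d: "d \<in> B" and y: "y \<in> F -` U \<inter> fst d"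
    then obtain V where "open V" "y \<in> V" "smooth_form B V (pull_form \<omega>)" using loc by blast
    then show "\<exists>V. open V \<and> y \<in> V \<and> smooth_fun B V (\<lambda>x. pull_form \<omega> x (\<lambda>l. from_chart B d x (w l)))"
      using d y open_chart[OF B d] unfolding smooth_form_def by (intro exI[of _ "V \<inter> fst d"]) auto
  qed
qed

lemma ext_d_pull_form:
  assumes U: "open U" "F y \<in> U" and w: "smooth_form A U \<omega>" and a: "\<And>x. x \<in> U \<Longrightarrow> alt_form k (\<omega> x)"
  shows "ext_d B k (pull_form \<omega>) y v = ext_d A k \<omega> (F y) (\<lambda>l. tangent_map B A F y (v l))"
proof -
  let ?c = "at_chart A (F y)" and ?d = "at_chart B y"
  note c = at_chart[OF A, of "F y"] and d = at_chart[OF B, of y]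
  note V = chart_neighbourhood[OF c d U]
  have "ed k (cform B ?d (pull_form \<omega>)) (snd ?d y) v =
      ed k (cform A ?c \<omega>) (snd ?c (F y)) (\<lambda>l. ddir (v l) (local_map ?c ?d) (snd ?d y))"
    by (rule ed_pullback_chart[OF A B c(1) d(1) U(1) w a V(1,2,3) _ V(5)])
      (auto simp: local_map_chart[OF d(1)] pull_form_def tangent_map_from_chart[OF c(1) _ d(1)])
  then show ?thesis unfolding ext_d_eq tangent_map_eq .
qed

end

text \<open>The chain rule for the composition of the two coordinate expressions, which is the
  identity near the point.\<close>

lemma (in diffeomorphism_pair) tangent_map_inverse: "tangent_map A B G (F y) (tangent_map B A F y v) = v"
proof -
  interpret G: diffeomorphism_pair B A G F by (rule diffeomorphism_pair_sym)
  let ?c = "at_chart A (F y)" and ?d = "at_chart B y"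
  note c = at_chart[OF A, of "F y"] and d = at_chart[OF B, of y]
  note V = chart_neighbourhood[OF c d open_UNIV UNIV_I]
  have "v = ddir v (\<lambda>z. z) (snd ?d y)" by (rule ddir_eqI[symmetric]) (rule has_derivative_ident)
  also have "\<dots> = ddir v (\<lambda>z. G.local_map ?d ?c (local_map ?c ?d z)) (snd ?d y)"
    by (rule ddir_cong_open[OF V(4)])
      (use V(2) in \<open>auto simp: local_map_chart[OF d(1)] G.local_map_chart[OF c(1)] GF\<close>)
  also have "\<dots> = ddir (ddir v (local_map ?c ?d) (snd ?d y)) (G.local_map ?d ?c) (local_map ?c ?d (snd ?d y))"
    by (rule ddir_compose(2)[OF local_map_differentiable[OF c(1) d c(2)]])
      (use G.local_map_differentiable[OF d(1) c(1,2)] d(2) in \<open>simp add: local_map_chart[OF d] GF\<close>)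
  also have "\<dots> = tangent_map A B G (F y) (tangent_map B A F y v)"
    by (simp add: tangent_map_eq G.tangent_map_eq local_map_chart[OF d] GF)
  finally show ?thesis by (rule sym)
qed

context diffeomorphism_pair
begin

lemma tangent_map_inverse': "tangent_map B A F y (tangent_map A B G (F y) w) = w"
  using diffeomorphism_pair.tangent_map_inverse[OF diffeomorphism_pair_sym, of "F y" w] by (simp add: GF)

text \<open>The model spaces are different types, and each manifold comes with its own complex
  dimension; the tangent map at one point ties them together.\<close>

lemma dim_eq: "DIM('f) = DIM('e)"
proof -
  \<comment> \<open>Any point serves, and types are nonempty.\<close>
  let ?T = "tangent_map B A F undefined"
  have "inj ?T" by (rule inj_on_inverseI) (rule tangent_map_inverse)
  moreover have "range ?T = UNIV" using tangent_map_inverse' by (metis surjI)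
  moreover have "linear ?T" by (rule linear_tangent_map)
  ultimately have "dim (?T ` UNIV) = dim (UNIV :: 'f set)" by (intro dim_image_eq) auto
  then show ?thesis using \<open>range ?T = UNIV\<close> by simp
qed

lemma pullback_pullback: "pullback A B G (pullback B A F s) = s"
proof (intro ext)
  fix x v
  have "tangent_map B A F (G x) (tangent_map A B G x w) = w" for w
    using tangent_map_inverse'[of "G x"] by (simp add: FG)
  then show "pullback A B G (pullback B A F s) x v = s x v" by (simp add: pullback_def FG)
qed

end

section \<open>Isomorphisms of almost complex manifolds\<close>

locale acm_isomorphism = diffeomorphism_pair A B F G + X: canonical A J n + Y: canonical B J' n
  for A :: "('x::{t2_space,second_countable_topology}, 'e::euclidean_space) atlas"
    and B :: "('y::{t2_space,second_countable_topology}, 'f::euclidean_space) atlas" and F G J J' n +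
  assumes tangent_map_J: "tangent_map B A F y (J' y v) = J (F y) (tangent_map B A F y v)"
begin

lemma dbar_fun_compose:
  assumes U: "open U" "F y \<in> U" and f: "smooth_fun A U f"
  shows "dbar_fun B J' (\<lambda>y. f (F y)) y u = dbar_fun A J f (F y) (tangent_map B A F y u)"
proof -
  have y: "y \<in> F -` U" using U by simp
  show ?thesis
    unfolding Y.dbar_fun_formula[OF smooth_fun_compose[OF U(1) f] y] X.dbar_fun_formula[OF f U(2)]
      dfun_compose[OF U f] tangent_map_J ..
qed

lemma kform_pull_form:
  assumes k: "X.kform U \<kappa>"
  shows "Y.kform (F -` U) (pull_form \<kappa>)"
  unfolding Y.kform_def
proof (intro conjI ballI)
  show "open (F -` U)" by (rule open_vimage_F[OF X.kformD(1)[OF k]])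
  show "smooth_form B (F -` U) (pull_form \<kappa>)" by (rule smooth_form_pull_form[OF X.kformD(1,4,5)[OF k]])
  fix y assume "y \<in> F -` U"
  then have y: "F y \<in> U" by simp
  let ?T = "tangent_map B A F y"
  show "holo_form (J' y) n (pull_form \<kappa> y)"
    unfolding holo_form_def
  proof (intro conjI allI impI)
    show "alt_form n (pull_form \<kappa> y)"
      unfolding pull_form_def[abs_def] by (rule alt_form_compose[OF X.kformD(5)[OF k y] linear_tangent_map])
    fix v i assume i: "i < n"
    have "(\<lambda>l. ?T ((v(i := J' y (v i))) l)) = (\<lambda>l. ?T (v l))(i := J (F y) (?T (v i)))"
      by (auto simp: fun_eq_iff tangent_map_J)
    then show "pull_form \<kappa> y (v(i := J' y (v i))) = \<i> * pull_form \<kappa> y v"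
      unfolding pull_form_def using holo_form_type[OF X.kformD(2)[OF k y] i, of "\<lambda>l. ?T (v l)"] by simp
  qed
  obtain v where v: "\<kappa> (F y) v \<noteq> 0" using X.kformD(3)[OF k y] by (auto simp: fun_eq_iff)
  \<comment> \<open>Arguments on which the form is nonzero are pulled back through the inverse
    tangent map.\<close>
  have "pull_form \<kappa> y (\<lambda>l. tangent_map A B G (F y) (v l)) \<noteq> 0"
    using v by (simp add: pull_form_def tangent_map_inverse')
  then show "pull_form \<kappa> y \<noteq> 0" by (metis zero_fun_apply)
qed

text \<open>The tangent map intertwines the two almost complex structures, hence also the
  projections in the arguments.\<close>

lemma unwedge_natural:
  "unwedge (J' y) n (\<lambda>v. \<eta> (\<lambda>l. tangent_map B A F y (v l))) u =
    (\<lambda>v. unwedge (J (F y)) n \<eta> (tangent_map B A F y u) (\<lambda>i l. tangent_map B A F y (v i l)))"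
proof -
  let ?T = "tangent_map B A F y"
  have "(\<lambda>l. ?T (case_nat u w l)) = case_nat (?T u) (\<lambda>l. ?T (w l))" for w
    by (auto simp: fun_eq_iff split: nat.split)
  then show ?thesis
    unfolding unwedge_def
    by (simp only: tproj_conj[of "{..<Suc n}" ?T "J' y" "J (F y)", OF finite_lessThan tangent_map_J])
qed

text \<open>Exterior derivative and \<open>unwedge\<close> are both natural, so the two connection
  forms multiply the same nonzero generator and must agree.\<close>

lemma conn_pull_form:
  assumes k: "X.kform U \<kappa>" and y: "F y \<in> U"
  shows "Y.conn (pull_form \<kappa>) y u = X.conn \<kappa> (F y) (tangent_map B A F y u)"
proof -
  let ?T = "tangent_map B A F y"
  have y': "y \<in> F -` U" using y by simp
  note k' = kform_pull_form[OF k]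
  have "fscale (Y.conn (pull_form \<kappa>) y u) (kpow 1 (pull_form \<kappa> y)) = unwedge (J' y) n (ext_d B n (pull_form \<kappa>) y) u"
    by (rule Y.conn(2)[OF k' y', symmetric])
  also have "ext_d B n (pull_form \<kappa>) y = (\<lambda>v. ext_d A n \<kappa> (F y) (\<lambda>l. ?T (v l)))"
    by (rule ext) (rule ext_d_pull_form[OF X.kformD(1)[OF k] y X.kformD(4,5)[OF k]])
  also have "unwedge (J' y) n (\<lambda>v. ext_d A n \<kappa> (F y) (\<lambda>l. ?T (v l))) u =
      fscale (X.conn \<kappa> (F y) (?T u)) (kpow 1 (pull_form \<kappa> y))"
    unfolding unwedge_natural X.conn(2)[OF k y] by (simp add: fscale_def kpow_def pull_form_def)
  finally show ?thesis unfolding Y.fscale_cancel[OF Y.kpow_ne_0[OF Y.kformD(3)[OF k' y']]] .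
qed

lemma pullback_kpow:
  assumes "s (F y) = fscale a (kpow m (\<kappa> (F y)))"
  shows "pullback B A F s y = fscale a (kpow m (pull_form \<kappa> y))"
  unfolding pullback_def assms by (simp add: fscale_def kpow_def pull_form_def)

lemma pullback_section:
  assumes s: "s \<in> sections A (K_power A J n m)"
  shows "pullback B A F s \<in> sections B (K_power B J' n m)"
proof -
  have loc: "\<exists>V. open V \<and> y \<in> V \<and> smooth_tensor B V (pullback B A F s) \<and> pullback B A F s y \<in> K_fibre (J' y) n m" for y
  proof -
    obtain U \<kappa> where k: "X.kform U \<kappa>" "F y \<in> U" using X.kform_exists by blast
    obtain a where a: "smooth_fun A U a" "\<forall>y\<in>U. s y = fscale (a y) (kpow m (\<kappa> y))"
      using X.section_coefficient[OF s k(1)] by blast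
    note k' = kform_pull_form[OF k(1)] and U = X.kformD(1)[OF k(1)]
    have e: "pullback B A F s q = fscale (a (F q)) (kpow m (pull_form \<kappa> q))" if "q \<in> F -` U" for q
      using a(2) that by (intro pullback_kpow) auto
    have "smooth_tensor B (F -` U) (pullback B A F s)"
      by (rule smooth_tensor_cong[OF B Y.kformD(1)[OF k'] e[symmetric]
            smooth_tensor_scale[OF B Y.kformD(1)[OF k'] smooth_fun_compose[OF U a(1)]
              smooth_tensor_kpow[OF B Y.kformD(1,4)[OF k']]]])
    moreover have y: "y \<in> F -` U" using k by simp
    moreover have "pullback B A F s y \<in> K_fibre (J' y) n m"
      unfolding Y.K_fibre_kform[OF k' y] using e[OF y] by blast
    ultimately show ?thesis using Y.kformD(1)[OF k'] by blast
  qed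
  show ?thesis
    unfolding Y.sections_K_iff
  proof (intro conjI allI)
    show "pullback B A F s y \<in> K_fibre (J' y) n m" for y using loc[of y] by blast
    show "smooth_tensor B UNIV (pullback B A F s)"
      by (rule smooth_tensor_local[OF B]) (use loc in blast)
  qed
qed

text \<open>A local generator pulls back to a local generator and the coefficient is composed with
  \<open>F\<close>; each term of the local formula is natural.\<close>

lemma dK_pullback:
  assumes s: "s \<in> sections A (K_power A J n m)"
  shows "Y.dK m (pullback B A F s) y u =
    (\<lambda>v. X.dK m s (F y) (tangent_map B A F y u) (\<lambda>i l. tangent_map B A F y (v i l)))"
proof -
  obtain U \<kappa> where k: "X.kform U \<kappa>" "F y \<in> U" using X.kform_exists by blast
  obtain a where a: "smooth_fun A U a" "\<forall>y\<in>U. s y = fscale (a y) (kpow m (\<kappa> y))"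
    using X.section_coefficient[OF s k(1)] by blast
  note k' = kform_pull_form[OF k(1)] and U = X.kformD(1)[OF k(1)]
  have y: "y \<in> F -` U" using k by simp
  have e: "\<forall>q\<in>F -` U. pullback B A F s q = fscale (a (F q)) (kpow m (pull_form \<kappa> q))"
    using a(2) by (intro ballI pullback_kpow) auto
  show ?thesis
    unfolding Y.dK_eq[OF k' y smooth_fun_compose[OF U a(1)] e] X.dK_eq[OF k a]
      dbar_fun_compose[OF U k(2) a(1)] conn_pull_form[OF k]
    by (simp add: fscale_def kpow_def pull_form_def)
qed

lemma pullback_H0_K:
  assumes s: "s \<in> H0_K A J n (Suc m)"
  shows "pullback B A F s \<in> H0_K B J' n (Suc m)"
proof -
  have s': "s \<in> sections A (K_power A J n (Suc m))" "\<And>x u. X.dK (Suc m) s x u = 0"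
    using s unfolding H0_K_def H0_def by (auto simp: X.dbar_K_power_eq simp del: dbar_K_power.simps)
  have "Y.dK (Suc m) (pullback B A F s) y u = 0" for y u
    unfolding dK_pullback[OF s'(1)] s'(2) by (simp add: fun_eq_iff)
  then show ?thesis
    unfolding H0_K_def H0_def using pullback_section[OF s'(1)]
    by (auto simp: Y.dbar_K_power_eq simp del: dbar_K_power.simps)
qed

lemma acm_isomorphism_sym: "acm_isomorphism B A G F J' J n"
proof -
  interpret S: diffeomorphism_pair B A G F by (rule diffeomorphism_pair_sym)
  show ?thesis
  proof unfold_locales
    fix x v
    have "v = tangent_map B A F (G x) (tangent_map A B G x v)"
      using S.tangent_map_inverse[of x v] by simp
    then have "J x v = tangent_map B A F (G x) (J' (G x) (tangent_map A B G x v))"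
      using tangent_map_J[of "G x" "tangent_map A B G x v"] by (simp add: FG)
    then show "tangent_map A B G x (J x v) = J' (G x) (tangent_map A B G x v)"
      using tangent_map_inverse[of "G x"] by (simp add: FG)
  qed
qed

lemma H0_K_isomorphism:
  "complex_isomorphism (section_scale (K_power A J n (Suc m))) (H0_K A J n (Suc m))
     (section_scale (K_power B J' n (Suc m))) (H0_K B J' n (Suc m)) (pullback B A F)"
  unfolding complex_isomorphism_def
proof (intro conjI ballI allI)
  \<comment> \<open>With the roles exchanged, pullback along \<open>G\<close> also preserves the
    spaces; it is the two-sided inverse.\<close>
  interpret S: acm_isomorphism B A G F J' J n by (rule acm_isomorphism_sym)
  show "bij_betw (pullback B A F) (H0_K A J n (Suc m)) (H0_K B J' n (Suc m))"
    by (rule bij_betwI[where g = "pullback A B G"])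
      (auto intro: pullback_H0_K S.pullback_H0_K simp: pullback_pullback S.pullback_pullback)
  show "pullback B A F (s + t) = pullback B A F s + pullback B A F t" for s t
    by (simp add: pullback_def fun_eq_iff)
  show "pullback B A F (section_scale (K_power A J n (Suc m)) c s) =
      section_scale (K_power B J' n (Suc m)) c (pullback B A F s)" for c s
    by (simp add: pullback_def fun_eq_iff section_scale_def X.K_simps Y.K_simps fscale_def)
qed

end

lemma (in canonical) finite_dimensional_H0_K:
  assumes "compact (UNIV :: 'x set)"
  shows "finite_dimensional_subspace (section_scale (K_power A J n (Suc m))) (H0_K A J n (Suc m))"
proof -
  interpret pseudoholomorphic_bundle A J "K_power A J n (Suc m)" "dbar_K_power A J n (Suc m)"
    by unfold_locales (rule bundle_K, rule pseudoholomorphic_structureI[OF dbar_K_power_eq])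
  show ?thesis unfolding H0_K_def by (rule finite_dimensional_H0[OF assms])
qed

theorem theorem1p1:
  fixes A :: "('x::{t2_space,second_countable_topology}, 'e::euclidean_space) atlas"
    and J :: "'x \<Rightarrow> 'e \<Rightarrow> 'e" and n :: nat
  assumes "almost_complex_manifold n A J" and "compact (UNIV :: 'x set)"
  shows "(\<forall>(E :: ('x, 'v::ab_group_add) cbundle) D.
            complex_vector_bundle A E \<and> pseudoholomorphic_structure A J E D \<longrightarrow>
            finite_dimensional_subspace (section_scale E) (H0 A E D))
       \<and> (\<forall>m\<ge>1.
            finite_dimensional_subspace (section_scale (K_power A J n m)) (H0_K A J n m)
          \<and> (\<forall>(B :: ('y::{t2_space,second_countable_topology}, 'f::euclidean_space) atlas) J' n' F.
               almost_complex_manifold n' B J' \<and> diffeomorphism B A F \<and>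
               (\<forall>y. tangent_map B A F y \<circ> J' y = J (F y) \<circ> tangent_map B A F y) \<longrightarrow>
               complex_isomorphism
                 (section_scale (K_power A J n m)) (H0_K A J n m)
                 (section_scale (K_power B J' n' m)) (H0_K B J' n' m)
                 (pullback B A F)))"
proof -
  interpret canonical A J n
    by unfold_locales (use assms(1) in \<open>auto simp: almost_complex_manifold_def\<close>)
  show ?thesis
  proof (intro conjI allI impI)
    fix E :: "('x, 'v) cbundle" and D
    assume "complex_vector_bundle A E \<and> pseudoholomorphic_structure A J E D"
    then interpret pseudoholomorphic_bundle A J E D by unfold_locales auto
    show "finite_dimensional_subspace (section_scale E) (H0 A E D)" by (rule finite_dimensional_H0[OF assms(2)])
  next
    fix m :: nat assume "m \<ge> 1"
    then obtain m' where m: "m = Suc m'" by (cases m) auto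
    show "finite_dimensional_subspace (section_scale (K_power A J n m)) (H0_K A J n m)"
      unfolding m by (rule finite_dimensional_H0_K[OF assms(2)])
    fix B :: "('y, 'f) atlas" and J' n' F
    assume h: "almost_complex_manifold n' B J' \<and> diffeomorphism B A F \<and>
      (\<forall>y. tangent_map B A F y \<circ> J' y = J (F y) \<circ> tangent_map B A F y)"
    have inv: "inv F (F y) = y" "F (inv F x) = x" for x y
      using h by (auto simp: diffeomorphism_def bij_is_inj bij_is_surj surj_f_inv_f)
    interpret diffeomorphism_pair A B F "inv F"
      by unfold_locales (use h A inv in \<open>auto simp: diffeomorphism_def almost_complex_manifold_def\<close>)
    \<comment> \<open>Both are half of the common real dimension.\<close>
    have n': "n' = n" using dim_eq dim h by (simp add: almost_complex_manifold_def)
    interpret acm_isomorphism A B F "inv F" J J' n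
    proof unfold_locales
      show "tangent_map B A F y (J' y v) = J (F y) (tangent_map B A F y v)" for y v
        using h by (metis comp_apply)
    qed (use h dim_eq dim in \<open>auto simp: almost_complex_manifold_def\<close>)
    show "complex_isomorphism (section_scale (K_power A J n m)) (H0_K A J n m)
        (section_scale (K_power B J' n' m)) (H0_K B J' n' m) (pullback B A F)"
      unfolding m n' by (rule H0_K_isomorphism)
  qed
qed

end
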